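(* Let $d\in\{2,3\}$, let $\Omega\subset\mathbb{R}^d$ be an open and bounded polytopal domain with Lipschitz boundary, and let $x_0\in\Omega$. There is $\varepsilon=\varepsilon(\Omega)>0$ such that the following holds for every $p\in\left(\frac{2d}{d+1}-\varepsilon,\frac{d}{d-1}\right)$. There is a constant $C>0$ such that for every $\boldsymbol f\in\mathbb{R}^d$, every mesh $\mathscr{T}\in\mathbb{T}$, and either choice (mini element or lowest order Taylor--Hood element) of $(\mathbf{V}(\mathscr{T}),\mathcal{P}(\mathscr{T}))$: if $(\boldsymbol u,\pi)\in\mathbf{W}_0^{1,p}(\Omega)\times \mathrm{L}^p(\Omega)/\mathbb{R}$ is the solution of the continuous Stokes problem and $(\boldsymbol u_{\mathscr{T}},\pi_{\mathscr{T}})\in\mathbf{V}(\mathscr{T})\times\mathcal{P}(\mathscr{T})$ is the solution of the discrete Stokes problem, then for every $T\in\mathscr{T}$ $$\eta_{p,T}^p\le C\left(\|\nabla(\boldsymbol u-\boldsymbol u_{\mathscr{T}})\|_{\mathbf{L}^p(\mathcal{N}_T)}^p+\|\pi-\pi_{\mathscr{T}}\|_{\mathrm{L}^p(\mathcal{N}_T)}^p\right).$$ The constant $C$ is independent of $(\boldsymbol u,\pi)$, of $(\boldsymbol u_{\mathscr{T}},\pi_{\mathscr{T}})$, of the size of the elements in $\mathscr{T}$, and of $\#\mathscr{T}$.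
   Context: **Spaces.** $p'=p/(p-1)$ denotes the conjugate exponent; since $p<d/(d-1)$ we have $p'>d$. Boldface spaces are vector/tensor valued. Elements of $\mathrm{L}^p(\Omega)/\mathbb{R}$ are represented by functions with zero mean. **Continuous problem.** With $a(\boldsymbol w,\boldsymbol v)=\int_\Omega\nabla\boldsymbol w:\nabla\boldsymbol v$, $b(\boldsymbol v,q)=-\int_\Omega q\,\mathrm{div}\,\boldsymbol v$ and $\langle\boldsymbol f\delta_{x_0},\boldsymbol v\rangle=\boldsymbol f\cdot\boldsymbol v(x_0)$ (well defined since $p'>d$): find $(\boldsymbol u,\pi)\in\mathbf{W}_0^{1,p}(\Omega)\times \mathrm{L}^p(\Omega)/\mathbb{R}$ such that $a(\boldsymbol u,\boldsymbol v)+b(\boldsymbol v,\pi)=\langle\boldsymbol f\delta_{x_0},\boldsymbol v\rangle$ for all $\boldsymbol v\in\mathbf{W}_0^{1,p'}(\Omega)$ and $b(\boldsymbol u,q)=0$ for all $q\in \mathrm{L}^{p'}(\Omega)/\mathbb{R}$. For some $\varepsilon=\varepsilon(\Omega)>0$ this problem is well-posed for every $p$ in the stated range. **Meshes.** $\mathbb{T}$ is a collection of conforming, (uniformly) shape regular partitions $\mathscr{T}$ of $\overline\Omega$ into closed simplices $T$, all refinements of an initial mesh $\mathscr{T}_0$; $h_T=\mathrm{diam}(T)$. Constants may depend on $\Omega$, $d$, $p$, $x_0$ and the shape regularity of $\mathbb{T}$. For $T\in\mathscr{T}$, the patch is $\mathcal{N}_T=\bigcup\{T'\in\mathscr{T}:T\cap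 T'\neq\emptyset\}$. $\mathscr{S}$ is the set of internal $(d-1)$-dimensional interelement boundaries. If $S\in\mathscr{S}$ is shared by distinct elements $T^+,T^-$, the jump of a piecewise smooth tensor field $\mathbf{W}$ is $\llbracket\mathbf{W}\cdot\boldsymbol\nu\rrbracket=\mathbf{W}|_{T^+}\cdot\boldsymbol\nu^++\mathbf{W}|_{T^-}\cdot\boldsymbol\nu^-$, with $\boldsymbol\nu^\pm$ the unit normal on $S$ pointing towards $T^\pm$. **Finite element spaces.** In both cases $\mathcal{P}(\mathscr{T})=\{q\in C(\overline\Omega): q|_T\in\mathbb{P}_1(T)\ \forall T\in\mathscr{T}\}\cap \mathrm{L}^{p'}(\Omega)/\mathbb{R}$. Mini element: $\mathbf{V}(\mathscr{T})=\{\boldsymbol v\in\mathbf{C}(\overline\Omega):\boldsymbol v|_T\in[\mathbb{P}_1(T)\oplus\mathbb{B}(T)]^d\ \forall T\in\mathscr{T}\}\cap\mathbf{W}_0^{1,p'}(\Omega)$, where $\mathbb{B}(T)$ is spanned by the local bubble function (the product of the $d+1$ barycentric coordinates of $T$). Lowest order Taylor--Hood element: $\mathbf{V}(\mathscr{T})=\{\boldsymbol v\in\mathbf{C}(\overline\Omega):\boldsymbol v|_T\in[\mathbb{P}_2(T)]^d\ \forall T\in\mathscr{T}\}\cap\mathbf{W}_0^{1,p'}(\Omega)$. **Discrete problem.** Find $(\boldsymbol u_{\mathscr{T}},\pi_{\mathscr{T}})\in\mathbf{V}(\mathscr{T})\times\mathcal{P}(\mathscr{T})$ with $a(\boldsymbol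 u_{\mathscr{T}},\boldsymbol v_{\mathscr{T}})+b(\boldsymbol v_{\mathscr{T}},\pi_{\mathscr{T}})=\boldsymbol f\cdot\boldsymbol v_{\mathscr{T}}(x_0)$ for all $\boldsymbol v_{\mathscr{T}}\in\mathbf{V}(\mathscr{T})$ and $b(\boldsymbol u_{\mathscr{T}},q_{\mathscr{T}})=0$ for all $q_{\mathscr{T}}\in\mathcal{P}(\mathscr{T})$. These pairs are inf-sup stable and the discrete problem has a unique solution. **Error indicators.** Call $x_0\in T$ *nodal for $T$* if it is a vertex of $T$ (mini element), respectively a vertex of $T$ or a midpoint of an edge of $T$ (Taylor--Hood). Let $\sigma_T=1$ if $x_0\in T$ and $x_0$ is not nodal for $T$, and $\sigma_T=0$ otherwise. With $\mathbb{I}_d$ the $d\times d$ identity matrix, $$\eta_{p,T}^p=h_T^p\|\Delta\boldsymbol u_{\mathscr{T}}-\nabla\pi_{\mathscr{T}}\|_{\mathbf{L}^p(T)}^p+h_T\|\llbracket(\nabla\boldsymbol u_{\mathscr{T}}-\mathbb{I}_d\pi_{\mathscr{T}})\cdot\boldsymbol\nu\rrbracket\|_{\mathbf{L}^p(\partial T\setminus\partial\Omega)}^p+\|\mathrm{div}\,\boldsymbol u_{\mathscr{T}}\|_{\mathrm{L}^p(T)}^p+\sigma_T\,h_T^{d-p(d-1)}|\boldsymbol f|^p.$$ *)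

theory Defs
  imports "HOL-Analysis.Analysis"
begin

definition polytopal :: "(real^'n) set \<Rightarrow> bool" where
  "polytopal \<Omega> \<longleftrightarrow> (\<exists>\<P>. finite \<P> \<and> (\<forall>P\<in>\<P>. polytope P) \<and> closure \<Omega> = \<Union>\<P>)"

text \<open>Near each boundary point, the domain is the strict epigraph of a Lipschitz function
  over a hyperplane with unit normal \<open>e\<close>.\<close>

definition lipschitz_boundary :: "(real^'n) set \<Rightarrow> bool" where
  "lipschitz_boundary \<Omega> \<longleftrightarrow>
     (\<forall>z\<in>frontier \<Omega>. \<exists>r>0. \<exists>e g L. norm e = 1 \<and> L-lipschitz_on {y. y \<bullet> e = 0} g \<and>
        \<Omega> \<inter> ball z r = {x \<in> ball z r. g (x - (x \<bullet> e) *\<^sub>R e) < x \<bullet> e})"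

definition partial :: "'n \<Rightarrow> (real^'n \<Rightarrow> 'b::real_normed_vector) \<Rightarrow> real^'n \<Rightarrow> 'b" where
  "partial j f x = frechet_derivative f (at x) (axis j 1)"

definition grad :: "(real^'n \<Rightarrow> real) \<Rightarrow> real^'n \<Rightarrow> real^'n" where
  "grad q x = (\<chi> j. partial j q x)"

definition laplacian :: "(real^'n \<Rightarrow> 'b::real_normed_vector) \<Rightarrow> real^'n \<Rightarrow> 'b" where
  "laplacian u x = (\<Sum>j\<in>UNIV. partial j (partial j u) x)"

primrec C_k :: "nat \<Rightarrow> (real^'n \<Rightarrow> 'b::real_normed_vector) \<Rightarrow> bool" where
  "C_k 0 f \<longleftrightarrow> continuous_on UNIV f"
| "C_k (Suc k) f \<longleftrightarrow> (\<forall>x. f differentiable (at x)) \<and> (\<forall>j. C_k k (partial j f))"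

definition test_function :: "(real^'n) set \<Rightarrow> (real^'n \<Rightarrow> 'b::real_normed_vector) \<Rightarrow> bool" where
  "test_function \<Omega> \<phi> \<longleftrightarrow> (\<forall>k. C_k k \<phi>) \<and>
     compact (closure {x. \<phi> x \<noteq> 0}) \<and> closure {x. \<phi> x \<noteq> 0} \<subseteq> \<Omega>"

text \<open>Elements of the function spaces are represented by functions on the whole space of which
  only the values on \<open>\<Omega>\<close>, up to null sets, are relevant. On vectors and matrices \<open>norm\<close> and
  \<open>\<bullet>\<close> are Euclidean, respectively Frobenius.\<close>

definition Lp :: "real \<Rightarrow> (real^'n) set \<Rightarrow> (real^'n \<Rightarrow> 'b::euclidean_space) \<Rightarrow> bool" where
  "Lp p A f \<longleftrightarrow> f \<in> borel_measurable (lebesgue_on A) \<and>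
     integrable (lebesgue_on A) (\<lambda>x. norm (f x) powr p)"

definition Lp_norm :: "real \<Rightarrow> (real^'n) set \<Rightarrow> (real^'n \<Rightarrow> 'b::euclidean_space) \<Rightarrow> real" where
  "Lp_norm p A f = (LINT x|lebesgue_on A. norm (f x) powr p) powr (1 / p)"

definition Lp_zero_mean :: "real \<Rightarrow> (real^'n) set \<Rightarrow> (real^'n \<Rightarrow> real) \<Rightarrow> bool" where
  "Lp_zero_mean p \<Omega> q \<longleftrightarrow> Lp p \<Omega> q \<and> (LINT x|lebesgue_on \<Omega>. q x) = 0"

definition locally_integrable :: "(real^'n) set \<Rightarrow> (real^'n \<Rightarrow> 'b::euclidean_space) \<Rightarrow> bool" where
  "locally_integrable \<Omega> f \<longleftrightarrow> (\<forall>K. compact K \<and> K \<subseteq> \<Omega> \<longrightarrow> f absolutely_integrable_on K)"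

definition has_weak_grad ::
    "(real^'n) set \<Rightarrow> (real^'n \<Rightarrow> real^'n) \<Rightarrow> (real^'n \<Rightarrow> real^'n^'n) \<Rightarrow> bool" where
  "has_weak_grad \<Omega> u G \<longleftrightarrow> locally_integrable \<Omega> u \<and> locally_integrable \<Omega> G \<and>
     (\<forall>\<phi> :: real^'n \<Rightarrow> real. test_function \<Omega> \<phi> \<longrightarrow>
        (\<forall>i j. (LINT x|lebesgue_on \<Omega>. u x $ i * partial j \<phi> x) =
               - (LINT x|lebesgue_on \<Omega>. G x $ i $ j * \<phi> x)))"

text \<open>As for \<open>jacobian\<close>, the convention is \<open>(\<nabla>u)\<^sub>i\<^sub>j = \<partial>\<^sub>j u\<^sub>i\<close>.
  The weak gradient is unique almost everywhere in \<open>\<Omega>\<close>; the chosen representative is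
  irrelevant because it is only used under integrals.\<close>

definition weak_grad :: "(real^'n) set \<Rightarrow> (real^'n \<Rightarrow> real^'n) \<Rightarrow> real^'n \<Rightarrow> real^'n^'n" where
  "weak_grad \<Omega> u = (SOME G. has_weak_grad \<Omega> u G)"

definition weak_div :: "(real^'n) set \<Rightarrow> (real^'n \<Rightarrow> real^'n) \<Rightarrow> real^'n \<Rightarrow> real" where
  "weak_div \<Omega> u x = trace (weak_grad \<Omega> u x)"

definition W1p :: "real \<Rightarrow> (real^'n) set \<Rightarrow> (real^'n \<Rightarrow> real^'n) \<Rightarrow> bool" where
  "W1p p \<Omega> u \<longleftrightarrow> Lp p \<Omega> u \<and> (\<exists>G. has_weak_grad \<Omega> u G \<and> Lp p \<Omega> G)"

definition W1p_0 :: "real \<Rightarrow> (real^'n) set \<Rightarrow> (real^'n \<Rightarrow> real^'n) \<Rightarrow> bool" where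
  "W1p_0 p \<Omega> u \<longleftrightarrow> W1p p \<Omega> u \<and>
     (\<exists>\<phi> :: nat \<Rightarrow> real^'n \<Rightarrow> real^'n. (\<forall>k. test_function \<Omega> (\<phi> k)) \<and>
        (\<lambda>k. Lp_norm p \<Omega> (\<lambda>x. u x - \<phi> k x)) \<longlonglongrightarrow> 0 \<and>
        (\<lambda>k. Lp_norm p \<Omega> (\<lambda>x. weak_grad \<Omega> u x - jacobian (\<phi> k) (at x))) \<longlonglongrightarrow> 0)"

definition conj_exp :: "real \<Rightarrow> real" where
  "conj_exp p = p / (p - 1)"

definition form_a :: "(real^'n) set \<Rightarrow> (real^'n \<Rightarrow> real^'n) \<Rightarrow> (real^'n \<Rightarrow> real^'n) \<Rightarrow> real" where
  "form_a \<Omega> w v = (LINT x|lebesgue_on \<Omega>. weak_grad \<Omega> w x \<bullet> weak_grad \<Omega> v x)"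

definition form_b :: "(real^'n) set \<Rightarrow> (real^'n \<Rightarrow> real^'n) \<Rightarrow> (real^'n \<Rightarrow> real) \<Rightarrow> real" where
  "form_b \<Omega> v q = - (LINT x|lebesgue_on \<Omega>. q x * weak_div \<Omega> v x)"

text \<open>Since \<open>conj_exp p > CARD('n)\<close>, every class in the test space has exactly one representative
  that is continuous on \<open>\<Omega>\<close>, and the value of the class at \<open>x0\<close> is the value of that
  representative. The test functions below are exactly these representatives.\<close>

definition stokes_solution ::
    "(real^'n) set \<Rightarrow> real^'n \<Rightarrow> real \<Rightarrow> real^'n \<Rightarrow>
     (real^'n \<Rightarrow> real^'n) \<Rightarrow> (real^'n \<Rightarrow> real) \<Rightarrow> bool" where
  "stokes_solution \<Omega> x0 p f u \<pi> \<longleftrightarrow>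
     W1p_0 p \<Omega> u \<and> Lp_zero_mean p \<Omega> \<pi> \<and>
     (\<forall>v. W1p_0 (conj_exp p) \<Omega> v \<and> continuous_on \<Omega> v \<longrightarrow>
        form_a \<Omega> u v + form_b \<Omega> v \<pi> = f \<bullet> v x0) \<and>
     (\<forall>q. Lp_zero_mean (conj_exp p) \<Omega> q \<longrightarrow> form_b \<Omega> u q = 0)"

text \<open>Conformity is the requirement, part of \<open>triangulation\<close>, that any two elements meet in a
  common face (possibly empty).\<close>

definition mesh :: "(real^'n) set \<Rightarrow> (real^'n) set set \<Rightarrow> bool" where
  "mesh \<Omega> \<T> \<longleftrightarrow> triangulation \<T> \<and> (\<forall>T\<in>\<T>. int CARD('n) simplex T) \<and> \<Union>\<T> = closure \<Omega>"

definition refines :: "(real^'n) set set \<Rightarrow> (real^'n) set set \<Rightarrow> bool" where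
  "refines \<T> \<T>0 \<longleftrightarrow> (\<forall>T\<in>\<T>. \<exists>T0\<in>\<T>0. T \<subseteq> T0)"

definition inball_diameter :: "(real^'n) set \<Rightarrow> real" where
  "inball_diameter T = Sup {2 * r |r. 0 \<le> r \<and> (\<exists>z. cball z r \<subseteq> T)}"

definition shape_regular :: "real \<Rightarrow> (real^'n) set set \<Rightarrow> bool" where
  "shape_regular \<kappa> \<T> \<longleftrightarrow> (\<forall>T\<in>\<T>. diameter T \<le> \<kappa> * inball_diameter T)"

definition mesh_family ::
    "(real^'n) set \<Rightarrow> real \<Rightarrow> (real^'n) set set \<Rightarrow> (real^'n) set set set \<Rightarrow> bool" where
  "mesh_family \<Omega> \<kappa> \<T>0 \<TT> \<longleftrightarrow> mesh \<Omega> \<T>0 \<and>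
     (\<forall>\<T>\<in>\<TT>. mesh \<Omega> \<T> \<and> refines \<T> \<T>0 \<and> shape_regular \<kappa> \<T>)"

definition patch :: "(real^'n) set set \<Rightarrow> (real^'n) set \<Rightarrow> (real^'n) set" where
  "patch \<T> T = \<Union>{T'\<in>\<T>. T \<inter> T' \<noteq> {}}"

definition internal_sides :: "(real^'n) set set \<Rightarrow> (real^'n) set set" where
  "internal_sides \<T> = {S. \<exists>T\<in>\<T>. \<exists>T'\<in>\<T>. T \<noteq> T' \<and> S facet_of T \<and> S facet_of T'}"

text \<open>Unit normal of the facet \<open>S\<close> of \<open>T\<close> that points towards \<open>T\<close>.\<close>

definition side_normal :: "(real^'n) set \<Rightarrow> (real^'n) set \<Rightarrow> real^'n" where
  "side_normal S T = (THE \<nu>. norm \<nu> = 1 \<and> (\<forall>x\<in>S. \<forall>y\<in>S. \<nu> \<bullet> (y - x) = 0) \<and>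
     (\<forall>x\<in>S. \<forall>y\<in>T. 0 \<le> \<nu> \<bullet> (y - x)))"

definition trace_from ::
    "(real^'n) set \<Rightarrow> (real^'n \<Rightarrow> 'b::t2_space) \<Rightarrow> real^'n \<Rightarrow> 'b" where
  "trace_from T W x = Lim (at x within interior T) W"

text \<open>An internal side \<open>S\<close> is a facet of exactly two elements, so the sum has two terms.\<close>

definition jump ::
    "(real^'n) set set \<Rightarrow> (real^'n) set \<Rightarrow> (real^'n \<Rightarrow> real^'n^'n) \<Rightarrow> real^'n \<Rightarrow> real^'n" where
  "jump \<T> S W x = (\<Sum>T\<in>{T\<in>\<T>. S facet_of T}. trace_from T W x *v side_normal S T)"

text \<open>Integral over a convex set \<open>S\<close> of codimension one with respect to surface measure. By
  Fubini it equals the volume integral, over the right prism of height one with midsection \<open>S\<close>,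
  of the function extended constantly in the normal direction. The orthogonal projection onto
  the hyperplane of \<open>S\<close> is \<open>closest_point (affine hull S)\<close>.\<close>

definition surface_integral :: "(real^'n) set \<Rightarrow> (real^'n \<Rightarrow> real) \<Rightarrow> real" where
  "surface_integral S g =
     (LINT y|lebesgue_on {y. closest_point (affine hull S) y \<in> S \<and> infdist y (affine hull S) \<le> 1 / 2}.
        g (closest_point (affine hull S) y))"

definition poly_space :: "nat \<Rightarrow> (real^'n \<Rightarrow> real) set" where
  "poly_space k = {g. \<exists>c :: ('n \<Rightarrow> nat) \<Rightarrow> real.
     \<forall>x. g x = (\<Sum>\<alpha> | (\<Sum>i\<in>UNIV. \<alpha> i) \<le> k. c \<alpha> * (\<Prod>i\<in>UNIV. x $ i ^ \<alpha> i))}"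

definition vertices :: "(real^'n) set \<Rightarrow> (real^'n) set" where
  "vertices T = {z. z extreme_point_of T}"

definition barycentric :: "(real^'n) set \<Rightarrow> real^'n \<Rightarrow> real^'n \<Rightarrow> real" where
  "barycentric T z = (THE l. l \<in> poly_space 1 \<and> (\<forall>w\<in>vertices T. l w = (if w = z then 1 else 0)))"

definition bubble :: "(real^'n) set \<Rightarrow> real^'n \<Rightarrow> real" where
  "bubble T x = (\<Prod>z\<in>vertices T. barycentric T z x)"

datatype element = Mini | Taylor_Hood

definition local_space :: "element \<Rightarrow> (real^'n) set \<Rightarrow> (real^'n \<Rightarrow> real) set" where
  "local_space el T = (case el of
       Mini \<Rightarrow> {\<lambda>x. g x + c * bubble T x |g c. g \<in> poly_space 1}
     | Taylor_Hood \<Rightarrow> poly_space 2)"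

definition velocity_space ::
    "element \<Rightarrow> (real^'n) set \<Rightarrow> real \<Rightarrow> (real^'n) set set \<Rightarrow> (real^'n \<Rightarrow> real^'n) \<Rightarrow> bool" where
  "velocity_space el \<Omega> p \<T> v \<longleftrightarrow> continuous_on (closure \<Omega>) v \<and>
     (\<forall>T\<in>\<T>. \<forall>i. \<exists>g\<in>local_space el T. \<forall>x\<in>T. v x $ i = g x) \<and> W1p_0 (conj_exp p) \<Omega> v"

definition pressure_space ::
    "(real^'n) set \<Rightarrow> real \<Rightarrow> (real^'n) set set \<Rightarrow> (real^'n \<Rightarrow> real) \<Rightarrow> bool" where
  "pressure_space \<Omega> p \<T> q \<longleftrightarrow> continuous_on (closure \<Omega>) q \<and>
     (\<forall>T\<in>\<T>. \<exists>g\<in>poly_space 1. \<forall>x\<in>T. q x = g x) \<and> Lp_zero_mean (conj_exp p) \<Omega> q"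

definition discrete_stokes_solution ::
    "element \<Rightarrow> (real^'n) set \<Rightarrow> real^'n \<Rightarrow> real \<Rightarrow> real^'n \<Rightarrow> (real^'n) set set \<Rightarrow>
     (real^'n \<Rightarrow> real^'n) \<Rightarrow> (real^'n \<Rightarrow> real) \<Rightarrow> bool" where
  "discrete_stokes_solution el \<Omega> x0 p f \<T> uh \<pi>h \<longleftrightarrow>
     velocity_space el \<Omega> p \<T> uh \<and> pressure_space \<Omega> p \<T> \<pi>h \<and>
     (\<forall>v. velocity_space el \<Omega> p \<T> v \<longrightarrow> form_a \<Omega> uh v + form_b \<Omega> v \<pi>h = f \<bullet> v x0) \<and>
     (\<forall>q. pressure_space \<Omega> p \<T> q \<longrightarrow> form_b \<Omega> uh q = 0)"

definition nodal :: "element \<Rightarrow> (real^'n) set \<Rightarrow> real^'n \<Rightarrow> bool" where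
  "nodal el T x \<longleftrightarrow> (case el of
       Mini \<Rightarrow> x \<in> vertices T
     | Taylor_Hood \<Rightarrow> x \<in> vertices T \<or> (\<exists>a b. closed_segment a b edge_of T \<and> x = midpoint a b))"

definition sigma :: "element \<Rightarrow> real^'n \<Rightarrow> (real^'n) set \<Rightarrow> real" where
  "sigma el x0 T = (if x0 \<in> T \<and> \<not> nodal el T x0 then 1 else 0)"

text \<open>The \<open>p\<close>-th power of the local indicator. The classical derivatives are those of the
  elementwise polynomials, since they only matter in the interior of elements. Up to a set of
  surface measure zero, \<open>frontier T - frontier \<Omega>\<close> is the union of the internal sides that
  are facets of \<open>T\<close>.\<close>

definition eta_powr ::
    "element \<Rightarrow> (real^'n) set \<Rightarrow> real^'n \<Rightarrow> real \<Rightarrow> real^'n \<Rightarrow> (real^'n) set set \<Rightarrow>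
     (real^'n \<Rightarrow> real^'n) \<Rightarrow> (real^'n \<Rightarrow> real) \<Rightarrow> (real^'n) set \<Rightarrow> real" where
  "eta_powr el \<Omega> x0 p f \<T> uh \<pi>h T =
     diameter T powr p * Lp_norm p T (\<lambda>x. laplacian uh x - grad \<pi>h x) powr p
   + diameter T * (\<Sum>S\<in>{S\<in>internal_sides \<T>. S facet_of T}. surface_integral S
        (\<lambda>x. norm (jump \<T> S (\<lambda>y. jacobian uh (at y) - \<pi>h y *\<^sub>R mat 1) x) powr p))
   + Lp_norm p T (weak_div \<Omega> uh) powr p
   + sigma el x0 T * diameter T powr (real CARD('n) - p * (real CARD('n) - 1)) * norm f powr p"

end

theory Submission
  imports Defs "HOL-Computational_Algebra.Polynomial"
begin

text \<open>The discrete stress \<open>F = \<nabla>u\<^sub>h - \<pi>\<^sub>h I\<close> is a polynomial on each element. Testing the Stokes system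
  with \<open>\<phi> g\<close>, where \<open>\<phi>\<close> is scalar and \<open>g\<close> a constant vector, bounds
  \<open>(f \<bullet> g) \<phi>(x\<^sub>0) - \<integral> g \<bullet> F \<nabla>\<phi>\<close> by \<open>\<bar>g\<bar> \<integral> e \<bar>\<nabla>\<phi>\<bar>\<close>, where \<open>e\<close> is the pointwise error. No bubble
  functions are used. Instead, \<open>\<phi>\<close> is a fixed bump dilated about a point \<open>b\<close> to the radii \<open>t\<^sub>i r\<close>, and
  the resulting bounds are combined with weights that single out one coefficient of the polynomial
  \<open>t \<mapsto> t\<^sup>n\<^sup>-\<^sup>1 F(b + t r y)\<close> in \<open>t\<close>. The coefficient of \<open>t\<^sup>n\<close> gives the divergence of \<open>F\<close> at a point \<open>b\<close> inside
  an element, and that of \<open>t\<^sup>n\<^sup>-\<^sup>1\<close> the jump at a point \<open>b\<close> of a side; there the bumps avoid \<open>x\<^sub>0\<close>.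
  The coefficient of \<open>t\<^sup>0\<close> vanishes, which isolates the source \<open>f \<bullet> g\<close>. For the latter, \<open>b\<close> is a
  point near \<open>x\<^sub>0\<close> such that the ball of radius \<open>r\<close>, comparable to \<open>h\<close>, meets only elements that
  contain \<open>b\<close>, so that \<open>F\<close> is a polynomial along almost every ray from \<open>b\<close>. Every local quantity is thus
  bounded by a mean of \<open>e\<close> over a ball in the patch. Extrapolating polynomials along lines extends
  the first two bounds from a small ball to the whole element or side.\<close>

section \<open>Polynomials along lines\<close>

text \<open>Substituting x = b + s y in the test with the bump of radius s gives a factor s^n from
  the volume and 1/s from the gradient; this is the origin of \<open>t^(n-1)\<close>. Where F is one
  polynomial along a ray, its degree is bounded in terms of n alone, so finitely many radii
  determine every coefficient and the weights do not see the mesh. The obstacle is the position of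
  x0. For the divergence and the jump, one of two opposite places in the same element or side is far
  from x0. For the source x0 is unavoidable, and it may lie arbitrarily close to a vertex or face
  without belonging to it; no ball about x0 of size h then meets only elements containing x0. Moving
  to a point b of the nearby face repairs this, and bumps that equal 1 near their centre do not
  notice the shift. The admissible radius is governed by the elements around b; their sizes are
  comparable even when b is a vertex, because elements at a vertex are linked by shared
  edges.\<close>

lemma lagrange_interpolation:
  fixes x :: "nat \<Rightarrow> real"
  assumes inj: "inj_on x {..M}"
  shows "\<exists>L. \<forall>p. degree p \<le> M \<longrightarrow> p = (\<Sum>i\<le>M. smult (poly p (x i)) (L i))"
proof -
  \<comment> \<open>The Lagrange basis polynomial of node i. Both sides of the claim have degree at
    most M and agree at M + 1 points.\<close>
  define L where "L i = (\<Prod>j\<in>{..M}-{i}. smult (1 / (x i - x j)) [:- x j, 1:])" for i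
  have degL: "degree (L i) \<le> M" if "i \<le> M" for i
  proof -
    have "degree (L i) \<le> (\<Sum>j\<in>{..M}-{i}. degree (smult (1 / (x i - x j)) [:- x j, 1:]))"
      unfolding L_def using degree_prod_sum_le[of "{..M}-{i}" "\<lambda>j. smult (1 / (x i - x j)) [:- x j, 1:]"]
      by (simp add: o_def)
    also have "\<dots> \<le> (\<Sum>j\<in>{..M}-{i}. 1)"
      by (intro sum_mono) simp
    also have "\<dots> = M" using that by simp
    finally show ?thesis .
  qed
  have valL: "poly (L i) (x k) = (if k = i then 1 else 0)" if "i \<le> M" "k \<le> M" for i k
  proof (cases "k = i")
    case True
    have "x i \<noteq> x j" if "j \<in> {..M} - {i}" for j
      using inj that \<open>i \<le> M\<close> by (auto simp: inj_on_def)
    then show ?thesis using True unfolding L_def by (simp add: poly_prod divide_simps)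
  next
    case False
    then show ?thesis unfolding L_def poly_prod
      using that by (auto intro!: prod_zero)
  qed
  have "p = (\<Sum>i\<le>M. smult (poly p (x i)) (L i))" if "degree p \<le> M" for p
  proof (rule poly_eqI_degree[where A = "x ` {..M}"])
    show "poly p z = poly (\<Sum>i\<le>M. smult (poly p (x i)) (L i)) z" if "z \<in> x ` {..M}" for z
    proof -
      from that obtain k where k: "k \<le> M" "z = x k" by auto
      have "poly (\<Sum>i\<le>M. smult (poly p (x i)) (L i)) z = (\<Sum>i\<le>M. poly p (x i) * (if k = i then 1 else 0))"
        unfolding poly_sum k(2) using valL k(1) by (intro sum.cong) auto
      also have "\<dots> = poly p (x k)" using k(1) by (simp add: if_distrib cong: if_cong)
      finally show ?thesis using k by simp
    qed
    have "card (x ` {..M}) = Suc M" using inj by (simp add: card_image)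
    then show "card (x ` {..M}) > degree p" using that by simp
    have "degree (\<Sum>i\<le>M. smult (poly p (x i)) (L i)) \<le> M"
      by (intro degree_sum_le) (auto intro: order_trans[OF degree_smult_le] degL)
    then show "card (x ` {..M}) > degree (\<Sum>i\<le>M. smult (poly p (x i)) (L i))"
      using \<open>card (x ` {..M}) = Suc M\<close> by simp
  qed
  then show ?thesis by blast
qed

text \<open>Nodes in (0, 1] keep every dilated ball inside the largest one. The lower bound 1 / (M +
  1) gives all bumps a common plateau around the centre.\<close>

definition node :: "nat \<Rightarrow> nat \<Rightarrow> real" where
  "node M i = real (Suc i) / real (Suc M)"

lemma node_pos: "0 < node M i" and node_ge: "1 / real (Suc M) \<le> node M i"
  by (auto simp: node_def divide_simps)

lemma node_le_1: "i \<le> M \<Longrightarrow> node M i \<le> 1"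
  by (auto simp: node_def divide_simps)

lemma inj_on_node: "inj_on (node M) A"
  by (auto simp: inj_on_def node_def)

text \<open>Reading off the coefficient of t^n is a linear functional on polynomials of degree at
  most M, hence a combination of values at M + 1 nodes. Its weights are the coefficients of t^n in
  the Lagrange basis.\<close>

lemma moment_weights:
  "\<exists>w::nat \<Rightarrow> real. \<forall>m\<le>M. (\<Sum>i\<le>M. w i * node M i ^ m) = (if m = n then 1 else 0)"
proof -
  obtain L where L: "\<And>p. degree p \<le> M \<Longrightarrow> p = (\<Sum>i\<le>M. smult (poly p (node M i)) (L i))"
    using lagrange_interpolation[OF inj_on_node] by blast
  have "(\<Sum>i\<le>M. coeff (L i) n * node M i ^ m) = (if m = n then 1 else 0)" if "m \<le> M" for m
  proof -
    have "monom 1 m = (\<Sum>i\<le>M. smult (poly (monom 1 m) (node M i)) (L i))"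
      using that by (intro L) (simp add: degree_monom_eq)
    then have "coeff (monom 1 m) n = coeff (\<Sum>i\<le>M. smult (poly (monom 1 m) (node M i)) (L i)) n"
      by simp
    then show ?thesis by (simp add: coeff_sum poly_monom mult.commute)
  qed
  then show ?thesis by (intro exI[of _ "\<lambda>i. coeff (L i) n"]) blast
qed

definition weight :: "nat \<Rightarrow> nat \<Rightarrow> nat \<Rightarrow> real" where
  "weight M n = (SOME w. \<forall>m\<le>M. (\<Sum>i\<le>M. w i * node M i ^ m) = (if m = n then 1 else 0))"

lemma weight: "m \<le> M \<Longrightarrow> (\<Sum>i\<le>M. weight M n i * node M i ^ m) = (if m = n then 1 else 0)"
  using someI_ex[OF moment_weights[of M n]] unfolding weight_def by blast

text \<open>Bounded degree along every line is all that is asked of the discrete functions besides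
  smoothness. The condition is stable under sums, products, affine substitutions and, for smooth
  functions, derivatives, and it reduces everything to polynomials in one variable.\<close>

definition line_poly :: "nat \<Rightarrow> ('a::real_vector \<Rightarrow> real) \<Rightarrow> bool" where
  "line_poly K f \<longleftrightarrow> (\<forall>b y. \<exists>p. degree p \<le> K \<and> (\<forall>t. f (b + t *\<^sub>R y) = poly p t))"

lemma line_polyD:
  assumes "line_poly K f"
  obtains p where "degree p \<le> K" "\<And>t. f (b + t *\<^sub>R y) = poly p t"
  using assms unfolding line_poly_def by blast

lemma line_poly_mono: "line_poly K f \<Longrightarrow> K \<le> L \<Longrightarrow> line_poly L f"
  unfolding line_poly_def by (meson order_trans)

lemma line_poly_const: "line_poly K (\<lambda>x. c)"
  unfolding line_poly_def by (intro allI exI[of _ "[:c:]"]) auto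

lemma line_poly_add:
  assumes "line_poly K f" "line_poly K g" shows "line_poly K (\<lambda>x. f x + g x)"
  unfolding line_poly_def
proof (intro allI)
  fix b y
  obtain p q where "degree p \<le> K" "\<And>t. f (b + t *\<^sub>R y) = poly p t"
    "degree q \<le> K" "\<And>t. g (b + t *\<^sub>R y) = poly q t"
    using line_polyD[OF assms(1)] line_polyD[OF assms(2)] by metis
  then show "\<exists>p. degree p \<le> K \<and> (\<forall>t. f (b + t *\<^sub>R y) + g (b + t *\<^sub>R y) = poly p t)"
    by (intro exI[of _ "p+q"]) (auto intro: degree_add_le)
qed

lemma line_poly_mult:
  assumes "line_poly K f" "line_poly L g" shows "line_poly (K + L) (\<lambda>x. f x * g x)"
  unfolding line_poly_def
proof (intro allI)
  fix b y
  obtain p q where "degree p \<le> K" "\<And>t. f (b + t *\<^sub>R y) = poly p t"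
    "degree q \<le> L" "\<And>t. g (b + t *\<^sub>R y) = poly q t"
    using line_polyD[OF assms(1)] line_polyD[OF assms(2)] by metis
  then show "\<exists>p. degree p \<le> K + L \<and> (\<forall>t. f (b + t *\<^sub>R y) * g (b + t *\<^sub>R y) = poly p t)"
    by (intro exI[of _ "p*q"]) (auto intro: order_trans[OF degree_mult_le])
qed

lemma line_poly_sum: "(\<And>i. i \<in> A \<Longrightarrow> line_poly K (f i)) \<Longrightarrow> line_poly K (\<lambda>x. \<Sum>i\<in>A. f i x)"
  by (induction A rule: infinite_finite_induct) (auto intro: line_poly_const line_poly_add)

lemma line_poly_prod:
  "(\<And>i. i \<in> A \<Longrightarrow> line_poly (K i) (f i)) \<Longrightarrow> line_poly (\<Sum>i\<in>A. K i) (\<lambda>x. \<Prod>i\<in>A. f i x)"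
  by (induction A rule: infinite_finite_induct) (auto intro: line_poly_const line_poly_mult)

lemma line_poly_power: "line_poly K f \<Longrightarrow> line_poly (n * K) (\<lambda>x. f x ^ n)"
  by (induction n) (auto intro: line_poly_const line_poly_mult)

lemma line_poly_cmult: "line_poly K f \<Longrightarrow> line_poly K (\<lambda>x. c * f x)"
  using line_poly_mult[OF line_poly_const[of 0 c], of K f] by simp

lemma line_poly_diff:
  "line_poly K f \<Longrightarrow> line_poly K g \<Longrightarrow> line_poly K (\<lambda>x. f x - g x)"
  using line_poly_add[of K f "\<lambda>x. - 1 * g x"] line_poly_cmult[of K g "-1"] by simp

lemma line_poly_inner: "line_poly (Suc 0) (\<lambda>x::'a::real_inner. x \<bullet> v)"
  unfolding line_poly_def
  by (intro allI, rule_tac x="[:b \<bullet> v, y \<bullet> v:]" in exI) (auto simp: inner_add_left)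

lemma line_poly_component: "line_poly (Suc 0) (\<lambda>x::real^'n. x $ i)"
  using line_poly_inner[of "axis i (1::real)"] by (simp add: inner_axis)

text \<open>Interpolation along lines as one linear identity whose coefficients depend neither on f
  nor on the line. In this form it can be differentiated with respect to the base point b, see
  \<open>line_poly_partial\<close>.\<close>

lemma line_poly_Lagrange:
  assumes inj: "inj_on x {..K}"
  obtains L :: "nat \<Rightarrow> real poly" where "\<And>i. i \<le> K \<Longrightarrow> degree (L i) \<le> K"
    "\<And>(f::'a::real_vector \<Rightarrow> real) b y t. line_poly K f \<Longrightarrow>
       f (b + t *\<^sub>R y) = (\<Sum>i\<le>K. poly (L i) t * f (b + x i *\<^sub>R y))"
proof -
  obtain L where L: "\<And>p. degree p \<le> K \<Longrightarrow> p = (\<Sum>i\<le>K. smult (poly p (x i)) (L i))"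
    using lagrange_interpolation[OF inj] by blast
  \<comment> \<open>\<open>lagrange_interpolation\<close> states no degree for the basis
    polynomials. Cutting off their terms of degree above K restores the bound and leaves the
    interpolation of polynomials of degree at most K intact.\<close>
  define L' where "L' i = poly_cutoff (Suc K) (L i)" for i
  have degL': "degree (L' i) \<le> K" for i
    unfolding L'_def by (rule degree_le) (simp add: coeff_poly_cutoff)
  have L': "p = (\<Sum>i\<le>K. smult (poly p (x i)) (L' i))" if "degree p \<le> K" for p
  proof (rule poly_eqI)
    fix n
    have "coeff p n = (\<Sum>i\<le>K. poly p (x i) * coeff (L i) n)"
      using arg_cong[OF L[OF that], of "\<lambda>p. coeff p n"] by (simp add: coeff_sum)
    then show "coeff p n = coeff (\<Sum>i\<le>K. smult (poly p (x i)) (L' i)) n"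
      using that by (cases "n \<le> K") (auto simp: coeff_sum L'_def coeff_poly_cutoff coeff_eq_0)
  qed
  show thesis
  proof (rule that[OF degL'])
    fix f :: "'a \<Rightarrow> real" and b y t assume "line_poly K f"
    then obtain p where p: "degree p \<le> K" "\<And>t. f (b + t *\<^sub>R y) = poly p t"
      unfolding line_poly_def by blast
    have "poly p t = (\<Sum>i\<le>K. poly p (x i) * poly (L' i) t)"
      using arg_cong[OF L'[OF p(1)], of "\<lambda>p. poly p t"] by (simp add: poly_sum)
    then show "f (b + t *\<^sub>R y) = (\<Sum>i\<le>K. poly (L' i) t * f (b + x i *\<^sub>R y))"
      using p(2) by (simp add: mult.commute)
  qed
qed

text \<open>Converse of \<open>line_poly_Lagrange\<close>: the right-hand side of the identity is
  visibly a polynomial in t. This is how the property passes to derivatives.\<close>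

lemma line_poly_of_Lagrange:
  fixes f :: "'a::real_vector \<Rightarrow> real"
  assumes "\<And>i. i \<le> K \<Longrightarrow> degree (L i) \<le> K"
    and "\<And>b y t. f (b + t *\<^sub>R y) = (\<Sum>i\<le>K. poly (L i) t * f (b + x i *\<^sub>R y))"
  shows "line_poly K f"
  unfolding line_poly_def
proof (intro allI)
  fix b y
  have "degree (\<Sum>i\<le>K. smult (f (b + x i *\<^sub>R y)) (L i)) \<le> K"
    using assms(1) by (intro degree_sum_le) (auto intro!: order_trans[OF degree_smult_le])
  moreover have "f (b + t *\<^sub>R y) = poly (\<Sum>i\<le>K. smult (f (b + x i *\<^sub>R y)) (L i)) t" for t
    by (subst assms(2)) (simp add: poly_sum mult.commute)
  ultimately show "\<exists>p. degree p \<le> K \<and> (\<forall>t. f (b + t *\<^sub>R y) = poly p t)"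
    by blast
qed

text \<open>Interpolating at nodes in \<open>(0, 1]\<close> along rays from \<open>b\<close> replaces the equivalence of norms on
  spaces of polynomials.\<close>

lemma line_poly_extrapolation:
  obtains C where "C > 0"
    "\<And>(f::'a::real_normed_vector \<Rightarrow> real) b r X x. line_poly K f \<Longrightarrow>
        (\<And>z. norm (z - b) \<le> r \<Longrightarrow> \<bar>f z\<bar> \<le> X) \<Longrightarrow> norm (x - b) \<le> R * r \<Longrightarrow> R > 0 \<Longrightarrow> \<bar>f x\<bar> \<le> C * X"
proof -
  obtain L :: "nat \<Rightarrow> real poly" where
    L: "\<And>(f::'a \<Rightarrow> real) b y t. line_poly K f \<Longrightarrow> f (b + t *\<^sub>R y) = (\<Sum>i\<le>K. poly (L i) t * f (b + node K i *\<^sub>R y))"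
    using line_poly_Lagrange[OF inj_on_node[of K "{..K}"], where 'a='a] by metis
  show thesis
  proof (rule that[of "1 + (\<Sum>i\<le>K. \<bar>poly (L i) R\<bar>)"])
    show "0 < 1 + (\<Sum>i\<le>K. \<bar>poly (L i) R\<bar>)" by (simp add: add_pos_nonneg sum_nonneg)
    fix f :: "'a \<Rightarrow> real" and b x r X
    assume f: "line_poly K f" and X: "\<And>z. norm (z - b) \<le> r \<Longrightarrow> \<bar>f z\<bar> \<le> X"
      and x: "norm (x - b) \<le> R * r" and R: "R > 0"
    \<comment> \<open>x sits at parameter R on the ray from b in direction y, and y is short enough
      for the nodes, which do not exceed 1, to stay in the ball of radius r.\<close>
    define y where "y = (1 / R) *\<^sub>R (x - b)"
    have "norm y = norm (x - b) / R" unfolding y_def norm_scaleR using R by simp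
    then have y: "norm y \<le> r" using x R by (simp add: pos_divide_le_eq mult.commute)
    have r: "0 \<le> r" using y norm_ge_zero[of y] by linarith
    have X0: "0 \<le> X" using X[of b] r by (simp) 
    have "f x = f (b + R *\<^sub>R y)" using R by (simp add: y_def)
    also have "\<dots> = (\<Sum>i\<le>K. poly (L i) R * f (b + node K i *\<^sub>R y))" by (rule L[OF f])
    finally have "\<bar>f x\<bar> \<le> (\<Sum>i\<le>K. \<bar>poly (L i) R\<bar> * \<bar>f (b + node K i *\<^sub>R y)\<bar>)"
      by (metis (no_types, lifting) sum_abs abs_mult sum.cong)
    also have "\<dots> \<le> (\<Sum>i\<le>K. \<bar>poly (L i) R\<bar> * X)"
    proof (intro sum_mono mult_left_mono X)
      fix i assume "i \<in> {..K}"
      then have "node K i * norm y \<le> 1 * r"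
        by (intro mult_mono y node_le_1) auto
      then show "norm (b + node K i *\<^sub>R y - b) \<le> r"
        using node_pos[of K i] by simp
    qed simp
    also have "\<dots> \<le> (1 + (\<Sum>i\<le>K. \<bar>poly (L i) R\<bar>)) * X"
      using X0 by (simp add: sum_distrib_left algebra_simps)
    finally show "\<bar>f x\<bar> \<le> (1 + (\<Sum>i\<le>K. \<bar>poly (L i) R\<bar>)) * X" .
  qed
qed

text \<open>The weights extract the coefficient of t^n from t^s p(t). With s the dimension minus 1,
  n = 0 gives 0 once s is positive, n = s gives the value at the centre, and n = s + 1 the first
  derivative there.\<close>

lemma weight_poly:
  assumes p: "degree p \<le> K" and M: "s + K \<le> M"
  shows "(\<Sum>i\<le>M. weight M n i * node M i ^ s * poly p (node M i)) =
    (if n < s then 0 else coeff p (n - s))"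
proof -
  have "(\<Sum>i\<le>M. weight M n i * node M i ^ s * poly p (node M i)) =
      (\<Sum>i\<le>M. \<Sum>m\<le>K. coeff p m * (weight M n i * node M i ^ (s + m)))"
  proof (rule sum.cong)
    fix i
    have "poly p (node M i) = (\<Sum>m\<le>K. coeff p m * node M i ^ m)"
      unfolding poly_altdef using p by (intro sum.mono_neutral_left) (auto simp: coeff_eq_0)
    then show "weight M n i * node M i ^ s * poly p (node M i) =
      (\<Sum>m\<le>K. coeff p m * (weight M n i * node M i ^ (s + m)))"
      by (simp add: sum_distrib_left power_add ac_simps)
  qed simp
  also have "\<dots> = (\<Sum>m\<le>K. coeff p m * (\<Sum>i\<le>M. weight M n i * node M i ^ (s + m)))"
    by (subst sum.swap) (simp add: sum_distrib_left)
  also have "\<dots> = (\<Sum>m\<le>K. coeff p m * (if s + m = n then 1 else 0))"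
    using M by (intro sum.cong) (auto simp: weight)
  also have "\<dots> = (\<Sum>m\<le>K. if m = n - s \<and> s \<le> n then coeff p m else 0)"
    by (intro sum.cong) auto
  also have "\<dots> = (if n < s then 0 else coeff p (n - s))"
    using p by (auto simp: coeff_eq_0)
  finally show ?thesis .
qed

section \<open>Smooth bump functions\<close>

definition smooth :: "(real^'n \<Rightarrow> 'b::real_normed_vector) \<Rightarrow> bool" where
  "smooth f \<longleftrightarrow> (\<forall>k. C_k k f)"

lemma partial_eq: "(f has_derivative f') (at x) \<Longrightarrow> partial j f x = f' (axis j 1)"
  unfolding partial_def using frechet_derivative_at by metis

lemma has_derivative_partial:
  assumes "f differentiable (at x)"
  shows "(f has_derivative (\<lambda>h. \<Sum>j\<in>UNIV. h $ j *\<^sub>R partial j f x)) (at x)"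
proof -
  from assms obtain f' where f': "(f has_derivative f') (at x)" by (auto simp: differentiable_def)
  then have "linear f'" by (rule has_derivative_linear)
  have "f' h = (\<Sum>j\<in>UNIV. h $ j *\<^sub>R partial j f x)" for h
  proof -
    have "f' h = f' (\<Sum>j\<in>UNIV. (h $ j) *\<^sub>R axis j 1)"
      using basis_expansion[of h] by (simp add: scalar_mult_eq_scaleR)
    then show ?thesis
      by (simp add: linear_sum[OF \<open>linear f'\<close>] linear_cmul[OF \<open>linear f'\<close>] partial_eq[OF f'])
  qed
  then show ?thesis using f' by (metis (no_types, lifting) ext)
qed

lemma C_k_differentiable: "C_k (Suc k) f \<Longrightarrow> f differentiable (at x)"
  by simp

lemma C_k_Suc_D: "C_k (Suc k) f \<Longrightarrow> C_k k f"
proof (induction k arbitrary: f)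
  case 0
  then show ?case
    by (auto intro!: differentiable_imp_continuous_on simp: differentiable_on_def
      intro: differentiable_at_withinI)
next
  case (Suc k)
  then show ?case by (metis C_k.simps(2))
qed

lemma C_k_const: "C_k k (\<lambda>x::real^'n. c)"
proof (induction k arbitrary: c)
  case (Suc k)
  have "partial j (\<lambda>x::real^'n. c) = (\<lambda>x. 0)" for j
    by (rule ext) (simp add: partial_def)
  then show ?case using Suc by simp
qed simp

lemma C_k_add: "C_k k f \<Longrightarrow> C_k k g \<Longrightarrow> C_k k (\<lambda>x. f x + g x)"
proof (induction k arbitrary: f g)
  case (Suc k)
  have "partial j (\<lambda>x. f x + g x) = (\<lambda>x. partial j f x + partial j g x)" for j
  proof
    fix x
    have "f differentiable (at x)" "g differentiable (at x)" using Suc.prems by auto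
    then show "partial j (\<lambda>x. f x + g x) x = partial j f x + partial j g x"
      unfolding frechet_derivative_works using partial_eq[OF has_derivative_add]
      by (fastforce simp: partial_def)
  qed
  then show ?case using Suc by simp
qed (auto intro: continuous_intros)

lemma partial_scaleR:
  assumes "f differentiable (at x)" "g differentiable (at x)"
  shows "partial j (\<lambda>x. f x *\<^sub>R g x) x = f x *\<^sub>R partial j g x + partial j f x *\<^sub>R g x"
  using partial_eq[OF has_derivative_scaleR[OF assms[unfolded frechet_derivative_works]]]
  by (simp add: partial_def)

lemma C_k_scaleR: "C_k k f \<Longrightarrow> C_k k g \<Longrightarrow> C_k k (\<lambda>x. f x *\<^sub>R g x)"
proof (induction k arbitrary: f g)
  case (Suc k)
  then have d: "f differentiable (at x)" "g differentiable (at x)" for x by auto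
  have "partial j (\<lambda>x. f x *\<^sub>R g x) = (\<lambda>x. f x *\<^sub>R partial j g x + partial j f x *\<^sub>R g x)" for j
    using partial_scaleR[OF d] by blast
  moreover have "C_k k (\<lambda>x. f x *\<^sub>R partial j g x + partial j f x *\<^sub>R g x)" for j
  proof (intro C_k_add Suc.IH)
    show "C_k k f" "C_k k g" using Suc.prems C_k_Suc_D by blast+
    show "C_k k (partial j f)" "C_k k (partial j g)" using Suc.prems by auto
  qed
  ultimately show ?case using d by (simp add: differentiable_scaleR)
qed (auto intro: continuous_intros)

lemma smooth_const [intro]: "smooth (\<lambda>x. c)"
  by (simp add: smooth_def C_k_const)

lemma smooth_add [intro]: "smooth f \<Longrightarrow> smooth g \<Longrightarrow> smooth (\<lambda>x. f x + g x)"
  by (simp add: smooth_def C_k_add)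

lemma smooth_scaleR [intro]: "smooth f \<Longrightarrow> smooth g \<Longrightarrow> smooth (\<lambda>x. f x *\<^sub>R g x)"
  by (simp add: smooth_def C_k_scaleR)

lemma smooth_mult [intro]:
  fixes f g :: "real^'n \<Rightarrow> real"
  shows "smooth f \<Longrightarrow> smooth g \<Longrightarrow> smooth (\<lambda>x. f x * g x)"
  using smooth_scaleR[of f g] by simp

lemma smooth_diff [intro]:
  assumes "smooth f" "smooth g" shows "smooth (\<lambda>x. f x - g x)"
proof -
  have "smooth (\<lambda>x. f x + (-1) *\<^sub>R g x)" using assms by (intro smooth_add smooth_scaleR) auto
  then show ?thesis by simp
qed

lemma smooth_sum: "(\<And>i. i \<in> A \<Longrightarrow> smooth (f i)) \<Longrightarrow> smooth (\<lambda>x. \<Sum>i\<in>A. f i x)"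
  by (induction A rule: infinite_finite_induct) auto

lemma smooth_prod:
  fixes f :: "'i \<Rightarrow> real^'n \<Rightarrow> real"
  shows "(\<And>i. i \<in> A \<Longrightarrow> smooth (f i)) \<Longrightarrow> smooth (\<lambda>x. \<Prod>i\<in>A. f i x)"
  by (induction A rule: infinite_finite_induct) auto

lemma smooth_power:
  fixes f :: "real^'n \<Rightarrow> real"
  shows "smooth f \<Longrightarrow> smooth (\<lambda>x. f x ^ n)"
  by (induction n) auto

lemma smooth_differentiable: "smooth f \<Longrightarrow> f differentiable (at x)"
  unfolding smooth_def using C_k_differentiable by blast

lemma smooth_partial: "smooth f \<Longrightarrow> smooth (partial j f)"
  unfolding smooth_def using C_k.simps(2) by blast

lemma smooth_continuous: "smooth f \<Longrightarrow> continuous_on A f"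
  unfolding smooth_def using C_k.simps(1) continuous_on_subset by (metis subset_UNIV)

lemma smooth_linear:
  assumes "bounded_linear f" shows "smooth f"
  unfolding smooth_def
proof
  fix k
  have "(f has_derivative f) (at x)" for x by (simp add: assms bounded_linear_imp_has_derivative)
  then have "f differentiable (at x)" "partial j f = (\<lambda>x. f (axis j 1))" for x j
    using partial_eq by (blast intro: differentiableI)+
  moreover have "continuous_on UNIV f" using assms by (simp add: linear_continuous_on)
  ultimately show "C_k k f" by (cases k) (auto simp: C_k_const)
qed

lemma smooth_component: "smooth (\<lambda>x. x $ i)"
  by (intro smooth_linear bounded_linear_vec_nth)

lemma smooth_norm_square: "smooth (\<lambda>x. x \<bullet> x)"
  unfolding inner_vec_def inner_real_def by (intro smooth_sum smooth_mult smooth_component)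

text \<open>A partial derivative of \<gamma> n composed with q is \<gamma> (n + 1) composed with q,
  times a partial derivative of q. So the induction on the order of differentiability has to treat
  all members of the tower at once.\<close>

lemma smooth_compose_tower:
  fixes q :: "real^'n \<Rightarrow> real" and \<gamma> :: "nat \<Rightarrow> real \<Rightarrow> real"
  assumes \<gamma>: "\<And>n x. (\<gamma> n has_real_derivative \<gamma> (Suc n) x) (at x)" and q: "smooth q"
  shows "smooth (\<lambda>x. \<gamma> n (q x))"
proof -
  have der: "((\<lambda>x. \<gamma> n (q x)) has_derivative (\<lambda>h. \<gamma> (Suc n) (q x) *\<^sub>R frechet_derivative q (at x) h)) (at x)" for n x
    using has_derivative_compose[OF smooth_differentiable[OF q, unfolded frechet_derivative_works]
      \<gamma>[unfolded has_field_derivative_def], of n x] by simp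
  have "C_k k (\<lambda>x. \<gamma> n (q x))" for k
  proof (induction k arbitrary: n)
    case 0
    have "(\<lambda>x. \<gamma> n (q x)) differentiable_on UNIV"
      using der by (auto simp: differentiable_on_def differentiable_def)
    then show ?case by (simp add: differentiable_imp_continuous_on)
  next
    case (Suc k)
    have "partial j (\<lambda>x. \<gamma> n (q x)) = (\<lambda>x. \<gamma> (Suc n) (q x) *\<^sub>R partial j q x)" for j
      using partial_eq[OF der] by (auto simp: partial_def)
    moreover have "C_k k (partial j q)" for j using smooth_partial[OF q] by (simp add: smooth_def)
    moreover have "(\<lambda>x. \<gamma> n (q x)) differentiable (at x)" for x using der by (rule differentiableI)
    moreover have "C_k k (\<lambda>x. \<gamma> (Suc n) (q x) *\<^sub>R partial j q x)" for j
      by (intro C_k_scaleR Suc.IH) fact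
    ultimately show ?case by simp
  qed
  then show ?thesis by (simp add: smooth_def)
qed

text \<open>With s = 1 / x, the derivative of P(s) exp(-s) with respect to x is s^2 (P(s) - P'(s))
  exp(-s); this is the recursion.\<close>

primrec flat_poly :: "nat \<Rightarrow> real poly" where
  "flat_poly 0 = 1"
| "flat_poly (Suc n) = [:0, 0, 1:] * (flat_poly n - pderiv (flat_poly n))"

text \<open>\<open>flat n\<close> is the \<open>n\<close>-th derivative of the function equal to \<open>exp (- 1 / x)\<close> for \<open>x > 0\<close>
  and to \<open>0\<close> otherwise.\<close>

definition flat :: "nat \<Rightarrow> real \<Rightarrow> real" where
  "flat n x = (if 0 < x then poly (flat_poly n) (inverse x) * exp (- inverse x) else 0)"

lemma poly_times_exp_tendsto_0: "((\<lambda>s::real. s ^ k * poly p s * exp (- s)) \<longlongrightarrow> 0) at_top"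
proof (induction p arbitrary: k)
  case (pCons a p)
  have "((\<lambda>s. a * (s ^ k / exp s) + s ^ Suc k * poly p s * exp (- s)) \<longlongrightarrow> a * 0 + 0) at_top"
    by (intro tendsto_intros tendsto_power_div_exp_0 pCons.IH)
  then show ?case by (simp add: exp_minus field_simps)
qed simp

lemma flat_has_derivative: "(flat n has_real_derivative flat (Suc n) x) (at x)"
proof (cases x "0::real" rule: linorder_cases)
  case less
  have "((\<lambda>x. 0) has_real_derivative 0) (at x)" by simp
  then have "(flat n has_real_derivative 0) (at x)"
    by (rule has_field_derivative_transform_within_open[where S = "{..<0}"]) (use less in \<open>auto simp: flat_def\<close>)
  then show ?thesis using less by (simp add: flat_def)
next
  case greater
  have "((\<lambda>x. poly (flat_poly n) (inverse x) * exp (- inverse x)) has_real_derivative flat (Suc n) x) (at x)"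
    using greater
    by (auto intro!: derivative_eq_intros DERIV_chain'[OF _ poly_DERIV] simp: flat_def power2_eq_square field_simps)
  then show ?thesis
    by (rule has_field_derivative_transform_within_open[where S = "{0<..}"]) (use greater in \<open>auto simp: flat_def\<close>)
next
  case equal
  \<comment> \<open>At 0 the difference quotient from the right is s P(s) exp(-s) with s = 1 / h,
    which tends to 0 as s grows; from the left it is 0.\<close>
  have "((\<lambda>s. s ^ 1 * poly (flat_poly n) s * exp (- s)) \<longlongrightarrow> 0) at_top"
    by (rule poly_times_exp_tendsto_0)
  then have "((\<lambda>h. inverse h ^ 1 * poly (flat_poly n) (inverse h) * exp (- inverse h)) \<longlongrightarrow> 0) (at_right 0)"
    by (rule filterlim_compose) (rule filterlim_inverse_at_top_right)
  then have "((\<lambda>h. (flat n (0 + h) - flat n 0) / h) \<longlongrightarrow> 0) (at_right 0)"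
    by (rule Lim_transform_eventually)
      (auto simp: flat_def field_simps eventually_at_filter)
  moreover have "((\<lambda>h. (flat n (0 + h) - flat n 0) / h) \<longlongrightarrow> 0) (at_left 0)"
    by (rule Lim_transform_eventually[OF tendsto_const])
      (auto simp: flat_def eventually_at_filter)
  ultimately have "((\<lambda>h. (flat n (0 + h) - flat n 0) / h) \<longlongrightarrow> 0) (at 0)"
    by (simp add: filterlim_split_at)
  then show ?thesis using equal by (simp add: DERIV_def flat_def)
qed

lemma smooth_flat: "smooth q \<Longrightarrow> smooth (\<lambda>x. flat n (q x))"
  by (rule smooth_compose_tower[where \<gamma> = flat]) (rule flat_has_derivative)

lemma flat_pos_iff: "0 < flat 0 x \<longleftrightarrow> 0 < x"
  by (simp add: flat_def)

lemma flat_eq_0_iff: "flat 0 x = 0 \<longleftrightarrow> x \<le> 0"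
  by (simp add: flat_def)

lemma flat_nonneg: "0 \<le> flat 0 x"
  by (simp add: flat_def)

lemma flat_le_1: "flat 0 x \<le> 1"
  by (simp add: flat_def)

lemma flat_mono: "x \<le> y \<Longrightarrow> flat 0 x \<le> flat 0 y"
  by (auto simp: flat_def)

lemma flat_1: "flat (Suc 0) x = (if 0 < x then exp (- inverse x) / x\<^sup>2 else 0)"
  by (simp add: flat_def power2_eq_square field_simps)

lemma continuous_flat: "continuous_on A (flat n)"
  by (intro continuous_at_imp_continuous_on ballI DERIV_isCont[OF flat_has_derivative])

text \<open>The inner \<open>flat\<close> vanishes for norm y at most 1/2, which gives a plateau of
  height 1. It reaches \<open>flat 0 (1/2)\<close> at y \<bullet> y = 3/4, and the bump is 0 from
  there on. The margin between 3/4 and 1 puts the support into the open unit ball.\<close>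

definition bump :: "real^'n \<Rightarrow> real" where
  "bump y = flat 0 (flat 0 (1/2) - flat 0 (y \<bullet> y - 1/4)) / flat 0 (flat 0 (1/2))"

text \<open>The gradient of the bump at y is \<open>- bump_slope y *\<^sub>R y\<close>. Keeping the
  radial factor apart makes the sign and the symmetry of the gradient visible.\<close>

definition bump_slope :: "real^'n \<Rightarrow> real" where
  "bump_slope y = 2 * flat 1 (flat 0 (1/2) - flat 0 (y \<bullet> y - 1/4)) * flat 1 (y \<bullet> y - 1/4) / flat 0 (flat 0 (1/2))"

lemma flat_flat_pos: "0 < flat 0 (flat 0 (1/2))"
  by (simp add: flat_pos_iff)

lemma smooth_bump: "smooth (bump :: real^'n \<Rightarrow> real)"
proof -
  have "smooth (\<lambda>y::real^'n. (1 / flat 0 (flat 0 (1/2))) * flat 0 (flat 0 (1/2) - flat 0 (y \<bullet> y - 1/4)))"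
    by (intro smooth_mult smooth_flat smooth_diff smooth_const smooth_norm_square)
  then show ?thesis by (simp add: bump_def[abs_def])
qed

lemma bump_nonneg: "0 \<le> bump y"
  by (simp add: bump_def flat_nonneg)

lemma norm_le_imp_inner_le: "norm (y::'a::real_inner) \<le> r \<Longrightarrow> y \<bullet> y \<le> r\<^sup>2"
  by (metis norm_ge_zero power2_norm_eq_inner power_mono)

lemma bump_eq_1:
  assumes "norm y \<le> 1/2" shows "bump y = 1"
proof -
  have "y \<bullet> y \<le> 1/4" using norm_le_imp_inner_le[OF assms] by (simp add: power2_eq_square)
  then have "flat 0 (y \<bullet> y - 1/4) = 0" by (simp add: flat_def)
  then show ?thesis using flat_flat_pos by (simp add: bump_def)
qed

lemma bump_outer:
  assumes "3/4 \<le> y \<bullet> y"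
  shows "bump y = 0" "bump_slope y = 0"
proof -
  have "flat 0 (1/2) \<le> flat 0 (y \<bullet> y - 1/4)" by (rule flat_mono) (use assms in simp)
  then show "bump y = 0" "bump_slope y = 0" by (auto simp: bump_def bump_slope_def flat_def)
qed

lemma bump_eq_0:
  assumes "1 \<le> norm y" shows "bump y = 0" "bump_slope y = 0"
proof -
  have "1\<^sup>2 \<le> (norm y)\<^sup>2" using assms by (intro power_mono) auto
  then have "3/4 \<le> y \<bullet> y" by (simp add: power2_norm_eq_inner)
  then show "bump y = 0" "bump_slope y = 0" by (rule bump_outer)+
qed

lemma bump_has_derivative: "(bump has_derivative (\<lambda>h. - bump_slope y * (y \<bullet> h))) (at y)"
proof -
  let ?m = "flat 0 (1/2)"
  have q: "((\<lambda>y. y \<bullet> y - 1/4) has_derivative (\<lambda>h. 2 * (y \<bullet> h))) (at y)"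
    by (auto intro!: derivative_eq_intros simp: inner_commute)
  have 1: "((\<lambda>y. flat 0 (y \<bullet> y - 1/4)) has_derivative (\<lambda>h. flat 1 (y \<bullet> y - 1/4) * (2 * (y \<bullet> h)))) (at y)"
    using has_derivative_compose[OF q flat_has_derivative[unfolded has_field_derivative_def]] by simp
  have 2: "((\<lambda>y. ?m - flat 0 (y \<bullet> y - 1/4)) has_derivative (\<lambda>h. - (flat 1 (y \<bullet> y - 1/4) * (2 * (y \<bullet> h))))) (at y)"
    using has_derivative_diff[OF has_derivative_const 1] by simp
  have 3: "((\<lambda>y. flat 0 (?m - flat 0 (y \<bullet> y - 1/4))) has_derivative
      (\<lambda>h. flat 1 (?m - flat 0 (y \<bullet> y - 1/4)) * (- (flat 1 (y \<bullet> y - 1/4) * (2 * (y \<bullet> h)))))) (at y)"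
    using has_derivative_compose[OF 2 flat_has_derivative[unfolded has_field_derivative_def]] by simp
  show ?thesis
    using has_derivative_mult_right[OF 3, of "1 / flat 0 ?m"]
    by (simp add: bump_def[abs_def] bump_slope_def mult_ac)
qed

lemma partial_bump: "partial j bump y = - bump_slope y * y $ j"
  using partial_eq[OF bump_has_derivative] by (simp add: inner_axis)

lemma bump_slope_nonneg: "0 \<le> bump_slope y"
  using flat_flat_pos by (auto simp: bump_slope_def flat_1 intro!: divide_nonneg_pos mult_nonneg_nonneg)

lemma bump_slope_pos:
  assumes "1/4 < y \<bullet> y" "y \<bullet> y < 3/4" shows "0 < bump_slope y"
proof -
  have "flat 0 (y \<bullet> y - 1/4) < flat 0 (1/2)" using assms by (auto simp: flat_def field_simps)
  then show ?thesis using assms flat_flat_pos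
    by (auto simp: bump_slope_def flat_1 intro!: divide_pos_pos mult_pos_pos)
qed

lemma bump_slope_minus: "bump_slope (- y) = bump_slope y"
  by (simp add: bump_slope_def)

lemma continuous_bump_slope: "continuous_on A bump_slope"
proof -
  have c: "continuous_on A (\<lambda>y. flat n (g y))" if "continuous_on A g" for g :: "real^'a \<Rightarrow> real" and n
    using continuous_on_compose2[OF continuous_flat[of UNIV n] that] by simp
  show ?thesis unfolding bump_slope_def[abs_def] divide_inverse
    by (intro continuous_intros c)
qed

text \<open>A smooth replacement for the indicator of an open box. The product is positive exactly
  inside the box, and the shift by 1 confines the support to the closed set where n times the
  product is at least 1. As n grows, the argument tends to infinity inside the box, where
  \<open>flat 0\<close> then tends to 1.\<close>

definition box_bump :: "real^'n \<Rightarrow> real^'n \<Rightarrow> nat \<Rightarrow> real^'n \<Rightarrow> real" where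
  "box_bump a b n x =
     flat 0 (real n * (\<Prod>i\<in>UNIV. flat 0 (x $ i - a $ i) * flat 0 (b $ i - x $ i)) - 1)"

lemma box_bump_nonneg: "0 \<le> box_bump a b n x" and box_bump_le_1: "box_bump a b n x \<le> 1"
  by (auto simp: box_bump_def flat_nonneg flat_le_1)

lemma box_bump_0: "x \<notin> box a b \<Longrightarrow> box_bump a b n x = 0"
proof -
  assume "x \<notin> box a b"
  then obtain i where "\<not> (a $ i < x $ i \<and> x $ i < b $ i)" by (auto simp: mem_box_cart)
  then have "flat 0 (x $ i - a $ i) * flat 0 (b $ i - x $ i) = 0" by (auto simp: flat_def)
  then have "(\<Prod>i\<in>UNIV. flat 0 (x $ i - a $ i) * flat 0 (b $ i - x $ i)) = 0"
    by (intro prod_zero) auto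
  then show ?thesis unfolding box_bump_def by (simp only:) (simp add: flat_def)
qed

lemma smooth_box: "smooth (\<lambda>x. \<Prod>i\<in>UNIV. flat 0 (x $ i - a $ i) * flat 0 (b $ i - x $ i))"
  by (intro smooth_prod smooth_mult smooth_flat smooth_diff smooth_const smooth_component)

lemma test_function_box_bump:
  assumes "box a b \<subseteq> \<Omega>" shows "test_function \<Omega> (box_bump a b n)"
proof -
  let ?q = "\<lambda>x. \<Prod>i\<in>UNIV. flat 0 (x $ i - a $ i) * flat 0 (b $ i - x $ i)"
  have sm: "smooth (box_bump a b n)" unfolding box_bump_def[abs_def]
    by (intro smooth_flat smooth_diff smooth_mult smooth_const smooth_box)
  have cont: "continuous_on UNIV ?q" by (rule smooth_continuous[OF smooth_box])
  have "closure {x. box_bump a b n x \<noteq> 0} \<subseteq> {x. 1 \<le> real n * ?q x}"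
    by (intro closure_minimal closed_Collect_le continuous_intros cont) (auto simp: box_bump_def flat_def)
  also have "\<dots> \<subseteq> box a b"
  proof
    fix x assume x: "x \<in> {x. 1 \<le> real n * ?q x}"
    have "?q x \<noteq> 0"
    proof
      assume "?q x = 0"
      moreover have "1 \<le> real n * ?q x" using x by blast
      ultimately have "1 \<le> real n * 0" by (simp only:)
      then show False by simp
    qed
    then have "flat 0 (x $ i - a $ i) * flat 0 (b $ i - x $ i) \<noteq> 0" for i by simp
    then have "flat 0 (x $ i - a $ i) \<noteq> 0" "flat 0 (b $ i - x $ i) \<noteq> 0" for i by (metis mult_eq_0_iff)+
    then show "x \<in> box a b" by (simp add: mem_box_cart flat_eq_0_iff not_le)
  qed
  finally have sub: "closure {x. box_bump a b n x \<noteq> 0} \<subseteq> box a b" .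
  then have "compact (closure {x. box_bump a b n x \<noteq> 0})"
    by (meson bounded_box bounded_subset closed_closure compact_eq_bounded_closed)
  then show ?thesis using sub assms sm unfolding test_function_def smooth_def by blast
qed

lemma box_bump_tendsto: "(\<lambda>n. box_bump a b n x) \<longlonglongrightarrow> indicator (box a b) x"
proof (cases "x \<in> box a b")
  case True
  define q where "q = (\<Prod>i\<in>UNIV. flat 0 (x $ i - a $ i) * flat 0 (b $ i - x $ i))"
  have q: "0 < q" unfolding q_def using True
    by (intro prod_pos) (auto simp: mem_box_cart flat_pos_iff)
  have "filterlim (\<lambda>n. real n * q) at_top sequentially"
    by (rule filterlim_at_top_mult_tendsto_pos[OF tendsto_const q filterlim_real_sequentially])
  then have lim: "filterlim (\<lambda>n. -1 + real n * q) at_top sequentially"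
    by (rule filterlim_tendsto_add_at_top[OF tendsto_const])
  then have "(\<lambda>n. inverse (-1 + real n * q)) \<longlonglongrightarrow> 0"
    by (rule filterlim_compose[OF tendsto_inverse_0_at_top[OF filterlim_ident]])
  then have "(\<lambda>n. exp (- inverse (-1 + real n * q))) \<longlonglongrightarrow> exp (- 0)"
    by (intro tendsto_intros)
  moreover have "\<forall>\<^sub>F n in sequentially. exp (- inverse (-1 + real n * q)) = box_bump a b n x"
    using lim[unfolded filterlim_at_top_dense, rule_format, of 0]
    unfolding box_bump_def q_def[symmetric] by eventually_elim (simp add: flat_def)
  ultimately show ?thesis using True by (simp add: Lim_transform_eventually)
qed (simp add: box_bump_0)

section \<open>Integration by parts and the fundamental lemma\<close>

lemma integral_lebesgue_on_support:
  fixes f :: "'a::euclidean_space \<Rightarrow> 'b::euclidean_space"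
  assumes "S \<in> sets lebesgue" "\<And>x. x \<notin> S \<Longrightarrow> f x = 0"
  shows "integral\<^sup>L (lebesgue_on S) f = integral\<^sup>L lebesgue f"
proof -
  have "(\<lambda>x. if x \<in> S then f x else 0) = f" using assms(2) by auto
  then show ?thesis using Lebesgue_Measure.integral_restrict_UNIV[OF assms(1), of f] by simp
qed

lemma integrable_lebesgue_on_support:
  fixes f :: "'a::euclidean_space \<Rightarrow> 'b::euclidean_space"
  assumes "S \<in> sets lebesgue" "\<And>x. x \<notin> S \<Longrightarrow> f x = 0"
  shows "integrable (lebesgue_on S) f \<longleftrightarrow> integrable lebesgue f"
proof -
  have "(\<lambda>x. if x \<in> S then f x else 0) = f" using assms(2) by auto
  then show ?thesis using Lebesgue_Measure.integrable_restrict_UNIV[OF assms(1), of f] by simp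
qed

lemma lebesgue_affine:
  fixes f :: "'a::euclidean_space \<Rightarrow> 'b::euclidean_space" and b :: 'a
  assumes s: "s \<noteq> 0" and f: "integrable lebesgue f"
  shows "integrable lebesgue (\<lambda>y. f (b + s *\<^sub>R y))"
    and "integral\<^sup>L lebesgue f = \<bar>s\<bar> ^ DIM('a) *\<^sub>R integral\<^sup>L lebesgue (\<lambda>y. f (b + s *\<^sub>R y))"
proof -
  have T: "(\<lambda>x. b + (\<Sum>j\<in>Basis. (s * (x \<bullet> j)) *\<^sub>R j)) = (\<lambda>x. b + s *\<^sub>R x)"
    unfolding scaleR_scaleR[symmetric] scaleR_sum_right[symmetric] euclidean_representation ..
  have leb: "lebesgue = density (distr lebesgue lebesgue (\<lambda>x. b + s *\<^sub>R x)) (\<lambda>_. \<bar>s\<bar> ^ DIM('a))"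
    using lebesgue_affine_euclidean[of "\<lambda>_. s" b] s by (simp add: T)
  have meas [measurable]: "(\<lambda>x. b + s *\<^sub>R x) \<in> lebesgue \<rightarrow>\<^sub>M lebesgue"
    using lebesgue_affine_measurable[of "\<lambda>_. s" b] s by (simp add: T)
  have fm [measurable]: "f \<in> borel_measurable lebesgue" using f by auto
  have "integrable (density (distr lebesgue lebesgue (\<lambda>x. b + s *\<^sub>R x)) (\<lambda>_. \<bar>s\<bar> ^ DIM('a))) f"
    using f leb by simp
  then have "integrable lebesgue (\<lambda>y. \<bar>s\<bar> ^ DIM('a) *\<^sub>R f (b + s *\<^sub>R y))"
    by (subst (asm) integrable_density) (auto simp: integrable_distr_eq)
  from integrable_scaleR_right[OF this, of "1 / \<bar>s\<bar> ^ DIM('a)"]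
  show "integrable lebesgue (\<lambda>y. f (b + s *\<^sub>R y))" using s by simp
  have "integral\<^sup>L lebesgue f =
      integral\<^sup>L (density (distr lebesgue lebesgue (\<lambda>x. b + s *\<^sub>R x)) (\<lambda>_. \<bar>s\<bar> ^ DIM('a))) f"
    using leb by simp
  also have "\<dots> = integral\<^sup>L lebesgue (\<lambda>y. \<bar>s\<bar> ^ DIM('a) *\<^sub>R f (b + s *\<^sub>R y))"
    by (subst integral_density) (auto simp: integral_distr)
  finally show "integral\<^sup>L lebesgue f = \<bar>s\<bar> ^ DIM('a) *\<^sub>R integral\<^sup>L lebesgue (\<lambda>y. f (b + s *\<^sub>R y))"
    by simp
qed

lemma integrable_lebesgue_compact_support:
  fixes f :: "'a::euclidean_space \<Rightarrow> 'b::euclidean_space"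
  assumes "continuous_on UNIV f" "\<And>x. x \<notin> K \<Longrightarrow> f x = 0" "bounded K"
  shows "integrable lebesgue f"
proof -
  have "compact (closure K)" using assms(3) by simp
  then have "integrable lborel (\<lambda>x. indicator (closure K) x *\<^sub>R f x)"
    by (rule borel_integrable_compact) (use assms(1) continuous_on_subset in blast)
  moreover have "(\<lambda>x. indicator (closure K) x *\<^sub>R f x) = f"
  proof
    fix x show "indicator (closure K) x *\<^sub>R f x = f x"
      using assms(2)[of x] closure_subset[of K] by (cases "x \<in> closure K") auto
  qed
  ultimately have "integrable lborel f" by simp
  then show ?thesis by (simp add: integrable_completion)
qed

lemma bounded_compact_support:
  fixes f :: "'a::euclidean_space \<Rightarrow> 'b::real_normed_vector"
  assumes "continuous_on UNIV f" "\<And>x. x \<notin> K \<Longrightarrow> f x = 0" "bounded K"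
  obtains B where "B > 0" "\<And>x. norm (f x) \<le> B"
proof -
  have "compact (f ` closure K)"
    using assms by (intro compact_continuous_image) (auto intro: continuous_on_subset)
  then obtain B where B: "B > 0" "\<And>x. x \<in> closure K \<Longrightarrow> norm (f x) \<le> B"
    using bounded_pos compact_imp_bounded by (metis imageI)
  have "norm (f x) \<le> B" for x
    using B(1) B(2)[of x] assms(2)[of x] closure_subset[of K] by (cases "x \<in> K") auto
  with B(1) show thesis using that by blast
qed

text \<open>Translation invariance in the direction \<open>v\<close>, differentiated under the integral.\<close>

lemma integral_directional_derivative_eq_0:
  fixes \<phi> :: "'a::euclidean_space \<Rightarrow> real"
  assumes der: "\<And>x. (\<phi> has_derivative D x) (at x)" and bd: "\<And>x. \<bar>D x v\<bar> \<le> B"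
    and supp: "\<And>x. x \<notin> K \<Longrightarrow> \<phi> x = 0" and K: "bounded K"
    and H: "H \<in> sets lebesgue" "\<And>x s. x + s *\<^sub>R v \<in> H \<longleftrightarrow> x \<in> H"
  shows "integral\<^sup>L lebesgue (\<lambda>x. indicator H x * D x v) = 0"
    and "integrable lebesgue (\<lambda>x. indicator H x * D x v)"
proof -
  have cont: "continuous_on UNIV \<phi>"
    by (intro continuous_at_imp_continuous_on ballI has_derivative_continuous[OF der])
  have int: "integrable lebesgue (\<lambda>x. indicator H x * \<phi> x)"
    using integrable_mult_indicator[OF H(1) integrable_lebesgue_compact_support[OF cont supp K]] by simp
  define t where "t n = 1 / real (Suc n)" for n
  have t: "0 < t n" "t n \<le> 1" for n by (auto simp: t_def)
  \<comment> \<open>Each difference quotient has integral 0, because the measure and H are invariant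
    under translation by multiples of v. The mean value theorem bounds the quotients by B, and since
    the steps are at most 1 they all vanish outside one ball; dominated convergence does the
    rest.\<close>
  define g where "g n x = indicator H x * ((\<phi> (x + t n *\<^sub>R v) - \<phi> x) / t n)" for n x
  have shift: "(\<lambda>x. indicator H x * \<phi> (x + t n *\<^sub>R v)) =
     (\<lambda>x. (\<lambda>x. indicator H x * \<phi> x) (t n *\<^sub>R v + 1 *\<^sub>R x))" for n
    using H(2)[of _ "t n"] by (auto simp: add.commute indicator_def)
  have int_shift: "integrable lebesgue (\<lambda>x. indicator H x * \<phi> (x + t n *\<^sub>R v))"
    and eq_shift: "integral\<^sup>L lebesgue (\<lambda>x. indicator H x * \<phi> (x + t n *\<^sub>R v)) =
      integral\<^sup>L lebesgue (\<lambda>x. indicator H x * \<phi> x)" for n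
    unfolding shift using lebesgue_affine[OF _ int, of 1 "t n *\<^sub>R v"] by auto
  have g: "g n = (\<lambda>x. (indicator H x * \<phi> (x + t n *\<^sub>R v) - indicator H x * \<phi> x) / t n)" for n
    by (auto simp: g_def field_simps)
  have g0: "integral\<^sup>L lebesgue (g n) = 0" and gint: "integrable lebesgue (g n)" for n
    unfolding g using int int_shift eq_shift by auto
  obtain R where R: "\<And>x. x \<in> K \<Longrightarrow> norm x \<le> R" using K by (auto simp: bounded_iff)
  define w where "w x = B * indicator (cball 0 (R + norm v)) x" for x :: 'a
  have wint: "integrable lebesgue w"
    unfolding w_def using emeasure_bounded_finite[OF bounded_cball[of 0 "R + norm v"]]
    by (intro integrable_mult_right integrable_real_indicator) (auto simp: fmeasurableD)
  have B0: "0 \<le> B" using bd[of 0] by (meson abs_ge_zero order_trans)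
  have line: "((\<lambda>s. \<phi> (x + s *\<^sub>R v)) has_real_derivative D (x + s *\<^sub>R v) v) (at s)" for x s
  proof -
    have "((\<lambda>s. x + s *\<^sub>R v) has_derivative (\<lambda>h. h *\<^sub>R v)) (at s)"
      by (auto intro!: derivative_eq_intros)
    from has_derivative_compose[OF this der]
    have "((\<lambda>s. \<phi> (x + s *\<^sub>R v)) has_derivative (\<lambda>h. D (x + s *\<^sub>R v) (h *\<^sub>R v))) (at s)" .
    moreover have "D (x + s *\<^sub>R v) (h *\<^sub>R v) = D (x + s *\<^sub>R v) v * h" for h
      using linear_cmul[OF has_derivative_linear[OF der]] by (simp add: mult.commute)
    ultimately show ?thesis by (simp add: has_field_derivative_def)
  qed
  have bound: "\<bar>g n x\<bar> \<le> w x" for n x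
  proof (cases "x \<in> cball 0 (R + norm v)")
    case True
    obtain z where z: "0 < z" "\<phi> (x + t n *\<^sub>R v) - \<phi> (x + 0 *\<^sub>R v) = (t n - 0) * D (x + z *\<^sub>R v) v"
      using MVT2[OF t(1)[of n], of "\<lambda>s. \<phi> (x + s *\<^sub>R v)" "\<lambda>s. D (x + s *\<^sub>R v) v"] line by blast
    then have "(\<phi> (x + t n *\<^sub>R v) - \<phi> x) / t n = D (x + z *\<^sub>R v) v" using t(1)[of n] by simp
    then show ?thesis using True bd B0 by (auto simp: g_def w_def indicator_def)
  next
    case False
    then have x: "R + norm v < norm x" by simp
    have "norm x \<le> norm (x + t n *\<^sub>R v) + norm (t n *\<^sub>R v)"
      by (metis add_diff_cancel_right' norm_triangle_ineq4)
    also have "norm (t n *\<^sub>R v) \<le> norm v" using t[of n] by (simp add: mult_left_le_one_le)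
    finally have "x + t n *\<^sub>R v \<notin> K" using x R by force
    moreover have "x \<notin> K" using x R[of x] norm_ge_zero[of v] by linarith
    ultimately show ?thesis using False supp by (simp add: g_def w_def)
  qed
  have t0: "filterlim t (at 0) sequentially"
    unfolding filterlim_at t_def using LIMSEQ_inverse_real_of_nat by (auto simp: inverse_eq_divide)
  have lim: "(\<lambda>n. g n x) \<longlonglongrightarrow> indicator H x * D x v" for x
  proof -
    have "((\<lambda>h. (\<phi> (x + (0 + h) *\<^sub>R v) - \<phi> (x + 0 *\<^sub>R v)) / h) \<longlongrightarrow> D (x + 0 *\<^sub>R v) v) (at 0)"
      using line[of x 0] by (simp only: DERIV_def)
    from filterlim_compose[OF this t0]
    have "((\<lambda>n. (\<phi> (x + t n *\<^sub>R v) - \<phi> x) / t n) \<longlongrightarrow> D x v) sequentially"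
      by simp
    then show ?thesis unfolding g_def by (intro tendsto_intros)
  qed
  have meas: "(\<lambda>x. indicator H x * D x v) \<in> borel_measurable lebesgue"
    by (rule borel_measurable_LIMSEQ_metric[OF borel_measurable_integrable[OF gint] lim])
  have bound': "AE x in lebesgue. norm (g n x) \<le> w x" for n using bound by simp
  show "integrable lebesgue (\<lambda>x. indicator H x * D x v)"
    by (rule integrable_dominated_convergence[OF meas borel_measurable_integrable[OF gint] wint AE_I2[OF lim] bound'])
  have "(\<lambda>n. integral\<^sup>L lebesgue (g n)) \<longlonglongrightarrow> integral\<^sup>L lebesgue (\<lambda>x. indicator H x * D x v)"
    by (rule integral_dominated_convergence[OF meas borel_measurable_integrable[OF gint] wint AE_I2[OF lim] bound'])
  then show "integral\<^sup>L lebesgue (\<lambda>x. indicator H x * D x v) = 0"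
    by (simp add: g0 LIMSEQ_const_iff)
qed

lemma smooth_partial_support:
  assumes f: "smooth f" and supp: "\<And>x. x \<notin> K \<Longrightarrow> f x = 0" and x: "x \<notin> closure K"
  shows "partial j f x = 0"
proof -
  have "((\<lambda>_. 0) has_derivative (\<lambda>_. 0)) (at x)" by simp
  then have "(f has_derivative (\<lambda>_. 0)) (at x)"
    by (rule has_derivative_transform_within_open[where s = "- closure K"])
      (use x supp closure_subset in auto)
  then show ?thesis by (simp add: partial_eq)
qed

lemma integral_by_parts:
  fixes u \<phi> :: "real^'n \<Rightarrow> real"
  assumes u: "smooth u" and \<phi>: "smooth \<phi>" and supp: "\<And>x. x \<notin> K \<Longrightarrow> \<phi> x = 0" and K: "bounded K"
  shows "integral\<^sup>L lebesgue (\<lambda>x. u x * partial j \<phi> x) = - integral\<^sup>L lebesgue (\<lambda>x. partial j u x * \<phi> x)"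
    and "integrable lebesgue (\<lambda>x. u x * partial j \<phi> x)"
    and "integrable lebesgue (\<lambda>x. partial j u x * \<phi> x)"
proof -
  have supp': "partial j \<phi> x = 0" if "x \<notin> closure K" for x
    using smooth_partial_support[OF \<phi> supp that] .
  have K': "bounded (closure K)" using K by (rule bounded_closure)
  note c = smooth_continuous[OF u] smooth_continuous[OF \<phi>] smooth_continuous[OF smooth_partial[OF u]]
    smooth_continuous[OF smooth_partial[OF \<phi>]]
  show i1: "integrable lebesgue (\<lambda>x. u x * partial j \<phi> x)"
    by (rule integrable_lebesgue_compact_support[OF _ _ K']) (auto intro!: continuous_intros c simp: supp')
  show i2: "integrable lebesgue (\<lambda>x. partial j u x * \<phi> x)"
    by (rule integrable_lebesgue_compact_support[OF _ _ K]) (auto intro!: continuous_intros c simp: supp)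
  define D where "D x h = u x * frechet_derivative \<phi> (at x) h + frechet_derivative u (at x) h * \<phi> x" for x h
  have der: "((\<lambda>x. u x * \<phi> x) has_derivative D x) (at x)" for x
    unfolding D_def using smooth_differentiable[OF u] smooth_differentiable[OF \<phi>]
    unfolding frechet_derivative_works by (rule has_derivative_mult)
  have Dj: "D x (axis j 1) = u x * partial j \<phi> x + partial j u x * \<phi> x" for x
    by (simp add: D_def partial_def)
  have cD: "continuous_on UNIV (\<lambda>x. D x (axis j 1))"
    unfolding Dj by (intro continuous_intros c)
  have "D x (axis j 1) = 0" if "x \<notin> closure K" for x
    using supp' supp that closure_subset[of K] by (auto simp: Dj)
  then obtain B where B: "\<And>x. \<bar>D x (axis j 1)\<bar> \<le> B"
    using bounded_compact_support[OF cD _ K'] by (metis real_norm_def)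
  have "integral\<^sup>L lebesgue (\<lambda>x. indicator UNIV x * D x (axis j 1)) = 0"
    by (rule integral_directional_derivative_eq_0[OF der B _ K]) (auto simp: supp)
  then show "integral\<^sup>L lebesgue (\<lambda>x. u x * partial j \<phi> x) = - integral\<^sup>L lebesgue (\<lambda>x. partial j u x * \<phi> x)"
    using i1 i2 by (simp add: Dj)
qed

text \<open>Boxes form an intersection-stable generator of the Borel sets, so the integrals vanish
  over every Borel set. The sets where f is nonnegative or nonpositive then give the claim.
  \<open>UNIV0\<close> serves the complement step, since the whole space is not a box.\<close>

lemma set_integral_boxes_0_imp_AE_0:
  fixes f :: "real^'n \<Rightarrow> real"
  assumes f: "integrable lebesgue f" and 0: "\<And>a b. integral\<^sup>L lebesgue (\<lambda>x. indicator (box a b) x * f x) = 0"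
    and UNIV0: "integral\<^sup>L lebesgue f = 0"
  shows "AE x in lebesgue. f x = 0"
proof -
  have intA: "integrable lebesgue (\<lambda>x. indicator A x * f x)" if "A \<in> sets lebesgue" for A
    using integrable_mult_indicator[OF that f] by simp
  have "integral\<^sup>L lebesgue (\<lambda>x. indicator A x * f x) = 0" if "A \<in> sets borel" for A
  proof -
    let ?G = "range (\<lambda>(a, b). box a b :: (real^'n) set)"
    have borel: "sigma_sets UNIV ?G = sets borel"
      by (subst borel_eq_box) (simp add: sets_measure_of)
    have A: "A \<in> sigma_sets UNIV ?G" using that borel by simp
    have "Int_stable ?G"
      unfolding Int_stable_def by (auto simp: Int_interval box_Int_box)
    moreover have "?G \<subseteq> Pow UNIV" by simp
    ultimately show ?thesis using A
    proof (induction rule: sigma_sets_induct_disjoint)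
      case (basic A)
      then show ?case using 0 by auto
    next
      case empty
      then show ?case by simp
    next
      case (compl A)
      then have A: "A \<in> sets lebesgue" using borel by auto
      have "(\<lambda>x. indicator (UNIV - A) x * f x) = (\<lambda>x. f x - indicator A x * f x)"
        by (auto simp: indicator_def)
      then show ?case using f intA[OF A] UNIV0 compl by simp
    next
      case (union A)
      then have A: "A i \<in> sets lebesgue" for i using borel by auto
      have "set_lebesgue_integral lebesgue (\<Union>i. A i) f = (\<Sum>i. set_lebesgue_integral lebesgue (A i) f)"
      proof (rule lebesgue_integral_countable_add)
        show "set_integrable lebesgue (\<Union>i. A i) f"
          unfolding set_integrable_def using A by (intro integrable_mult_indicator f) auto
      qed (use A union in \<open>auto simp: disjoint_family_on_def\<close>)
      then show ?case using union by (simp add: set_lebesgue_integral_def)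
    qed
  qed note borel0 = this
  \<comment> \<open>f is only Lebesgue measurable. The sign sets are those of an almost everywhere
    equal Borel function g, so that they are Borel sets.\<close>
  obtain g where g [measurable]: "g \<in> borel_measurable lborel" and fg: "AE x in lborel. f x = g x"
    using completion_ex_borel_measurable_real f by blast
  have fg': "AE x in lebesgue. f x = g x" using fg by (rule AE_completion)
  have gm: "g \<in> borel_measurable lebesgue" using g by (rule measurable_completion)
  have sign0: "AE x in lebesgue. indicator A x * f x = 0"
    if A: "A \<in> sets borel" and c: "\<And>x. x \<in> A \<Longrightarrow> 0 \<le> c * g x" "c \<noteq> 0" for A and c :: real
  proof -
    have A': "A \<in> sets lebesgue" using A by auto
    have "AE x in lebesgue. 0 \<le> c * (indicator A x * f x)"
      using fg' by eventually_elim (auto simp: indicator_def c)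
    moreover have "integrable lebesgue (\<lambda>x. c * (indicator A x * f x))" using intA[OF A'] by simp
    moreover have "integral\<^sup>L lebesgue (\<lambda>x. c * (indicator A x * f x)) = 0" using borel0[OF A] by simp
    ultimately have "AE x in lebesgue. c * (indicator A x * f x) = 0"
      using integral_nonneg_eq_0_iff_AE[of lebesgue "\<lambda>x. c * (indicator A x * f x)"] by simp
    then show ?thesis using c by simp
  qed
  have "{x. 0 \<le> g x} \<in> sets borel" "{x. g x \<le> 0} \<in> sets borel"
    using g by simp_all
  from sign0[OF this(1), of 1] sign0[OF this(2), of "-1"]
  have "AE x in lebesgue. indicator {x. 0 \<le> g x} x * f x = 0" "AE x in lebesgue. indicator {x. g x \<le> 0} x * f x = 0"
    by auto
  then show ?thesis by eventually_elim (auto simp: indicator_def split: if_splits)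
qed

lemma locally_integrable_mult:
  fixes h \<phi> :: "real^'n \<Rightarrow> real"
  assumes h: "locally_integrable \<Omega> h" and \<phi>: "continuous_on UNIV \<phi>"
    and K: "compact K" "K \<subseteq> \<Omega>" "\<And>x. x \<notin> K \<Longrightarrow> \<phi> x = 0"
  shows "integrable lebesgue (\<lambda>x. h x * \<phi> x)"
proof -
  have "integrable lebesgue (\<lambda>x. indicator K x * h x)"
    using h K unfolding locally_integrable_def set_integrable_def by simp
  obtain B where B: "B > 0" "\<And>x. norm (\<phi> x) \<le> B"
    using bounded_compact_support[OF \<phi> K(3)] K(1) compact_imp_bounded by blast
  have "\<phi> \<in> borel_measurable lebesgue"
    using \<phi> by (simp add: borel_measurable_continuous_onI measurable_completion)
  have "integrable lebesgue (\<lambda>x. (indicator K x * h x) * \<phi> x)"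
  proof (rule Bochner_Integration.integrable_bound)
    show "integrable lebesgue (\<lambda>x. B * (indicator K x * h x))" using \<open>integrable lebesgue (\<lambda>x. indicator K x * h x)\<close> by simp
    show "(\<lambda>x. (indicator K x * h x) * \<phi> x) \<in> borel_measurable lebesgue"
      using \<open>integrable lebesgue (\<lambda>x. indicator K x * h x)\<close> \<open>\<phi> \<in> borel_measurable lebesgue\<close> by auto
    show "AE x in lebesgue. norm ((indicator K x * h x) * \<phi> x) \<le> norm (B * (indicator K x * h x))"
      using B by (auto simp: abs_mult mult.commute intro!: mult_right_mono)
  qed
  moreover have "(\<lambda>x. (indicator K x * h x) * \<phi> x) = (\<lambda>x. h x * \<phi> x)"
    using K(3) by (force simp: indicator_def)
  ultimately show ?thesis by simp
qed

lemma open_sets_lebesgue: "open \<Omega> \<Longrightarrow> \<Omega> \<in> sets lebesgue"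
  by (simp add: borel_open)

text \<open>Letting \<open>box_bump\<close> tend to the indicator of a box turns the hypothesis into
  vanishing integrals over all boxes with closure in \<Omega>. Hence h vanishes almost everywhere on
  each such box, and countably many of them cover \<Omega> up to a null set.\<close>

lemma fundamental_lemma:
  fixes h :: "real^'n \<Rightarrow> real"
  assumes \<Omega>: "open \<Omega>" and h: "locally_integrable \<Omega> h"
    and 0: "\<And>\<phi>. test_function \<Omega> \<phi> \<Longrightarrow> (LINT x|lebesgue_on \<Omega>. h x * \<phi> x) = 0"
  shows "AE x in lebesgue. x \<in> \<Omega> \<longrightarrow> h x = 0"
proof -
  note \<Omega>l = open_sets_lebesgue[OF \<Omega>]
  have box0: "integral\<^sup>L lebesgue (\<lambda>x. indicator (box a b) x * h x) = 0" if ab: "cbox a b \<subseteq> \<Omega>" for a b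
  proof -
    have sub: "box a b \<subseteq> \<Omega>" using ab box_subset_cbox by blast
    have int: "integrable lebesgue (\<lambda>x. indicator (cbox a b) x * h x)"
      using h ab unfolding locally_integrable_def set_integrable_def by simp
    have tf: "test_function \<Omega> (box_bump a b n)" for n by (rule test_function_box_bump[OF sub])
    have eq: "h x * box_bump a b n x = (indicator (cbox a b) x * h x) * box_bump a b n x" for n x
      using box_bump_0[of x a b n] box_subset_cbox[of a b] by (auto simp: indicator_def)
    have m: "box_bump a b n \<in> borel_measurable lebesgue" for n
    proof -
      have "smooth (box_bump a b n)" using tf by (simp add: test_function_def smooth_def)
      then have "continuous_on UNIV (box_bump a b n)" by (rule smooth_continuous)
      then show ?thesis by (simp add: borel_measurable_continuous_onI measurable_completion)
    qed
    have "(\<lambda>n. integral\<^sup>L lebesgue (\<lambda>x. (indicator (cbox a b) x * h x) * box_bump a b n x)) \<longlonglongrightarrow>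
      integral\<^sup>L lebesgue (\<lambda>x. (indicator (cbox a b) x * h x) * indicator (box a b) x)"
    proof (rule integral_dominated_convergence[where w = "\<lambda>x. norm (indicator (cbox a b) x * h x)"])
      show "(\<lambda>x. indicator (cbox a b) x * h x * indicator (box a b) x) \<in> borel_measurable lebesgue"
        using int by (intro borel_measurable_times borel_measurable_integrable borel_measurable_indicator) auto
      show "(\<lambda>x. indicator (cbox a b) x * h x * box_bump a b n x) \<in> borel_measurable lebesgue" for n
        using int m by auto
      show "integrable lebesgue (\<lambda>x. norm (indicator (cbox a b) x * h x))" using int by (rule integrable_norm)
      show "AE x in lebesgue. norm (indicator (cbox a b) x * h x * box_bump a b n x) \<le> norm (indicator (cbox a b) x * h x)" for n
        by (auto simp: abs_mult box_bump_nonneg box_bump_le_1 intro!: mult_left_le)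
    qed (auto intro!: tendsto_intros box_bump_tendsto)
    moreover have "integral\<^sup>L lebesgue (\<lambda>x. (indicator (cbox a b) x * h x) * box_bump a b n x) = 0" for n
    proof -
      have "integral\<^sup>L lebesgue (\<lambda>x. h x * box_bump a b n x) = (LINT x|lebesgue_on \<Omega>. h x * box_bump a b n x)"
        using box_bump_0[of _ a b n] sub by (intro integral_lebesgue_on_support[symmetric] \<Omega>l) auto
      then show ?thesis using 0[OF tf] by (simp only: eq)
    qed
    ultimately have "integral\<^sup>L lebesgue (\<lambda>x. (indicator (cbox a b) x * h x) * indicator (box a b) x) = 0"
      by (simp add: LIMSEQ_const_iff)
    moreover have "(\<lambda>x. (indicator (cbox a b) x * h x) * indicator (box a b) x) = (\<lambda>x. indicator (box a b) x * h x)"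
    proof
      fix x show "(indicator (cbox a b) x * h x) * indicator (box a b) x = indicator (box a b) x * h x"
        using box_subset_cbox[of a b] by (cases "x \<in> box a b") auto
    qed
    ultimately show ?thesis by simp
  qed
  have ae: "AE x in lebesgue. x \<in> box c d \<longrightarrow> h x = 0" if cd: "cbox c d \<subseteq> \<Omega>" for c d
  proof -
    let ?f = "\<lambda>x. indicator (box c d) x * h x"
    have "integrable lebesgue (\<lambda>x. indicator (cbox c d) x * h x)"
      using h cd unfolding locally_integrable_def set_integrable_def by simp
    from integrable_mult_indicator[OF _ this, of "box c d"]
    have "integrable lebesgue (\<lambda>x. indicator (box c d) x * (indicator (cbox c d) x * h x))" by simp
    moreover have "(\<lambda>x. indicator (box c d) x * (indicator (cbox c d) x * h x)) = ?f"
    proof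
      fix x show "indicator (box c d) x * (indicator (cbox c d) x * h x) = ?f x"
        using box_subset_cbox[of c d] by (cases "x \<in> box c d") auto
    qed
    ultimately have int: "integrable lebesgue ?f" by simp
    have "AE x in lebesgue. ?f x = 0"
    proof (rule set_integral_boxes_0_imp_AE_0[OF int])
      fix a b
      obtain a' b' where ab: "box a b \<inter> box c d = box a' b'" 
        using box_Int_box[of a b c d] by blast
      have "cbox a' b' \<subseteq> \<Omega>" if "box a' b' \<noteq> {}"
      proof -
        have "box a' b' \<subseteq> cbox c d" using ab box_subset_cbox[of c d] by blast
        then have "closure (box a' b') \<subseteq> cbox c d" by (rule closure_minimal) (rule closed_cbox)
        then show ?thesis using closure_box[OF that] cd by blast
      qed
      moreover have "(\<lambda>x. indicator (box a b) x * ?f x) = (\<lambda>x. indicator (box a' b') x * h x)"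
        unfolding ab[symmetric] by (auto simp: indicator_def)
      ultimately show "integral\<^sup>L lebesgue (\<lambda>x. indicator (box a b) x * ?f x) = 0"
        using box0[of a' b'] by (cases "box a' b' = {}") auto
    qed (use box0[OF cd] in simp)
    then show ?thesis by eventually_elim (auto simp: indicator_def split: if_splits)
  qed
  \<comment> \<open>Two coverings are needed, as the closures of the open boxes that exhaust
    \<Omega> may leave \<Omega>. Each open box is therefore exhausted by closed ones, whose faces
    are null sets.\<close>
  obtain D where D: "countable D" "D \<subseteq> Pow \<Omega>" "\<And>X. X \<in> D \<Longrightarrow> \<exists>a b. X = box a b" "\<Union>D = \<Omega>"
    using open_countable_Union_open_box[OF \<Omega>] by metis
  have "AE x in lebesgue. \<forall>X\<in>D. x \<in> X \<longrightarrow> h x = 0"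
  proof (subst AE_ball_countable[OF D(1)], rule ballI)
    fix X assume X: "X \<in> D"
    then obtain a b where ab: "X = box a b" using D by blast
    have "box a b \<subseteq> \<Omega>" using X ab D by auto
    obtain E where E: "countable E" "E \<subseteq> Pow (box a b)" "\<And>X. X \<in> E \<Longrightarrow> \<exists>a b. X = cbox a b" "\<Union>E = box a b"
      using open_countable_Union_open_cbox[OF open_box] by metis
    have "AE x in lebesgue. \<forall>Y\<in>E. x \<in> Y \<longrightarrow> h x = 0"
    proof (subst AE_ball_countable[OF E(1)], rule ballI)
      fix Y assume Y: "Y \<in> E"
      then obtain c d where cd: "Y = cbox c d" using E by blast
      then have "cbox c d \<subseteq> \<Omega>" using Y E(2) \<open>box a b \<subseteq> \<Omega>\<close> by blast
      from ae[OF this] have "AE x in lebesgue. x \<in> box c d \<longrightarrow> h x = 0" .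
      moreover have "AE x in lebesgue. x \<notin> cbox c d - box c d"
        by (rule AE_not_in) (metis negligible_frontier_interval negligible_iff_null_sets)
      ultimately show "AE x in lebesgue. x \<in> Y \<longrightarrow> h x = 0"
        unfolding cd by eventually_elim auto
    qed
    then show "AE x in lebesgue. x \<in> X \<longrightarrow> h x = 0"
      by eventually_elim (use E(4) ab in auto)
  qed
  then show ?thesis by eventually_elim (use D(4) in blast)
qed

section \<open>Integrals of the bump and of its gradient over half-spaces\<close>

lemma integrable_bump: "integrable lebesgue (bump :: real^'n \<Rightarrow> real)"
  by (rule integrable_lebesgue_compact_support[OF smooth_continuous[OF smooth_bump], of "ball 0 1"])
    (auto simp: bump_eq_0)

lemma integral_bump_pos: "0 < integral\<^sup>L lebesgue (bump :: real^'n \<Rightarrow> real)"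
proof (rule ccontr)
  assume "\<not> ?thesis"
  moreover have "0 \<le> integral\<^sup>L lebesgue (bump :: real^'n \<Rightarrow> real)"
    by (simp add: bump_nonneg)
  ultimately have "integral\<^sup>L lebesgue (bump :: real^'n \<Rightarrow> real) = 0" by simp
  then have "AE x::real^'n in lebesgue. bump x = 0"
    using integral_nonneg_eq_0_iff_AE[OF integrable_bump[where 'n='n]] by (simp add: bump_nonneg)
  then have "AE x::real^'n in lebesgue. x \<notin> ball 0 (1/2)"
    by eventually_elim (metis bump_eq_1 mem_ball_0 less_imp_le zero_neq_one)
  then have "negligible (ball (0::real^'n) (1/2))"
    by (subst negligible_iff_null_sets, subst (asm) AE_iff_null_sets[symmetric]) auto
  then show False using open_not_negligible[of "ball (0::real^'n) (1/2)"] by simp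
qed

lemma continuous_partial_bump: "continuous_on A (partial j bump)"
  by (rule smooth_continuous[OF smooth_partial[OF smooth_bump]])

lemma integrable_bump_slope_mult:
  assumes "continuous_on UNIV g" "H \<in> sets lebesgue"
  shows "integrable lebesgue (\<lambda>y::real^'n. indicator H y * (bump_slope y * g y :: real))"
proof -
  have "integrable lebesgue (\<lambda>y::real^'n. bump_slope y * g y)"
    by (rule integrable_lebesgue_compact_support[of _ "ball 0 1"])
      (auto simp: bump_eq_0 intro!: continuous_intros continuous_bump_slope assms)
  from integrable_mult_indicator[OF assms(2) this] show ?thesis by simp
qed

lemma halfspace_sets: "{y::'a::euclidean_space. 0 < y \<bullet> \<nu>} \<in> sets lebesgue"
  by (intro open_sets_lebesgue open_Collect_less continuous_intros)

text \<open>The integrand is, up to sign, the derivative of the bump in direction \<tau>, and the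
  half-space is invariant under translations along \<tau>.\<close>

lemma halfspace_integral_tangential:
  fixes \<nu> \<tau> :: "real^'n"
  assumes "\<tau> \<bullet> \<nu> = 0"
  shows "integral\<^sup>L lebesgue (\<lambda>y. indicator {y. 0 < y \<bullet> \<nu>} y * (bump_slope y * (y \<bullet> \<tau>))) = 0"
proof -
  have c: "continuous_on UNIV (\<lambda>y. - bump_slope y * (y \<bullet> \<tau>))"
    by (intro continuous_intros continuous_bump_slope)
  have "- bump_slope y * (y \<bullet> \<tau>) = 0" if "y \<notin> ball 0 1" for y
    using that bump_eq_0(2)[of y] by simp
  from bounded_compact_support[OF c this bounded_ball]
  obtain B where B: "\<And>y. \<bar>- bump_slope y * (y \<bullet> \<tau>)\<bar> \<le> B" by (metis real_norm_def)
  have "integral\<^sup>L lebesgue (\<lambda>y. indicator {y. 0 < y \<bullet> \<nu>} y * (- bump_slope y * (y \<bullet> \<tau>))) = 0"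
    by (rule integral_directional_derivative_eq_0[OF bump_has_derivative B, of "ball 0 1"])
      (auto simp: bump_eq_0 halfspace_sets inner_add_left assms)
  then show ?thesis by simp
qed

text \<open>The reflection y to -y exchanges the two half-spaces. The left-hand side is visibly even
  and continuous in \<nu>, which the integral over the half-space is not.\<close>

lemma halfspace_integral_normal:
  fixes \<nu> :: "real^'n"
  shows "integral\<^sup>L lebesgue (\<lambda>y. bump_slope y * \<bar>y \<bullet> \<nu>\<bar>) =
    2 * integral\<^sup>L lebesgue (\<lambda>y. indicator {y. 0 < y \<bullet> \<nu>} y * (bump_slope y * (y \<bullet> \<nu>)))"
proof -
  let ?f = "\<lambda>y. indicator {y. 0 < y \<bullet> \<nu>} y * (bump_slope y * (y \<bullet> \<nu>))"
  have int: "integrable lebesgue ?f"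
    by (intro integrable_bump_slope_mult halfspace_sets continuous_intros)
  have eq: "bump_slope y * \<bar>y \<bullet> \<nu>\<bar> = ?f y + ?f (0 + (-1) *\<^sub>R y)" for y
    by (cases "y \<bullet> \<nu>" "0::real" rule: linorder_cases) (auto simp: bump_slope_minus)
  show ?thesis
    unfolding eq using lebesgue_affine[OF _ int, of "-1" 0] int by simp
qed

text \<open>Sides may have any normal, so the lower bound must be uniform in the direction. It comes
  from compactness of the unit sphere instead of rotation invariance: the integral depends on \<nu>
  in a Lipschitz way and is positive for each \<nu>.\<close>

lemma halfspace_constant:
  obtains c where "c > 0" "\<And>\<nu>::real^'n. norm \<nu> = 1 \<Longrightarrow>
    c \<le> integral\<^sup>L lebesgue (\<lambda>y. indicator {y. 0 < y \<bullet> \<nu>} y * (bump_slope y * (y \<bullet> \<nu>)))"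
proof -
  define N where "N \<nu> = integral\<^sup>L lebesgue (\<lambda>y::real^'n. bump_slope y * \<bar>y \<bullet> \<nu>\<bar>)" for \<nu>
  have int: "integrable lebesgue (\<lambda>y::real^'n. bump_slope y * \<bar>y \<bullet> \<nu>\<bar>)" for \<nu>
    using integrable_bump_slope_mult[of "\<lambda>y. \<bar>y \<bullet> \<nu>\<bar>" UNIV] by (simp add: continuous_intros)
  define L where "L = integral\<^sup>L lebesgue (\<lambda>y::real^'n. bump_slope y * norm y)"
  have intL: "integrable lebesgue (\<lambda>y::real^'n. bump_slope y * norm y)"
    using integrable_bump_slope_mult[of norm UNIV] by (simp add: continuous_intros)
  have N_le: "N \<nu> - N \<mu> \<le> L * dist \<nu> \<mu>" for \<nu> \<mu>
  proof -
    have "N \<nu> - N \<mu> = integral\<^sup>L lebesgue (\<lambda>y. bump_slope y * \<bar>y \<bullet> \<nu>\<bar> - bump_slope y * \<bar>y \<bullet> \<mu>\<bar>)"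
      unfolding N_def using int by simp
    also have "\<dots> \<le> integral\<^sup>L lebesgue (\<lambda>y::real^'n. (bump_slope y * norm y) * dist \<nu> \<mu>)"
    proof (rule Bochner_Integration.integral_mono)
      fix y :: "real^'n"
      have "\<bar>y \<bullet> \<nu>\<bar> - \<bar>y \<bullet> \<mu>\<bar> \<le> \<bar>y \<bullet> (\<nu> - \<mu>)\<bar>" by (simp add: inner_diff_right)
      also have "\<dots> \<le> norm y * dist \<nu> \<mu>" unfolding dist_norm by (rule Cauchy_Schwarz_ineq2)
      finally show "bump_slope y * \<bar>y \<bullet> \<nu>\<bar> - bump_slope y * \<bar>y \<bullet> \<mu>\<bar> \<le> (bump_slope y * norm y) * dist \<nu> \<mu>"
        using mult_left_mono[OF _ bump_slope_nonneg[of y]] by (simp add: right_diff_distrib[symmetric] mult.assoc)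
    qed (use int intL in auto)
    also have "\<dots> = L * dist \<nu> \<mu>" by (simp add: L_def)
    finally show ?thesis .
  qed
  have L0: "0 \<le> L" unfolding L_def by (simp add: bump_slope_nonneg)
  have "continuous_on (sphere 0 1) N"
  proof (rule lipschitz_on_continuous_on)
    show "L-lipschitz_on (sphere 0 1) N"
      using N_le L0 by (intro lipschitz_onI) (auto simp: dist_real_def abs_le_iff, metis dist_commute)
  qed
  moreover have "sphere (0::real^'n) 1 \<noteq> {}" by simp
  ultimately obtain \<nu>0 :: "real^'n" where \<nu>0: "norm \<nu>0 = 1" "\<And>\<nu>. norm \<nu> = 1 \<Longrightarrow> N \<nu>0 \<le> N \<nu>"
    using continuous_attains_inf[OF compact_sphere, of 0 1 N] by auto
  have "0 < N \<nu>0"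
  proof (rule ccontr)
    assume "\<not> 0 < N \<nu>0"
    moreover have "0 \<le> N \<nu>0" unfolding N_def by (simp add: bump_slope_nonneg)
    ultimately have "N \<nu>0 = 0" by simp
    then have "AE y in lebesgue. bump_slope y * \<bar>y \<bullet> \<nu>0\<bar> = 0"
      using integral_nonneg_eq_0_iff_AE[OF int] unfolding N_def by (simp add: bump_slope_nonneg)
    \<comment> \<open>On this open set both factors are positive. It contains 3/4 \<nu>0, whose
      squared norm 9/16 lies between 1/4 and 3/4.\<close>
    moreover define U where "U = {y::real^'n. 1/4 < y \<bullet> y} \<inter> {y. y \<bullet> y < 3/4} \<inter> {y. 0 < y \<bullet> \<nu>0}"
    ultimately have "AE y in lebesgue. y \<notin> U"
      by (elim AE_mp, intro AE_I2) (use bump_slope_pos in \<open>force simp: U_def\<close>)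
    moreover have "open U" unfolding U_def by (intro open_Int open_Collect_less continuous_intros)
    ultimately have "negligible U"
      by (subst negligible_iff_null_sets, subst (asm) AE_iff_null_sets[symmetric]) (auto intro: open_sets_lebesgue)
    moreover have "(3/4) *\<^sub>R \<nu>0 \<in> U"
      using \<nu>0(1) by (simp add: U_def norm_eq_1)
    ultimately show False using open_not_negligible[OF \<open>open U\<close>] by auto
  qed
  moreover have "N \<nu>0 / 2 \<le> integral\<^sup>L lebesgue (\<lambda>y. indicator {y. 0 < y \<bullet> \<nu>} y * (bump_slope y * (y \<bullet> \<nu>)))"
    if "norm \<nu> = 1" for \<nu> :: "real^'n"
    using \<nu>0(2)[OF that] halfspace_integral_normal[of \<nu>] by (simp add: N_def)
  ultimately show thesis using that[of "N \<nu>0 / 2"] by simp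
qed

text \<open>Of the tangential and normal parts of \<tau> only the normal one contributes. Applied to
  a constant matrix, this turns an integral against \<open>grad bump\<close> over a half-space into
  a multiple of the matrix times \<nu>.\<close>

lemma halfspace_integral_grad_bump:
  fixes \<nu> \<tau> :: "real^'n"
  assumes "norm \<nu> = 1"
  shows "integral\<^sup>L lebesgue (\<lambda>y. indicator {y. 0 < y \<bullet> \<nu>} y * (grad bump y \<bullet> \<tau>)) =
    - integral\<^sup>L lebesgue (\<lambda>y. indicator {y. 0 < y \<bullet> \<nu>} y * (bump_slope y * (y \<bullet> \<nu>))) * (\<nu> \<bullet> \<tau>)"
proof -
  define \<sigma> where "\<sigma> = \<tau> - (\<nu> \<bullet> \<tau>) *\<^sub>R \<nu>"
  have \<sigma>: "\<sigma> \<bullet> \<nu> = 0" using assms by (simp add: \<sigma>_def inner_diff_left inner_diff_right inner_commute norm_eq_1)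
  have g: "grad bump y \<bullet> \<tau> = - bump_slope y * (y \<bullet> \<tau>)" for y
    unfolding grad_def partial_bump by (simp add: inner_vec_def sum_distrib_left mult.assoc sum_negf)
  have \<tau>: "\<tau> = \<sigma> + (\<nu> \<bullet> \<tau>) *\<^sub>R \<nu>" by (simp add: \<sigma>_def)
  have eq: "indicator {y. 0 < y \<bullet> \<nu>} y * (grad bump y \<bullet> \<tau>) =
    - (indicator {y. 0 < y \<bullet> \<nu>} y * (bump_slope y * (y \<bullet> \<sigma>)))
    - (\<nu> \<bullet> \<tau>) * (indicator {y. 0 < y \<bullet> \<nu>} y * (bump_slope y * (y \<bullet> \<nu>)))" for y
    unfolding g by (subst \<tau>) (simp add: inner_add_right algebra_simps)
  have int: "integrable lebesgue (\<lambda>y. indicator {y. 0 < y \<bullet> \<nu>} y * (bump_slope y * (y \<bullet> \<mu>)))" for \<mu>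
    by (intro integrable_bump_slope_mult halfspace_sets continuous_intros)
  show ?thesis unfolding eq
    using int halfspace_integral_tangential[OF \<sigma>] by simp
qed

text \<open>Jensen's inequality in disguise. Pointwise e is at most l + l^(1-p) e^p for every l > 0,
  and l is chosen so that the first term consumes just half of the left-hand side of
  \<open>main\<close>.\<close>

lemma mean_bound_imp_powr_bound:
  fixes e :: "real^'n \<Rightarrow> real"
  assumes p: "1 < p" and S: "S \<in> lmeasurable" and S_le: "measure lebesgue S \<le> \<omega> * r ^ k"
    and r: "0 < r" and \<omega>: "0 < \<omega>" and M: "0 < M" and X: "0 \<le> X"
    and e: "\<And>x. 0 \<le> e x" "e \<in> borel_measurable (lebesgue_on S)" "integrable (lebesgue_on S) (\<lambda>x. e x powr p)"
    and main: "X * r ^ k \<le> M * (LINT x|lebesgue_on S. e x)"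
  shows "X powr p * r ^ k \<le> 2 * M * (2 * M * \<omega>) powr (p - 1) * (LINT x|lebesgue_on S. e x powr p)"
proof (cases "X = 0")
  case False
  with X have X: "0 < X" by simp
  let ?I = "LINT x|lebesgue_on S. e x powr p"
  define l where "l = X / (2 * M * \<omega>)"
  have l: "0 < l" using X M \<omega> by (simp add: l_def)
  have le: "e x \<le> l + l powr (1 - p) * e x powr p" for x
  proof (cases "e x \<le> l")
    case True
    then show ?thesis by (simp add: add_increasing2)
  next
    case False
    then have "e x = e x powr (1 - p) * e x powr p" using l by (simp add: powr_add[symmetric])
    also have "\<dots> \<le> l powr (1 - p) * e x powr p"
      using False l p by (intro mult_right_mono powr_mono2') auto
    finally show ?thesis using l by simp
  qed
  interpret finite_measure "lebesgue_on S" using S by (rule finite_measure_lebesgue_on)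
  have intr: "integrable (lebesgue_on S) (\<lambda>x. l + l powr (1 - p) * e x powr p)"
    using e(3) by (intro Bochner_Integration.integrable_add integrable_const integrable_mult_right)
  have inte: "integrable (lebesgue_on S) e"
  proof (rule Bochner_Integration.integrable_bound[OF intr e(2)], rule AE_I2)
    fix x show "norm (e x) \<le> norm (l + l powr (1 - p) * e x powr p)"
      using le[of x] e(1)[of x] by simp
  qed
  have ms: "measure (lebesgue_on S) S = measure lebesgue S"
    using S by (intro measure_restrict_space) auto
  have "(LINT x|lebesgue_on S. e x) \<le> (LINT x|lebesgue_on S. l + l powr (1 - p) * e x powr p)"
    by (rule integral_mono[OF inte intr le])
  also have "\<dots> = l * measure lebesgue S + l powr (1 - p) * ?I"
    using e(3) S ms by (subst Bochner_Integration.integral_add) (auto simp: space_restrict_space)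
  also have "\<dots> \<le> l * (\<omega> * r ^ k) + l powr (1 - p) * ?I"
    using S_le l by simp
  finally have "M * (LINT x|lebesgue_on S. e x) \<le> M * (l * (\<omega> * r ^ k) + l powr (1 - p) * ?I)"
    using M by simp
  with main have "X * r ^ k \<le> M * (l * (\<omega> * r ^ k)) + M * (l powr (1 - p) * ?I)"
    by (simp add: distrib_left)
  moreover have "M * (l * (\<omega> * r ^ k)) = X * r ^ k / 2" using M \<omega> by (simp add: l_def)
  ultimately have "X * r ^ k \<le> 2 * M * l powr (1 - p) * ?I" by simp
  then have "l powr (p - 1) * (X * r ^ k) \<le> l powr (p - 1) * (2 * M * l powr (1 - p) * ?I)"
    by (rule mult_left_mono) simp
  also have "\<dots> = 2 * M * ?I * (l powr (p - 1) * l powr (1 - p))" by simp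
  also have "l powr (p - 1) * l powr (1 - p) = 1" using l by (simp add: powr_add[symmetric])
  finally have 1: "l powr (p - 1) * X * r ^ k \<le> 2 * M * ?I" by (simp add: mult.assoc)
  have Xl: "X = (2 * M * \<omega>) * l" using M \<omega> by (simp add: l_def)
  have "X powr (p - 1) = (2 * M * \<omega>) powr (p - 1) * l powr (p - 1)"
    by (subst Xl, subst powr_mult) (use M \<omega> l in auto)
  moreover have "X powr p = X powr (p - 1) * X" using X by (simp add: powr_diff)
  ultimately have "X powr p = (2 * M * \<omega>) powr (p - 1) * (l powr (p - 1) * X)" by simp
  then have "X powr p * r ^ k = (2 * M * \<omega>) powr (p - 1) * (l powr (p - 1) * X * r ^ k)" by simp
  also have "\<dots> \<le> (2 * M * \<omega>) powr (p - 1) * (2 * M * ?I)"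
    by (rule mult_left_mono[OF 1]) simp
  finally show ?thesis by (simp add: mult_ac)
qed (use M in simp)

section \<open>Weak gradients and Lebesgue spaces\<close>

lemma AE_lebesgue_on_iff:
  "S \<in> sets lebesgue \<Longrightarrow> (AE x in lebesgue_on S. P x) \<longleftrightarrow> (AE x in lebesgue. x \<in> S \<longrightarrow> P x)"
  by (subst AE_restrict_space_iff) auto

lemma borel_measurable_lebesgue_on_AE:
  fixes f g :: "'a::euclidean_space \<Rightarrow> 'b::euclidean_space"
  assumes S: "S \<in> sets lebesgue" and f: "f \<in> borel_measurable (lebesgue_on S)"
    and ae: "AE x in lebesgue_on S. f x = g x"
  shows "g \<in> borel_measurable (lebesgue_on S)"
proof -
  have "(\<lambda>x. if x \<in> S then f x else 0) \<in> borel_measurable lebesgue"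
    using f borel_measurable_if[OF S] by blast
  moreover have "AE x in lebesgue. (if x \<in> S then f x else 0) = (if x \<in> S then g x else 0)"
    using ae unfolding AE_lebesgue_on_iff[OF S] by eventually_elim auto
  ultimately have "(\<lambda>x. if x \<in> S then g x else 0) \<in> borel_measurable lebesgue"
    by (rule borel_measurable_AE)
  then show ?thesis using borel_measurable_if[OF S] by blast
qed

text \<open>Completeness of Lebesgue measure makes measurability invariant under changes on null
  sets. If f is not measurable, neither is g, and both integrals have the default value 0.\<close>

lemma
  fixes f g :: "'a::euclidean_space \<Rightarrow> 'b::euclidean_space"
  assumes S: "S \<in> sets lebesgue" and ae: "AE x in lebesgue_on S. f x = g x"
  shows integrable_cong_AE_on: "integrable (lebesgue_on S) f \<longleftrightarrow> integrable (lebesgue_on S) g"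
    and integral_cong_AE_on: "integral\<^sup>L (lebesgue_on S) f = integral\<^sup>L (lebesgue_on S) g"
proof -
  have ae': "AE x in lebesgue_on S. g x = f x" using ae by eventually_elim simp
  have m: "f \<in> borel_measurable (lebesgue_on S) \<longleftrightarrow> g \<in> borel_measurable (lebesgue_on S)"
    using borel_measurable_lebesgue_on_AE[OF S] ae ae' by blast
  show 1: "integrable (lebesgue_on S) f \<longleftrightarrow> integrable (lebesgue_on S) g"
  proof (cases "f \<in> borel_measurable (lebesgue_on S)")
    case True
    then show ?thesis using m ae by (intro integrable_cong_AE) auto
  next
    case False
    then show ?thesis using m by (auto dest: borel_measurable_integrable)
  qed
  show "integral\<^sup>L (lebesgue_on S) f = integral\<^sup>L (lebesgue_on S) g"
  proof (cases "f \<in> borel_measurable (lebesgue_on S)")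
    case True
    then show ?thesis using m ae by (intro integral_cong_AE) auto
  next
    case False
    then show ?thesis using 1 m by (metis borel_measurable_integrable not_integrable_integral_eq)
  qed
qed

lemma integrable_mult_bounded:
  fixes h w :: "'a \<Rightarrow> real"
  assumes "integrable M h" "w \<in> borel_measurable M" "\<And>x. \<bar>w x\<bar> \<le> B"
  shows "integrable M (\<lambda>x. h x * w x)"
proof (rule Bochner_Integration.integrable_bound)
  show "integrable M (\<lambda>x. B * h x)" using assms(1) by simp
  show "(\<lambda>x. h x * w x) \<in> borel_measurable M" using assms by simp
  have "\<bar>w x\<bar> \<le> \<bar>B\<bar>" for x using assms(3)[of x] by simp
  then show "AE x in M. norm (h x * w x) \<le> norm (B * h x)"
    by (intro AE_I2) (simp add: abs_mult mult.commute[of "\<bar>h _\<bar>"] mult_right_mono)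
qed

lemma borel_measurable_continuous_lebesgue_on:
  fixes f :: "'a::euclidean_space \<Rightarrow> 'b::euclidean_space"
  assumes "continuous_on UNIV f"
  shows "f \<in> borel_measurable (lebesgue_on S)"
  using assms by (intro measurable_restrict_space1 measurable_completion) (simp add: borel_measurable_continuous_onI)

lemma integrable_matrix_inner:
  fixes A :: "'a::euclidean_space \<Rightarrow> real^'n^'n" and w :: "'a \<Rightarrow> real^'n"
  assumes A: "integrable (lebesgue_on S) A" and w: "continuous_on UNIV w" and B: "\<And>x. norm (w x) \<le> B"
  shows "integrable (lebesgue_on S) (\<lambda>x. g \<bullet> (A x *v w x))"
proof -
  have eq: "g \<bullet> (A x *v w x) = (\<Sum>i\<in>UNIV. \<Sum>j\<in>UNIV. g $ i * (A x $ i $ j * w x $ j))" for x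
    by (simp add: inner_vec_def matrix_vector_mult_def sum_distrib_left)
  have "integrable (lebesgue_on S) (\<lambda>x. A x $ i $ j)" for i j
    using integrable_bounded_linear[OF bounded_linear_compose[OF bounded_linear_vec_nth bounded_linear_vec_nth] A] .
  moreover have "(\<lambda>x. w x $ j) \<in> borel_measurable (lebesgue_on S)" for j
    by (intro borel_measurable_continuous_lebesgue_on continuous_intros w)
  moreover have "\<bar>w x $ j\<bar> \<le> B" for x j
    using component_le_norm_cart[of "w x" j] B[of x] by simp
  ultimately show ?thesis unfolding eq
    by (intro Bochner_Integration.integrable_sum integrable_mult_right integrable_mult_bounded) auto
qed

lemma norm_matrix_vector_mult_le:
  fixes A :: "real^'n^'m" and x :: "real^'n"
  shows "norm (A *v x) \<le> norm A * norm x"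
proof -
  have "norm (A *v x) = L2_set (\<lambda>i. norm (A $ i \<bullet> x)) UNIV"
    by (simp add: norm_vec_def matrix_vector_mul_component)
  also have "\<dots> \<le> L2_set (\<lambda>i. norm (A $ i) * norm x) UNIV"
    by (intro L2_set_mono) (auto simp: Cauchy_Schwarz_ineq2)
  also have "\<dots> = norm A * norm x"
    by (simp add: L2_set_left_distrib norm_vec_def)
  finally show ?thesis .
qed

text \<open>In the form of a Frobenius product, the trace is bounded by Cauchy-Schwarz and is
  integrable by bounded linearity.\<close>

lemma trace_eq_inner_mat: "trace A = A \<bullet> (mat 1 :: real^'n^'n)"
proof -
  have "A $ i \<bullet> (mat 1 :: real^'n^'n) $ i = A $ i $ i" for i
  proof -
    have "A $ i \<bullet> (mat 1 :: real^'n^'n) $ i = (\<Sum>j\<in>UNIV. if i = j then A $ i $ j else 0)"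
      unfolding inner_vec_def mat_def by (intro sum.cong) auto
    then show ?thesis by simp
  qed
  then show ?thesis unfolding trace_def by (subst inner_vec_def) (simp only:)
qed

lemma test_function_support:
  assumes "test_function \<Omega> \<phi>"
  obtains K where "compact K" "K \<subseteq> \<Omega>" "\<And>x. x \<notin> K \<Longrightarrow> \<phi> x = 0" "smooth \<phi>"
    "\<And>x j. x \<notin> K \<Longrightarrow> partial j \<phi> x = 0"
proof -
  let ?K = "closure {x. \<phi> x \<noteq> 0}"
  have sm: "smooth \<phi>" using assms by (simp add: test_function_def smooth_def)
  show thesis
  proof (rule that[OF _ _ _ sm])
    show "compact ?K" "?K \<subseteq> \<Omega>" using assms by (auto simp: test_function_def)
    show "\<phi> x = 0" if "x \<notin> ?K" for x
      using that closure_subset[of "{x. \<phi> x \<noteq> 0}"] by blast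
    show "partial j \<phi> x = 0" if "x \<notin> ?K" for x j
      using smooth_partial_support[OF sm, of "{x. \<phi> x \<noteq> 0}"] that by blast
  qed
qed

lemma locally_integrable_bounded_linear:
  assumes "locally_integrable \<Omega> f" "bounded_linear T"
  shows "locally_integrable \<Omega> (\<lambda>x. T (f x))"
  unfolding locally_integrable_def set_integrable_def
proof (intro allI impI)
  fix K assume "compact K \<and> K \<subseteq> \<Omega>"
  then have "integrable lebesgue (\<lambda>x. indicator K x *\<^sub>R f x)"
    using assms(1) unfolding locally_integrable_def set_integrable_def by blast
  from integrable_bounded_linear[OF assms(2) this]
  show "integrable lebesgue (\<lambda>x. indicator K x *\<^sub>R T (f x))"
    by (simp add: linear_cmul[OF bounded_linear.linear[OF assms(2)]])
qed

lemma locally_integrable_diff: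
  assumes "locally_integrable \<Omega> f" "locally_integrable \<Omega> g"
  shows "locally_integrable \<Omega> (\<lambda>x. f x - g x)"
  using assms unfolding locally_integrable_def by (auto intro: set_integral_diff)

lemma locally_integrable_continuous:
  fixes f :: "real^'n \<Rightarrow> 'b::euclidean_space"
  assumes "continuous_on UNIV f" shows "locally_integrable \<Omega> f"
  unfolding locally_integrable_def set_integrable_def
proof (intro allI impI)
  fix K assume "compact K \<and> K \<subseteq> \<Omega>"
  then have K: "compact K" by simp
  have "integrable lborel (\<lambda>x. indicator K x *\<^sub>R f x)"
    by (rule borel_integrable_compact[OF K]) (use assms continuous_on_subset in blast)
  then show "integrable lebesgue (\<lambda>x. indicator K x *\<^sub>R f x)"
    by (subst integrable_completion) auto
qed

lemma locally_integrable_subset: "locally_integrable \<Omega> f \<Longrightarrow> U \<subseteq> \<Omega> \<Longrightarrow> locally_integrable U f"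
  unfolding locally_integrable_def by blast

lemma bounded_linear_entry: "bounded_linear (\<lambda>A::real^'n^'m. A $ i $ j)"
  using bounded_linear_compose[OF bounded_linear_vec_nth bounded_linear_vec_nth] .

lemma has_weak_grad_component:
  assumes \<Omega>: "open \<Omega>" and G: "has_weak_grad \<Omega> u G" and \<phi>: "test_function \<Omega> \<phi>"
  shows "integrable lebesgue (\<lambda>x. u x $ i * partial j \<phi> x)" "integrable lebesgue (\<lambda>x. G x $ i $ j * \<phi> x)"
    "integral\<^sup>L lebesgue (\<lambda>x. u x $ i * partial j \<phi> x) = - integral\<^sup>L lebesgue (\<lambda>x. G x $ i $ j * \<phi> x)"
proof -
  obtain K where K: "compact K" "K \<subseteq> \<Omega>" "\<And>x. x \<notin> K \<Longrightarrow> \<phi> x = 0" and sm: "smooth \<phi>"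
    and K': "\<And>x j. x \<notin> K \<Longrightarrow> partial j \<phi> x = 0"
    using test_function_support[OF \<phi>] by metis
  have lu: "locally_integrable \<Omega> (\<lambda>x. u x $ i)" and lG: "locally_integrable \<Omega> (\<lambda>x. G x $ i $ j)"
    using G locally_integrable_bounded_linear[OF _ bounded_linear_vec_nth]
      locally_integrable_bounded_linear[OF _ bounded_linear_entry]
    unfolding has_weak_grad_def by blast+
  show "integrable lebesgue (\<lambda>x. u x $ i * partial j \<phi> x)"
    using locally_integrable_mult[OF lu smooth_continuous[OF smooth_partial[OF sm]] K(1,2) K'] .
  show "integrable lebesgue (\<lambda>x. G x $ i $ j * \<phi> x)"
    using locally_integrable_mult[OF lG smooth_continuous[OF sm] K(1,2,3)] .
  note S = open_sets_lebesgue[OF \<Omega>]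
  have "(LINT x|lebesgue_on \<Omega>. u x $ i * partial j \<phi> x) = - (LINT x|lebesgue_on \<Omega>. G x $ i $ j * \<phi> x)"
    using G \<phi> unfolding has_weak_grad_def by blast
  moreover have "(LINT x|lebesgue_on \<Omega>. u x $ i * partial j \<phi> x) = integral\<^sup>L lebesgue (\<lambda>x. u x $ i * partial j \<phi> x)"
    by (rule integral_lebesgue_on_support[OF S]) (use K' K(2) in auto)
  moreover have "(LINT x|lebesgue_on \<Omega>. G x $ i $ j * \<phi> x) = integral\<^sup>L lebesgue (\<lambda>x. G x $ i $ j * \<phi> x)"
    by (rule integral_lebesgue_on_support[OF S]) (use K(2,3) in auto)
  ultimately show "integral\<^sup>L lebesgue (\<lambda>x. u x $ i * partial j \<phi> x) = - integral\<^sup>L lebesgue (\<lambda>x. G x $ i $ j * \<phi> x)"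
    by simp
qed

lemma test_function_subset: "test_function U \<phi> \<Longrightarrow> U \<subseteq> \<Omega> \<Longrightarrow> test_function \<Omega> \<phi>"
  by (auto simp: test_function_def)

lemma AE_matrix_eqI:
  fixes A B :: "'a \<Rightarrow> real^'n^'m"
  assumes "\<And>i j. AE x in M. P x \<longrightarrow> A x $ i $ j - B x $ i $ j = 0"
  shows "AE x in M. P x \<longrightarrow> A x = B x"
proof -
  have "AE x in M. \<forall>i\<in>UNIV. \<forall>j\<in>UNIV. P x \<longrightarrow> A x $ i $ j - B x $ i $ j = 0"
    using assms by (subst AE_ball_countable, simp, intro ballI)+ auto
  then show ?thesis by eventually_elim (auto simp: vec_eq_iff)
qed

text \<open>Each entry of the difference integrates to zero against every test function.\<close>

lemma weak_grad_unique:
  assumes \<Omega>: "open \<Omega>" and G: "has_weak_grad \<Omega> u G" and H: "has_weak_grad \<Omega> u H"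
  shows "AE x in lebesgue. x \<in> \<Omega> \<longrightarrow> G x = H x"
proof (rule AE_matrix_eqI)
  fix i j
  show "AE x in lebesgue. x \<in> \<Omega> \<longrightarrow> G x $ i $ j - H x $ i $ j = 0"
  proof (rule fundamental_lemma[OF \<Omega>])
    show "locally_integrable \<Omega> (\<lambda>x. G x $ i $ j - H x $ i $ j)"
      using G H unfolding has_weak_grad_def
      by (intro locally_integrable_diff locally_integrable_bounded_linear[OF _ bounded_linear_entry]) auto
    fix \<phi> :: "real^'a \<Rightarrow> real" assume \<phi>: "test_function \<Omega> \<phi>"
    obtain K where K: "K \<subseteq> \<Omega>" "\<And>x. x \<notin> K \<Longrightarrow> \<phi> x = 0"
      using test_function_support[OF \<phi>] by metis
    note 1 = has_weak_grad_component[OF \<Omega> G \<phi>] and 2 = has_weak_grad_component[OF \<Omega> H \<phi>]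
    have "(LINT x|lebesgue_on \<Omega>. (G x $ i $ j - H x $ i $ j) * \<phi> x) =
      integral\<^sup>L lebesgue (\<lambda>x. (G x $ i $ j - H x $ i $ j) * \<phi> x)"
      by (rule integral_lebesgue_on_support[OF open_sets_lebesgue[OF \<Omega>]]) (use K in auto)
    also have "\<dots> = 0"
      using 1(2)[of i j] 2(2)[of i j] 1(3)[of i j] 2(3)[of i j] by (simp add: left_diff_distrib)
    finally show "(LINT x|lebesgue_on \<Omega>. (G x $ i $ j - H x $ i $ j) * \<phi> x) = 0" .
  qed
qed

lemma has_weak_grad_smooth:
  assumes \<Omega>: "open \<Omega>" and v: "\<And>i. smooth (\<lambda>x. v x $ i)"
  shows "has_weak_grad \<Omega> v (\<lambda>x. \<chi> i j. partial j (\<lambda>x. v x $ i) x)"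
  unfolding has_weak_grad_def
proof (intro conjI allI impI)
  have "continuous_on UNIV (\<lambda>x. \<chi> i. v x $ i)"
    by (intro continuous_intros smooth_continuous v)
  then show "locally_integrable \<Omega> v" by (simp add: locally_integrable_continuous)
  show "locally_integrable \<Omega> (\<lambda>x. \<chi> i j. partial j (\<lambda>x. v x $ i) x)"
    by (intro locally_integrable_continuous continuous_intros smooth_continuous smooth_partial v)
  fix \<phi> :: "real^'a \<Rightarrow> real" and i j
  assume \<phi>: "test_function \<Omega> \<phi>"
  obtain K where K: "compact K" "K \<subseteq> \<Omega>" "\<And>x. x \<notin> K \<Longrightarrow> \<phi> x = 0" and sm: "smooth \<phi>"
    and K': "\<And>x j. x \<notin> K \<Longrightarrow> partial j \<phi> x = 0"
    using test_function_support[OF \<phi>] by metis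
  note S = open_sets_lebesgue[OF \<Omega>]
  have "(LINT x|lebesgue_on \<Omega>. v x $ i * partial j \<phi> x) = integral\<^sup>L lebesgue (\<lambda>x. v x $ i * partial j \<phi> x)"
    by (rule integral_lebesgue_on_support[OF S]) (use K' K(2) in auto)
  also have "\<dots> = - integral\<^sup>L lebesgue (\<lambda>x. partial j (\<lambda>x. v x $ i) x * \<phi> x)"
    by (rule integral_by_parts(1)[OF v sm K(3) compact_imp_bounded[OF K(1)]])
  also have "integral\<^sup>L lebesgue (\<lambda>x. partial j (\<lambda>x. v x $ i) x * \<phi> x) =
    (LINT x|lebesgue_on \<Omega>. partial j (\<lambda>x. v x $ i) x * \<phi> x)"
    by (rule integral_lebesgue_on_support[OF S, symmetric]) (use K in auto)
  finally show "(LINT x|lebesgue_on \<Omega>. v x $ i * partial j \<phi> x) =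
    - (LINT x|lebesgue_on \<Omega>. (\<chi> i j. partial j (\<lambda>x. v x $ i) x) $ i $ j * \<phi> x)" by simp
qed

text \<open>Test functions of U are test functions of \<Omega>. The second function v, which agrees
  with u on U only, is meant for the polynomial piece of a discrete function on one element.\<close>

lemma has_weak_grad_restrict:
  assumes \<Omega>: "open \<Omega>" and U: "open U" "U \<subseteq> \<Omega>" and G: "has_weak_grad \<Omega> u G" and v: "\<And>x. x \<in> U \<Longrightarrow> u x = v x"
    and lv: "locally_integrable U v"
  shows "has_weak_grad U v G"
  unfolding has_weak_grad_def
proof (intro conjI allI impI)
  show "locally_integrable U G" "locally_integrable U v"
    using G U lv locally_integrable_subset unfolding has_weak_grad_def by blast+
  fix \<phi> :: "real^'a \<Rightarrow> real" and i j
  assume \<phi>: "test_function U \<phi>"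
  obtain K where K: "compact K" "K \<subseteq> U" "\<And>x. x \<notin> K \<Longrightarrow> \<phi> x = 0"
    and K': "\<And>x j. x \<notin> K \<Longrightarrow> partial j \<phi> x = 0"
    using test_function_support[OF \<phi>] by metis
  note S = open_sets_lebesgue[OF U(1)]
  have "(LINT x|lebesgue_on U. v x $ i * partial j \<phi> x) = integral\<^sup>L lebesgue (\<lambda>x. v x $ i * partial j \<phi> x)"
    by (rule integral_lebesgue_on_support[OF S]) (use K' K(2) in auto)
  also have "\<dots> = integral\<^sup>L lebesgue (\<lambda>x. u x $ i * partial j \<phi> x)"
  proof (rule Bochner_Integration.integral_cong[OF refl])
    fix x show "v x $ i * partial j \<phi> x = u x $ i * partial j \<phi> x"
      using K'[of x j] K(2) v[of x] by (cases "x \<in> K") auto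
  qed
  also have "\<dots> = - integral\<^sup>L lebesgue (\<lambda>x. G x $ i $ j * \<phi> x)"
    by (rule has_weak_grad_component[OF \<Omega> G test_function_subset[OF \<phi> U(2)]])
  also have "integral\<^sup>L lebesgue (\<lambda>x. G x $ i $ j * \<phi> x) = (LINT x|lebesgue_on U. G x $ i $ j * \<phi> x)"
    by (rule integral_lebesgue_on_support[OF S, symmetric]) (use K in auto)
  finally show "(LINT x|lebesgue_on U. v x $ i * partial j \<phi> x) = - (LINT x|lebesgue_on U. G x $ i $ j * \<phi> x)" .
qed

lemma has_weak_grad_diff:
  assumes \<Omega>: "open \<Omega>" and G: "has_weak_grad \<Omega> u G" and H: "has_weak_grad \<Omega> v H"
  shows "has_weak_grad \<Omega> (\<lambda>x. u x - v x) (\<lambda>x. G x - H x)"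
  unfolding has_weak_grad_def
proof (intro conjI allI impI)
  show "locally_integrable \<Omega> (\<lambda>x. u x - v x)" "locally_integrable \<Omega> (\<lambda>x. G x - H x)"
    using G H locally_integrable_diff unfolding has_weak_grad_def by blast+
  fix \<phi> :: "real^'a \<Rightarrow> real" and i j
  assume \<phi>: "test_function \<Omega> \<phi>"
  obtain K where K: "compact K" "K \<subseteq> \<Omega>" "\<And>x. x \<notin> K \<Longrightarrow> \<phi> x = 0"
    and K': "\<And>x j. x \<notin> K \<Longrightarrow> partial j \<phi> x = 0"
    using test_function_support[OF \<phi>] by metis
  note S = open_sets_lebesgue[OF \<Omega>]
  note 1 = has_weak_grad_component[OF \<Omega> G \<phi>, of i j] and 2 = has_weak_grad_component[OF \<Omega> H \<phi>, of i j]
  have "(LINT x|lebesgue_on \<Omega>. (u x - v x) $ i * partial j \<phi> x) = integral\<^sup>L lebesgue (\<lambda>x. (u x - v x) $ i * partial j \<phi> x)"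
    by (rule integral_lebesgue_on_support[OF S]) (use K' K(2) in auto)
  also have "\<dots> = - integral\<^sup>L lebesgue (\<lambda>x. (G x - H x) $ i $ j * \<phi> x)"
    using 1 2 by (simp add: left_diff_distrib)
  also have "integral\<^sup>L lebesgue (\<lambda>x. (G x - H x) $ i $ j * \<phi> x) = (LINT x|lebesgue_on \<Omega>. (G x - H x) $ i $ j * \<phi> x)"
    by (rule integral_lebesgue_on_support[OF S, symmetric]) (use K in auto)
  finally show "(LINT x|lebesgue_on \<Omega>. (u x - v x) $ i * partial j \<phi> x) =
    - (LINT x|lebesgue_on \<Omega>. (G x - H x) $ i $ j * \<phi> x)" .
qed

lemma has_weak_grad_weak_grad: "has_weak_grad \<Omega> u G \<Longrightarrow> has_weak_grad \<Omega> u (weak_grad \<Omega> u)"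
  unfolding weak_grad_def by (rule someI[of "has_weak_grad \<Omega> u"])

text \<open>This makes the arbitrary choice in \<open>weak_grad\<close> harmless: any known weak
  gradient may replace it under integrals.\<close>

lemma weak_grad_AE_eq:
  assumes "open \<Omega>" "has_weak_grad \<Omega> u G"
  shows "AE x in lebesgue_on \<Omega>. weak_grad \<Omega> u x = G x"
  unfolding AE_lebesgue_on_iff[OF open_sets_lebesgue[OF assms(1)]]
  using weak_grad_unique[OF assms(1) has_weak_grad_weak_grad[OF assms(2)] assms(2)] .

lemma Lp_AE_cong:
  assumes S: "S \<in> sets lebesgue" and f: "Lp p S f" and ae: "AE x in lebesgue_on S. f x = g x"
  shows "Lp p S g"
  unfolding Lp_def
proof
  show "g \<in> borel_measurable (lebesgue_on S)"
    using borel_measurable_lebesgue_on_AE[OF S _ ae] f by (simp add: Lp_def)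
  have "AE x in lebesgue_on S. norm (f x) powr p = norm (g x) powr p"
    using ae by eventually_elim simp
  from integrable_cong_AE_on[OF S this] show "integrable (lebesgue_on S) (\<lambda>x. norm (g x) powr p)"
    using f by (simp add: Lp_def)
qed

lemma W1p_weak_grad:
  assumes "open \<Omega>" "W1p p \<Omega> u"
  shows "has_weak_grad \<Omega> u (weak_grad \<Omega> u)" "Lp p \<Omega> (weak_grad \<Omega> u)"
proof -
  obtain G where G: "has_weak_grad \<Omega> u G" "Lp p \<Omega> G" using assms(2) by (auto simp: W1p_def)
  show "has_weak_grad \<Omega> u (weak_grad \<Omega> u)" using has_weak_grad_weak_grad[OF G(1)] .
  have "AE x in lebesgue_on \<Omega>. G x = weak_grad \<Omega> u x"
    using weak_grad_AE_eq[OF assms(1) G(1)] by eventually_elim simp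
  then show "Lp p \<Omega> (weak_grad \<Omega> u)" using Lp_AE_cong[OF open_sets_lebesgue[OF assms(1)] G(2)] by blast
qed

section \<open>Algebra and inclusions of L^p spaces\<close>

lemma powr_add_le:
  assumes "0 \<le> a" "0 \<le> b" "0 \<le> p"
  shows "((a::real) + b) powr p \<le> 2 powr p * (a powr p + b powr p)"
proof -
  have "(a + b) powr p \<le> (2 * max a b) powr p" using assms by (intro powr_mono2) auto
  also have "\<dots> = 2 powr p * max a b powr p" using assms by (simp add: powr_mult)
  also have "\<dots> \<le> 2 powr p * (a powr p + b powr p)" by (intro mult_left_mono) (auto simp: max_def)
  finally show ?thesis .
qed

lemma Lp_mono:
  fixes f :: "real^'n \<Rightarrow> 'b::euclidean_space" and g :: "real^'n \<Rightarrow> real"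
  assumes "f \<in> borel_measurable (lebesgue_on S)" "integrable (lebesgue_on S) g" "\<And>x. norm (f x) powr p \<le> g x"
  shows "Lp p S f"
  unfolding Lp_def
proof
  show "integrable (lebesgue_on S) (\<lambda>x. norm (f x) powr p)"
  proof (rule Bochner_Integration.integrable_bound[OF assms(2)])
    show "AE x in lebesgue_on S. norm (norm (f x) powr p) \<le> norm (g x)"
      using assms(3) by (intro AE_I2) (metis abs_ge_self order_trans powr_ge_zero real_norm_def abs_of_nonneg)
  qed (use assms(1) in auto)
qed (rule assms(1))

lemma Lp_add:
  assumes "Lp p S f" "Lp p S g" "0 \<le> p" shows "Lp p S (\<lambda>x. f x + g x)"
proof (rule Lp_mono)
  show "(\<lambda>x. f x + g x) \<in> borel_measurable (lebesgue_on S)" using assms by (auto simp: Lp_def)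
  show "integrable (lebesgue_on S) (\<lambda>x. 2 powr p * (norm (f x) powr p + norm (g x) powr p))"
    using assms by (auto simp: Lp_def)
  fix x
  have "norm (f x + g x) powr p \<le> (norm (f x) + norm (g x)) powr p"
    using assms by (intro powr_mono2) (auto simp: norm_triangle_ineq)
  also have "\<dots> \<le> 2 powr p * (norm (f x) powr p + norm (g x) powr p)"
    using assms by (intro powr_add_le) auto
  finally show "norm (f x + g x) powr p \<le> 2 powr p * (norm (f x) powr p + norm (g x) powr p)" .
qed

lemma Lp_bounded_linear:
  assumes f: "Lp p S f" and T: "bounded_linear T" and p: "0 \<le> p"
  shows "Lp p S (\<lambda>x. T (f x))"
proof -
  obtain B where B: "0 < B" "\<And>x. norm (T x) \<le> norm x * B" using bounded_linear.pos_bounded[OF T] by blast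
  show ?thesis
  proof (rule Lp_mono)
    show "(\<lambda>x. T (f x)) \<in> borel_measurable (lebesgue_on S)"
      using f borel_measurable_continuous_onI[OF linear_continuous_on[OF T]]
      by (auto simp: Lp_def intro: measurable_compose)
    show "integrable (lebesgue_on S) (\<lambda>x. norm (f x) powr p * B powr p)" using f by (auto simp: Lp_def)
    show "norm (T (f x)) powr p \<le> norm (f x) powr p * B powr p" for x
      using B p by (subst powr_mult[symmetric]) (auto intro: powr_mono2)
  qed
qed

lemma Lp_diff:
  assumes "Lp p S f" "Lp p S g" "0 \<le> p" shows "Lp p S (\<lambda>x. f x - g x)"
  using Lp_add[OF assms(1) Lp_bounded_linear[OF assms(2) bounded_linear_minus[OF bounded_linear_ident] assms(3)] assms(3)]
  by simp

lemma Lp_exponent_mono: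
  assumes "Lp q S f" "p \<le> q" "0 \<le> p" "S \<in> lmeasurable" shows "Lp p S f"
proof (rule Lp_mono)
  interpret finite_measure "lebesgue_on S" using assms(4) by (rule finite_measure_lebesgue_on)
  show "f \<in> borel_measurable (lebesgue_on S)" "integrable (lebesgue_on S) (\<lambda>x. 1 + norm (f x) powr q)"
    using assms(1) by (auto simp: Lp_def)
  fix x
  show "norm (f x) powr p \<le> 1 + norm (f x) powr q"
  proof (cases "norm (f x) \<le> 1")
    case True
    then have "norm (f x) powr p \<le> 1 powr p" using assms(3) by (intro powr_mono2) auto
    then show ?thesis by (simp add: add_increasing2)
  next
    case False
    then have "norm (f x) powr p \<le> norm (f x) powr q" using assms by (intro powr_mono) auto
    then show ?thesis by simp
  qed
qed

lemma Lp_integrable: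
  assumes "Lp p S f" "1 \<le> p" "S \<in> lmeasurable" shows "integrable (lebesgue_on S) f"
proof -
  have "Lp 1 S f" using Lp_exponent_mono[OF assms(1,2) _ assms(3)] by simp
  then show ?thesis by (auto simp: Lp_def intro: integrable_norm_iff[THEN iffD1])
qed

lemma Lp_subset:
  assumes "Lp p S f" "A \<subseteq> S" "A \<in> sets lebesgue" "S \<in> sets lebesgue" shows "Lp p A f"
  unfolding Lp_def
proof
  show "f \<in> borel_measurable (lebesgue_on A)"
    using assms by (auto simp: Lp_def intro: measurable_restrict_mono)
  have "integrable lebesgue (\<lambda>x. if x \<in> S then norm (f x) powr p else 0)"
    using assms Lebesgue_Measure.integrable_restrict_UNIV[OF assms(4), of "\<lambda>x. norm (f x) powr p"] by (auto simp: Lp_def)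
  from integrable_mult_indicator[OF assms(3) this]
  have "integrable lebesgue (\<lambda>x. indicator A x *\<^sub>R (if x \<in> S then norm (f x) powr p else 0))" .
  also have "(\<lambda>x. indicator A x *\<^sub>R (if x \<in> S then norm (f x) powr p else 0)) = (\<lambda>x. if x \<in> A then norm (f x) powr p else 0)"
    using assms(2) by (intro ext) (auto simp: indicator_def)
  finally show "integrable (lebesgue_on A) (\<lambda>x. norm (f x) powr p)"
    using Lebesgue_Measure.integrable_restrict_UNIV[OF assms(3), of "\<lambda>x. norm (f x) powr p"] by blast
qed

lemma Lp_norm_powr:
  assumes "0 < p" shows "Lp_norm p S f powr p = (LINT x|lebesgue_on S. norm (f x) powr p)"
proof -
  have "0 \<le> (LINT x|lebesgue_on S. norm (f x) powr p)" by simp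
  then show ?thesis using assms by (simp add: Lp_norm_def powr_powr)
qed

section \<open>The error equation\<close>

lemma partial_bounded_linear:
  assumes T: "bounded_linear T" and f: "f differentiable (at x)"
  shows "partial j (\<lambda>x. T (f x)) x = T (partial j f x)" "(\<lambda>x. T (f x)) differentiable (at x)"
proof -
  have "((\<lambda>x. T (f x)) has_derivative (\<lambda>h. T (frechet_derivative f (at x) h))) (at x)"
    using bounded_linear.has_derivative[OF T] f frechet_derivative_works by blast
  then show "partial j (\<lambda>x. T (f x)) x = T (partial j f x)" "(\<lambda>x. T (f x)) differentiable (at x)"
    using partial_eq by (auto simp: partial_def differentiable_def)
qed

lemma smooth_bounded_linear:
  assumes T: "bounded_linear T" and f: "smooth f"
  shows "smooth (\<lambda>x. T (f x))"
proof -
  have "C_k k f \<Longrightarrow> C_k k (\<lambda>x. T (f x))" for k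
  proof (induction k arbitrary: f)
    case 0
    then show ?case by (simp add: bounded_linear.continuous_on[OF T])
  next
    case (Suc k)
    then have "f differentiable (at x)" for x by simp
    note 1 = partial_bounded_linear[OF T this]
    have "partial j (\<lambda>x. T (f x)) = (\<lambda>x. T (partial j f x))" for j
      using 1(1) by blast
    then show ?case using Suc 1(2) by simp
  qed
  then show ?thesis using f by (simp add: smooth_def)
qed

lemma smooth_vec_nth: "smooth v \<Longrightarrow> smooth (\<lambda>x. v x $ i)"
  using smooth_bounded_linear[OF bounded_linear_vec_nth] .

lemma jacobian_entry:
  assumes "v differentiable (at x)"
  shows "jacobian v (at x) $ i $ j = partial j (\<lambda>x. v x $ i) x"
  using partial_bounded_linear(1)[OF bounded_linear_vec_nth assms]
  by (simp add: jacobian_def matrix_def partial_def)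

lemma jacobian_smooth:
  assumes "smooth v"
  shows "jacobian v (at x) = (\<chi> i j. partial j (\<lambda>x. v x $ i) x)"
  using jacobian_entry[OF smooth_differentiable[OF assms]] by (simp add: vec_eq_iff)

lemma continuous_jacobian_smooth:
  assumes "smooth v" shows "continuous_on UNIV (\<lambda>x. jacobian v (at x))"
  unfolding jacobian_smooth[OF assms]
  by (intro continuous_intros smooth_continuous smooth_partial smooth_vec_nth assms)

lemma Lp_bounded:
  fixes f :: "real^'n \<Rightarrow> 'b::euclidean_space"
  assumes "f \<in> borel_measurable (lebesgue_on S)" "\<And>x. norm (f x) \<le> B" "S \<in> lmeasurable" "0 \<le> q"
  shows "Lp q S f"
proof (rule Lp_mono[OF assms(1)])
  interpret finite_measure "lebesgue_on S" using assms(3) by (rule finite_measure_lebesgue_on)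
  show "integrable (lebesgue_on S) (\<lambda>x. B powr q)" by simp
  show "norm (f x) powr q \<le> B powr q" for x using assms(2,4) by (intro powr_mono2) auto
qed

lemma Lp_jacobian_test:
  assumes v: "test_function \<Omega> v" and \<Omega>: "\<Omega> \<in> lmeasurable" and q: "0 \<le> q"
  shows "Lp q \<Omega> v" "Lp q \<Omega> (\<lambda>x. jacobian v (at x))"
proof -
  obtain K where K: "compact K" "K \<subseteq> \<Omega>" "\<And>x. x \<notin> K \<Longrightarrow> v x = 0" and sm: "smooth v"
    and K': "\<And>x j. x \<notin> K \<Longrightarrow> partial j v x = 0"
    using test_function_support[OF v] by metis
  have c: "continuous_on UNIV v" by (rule smooth_continuous[OF sm])
  obtain B where "\<And>x. norm (v x) \<le> B"
    using bounded_compact_support[OF c K(3) compact_imp_bounded[OF K(1)]] by blast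
  then show "Lp q \<Omega> v"
    using Lp_bounded[OF borel_measurable_continuous_lebesgue_on[OF c] _ \<Omega> q] by blast
  have c: "continuous_on UNIV (\<lambda>x. jacobian v (at x))" by (rule continuous_jacobian_smooth[OF sm])
  have "jacobian v (at x) = 0" if "x \<notin> K" for x
    using K'[OF that] jacobian_entry[OF smooth_differentiable[OF sm]]
      partial_bounded_linear(1)[OF bounded_linear_vec_nth smooth_differentiable[OF sm]]
    by (simp add: vec_eq_iff)
  then obtain B where "\<And>x. norm (jacobian v (at x)) \<le> B"
    using bounded_compact_support[OF c _ compact_imp_bounded[OF K(1)]] by blast
  then show "Lp q \<Omega> (\<lambda>x. jacobian v (at x))"
    using Lp_bounded[OF borel_measurable_continuous_lebesgue_on[OF c] _ \<Omega> q] by blast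
qed

lemma bounded_open_lmeasurable: "open \<Omega> \<Longrightarrow> bounded \<Omega> \<Longrightarrow> (\<Omega>::'a::euclidean_space set) \<in> lmeasurable"
  by (simp add: bounded_set_imp_lmeasurable open_sets_lebesgue borel_open)

text \<open>The approximating sequence required by \<open>W1p_0\<close> is constantly v.\<close>

lemma W1p_0_test_function:
  fixes v :: "real^'n \<Rightarrow> real^'n"
  assumes \<Omega>: "open \<Omega>" "bounded \<Omega>" and v: "test_function \<Omega> v" and q: "0 < q"
  shows "W1p_0 q \<Omega> v" "AE x in lebesgue_on \<Omega>. weak_grad \<Omega> v x = jacobian v (at x)"
proof -
  have sm: "smooth v" using v by (simp add: test_function_def smooth_def)
  have wg: "has_weak_grad \<Omega> v (\<lambda>x. jacobian v (at x))"
    unfolding jacobian_smooth[OF sm] by (rule has_weak_grad_smooth[OF \<Omega>(1) smooth_vec_nth[OF sm]])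
  note lm = bounded_open_lmeasurable[OF \<Omega>]
  show ae: "AE x in lebesgue_on \<Omega>. weak_grad \<Omega> v x = jacobian v (at x)"
    by (rule weak_grad_AE_eq[OF \<Omega>(1) wg])
  have "W1p q \<Omega> v" unfolding W1p_def using Lp_jacobian_test[OF v lm] wg q by (metis less_imp_le)
  moreover have "Lp_norm q \<Omega> (\<lambda>x. v x - v x) = 0"
    using q by (simp add: Lp_norm_def)
  moreover have "Lp_norm q \<Omega> (\<lambda>x. weak_grad \<Omega> v x - jacobian v (at x)) = 0"
  proof -
    have "AE x in lebesgue_on \<Omega>. norm (weak_grad \<Omega> v x - jacobian v (at x)) powr q = 0"
      using ae by eventually_elim (use q in simp)
    from integral_cong_AE_on[OF open_sets_lebesgue[OF \<Omega>(1)] this] show ?thesis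
      using q by (simp add: Lp_norm_def)
  qed
  ultimately show "W1p_0 q \<Omega> v"
    unfolding W1p_0_def using v by (intro conjI exI[of _ "\<lambda>k. v"]) auto
qed

lemma test_function_scaleR:
  fixes g :: "'b::real_normed_vector"
  assumes "test_function \<Omega> \<phi>" shows "test_function \<Omega> (\<lambda>x. \<phi> x *\<^sub>R g)"
proof -
  have "smooth (\<lambda>x. \<phi> x *\<^sub>R g)"
    using assms by (intro smooth_scaleR) (auto simp: test_function_def smooth_def C_k_const)
  moreover have sub: "closure {x. \<phi> x *\<^sub>R g \<noteq> 0} \<subseteq> closure {x. \<phi> x \<noteq> 0}"
    by (intro closure_mono) auto
  then have "compact (closure {x. \<phi> x *\<^sub>R g \<noteq> 0})"
    using assms by (auto simp: test_function_def compact_closure elim: bounded_subset)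
  ultimately show ?thesis using assms sub unfolding test_function_def smooth_def by blast
qed

lemma jacobian_scaleR_const:
  fixes \<phi> :: "real^'n \<Rightarrow> real" and g :: "real^'n"
  assumes "smooth \<phi>"
  shows "jacobian (\<lambda>x. \<phi> x *\<^sub>R g) (at x) = (\<chi> i j. g $ i * grad \<phi> x $ j)"
proof -
  have "partial j (\<lambda>x. \<phi> x * g $ i) x = g $ i * partial j \<phi> x" for i j
    using partial_bounded_linear(1)[OF bounded_linear_mult_left smooth_differentiable[OF assms], of j "g $ i"]
    by (simp add: mult.commute)
  moreover have "smooth (\<lambda>x. \<phi> x *\<^sub>R g)" using assms by (intro smooth_scaleR) auto
  ultimately show ?thesis by (simp add: jacobian_smooth grad_def)
qed

lemma outer_inner:
  fixes A :: "real^'n^'n"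
  shows "A \<bullet> (\<chi> i j. g $ i * w $ j) = g \<bullet> (A *v w)"
  by (simp add: inner_vec_def matrix_vector_mult_def sum_distrib_left mult_ac)

lemma trace_outer: "trace (\<chi> i j. g $ i * w $ j) = g \<bullet> (w :: real^'n)"
  by (simp add: trace_def inner_vec_def)

lemma scaleR_mat_mult_vec: "(c *\<^sub>R mat 1) *v w = c *\<^sub>R (w :: real^'n)"
  by (simp add: scaleR_matrix_vector_assoc[symmetric])

lemma grad_test_function:
  fixes \<phi> :: "real^'n \<Rightarrow> real"
  assumes \<phi>: "test_function \<Omega> \<phi>"
  obtains B where "continuous_on UNIV (grad \<phi>)" "\<And>x. norm (grad \<phi> x) \<le> B"
proof -
  obtain K where K: "compact K" and sm: "smooth \<phi>" and K': "\<And>x j. x \<notin> K \<Longrightarrow> partial j \<phi> x = 0"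
    using test_function_support[OF \<phi>] by metis
  have c: "continuous_on UNIV (grad \<phi>)" unfolding grad_def
    by (intro continuous_intros smooth_continuous smooth_partial sm)
  have "grad \<phi> x = 0" if "x \<notin> K" for x using K'[OF that] by (simp add: grad_def vec_eq_iff)
  from bounded_compact_support[OF c this compact_imp_bounded[OF K]] c show thesis using that by blast
qed

text \<open>The gradient of \<phi> g is the outer product of g and grad \<phi>, and its divergence
  is their inner product. So the two forms combine to the stress of the solution applied to grad
  \<phi>.\<close>

lemma stokes_test_identity:
  fixes \<Omega> :: "(real^'n) set" and g :: "real^'n"
  assumes \<Omega>: "open \<Omega>" "bounded \<Omega>" and p: "1 < p"
    and sol: "stokes_solution \<Omega> x0 p f u \<pi>" and \<phi>: "test_function \<Omega> \<phi>"
  shows "(f \<bullet> g) * \<phi> x0 = (LINT x|lebesgue_on \<Omega>. g \<bullet> ((weak_grad \<Omega> u x - \<pi> x *\<^sub>R mat 1) *v grad \<phi> x))"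
proof -
  let ?v = "\<lambda>x. \<phi> x *\<^sub>R g"
  note lm = bounded_open_lmeasurable[OF \<Omega>] and S = open_sets_lebesgue[OF \<Omega>(1)]
  have q: "0 < conj_exp p" using p by (simp add: conj_exp_def)
  have tv: "test_function \<Omega> ?v" by (rule test_function_scaleR[OF \<phi>])
  have sm: "smooth \<phi>" using \<phi> by (simp add: test_function_def smooth_def)
  note W = W1p_0_test_function[OF \<Omega> tv q]
  have wv: "AE x in lebesgue_on \<Omega>. weak_grad \<Omega> ?v x = (\<chi> i j. g $ i * grad \<phi> x $ j)"
    using W(2) unfolding jacobian_scaleR_const[OF sm] .
  have "smooth ?v" using sm by (intro smooth_scaleR) auto
  then have "continuous_on \<Omega> ?v" by (rule smooth_continuous)
  then have main: "form_a \<Omega> u ?v + form_b \<Omega> ?v \<pi> = f \<bullet> ?v x0"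
    using sol W(1) unfolding stokes_solution_def by blast
  have u: "W1p p \<Omega> u" using sol by (simp add: stokes_solution_def W1p_0_def)
  have ui: "integrable (lebesgue_on \<Omega>) (weak_grad \<Omega> u)"
    using Lp_integrable[OF W1p_weak_grad(2)[OF \<Omega>(1) u] _ lm] p by simp
  have pi: "integrable (lebesgue_on \<Omega>) \<pi>"
    using sol Lp_integrable[OF _ _ lm] p unfolding stokes_solution_def Lp_zero_mean_def by (metis less_imp_le)
  then have pi: "integrable (lebesgue_on \<Omega>) (\<lambda>x. \<pi> x *\<^sub>R (mat 1 :: real^'n^'n))"
    by (rule integrable_scaleR_left)
  obtain B where B: "continuous_on UNIV (grad \<phi>)" "\<And>x. norm (grad \<phi> x) \<le> B"
    using grad_test_function[OF \<phi>] by blast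
  have "AE x in lebesgue_on \<Omega>. weak_grad \<Omega> u x \<bullet> weak_grad \<Omega> ?v x = g \<bullet> (weak_grad \<Omega> u x *v grad \<phi> x)"
    using wv by eventually_elim (simp only: outer_inner)
  from integral_cong_AE_on[OF S this]
  have a: "form_a \<Omega> u ?v = (LINT x|lebesgue_on \<Omega>. g \<bullet> (weak_grad \<Omega> u x *v grad \<phi> x))"
    by (simp add: form_a_def)
  have "AE x in lebesgue_on \<Omega>. \<pi> x * weak_div \<Omega> ?v x = g \<bullet> ((\<pi> x *\<^sub>R mat 1) *v grad \<phi> x)"
    using wv by eventually_elim (simp add: weak_div_def trace_outer scaleR_mat_mult_vec)
  from integral_cong_AE_on[OF S this]
  have b: "form_b \<Omega> ?v \<pi> = - (LINT x|lebesgue_on \<Omega>. g \<bullet> ((\<pi> x *\<^sub>R mat 1) *v grad \<phi> x))"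
    by (simp add: form_b_def)
  have "(LINT x|lebesgue_on \<Omega>. g \<bullet> ((weak_grad \<Omega> u x - \<pi> x *\<^sub>R mat 1) *v grad \<phi> x)) =
    (LINT x|lebesgue_on \<Omega>. g \<bullet> (weak_grad \<Omega> u x *v grad \<phi> x) - g \<bullet> ((\<pi> x *\<^sub>R mat 1) *v grad \<phi> x))"
    by (simp add: matrix_vector_mult_diff_rdistrib inner_diff_right)
  also have "\<dots> = form_a \<Omega> u ?v + form_b \<Omega> ?v \<pi>"
    unfolding a b using integrable_matrix_inner[OF ui B] integrable_matrix_inner[OF pi B] by simp
  also have "\<dots> = (f \<bullet> g) * \<phi> x0" using main by simp
  finally show ?thesis by simp
qed

text \<open>The factor \<open>norm (mat 1)\<close> is the Frobenius norm of the identity. With it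
  the function dominates the norm of the difference of the two stresses.\<close>

definition err :: "(real^'n) set \<Rightarrow> (real^'n \<Rightarrow> real^'n) \<Rightarrow> (real^'n \<Rightarrow> real^'n) \<Rightarrow>
    (real^'n \<Rightarrow> real) \<Rightarrow> (real^'n \<Rightarrow> real) \<Rightarrow> real^'n \<Rightarrow> real" where
  "err \<Omega> u uh \<pi> \<pi>h x = norm (weak_grad \<Omega> (\<lambda>x. u x - uh x) x) + norm (mat 1 :: real^'n^'n) * \<bar>\<pi> x - \<pi>h x\<bar>"

text \<open>Discrete functions are given with the conjugate exponent; on a bounded domain this
  comparison gives them the exponent p as well.\<close>

lemma conj_exp_ge: "1 < p \<Longrightarrow> p \<le> 2 \<Longrightarrow> p \<le> conj_exp p"
proof -
  assume p: "1 < p" "p \<le> 2"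
  then have "p * (p - 1) \<le> p * 1" by (intro mult_left_mono) auto
  then show ?thesis using p by (simp add: conj_exp_def pos_le_divide_eq)
qed

lemma err_Lp:
  fixes \<Omega> :: "(real^'n) set"
  assumes \<Omega>: "open \<Omega>" "bounded \<Omega>" and p: "1 < p" "p \<le> 2"
    and sol: "stokes_solution \<Omega> x0 p f u \<pi>"
    and uh: "W1p (conj_exp p) \<Omega> uh" and \<pi>h: "Lp (conj_exp p) \<Omega> \<pi>h"
  shows "Lp p \<Omega> (weak_grad \<Omega> uh)" "Lp p \<Omega> \<pi>h"
    "AE x in lebesgue_on \<Omega>. weak_grad \<Omega> (\<lambda>x. u x - uh x) x = weak_grad \<Omega> u x - weak_grad \<Omega> uh x"
    "Lp p \<Omega> (weak_grad \<Omega> (\<lambda>x. u x - uh x))" "Lp p \<Omega> (\<lambda>x. \<pi> x - \<pi>h x)" "Lp p \<Omega> (err \<Omega> u uh \<pi> \<pi>h)"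
proof -
  note lm = bounded_open_lmeasurable[OF \<Omega>] and S = open_sets_lebesgue[OF \<Omega>(1)]
  have p0: "0 \<le> p" using p by simp
  have u: "W1p p \<Omega> u" and pi: "Lp p \<Omega> \<pi>"
    using sol by (simp_all add: stokes_solution_def W1p_0_def Lp_zero_mean_def)
  note U = W1p_weak_grad[OF \<Omega>(1) u] and UH = W1p_weak_grad[OF \<Omega>(1) uh]
  show 1: "Lp p \<Omega> (weak_grad \<Omega> uh)" by (rule Lp_exponent_mono[OF UH(2) conj_exp_ge[OF p] p0 lm])
  show 2: "Lp p \<Omega> \<pi>h" by (rule Lp_exponent_mono[OF \<pi>h conj_exp_ge[OF p] p0 lm])
  show ae: "AE x in lebesgue_on \<Omega>. weak_grad \<Omega> (\<lambda>x. u x - uh x) x = weak_grad \<Omega> u x - weak_grad \<Omega> uh x"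
    by (rule weak_grad_AE_eq[OF \<Omega>(1) has_weak_grad_diff[OF \<Omega>(1) U(1) UH(1)]])
  have "AE x in lebesgue_on \<Omega>. weak_grad \<Omega> u x - weak_grad \<Omega> uh x = weak_grad \<Omega> (\<lambda>x. u x - uh x) x"
    using ae by eventually_elim simp
  then show 3: "Lp p \<Omega> (weak_grad \<Omega> (\<lambda>x. u x - uh x))"
    by (rule Lp_AE_cong[OF S Lp_diff[OF U(2) 1 p0]])
  show 4: "Lp p \<Omega> (\<lambda>x. \<pi> x - \<pi>h x)" by (rule Lp_diff[OF pi 2 p0])
  have norm_Lp: "Lp p \<Omega> (\<lambda>x. norm (h x))" if "Lp p \<Omega> h" for h :: "real^'n \<Rightarrow> 'b::euclidean_space"
    using that by (auto simp: Lp_def)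
  show "Lp p \<Omega> (err \<Omega> u uh \<pi> \<pi>h)"
    unfolding err_def[abs_def] real_norm_def[symmetric]
    by (intro Lp_add norm_Lp[OF 3] Lp_bounded_linear[OF norm_Lp[OF 4] bounded_linear_mult_right] p0)
qed

text \<open>The discrete stress is subtracted under the integral of
  \<open>stokes_test_identity\<close>, and the difference is bounded pointwise.\<close>

lemma residual_bound:
  fixes \<Omega> :: "(real^'n) set" and g :: "real^'n"
  assumes \<Omega>: "open \<Omega>" "bounded \<Omega>" and p: "1 < p" "p \<le> 2"
    and sol: "stokes_solution \<Omega> x0 p f u \<pi>"
    and uh: "W1p (conj_exp p) \<Omega> uh" and \<pi>h: "Lp (conj_exp p) \<Omega> \<pi>h" and \<phi>: "test_function \<Omega> \<phi>"
  shows "\<bar>(f \<bullet> g) * \<phi> x0 - (LINT x|lebesgue_on \<Omega>. g \<bullet> ((weak_grad \<Omega> uh x - \<pi>h x *\<^sub>R mat 1) *v grad \<phi> x))\<bar>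
    \<le> norm g * (LINT x|lebesgue_on \<Omega>. err \<Omega> u uh \<pi> \<pi>h x * norm (grad \<phi> x))"
proof -
  note lm = bounded_open_lmeasurable[OF \<Omega>] and S = open_sets_lebesgue[OF \<Omega>(1)]
  note E = err_Lp[OF \<Omega> p sol uh \<pi>h]
  have p1: "1 \<le> p" using p by simp
  obtain B where B: "continuous_on UNIV (grad \<phi>)" "\<And>x. norm (grad \<phi> x) \<le> B"
    using grad_test_function[OF \<phi>] by blast
  have u: "W1p p \<Omega> u" and pi: "Lp p \<Omega> \<pi>"
    using sol by (simp_all add: stokes_solution_def W1p_0_def Lp_zero_mean_def)
  have Ai: "integrable (lebesgue_on \<Omega>) (\<lambda>x. weak_grad \<Omega> u x - \<pi> x *\<^sub>R (mat 1 :: real^'n^'n))"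
    using Lp_integrable[OF W1p_weak_grad(2)[OF \<Omega>(1) u] p1 lm] Lp_integrable[OF pi p1 lm]
    by (intro Bochner_Integration.integrable_diff integrable_scaleR_left)
  have Bi: "integrable (lebesgue_on \<Omega>) (\<lambda>x. weak_grad \<Omega> uh x - \<pi>h x *\<^sub>R (mat 1 :: real^'n^'n))"
    using Lp_integrable[OF E(1) p1 lm] Lp_integrable[OF E(2) p1 lm]
    by (intro Bochner_Integration.integrable_diff integrable_scaleR_left)
  let ?A = "\<lambda>x. g \<bullet> ((weak_grad \<Omega> u x - \<pi> x *\<^sub>R mat 1) *v grad \<phi> x)"
  let ?B = "\<lambda>x. g \<bullet> ((weak_grad \<Omega> uh x - \<pi>h x *\<^sub>R mat 1) *v grad \<phi> x)"
  note ABi = integrable_matrix_inner[OF Ai B, of g] integrable_matrix_inner[OF Bi B, of g]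
  have eq: "(f \<bullet> g) * \<phi> x0 - (LINT x|lebesgue_on \<Omega>. ?B x) = (LINT x|lebesgue_on \<Omega>. ?A x - ?B x)"
    using stokes_test_identity[OF \<Omega> p(1) sol \<phi>, of g] ABi by simp
  have "\<bar>(f \<bullet> g) * \<phi> x0 - (LINT x|lebesgue_on \<Omega>. ?B x)\<bar> \<le> (LINT x|lebesgue_on \<Omega>. \<bar>?A x - ?B x\<bar>)"
    unfolding eq by (rule integral_abs_bound)
  also have "\<dots> \<le> (LINT x|lebesgue_on \<Omega>. norm g * (err \<Omega> u uh \<pi> \<pi>h x * norm (grad \<phi> x)))"
  proof (rule Bochner_Integration.integral_mono_AE)
    show "integrable (lebesgue_on \<Omega>) (\<lambda>x. \<bar>?A x - ?B x\<bar>)" using ABi by simp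
    have "integrable (lebesgue_on \<Omega>) (\<lambda>x. err \<Omega> u uh \<pi> \<pi>h x * norm (grad \<phi> x))"
      by (rule integrable_mult_bounded[OF Lp_integrable[OF E(6) p1 lm]
            borel_measurable_continuous_lebesgue_on[OF continuous_on_norm[OF B(1)]], of B]) (use B in simp)
    then show "integrable (lebesgue_on \<Omega>) (\<lambda>x. norm g * (err \<Omega> u uh \<pi> \<pi>h x * norm (grad \<phi> x)))" by simp
    show "AE x in lebesgue_on \<Omega>. \<bar>?A x - ?B x\<bar> \<le> norm g * (err \<Omega> u uh \<pi> \<pi>h x * norm (grad \<phi> x))"
      using E(3)
    proof eventually_elim
      case (elim x)
      let ?M = "(weak_grad \<Omega> u x - weak_grad \<Omega> uh x) - (\<pi> x - \<pi>h x) *\<^sub>R (mat 1 :: real^'n^'n)"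
      have eq: "?M = (weak_grad \<Omega> u x - \<pi> x *\<^sub>R mat 1) - (weak_grad \<Omega> uh x - \<pi>h x *\<^sub>R mat 1)"
        by (simp add: algebra_simps)
      have AB: "?A x - ?B x = g \<bullet> (?M *v grad \<phi> x)"
        unfolding eq by (simp add: matrix_vector_mult_diff_rdistrib inner_diff_right)
      have "\<bar>?A x - ?B x\<bar> \<le> norm g * norm (?M *v grad \<phi> x)"
        unfolding AB by (rule Cauchy_Schwarz_ineq2)
      also have "\<dots> \<le> norm g * (norm ?M * norm (grad \<phi> x))"
        by (intro mult_left_mono norm_matrix_vector_mult_le) simp
      also have "\<dots> \<le> norm g * (err \<Omega> u uh \<pi> \<pi>h x * norm (grad \<phi> x))"
      proof (intro mult_left_mono mult_right_mono)
        show "norm ?M \<le> err \<Omega> u uh \<pi> \<pi>h x"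
          unfolding err_def elim by (rule order_trans[OF norm_triangle_ineq4]) (simp add: mult.commute)
      qed simp_all
      finally show ?case .
    qed
  qed
  finally show ?thesis by simp
qed

text \<open>The splitting of \<open>mean_bound_imp_powr_bound\<close> with a free parameter. If the
  integral of e^p tends to 0 then so does that of e, by letting l tend to 0 afterwards.\<close>

lemma integral_le_powr:
  fixes e :: "real^'n \<Rightarrow> real"
  assumes e: "Lp p S e" "\<And>x. 0 \<le> e x" and p: "1 \<le> p" and S: "S \<in> lmeasurable" and l: "0 < l"
  shows "(LINT x|lebesgue_on S. e x) \<le> l * measure lebesgue S + l powr (1 - p) * (LINT x|lebesgue_on S. e x powr p)"
proof -
  have le: "e x \<le> l + l powr (1 - p) * e x powr p" for x
  proof (cases "e x \<le> l")
    case True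
    then show ?thesis by (simp add: add_increasing2)
  next
    case False
    then have "e x = e x powr (1 - p) * e x powr p" using l by (simp add: powr_add[symmetric])
    also have "\<dots> \<le> l powr (1 - p) * e x powr p"
      using False l p by (intro mult_right_mono powr_mono2') auto
    finally show ?thesis using l by simp
  qed
  interpret finite_measure "lebesgue_on S" using S by (rule finite_measure_lebesgue_on)
  have ip: "integrable (lebesgue_on S) (\<lambda>x. e x powr p)" using e by (simp add: Lp_def)
  then have intr: "integrable (lebesgue_on S) (\<lambda>x. l + l powr (1 - p) * e x powr p)"
    by (intro Bochner_Integration.integrable_add integrable_const integrable_mult_right)
  have ms: "measure (lebesgue_on S) S = measure lebesgue S"
    using S by (intro measure_restrict_space) auto
  have "(LINT x|lebesgue_on S. e x) \<le> (LINT x|lebesgue_on S. l + l powr (1 - p) * e x powr p)"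
    by (rule Bochner_Integration.integral_mono[OF Lp_integrable[OF e(1) p S] intr le])
  also have "\<dots> = l * measure lebesgue S + l powr (1 - p) * (LINT x|lebesgue_on S. e x powr p)"
    using ip S ms by (subst Bochner_Integration.integral_add) (auto simp: space_restrict_space)
  finally show ?thesis .
qed

lemma integral_trace_jacobian_test:
  assumes \<Omega>: "open \<Omega>" and v: "test_function \<Omega> v"
  shows "(LINT x|lebesgue_on \<Omega>. trace (jacobian v (at x))) = 0"
proof -
  obtain K where K: "compact K" "K \<subseteq> \<Omega>" "\<And>x. x \<notin> K \<Longrightarrow> v x = 0" and sm: "smooth v"
    and K': "\<And>x j. x \<notin> K \<Longrightarrow> partial j v x = 0"
    using test_function_support[OF v] by metis
  note smi = smooth_vec_nth[OF sm]
  have K0: "partial i (\<lambda>x. v x $ i) x = 0" if "x \<notin> K" for x i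
    using K'[OF that] partial_bounded_linear(1)[OF bounded_linear_vec_nth smooth_differentiable[OF sm]] by simp
  have z: "integral\<^sup>L lebesgue (\<lambda>x. partial i (\<lambda>x. v x $ i) x) = 0" for i
    using integral_by_parts(1)[OF smooth_const[of 1] smi, of K i i] K compact_imp_bounded[OF K(1)]
    by (simp add: partial_def)
  have tr: "trace (jacobian v (at x)) = (\<Sum>i\<in>UNIV. partial i (\<lambda>x. v x $ i) x)" for x
    by (simp add: trace_def jacobian_smooth[OF sm])
  have "(LINT x|lebesgue_on \<Omega>. trace (jacobian v (at x))) = integral\<^sup>L lebesgue (\<lambda>x. trace (jacobian v (at x)))"
    by (rule integral_lebesgue_on_support[OF open_sets_lebesgue[OF \<Omega>]]) (use K0 K(2) in \<open>auto simp: tr intro!: sum.neutral\<close>)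
  also have "\<dots> = (\<Sum>i\<in>UNIV. integral\<^sup>L lebesgue (\<lambda>x. partial i (\<lambda>x. v x $ i) x))"
    unfolding tr
    by (intro Bochner_Integration.integral_sum integrable_lebesgue_compact_support[OF _ K0 compact_imp_bounded[OF K(1)]]
        smooth_continuous smooth_partial smi)
  finally show ?thesis using z by simp
qed

text \<open>It holds for test functions by integration by parts and passes to the limit in W^(1,p).
  It permits subtracting a constant from the test pressure in
  \<open>weak_div_stokes_solution\<close>.\<close>

lemma integral_weak_div_eq_0:
  fixes \<Omega> :: "(real^'n) set"
  assumes \<Omega>: "open \<Omega>" "bounded \<Omega>" and p: "1 < p" and u: "W1p_0 p \<Omega> u"
  shows "(LINT x|lebesgue_on \<Omega>. weak_div \<Omega> u x) = 0"
proof -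
  note lm = bounded_open_lmeasurable[OF \<Omega>]
  have p1: "1 \<le> p" and p0: "0 \<le> p" using p by auto
  let ?N = "norm (mat 1 :: real^'n^'n)" and ?m = "measure lebesgue \<Omega>"
  have u1: "W1p p \<Omega> u" using u by (simp add: W1p_0_def)
  note U = W1p_weak_grad[OF \<Omega>(1) u1]
  obtain \<phi> :: "nat \<Rightarrow> real^'n \<Rightarrow> real^'n" where \<phi>: "\<And>k. test_function \<Omega> (\<phi> k)"
    and lim: "(\<lambda>k. Lp_norm p \<Omega> (\<lambda>x. weak_grad \<Omega> u x - jacobian (\<phi> k) (at x))) \<longlonglongrightarrow> 0"
    using u unfolding W1p_0_def by blast
  define I where "I k = (LINT x|lebesgue_on \<Omega>. norm (weak_grad \<Omega> u x - jacobian (\<phi> k) (at x)) powr p)" for k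
  have "(\<lambda>k. Lp_norm p \<Omega> (\<lambda>x. weak_grad \<Omega> u x - jacobian (\<phi> k) (at x)) powr p) \<longlonglongrightarrow> 0 powr p"
    using p by (intro tendsto_powr'[OF lim tendsto_const]) (auto simp: Lp_norm_def)
  then have I0: "I \<longlonglongrightarrow> 0" using p by (simp add: Lp_norm_powr I_def[abs_def])
  let ?D = "\<bar>LINT x|lebesgue_on \<Omega>. weak_div \<Omega> u x\<bar>"
  have bound: "?D \<le> ?N * (l * ?m + l powr (1 - p) * I k)" if l: "0 < l" for l k
  proof -
    let ?h = "\<lambda>x. weak_grad \<Omega> u x - jacobian (\<phi> k) (at x)"
    have J: "Lp p \<Omega> (\<lambda>x. jacobian (\<phi> k) (at x))" by (rule Lp_jacobian_test(2)[OF \<phi> lm p0])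
    have h: "Lp p \<Omega> ?h" by (rule Lp_diff[OF U(2) J p0])
    have nh: "Lp p \<Omega> (\<lambda>x. norm (?h x))" using h by (auto simp: Lp_def)
    have tr: "integrable (lebesgue_on \<Omega>) (\<lambda>x. trace (A x))"
      if "Lp p \<Omega> A" for A :: "real^'n \<Rightarrow> real^'n^'n"
      unfolding trace_eq_inner_mat
      by (rule integrable_bounded_linear[OF bounded_linear_inner_left Lp_integrable[OF that p1 lm]])
    have eq: "(LINT x|lebesgue_on \<Omega>. weak_div \<Omega> u x) = (LINT x|lebesgue_on \<Omega>. trace (?h x))"
      using tr[OF U(2)] tr[OF J] integral_trace_jacobian_test[OF \<Omega>(1) \<phi>[of k]]
      by (simp add: weak_div_def trace_sub)
    have "?D \<le> (LINT x|lebesgue_on \<Omega>. \<bar>trace (?h x)\<bar>)" unfolding eq by (rule integral_abs_bound)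
    also have "\<dots> \<le> (LINT x|lebesgue_on \<Omega>. ?N * norm (?h x))"
    proof (rule Bochner_Integration.integral_mono)
      show "integrable (lebesgue_on \<Omega>) (\<lambda>x. \<bar>trace (?h x)\<bar>)" using tr[OF h] by simp
      show "integrable (lebesgue_on \<Omega>) (\<lambda>x. ?N * norm (?h x))" using Lp_integrable[OF nh p1 lm] by simp
      show "\<bar>trace (?h x)\<bar> \<le> ?N * norm (?h x)" for x
        unfolding trace_eq_inner_mat using Cauchy_Schwarz_ineq2[of "?h x" "mat 1"] by (simp add: mult.commute)
    qed
    also have "\<dots> = ?N * (LINT x|lebesgue_on \<Omega>. norm (?h x))" by simp
    also have "\<dots> \<le> ?N * (l * ?m + l powr (1 - p) * I k)"
      using integral_le_powr[OF nh _ p1 lm l] by (intro mult_left_mono) (auto simp: I_def)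
    finally show ?thesis .
  qed
  \<comment> \<open>The order of limits matters: first k tends to infinity with l fixed, then l = 1
    / (n + 1) tends to 0.\<close>
  have "?D \<le> ?N * (l * ?m)" if l: "0 < l" for l
  proof -
    have "(\<lambda>k. ?N * (l * ?m + l powr (1 - p) * I k)) \<longlonglongrightarrow> ?N * (l * ?m + l powr (1 - p) * 0)"
      by (intro tendsto_intros I0)
    then show ?thesis using bound[OF l] by (intro LIMSEQ_le_const) auto
  qed
  then have "?D \<le> ?N * (inverse (real (Suc n)) * ?m)" for n by simp
  moreover have "(\<lambda>n. ?N * (inverse (real (Suc n)) * ?m)) \<longlonglongrightarrow> ?N * (0 * ?m)"
    by (intro tendsto_intros LIMSEQ_inverse_real_of_nat)
  ultimately have "?D \<le> ?N * (0 * ?m)" by (intro LIMSEQ_le_const) auto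
  then show ?thesis by simp
qed

text \<open>The test pressure is the sign of div u minus its mean. As div u has integral zero, the
  mean does not contribute, and what remains is the integral of the absolute value of div u.\<close>

lemma weak_div_stokes_solution:
  fixes \<Omega> :: "(real^'n) set"
  assumes \<Omega>: "open \<Omega>" "bounded \<Omega>" and p: "1 < p" and sol: "stokes_solution \<Omega> x0 p f u \<pi>"
  shows "AE x in lebesgue_on \<Omega>. weak_div \<Omega> u x = 0"
proof -
  note lm = bounded_open_lmeasurable[OF \<Omega>]
  interpret finite_measure "lebesgue_on \<Omega>" using lm by (rule finite_measure_lebesgue_on)
  have p1: "1 \<le> p" using p by auto
  have u: "W1p_0 p \<Omega> u" using sol by (simp add: stokes_solution_def)
  then have u1: "W1p p \<Omega> u" by (simp add: W1p_0_def)
  let ?D = "weak_div \<Omega> u"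
  have Di: "integrable (lebesgue_on \<Omega>) ?D"
    unfolding weak_div_def[abs_def] trace_eq_inner_mat
    by (rule integrable_bounded_linear[OF bounded_linear_inner_left Lp_integrable[OF W1p_weak_grad(2)[OF \<Omega>(1) u1] p1 lm]])
  define s where "s x = sgn (?D x)" for x
  have sm: "s \<in> borel_measurable (lebesgue_on \<Omega>)" unfolding s_def using Di by (auto intro!: borel_measurable_sgn)
  have sb: "\<bar>s x\<bar> \<le> 1" for x by (auto simp: s_def sgn_if)
  have si: "integrable (lebesgue_on \<Omega>) s"
    by (rule integrable_const_bound[of _ 1]) (use sm sb in auto)
  define c where "c = (if measure lebesgue \<Omega> = 0 then 0 else (LINT x|lebesgue_on \<Omega>. s x) / measure lebesgue \<Omega>)"
  have ms: "measure (lebesgue_on \<Omega>) \<Omega> = measure lebesgue \<Omega>"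
    using lm by (intro measure_restrict_space) auto
  have "(LINT x|lebesgue_on \<Omega>. s x) = 0" if "measure lebesgue \<Omega> = 0"
  proof -
    have "emeasure lebesgue \<Omega> = 0" using that lm by (simp add: emeasure_eq_measure2 fmeasurableD2)
    then have "AE x in lebesgue_on \<Omega>. s x = 0"
      using lm by (subst AE_lebesgue_on_iff) (auto intro!: AE_I'[of \<Omega>] simp: null_sets_def)
    then have "(LINT x|lebesgue_on \<Omega>. s x) = (LINT x|lebesgue_on \<Omega>. 0)"
      using lm by (intro integral_cong_AE_on) auto
    then show ?thesis by simp
  qed
  then have mean: "(LINT x|lebesgue_on \<Omega>. s x - c) = 0"
    using si by (auto simp: c_def ms)
  have "Lp (conj_exp p) \<Omega> (\<lambda>x. s x - c)"
  proof (rule Lp_bounded[OF _ _ lm])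
    show "norm (s x - c) \<le> 1 + \<bar>c\<bar>" for x using sb[of x] by simp
    show "0 \<le> conj_exp p" using p by (simp add: conj_exp_def)
  qed (use sm in simp)
  then have "form_b \<Omega> u (\<lambda>x. s x - c) = 0"
    using sol mean unfolding stokes_solution_def Lp_zero_mean_def by blast
  then have "(LINT x|lebesgue_on \<Omega>. (s x - c) * ?D x) = 0" by (simp add: form_b_def)
  moreover have "(s x - c) * ?D x = \<bar>?D x\<bar> - c * ?D x" for x
    by (simp add: s_def abs_sgn algebra_simps)
  ultimately have "(LINT x|lebesgue_on \<Omega>. \<bar>?D x\<bar>) = 0"
    using Di integral_weak_div_eq_0[OF \<Omega> p u] by simp
  then have "AE x in lebesgue_on \<Omega>. \<bar>?D x\<bar> = 0"
    using Di by (subst (asm) integral_nonneg_eq_0_iff_AE) auto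
  then show ?thesis by eventually_elim simp
qed

section \<open>Simplices\<close>

text \<open>Near a boundary point, closure \<Omega> misses the open region strictly below the graph.
  So \<Omega> has no slits, and the interiors of mesh elements lie in \<Omega>. The boundary is
  locally part of the graph of a Lipschitz function over a hyperplane, hence a null set.\<close>

lemma interior_closure_lipschitz:
  fixes \<Omega> :: "(real^'n) set"
  assumes \<Omega>: "open \<Omega>" and lip: "lipschitz_boundary \<Omega>"
  shows "interior (closure \<Omega>) \<subseteq> \<Omega>" "negligible (frontier \<Omega>)"
proof -
  have chart: "\<exists>r>0. \<exists>e g L. norm e = 1 \<and> L-lipschitz_on {y. y \<bullet> e = 0} g \<and>
      (\<forall>x. x \<in> ball z r \<longrightarrow> (x \<in> \<Omega> \<longleftrightarrow> g (x - (x \<bullet> e) *\<^sub>R e) < x \<bullet> e)) \<and>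
      closure \<Omega> \<inter> ball z r \<inter> {x. x \<bullet> e < g (x - (x \<bullet> e) *\<^sub>R e)} = {}"
    if z: "z \<in> frontier \<Omega>" for z
  proof -
    obtain r e g L where r: "r > 0" and e: "norm e = 1" and g: "L-lipschitz_on {y. y \<bullet> e = 0} g"
      and eq: "\<Omega> \<inter> ball z r = {x \<in> ball z r. g (x - (x \<bullet> e) *\<^sub>R e) < x \<bullet> e}"
      using bspec[OF lip[unfolded lipschitz_boundary_def] z] by (elim exE conjE) (rule that)
    have ee: "e \<bullet> e = 1" using e by (simp add: norm_eq_1)
    have "continuous_on UNIV (\<lambda>x. g (x - (x \<bullet> e) *\<^sub>R e))"
      by (rule continuous_on_compose2[OF lipschitz_on_continuous_on[OF g]])
        (auto intro!: continuous_intros simp: inner_diff_left ee)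
    then have op: "open (ball z r \<inter> {x. x \<bullet> e < g (x - (x \<bullet> e) *\<^sub>R e)})"
      by (intro open_Int open_ball open_Collect_less continuous_intros)
    have "ball z r \<inter> {x. x \<bullet> e < g (x - (x \<bullet> e) *\<^sub>R e)} \<inter> \<Omega> = {}"
      using eq by force
    then have "ball z r \<inter> {x. x \<bullet> e < g (x - (x \<bullet> e) *\<^sub>R e)} \<inter> closure \<Omega> = {}"
      using open_Int_closure_eq_empty[OF op] by blast
    moreover have "\<forall>x. x \<in> ball z r \<longrightarrow> (x \<in> \<Omega> \<longleftrightarrow> g (x - (x \<bullet> e) *\<^sub>R e) < x \<bullet> e)"
      using eq by blast
    ultimately show ?thesis using r e g by blast
  qed
  show "interior (closure \<Omega>) \<subseteq> \<Omega>"
  proof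
    fix z assume z: "z \<in> interior (closure \<Omega>)"
    show "z \<in> \<Omega>"
    proof (rule ccontr)
      assume "z \<notin> \<Omega>"
      then have "z \<in> frontier \<Omega>"
        using z \<Omega> interior_subset by (auto simp: frontier_def interior_open)
      from chart[OF this] obtain r e g L where r: "r > 0" and e: "norm e = 1" and "L-lipschitz_on {y. y \<bullet> e = 0} g"
        and iff0: "\<forall>x. x \<in> ball z r \<longrightarrow> (x \<in> \<Omega> \<longleftrightarrow> g (x - (x \<bullet> e) *\<^sub>R e) < x \<bullet> e)"
        and out: "closure \<Omega> \<inter> ball z r \<inter> {x. x \<bullet> e < g (x - (x \<bullet> e) *\<^sub>R e)} = {}" by (elim exE conjE) (rule that)
      note iff = iff0[rule_format]
      have ee: "e \<bullet> e = 1" using e by (simp add: norm_eq_1)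
      obtain s where s: "s > 0" "ball z s \<subseteq> closure \<Omega>" using z by (meson mem_interior)
      define t where "t = min r s / 2"
      have t: "0 < t" "t < r" "t < s" using r s by (auto simp: t_def)
      \<comment> \<open>z lies on or below the graph. Moving further down leads strictly below it
        while staying in a ball inside closure \<Omega>.\<close>
      define w where "w = z - t *\<^sub>R e"
      have dw: "dist z w = t" using t e by (simp add: w_def dist_norm)
      have "w - (w \<bullet> e) *\<^sub>R e = z - (z \<bullet> e) *\<^sub>R e" "w \<bullet> e = z \<bullet> e - t"
        by (simp_all add: w_def inner_diff_left ee algebra_simps)
      moreover have "z \<bullet> e \<le> g (z - (z \<bullet> e) *\<^sub>R e)" using iff[of z] r \<open>z \<notin> \<Omega>\<close> by simp
      ultimately have "w \<bullet> e < g (w - (w \<bullet> e) *\<^sub>R e)" using t by simp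
      moreover have "w \<in> ball z r" "w \<in> closure \<Omega>" using dw t s by auto
      ultimately show False using out by blast
    qed
  qed
  have "\<exists>U. openin (top_of_set (frontier \<Omega>)) U \<and> z \<in> U \<and> negligible U" if z: "z \<in> frontier \<Omega>" for z
  proof -
    obtain r e g L where r: "r > 0" and e: "norm e = 1" and g: "L-lipschitz_on {y. y \<bullet> e = 0} g"
        and iff0: "\<forall>x. x \<in> ball z r \<longrightarrow> (x \<in> \<Omega> \<longleftrightarrow> g (x - (x \<bullet> e) *\<^sub>R e) < x \<bullet> e)"
        and out: "closure \<Omega> \<inter> ball z r \<inter> {x. x \<bullet> e < g (x - (x \<bullet> e) *\<^sub>R e)} = {}"
      using chart[OF z] by (elim exE conjE) (rule that)
    note iff = iff0[rule_format]
    let ?H = "{y. y \<bullet> e = 0}"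
    have "e \<noteq> 0" using e by auto
    then have "negligible ?H" using negligible_hyperplane[of e 0] by (simp add: inner_commute)
    have ee: "e \<bullet> e = 1" using e by (simp add: norm_eq_1)
    have "negligible ((\<lambda>y. y + g y *\<^sub>R e) ` ?H)"
    proof (rule negligible_locally_Lipschitz_image)
      fix x assume x: "x \<in> ?H"
      have "norm (y + g y *\<^sub>R e - (x + g x *\<^sub>R e)) \<le> (1 + L) * norm (y - x)" if "y \<in> ?H" for y
      proof -
        have "y + g y *\<^sub>R e - (x + g x *\<^sub>R e) = (y - x) + (g y - g x) *\<^sub>R e" by (simp add: algebra_simps)
        then have "norm (y + g y *\<^sub>R e - (x + g x *\<^sub>R e)) \<le> norm (y - x) + norm ((g y - g x) *\<^sub>R e)"
          using norm_triangle_ineq by metis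
        also have "norm ((g y - g x) *\<^sub>R e) \<le> L * norm (y - x)"
          using lipschitz_onD[OF g that x] e by (simp add: dist_norm)
        finally show ?thesis by (simp add: algebra_simps)
      qed
      then show "\<exists>T B. open T \<and> x \<in> T \<and> (\<forall>y \<in> ?H \<inter> T. norm (y + g y *\<^sub>R e - (x + g x *\<^sub>R e)) \<le> B * norm (y - x))"
        by (intro exI[of _ UNIV] exI[of _ "1 + L"]) auto
    qed (use \<open>negligible ?H\<close> in auto)
    moreover have "frontier \<Omega> \<inter> ball z r \<subseteq> (\<lambda>y. y + g y *\<^sub>R e) ` ?H"
    proof
      fix x assume x: "x \<in> frontier \<Omega> \<inter> ball z r"
      then have "x \<notin> \<Omega>" "x \<in> closure \<Omega>" using \<Omega> by (auto simp: frontier_def interior_open)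
      then have "g (x - (x \<bullet> e) *\<^sub>R e) = x \<bullet> e" using iff[of x] out x by force
      moreover have "(x - (x \<bullet> e) *\<^sub>R e) \<in> ?H" by (simp add: inner_diff_left ee)
      ultimately show "x \<in> (\<lambda>y. y + g y *\<^sub>R e) ` ?H"
        by (intro image_eqI[of _ _ "x - (x \<bullet> e) *\<^sub>R e"]) auto
    qed
    ultimately have "negligible (frontier \<Omega> \<inter> ball z r)" by (rule negligible_subset)
    moreover have "openin (top_of_set (frontier \<Omega>)) (frontier \<Omega> \<inter> ball z r)" by (simp add: openin_open_Int)
    ultimately show ?thesis using z r by (intro exI[of _ "frontier \<Omega> \<inter> ball z r"]) auto
  qed
  then show "negligible (frontier \<Omega>)" by (subst locally_negligible_alt) blast
qed

definition simplex_points :: "(real^'n) set \<Rightarrow> bool" where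
  "simplex_points C \<longleftrightarrow> \<not> affine_dependent C \<and> card C = CARD('n) + 1"

lemma simplex_pointsE:
  fixes T :: "(real^'n) set"
  assumes "int CARD('n) simplex T"
  obtains C where "simplex_points C" "T = convex hull C"
  using assms unfolding simplex_def simplex_points_def by (metis of_nat_1 of_nat_add of_nat_eq_iff)

lemma simplex_points_finite: "simplex_points C \<Longrightarrow> finite C"
  by (simp add: simplex_points_def aff_independent_finite)

lemma simplex_points_hull: "simplex_points C \<Longrightarrow> affine hull C = UNIV"
  using affine_independent_card_dim_diffs aff_dim_affine_independent[of C]
  by (auto simp: simplex_points_def aff_dim_eq_full[symmetric])

lemma vertices_simplex: "simplex_points C \<Longrightarrow> vertices (convex hull C) = C"
  by (auto simp: vertices_def simplex_points_def extreme_point_of_convex_hull_affine_independent)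

text \<open>After one point is moved to the origin the others are linearly independent, so some
  linear functional takes prescribed values; v represents it.\<close>

lemma affine_interpolation:
  fixes C :: "(real^'n) set" and f :: "real^'n \<Rightarrow> real"
  assumes "\<not> affine_dependent C"
  shows "\<exists>k v. \<forall>c\<in>C. k + v \<bullet> c = f c"
proof (cases "C = {}")
  case False
  then obtain a where a: "a \<in> C" by blast
  have "independent ((\<lambda>x. - a + x) ` (C - {a}))"
    using assms affine_dependent_iff_dependent2[OF a] by blast
  from linear_independent_extend[OF this, of "\<lambda>y. f (a + y) - f a"]
  obtain g where g: "linear g" "\<And>c. c \<in> C - {a} \<Longrightarrow> g (- a + c) = f c - f a" by auto
  define v where "v = adjoint g 1"
  have v: "g y = v \<bullet> y" for y using adjoint_works[OF g(1), of y 1] by (simp add: v_def inner_commute)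
  have "f a - v \<bullet> a + v \<bullet> c = f c" if "c \<in> C" for c
    using g(2)[of c] that v[of "- a + c"] by (cases "c = a") (auto simp: inner_diff_right)
  then show ?thesis by blast
qed simp

lemma affine_fun_eqI:
  fixes C :: "(real^'n) set"
  assumes C: "simplex_points C" and eq: "\<And>c. c \<in> C \<Longrightarrow> k + v \<bullet> c = k' + v' \<bullet> c"
  shows "k = k'" "v = v'"
proof -
  have "affine {x. (v - v') \<bullet> x = k' - k}" by (rule affine_hyperplane)
  then have "affine hull C \<subseteq> {x. (v - v') \<bullet> x = k' - k}"
    using eq by (intro hull_minimal) (force simp: inner_diff_left)+
  then have all: "(v - v') \<bullet> x = k' - k" for x using simplex_points_hull[OF C] by auto
  from all[of 0] show "k = k'" by simp
  with all[of "v - v'"] show "v = v'" by simp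
qed

text \<open>Barycentric coordinates as affine functions on the whole space;
  \<open>barycentric_eq_bary\<close> identifies them with \<open>barycentric\<close> later. Their
  Lipschitz constants carry the shape of the simplex.\<close>

definition bary :: "(real^'n) set \<Rightarrow> real^'n \<Rightarrow> real^'n \<Rightarrow> real" where
  "bary C c = (SOME l. (\<exists>k v. l = (\<lambda>x. k + v \<bullet> x)) \<and> (\<forall>z\<in>C. l z = (if z = c then 1 else 0)))"

lemma
  assumes "simplex_points C"
  shows bary_affine: "\<exists>k v. bary C c = (\<lambda>x. k + v \<bullet> x)"
    and bary_vertex: "z \<in> C \<Longrightarrow> bary C c z = (if z = c then 1 else 0)"
proof -
  have "\<exists>l. (\<exists>k v. l = (\<lambda>x. k + v \<bullet> x)) \<and> (\<forall>z\<in>C. l z = (if z = c then 1 else (0::real)))"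
    using affine_interpolation[of C "\<lambda>z. if z = c then 1 else 0"] assms unfolding simplex_points_def by blast
  from someI_ex[OF this] show "\<exists>k v. bary C c = (\<lambda>x. k + v \<bullet> x)"
    "z \<in> C \<Longrightarrow> bary C c z = (if z = c then 1 else 0)"
    unfolding bary_def by blast+
qed

lemma affine_fun_sum:
  assumes "(\<Sum>a\<in>A. \<beta> a) = 1"
  shows "k + v \<bullet> (\<Sum>a\<in>A. \<beta> a *\<^sub>R f a) = (\<Sum>a\<in>A. \<beta> a * (k + v \<bullet> f a))"
  by (simp add: inner_sum_right distrib_left sum.distrib sum_distrib_right[symmetric] assms)

lemma bary_sum:
  assumes "simplex_points C" "(\<Sum>a\<in>A. \<beta> a) = 1"
  shows "bary C c (\<Sum>a\<in>A. \<beta> a *\<^sub>R f a) = (\<Sum>a\<in>A. \<beta> a * bary C c (f a))"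
proof -
  obtain k v where "bary C c = (\<lambda>x. k + v \<bullet> x)" using bary_affine[OF assms(1)] by blast
  then show ?thesis using affine_fun_sum[OF assms(2)] by simp
qed

lemma bary_sum_vertices:
  assumes C: "simplex_points C" and "finite A" "A \<subseteq> C" "(\<Sum>a\<in>A. \<beta> a) = 1"
  shows "bary C c (\<Sum>a\<in>A. \<beta> a *\<^sub>R a) = (if c \<in> A then \<beta> c else 0)"
proof -
  have "bary C c (\<Sum>a\<in>A. \<beta> a *\<^sub>R a) = (\<Sum>a\<in>A. \<beta> a * bary C c a)"
    by (rule bary_sum[OF C assms(4)])
  also have "\<dots> = (\<Sum>a\<in>A. if a = c then \<beta> a else 0)"
    using assms(3) bary_vertex[OF C] by (intro sum.cong) auto
  finally show ?thesis using assms(2) by simp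
qed

lemma bary_partition:
  assumes C: "simplex_points C"
  shows "(\<Sum>c\<in>C. bary C c x *\<^sub>R c) = x" "(\<Sum>c\<in>C. bary C c x) = 1"
proof -
  have "x \<in> affine hull C" using simplex_points_hull[OF C] by simp
  then obtain u where u: "sum u C = 1" "(\<Sum>c\<in>C. u c *\<^sub>R c) = x"
    unfolding affine_hull_finite[OF simplex_points_finite[OF C]] by blast
  have "bary C c x = u c" if "c \<in> C" for c
    using bary_sum_vertices[OF C simplex_points_finite[OF C] subset_refl u(1), of c] u(2) that by simp
  then show "(\<Sum>c\<in>C. bary C c x *\<^sub>R c) = x" "(\<Sum>c\<in>C. bary C c x) = 1"
    using u by (auto cong: sum.cong)
qed

lemma convex_hull_bary:
  assumes C: "simplex_points C" and C0: "C0 \<subseteq> C"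
  shows "convex hull C0 = {x. (\<forall>c\<in>C. 0 \<le> bary C c x) \<and> (\<forall>c\<in>C - C0. bary C c x = 0)}"
proof safe
  have fin: "finite C0" using C0 simplex_points_finite[OF C] finite_subset by blast
  fix x assume "x \<in> convex hull C0"
  then obtain u where u: "\<And>c. c \<in> C0 \<Longrightarrow> 0 \<le> u c" "sum u C0 = 1" "(\<Sum>c\<in>C0. u c *\<^sub>R c) = x"
    unfolding convex_hull_finite[OF fin] by blast
  note * = bary_sum_vertices[OF C fin C0 u(2), unfolded u(3)]
  show "0 \<le> bary C c x" if "c \<in> C" for c using *[of c] u(1) by simp
  show "bary C c x = 0" if "c \<in> C" "c \<notin> C0" for c using *[of c] that by simp
next
  have fin: "finite C0" using C0 simplex_points_finite[OF C] finite_subset by blast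
  fix x assume x: "\<forall>c\<in>C. 0 \<le> bary C c x" "\<forall>c\<in>C - C0. bary C c x = 0"
  have "(\<Sum>c\<in>C0. bary C c x *\<^sub>R c) = (\<Sum>c\<in>C. bary C c x *\<^sub>R c)" "(\<Sum>c\<in>C0. bary C c x) = (\<Sum>c\<in>C. bary C c x)"
    using x(2) by (intro sum.mono_neutral_left simplex_points_finite[OF C] C0; simp)+
  then show "x \<in> convex hull C0"
    unfolding convex_hull_finite[OF fin] using bary_partition[OF C, of x] x(1) C0
    by (intro CollectI exI[of _ "\<lambda>c. bary C c x"]) auto
qed

lemma simplex_bary:
  assumes "simplex_points C" shows "x \<in> convex hull C \<longleftrightarrow> (\<forall>c\<in>C. 0 \<le> bary C c x)"
  using convex_hull_bary[OF assms subset_refl] by auto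

lemma bary_le_1:
  assumes C: "simplex_points C" and x: "x \<in> convex hull C" and c: "c \<in> C"
  shows "bary C c x \<le> 1"
proof -
  have "bary C c x \<le> (\<Sum>c\<in>C. bary C c x)"
    using simplex_bary[OF C] x c simplex_points_finite[OF C] by (intro member_le_sum) auto
  then show ?thesis using bary_partition(2)[OF C] by simp
qed

text \<open>On the simplex a coordinate stays between 0 and 1, yet across the inscribed ball it
  changes by 2 \<rho> times the length of its gradient. This bounds the gradient.\<close>

lemma bary_lipschitz:
  assumes C: "simplex_points C" and c: "c \<in> C" and z: "cball z \<rho> \<subseteq> convex hull C" and \<rho>: "0 \<le> \<rho>"
  shows "2 * \<rho> * \<bar>bary C c x - bary C c y\<bar> \<le> dist x y"
proof -
  obtain k v where kv: "bary C c = (\<lambda>x. k + v \<bullet> x)" using bary_affine[OF C] by blast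
  have "2 * \<rho> * norm v \<le> 1"
  proof (cases "v = 0")
    case False
    \<comment> \<open>w has length \<rho> and points along the gradient, so z + w and z - w are
      opposite points of the ball.\<close>
    define w where "w = (\<rho> / norm v) *\<^sub>R v"
    have "norm w = \<rho>" using False \<rho> by (simp add: w_def)
    then have "z + w \<in> convex hull C" "z - w \<in> convex hull C" using z by (auto simp: dist_norm subset_eq)
    then have "bary C c (z + w) \<le> 1" "0 \<le> bary C c (z - w)"
      using bary_le_1[OF C _ c] simplex_bary[OF C] c by auto
    moreover have "bary C c (z + w) - bary C c (z - w) = 2 * (v \<bullet> w)"
      by (simp add: kv inner_add_right inner_diff_right)
    moreover have "v \<bullet> w = \<rho> * norm v"
      using False by (simp add: w_def power2_norm_eq_inner[symmetric] power2_eq_square)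
    ultimately show ?thesis by simp
  qed simp
  then have "2 * \<rho> * norm v * dist x y \<le> 1 * dist x y" by (intro mult_right_mono) auto
  moreover have "\<bar>bary C c x - bary C c y\<bar> \<le> norm v * dist x y"
    using Cauchy_Schwarz_ineq2[of v "x - y"] by (simp add: kv inner_diff_right dist_norm)
  then have "2 * \<rho> * \<bar>bary C c x - bary C c y\<bar> \<le> 2 * \<rho> * (norm v * dist x y)"
    using \<rho> by (intro mult_left_mono) auto
  ultimately show ?thesis by (simp add: mult.assoc)
qed

text \<open>Along the edge the coordinate of c falls from 1 to 0.\<close>

lemma simplex_edge_ge:
  assumes C: "simplex_points C" and c: "c \<in> C" "c' \<in> C" "c \<noteq> c'" and z: "cball z \<rho> \<subseteq> convex hull C" and \<rho>: "0 \<le> \<rho>"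
  shows "2 * \<rho> \<le> dist c c'"
  using bary_lipschitz[OF C c(1) z \<rho>, of c c'] c bary_vertex[OF C, of c c] bary_vertex[OF C, of c' c] by simp

lemma simplex_diameter_pos:
  assumes C: "simplex_points C" shows "0 < diameter (convex hull C)"
proof -
  have "2 \<le> card C" using C zero_less_card_finite by (simp add: simplex_points_def Suc_le_eq)
  then obtain a b where ab: "a \<in> C" "b \<in> C" "a \<noteq> b"
    by (metis card_2_iff' card_le_Suc0_iff_eq not_less_eq_eq numeral_2_eq_2 simplex_points_finite[OF C])
  have "bounded (convex hull C)" using simplex_points_finite[OF C] by (simp add: bounded_convex_hull finite_imp_bounded)
  then have "dist a b \<le> diameter (convex hull C)"
    using ab by (intro diameter_bounded_bound) (auto intro: hull_inc)
  then show ?thesis using ab by (meson less_le_trans zero_less_dist_iff)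
qed

text \<open>Shape regularity without the supremum of \<open>inball_diameter\<close>: one concrete
  inscribed ball.\<close>

definition fat :: "real \<Rightarrow> (real^'n) set \<Rightarrow> bool" where
  "fat k T \<longleftrightarrow> (\<exists>z. cball z (diameter T / k) \<subseteq> T)"

text \<open>Of the factor 4, one 2 turns diameters into radii; the other makes the inequality below
  the supremum strict, so that some inscribed ball realises it. max \<kappa> 1 keeps the constant
  positive.\<close>

lemma shape_regular_fat:
  fixes T :: "(real^'n) set"
  assumes T: "int CARD('n) simplex T" and d: "diameter T \<le> \<kappa> * inball_diameter T"
  shows "fat (4 * max \<kappa> 1) T"
proof -
  obtain C where C: "simplex_points C" "T = convex hull C" using simplex_pointsE[OF T] .
  have h: "0 < diameter T" using simplex_diameter_pos[OF C(1)] C(2) by simp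
  have bT: "bounded T" using simplex_points_finite[OF C(1)] C(2) by (simp add: bounded_convex_hull finite_imp_bounded)
  let ?R = "{2 * r |r. 0 \<le> r \<and> (\<exists>z. cball z r \<subseteq> T)}"
  have "T \<noteq> {}" using h by auto
  then obtain z0 where "z0 \<in> T" by blast
  then have 0: "0 \<in> ?R" by (intro CollectI exI[of _ 0]) auto
  have bd: "bdd_above ?R"
  proof (rule bdd_aboveI)
    fix s assume "s \<in> ?R"
    then obtain r z where r: "s = 2 * r" "0 \<le> r" "cball z r \<subseteq> T" by blast
    have "diameter (cball z r) \<le> diameter T" by (rule diameter_subset[OF r(3) bT])
    then show "s \<le> diameter T" using r by simp
  qed
  define D where "D = Sup ?R"
  have D0: "0 \<le> D" unfolding D_def by (rule cSup_upper[OF 0 bd])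
  have dD: "diameter T \<le> \<kappa> * D" using d by (simp add: inball_diameter_def D_def)
  also have "\<dots> \<le> max \<kappa> 1 * D" using D0 by (intro mult_right_mono) auto
  finally have le: "diameter T \<le> max \<kappa> 1 * D" .
  then have "0 < max \<kappa> 1 * D" using h by linarith
  then have "diameter T < 2 * max \<kappa> 1 * D" using le by linarith
  then have "diameter T / (2 * max \<kappa> 1) < D" by (simp add: pos_divide_less_eq mult.commute)
  then have "diameter T / (2 * max \<kappa> 1) < Sup ?R" unfolding D_def .
  then obtain s where s: "s \<in> ?R" "diameter T / (2 * max \<kappa> 1) < s"
    using less_cSupD[of ?R] 0 by blast
  then obtain r z where r: "s = 2 * r" "cball z r \<subseteq> T" by blast
  have "diameter T / (4 * max \<kappa> 1) \<le> r" using s r by simp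
  then have "cball z (diameter T / (4 * max \<kappa> 1)) \<subseteq> T" using r(2) by (meson order_trans subset_cball)
  then show ?thesis by (auto simp: fat_def)
qed

text \<open>The coordinate of the vertex a opposite to the side vanishes on the side and is
  nonnegative on the simplex, so its normalised gradient points inwards. Conversely, an admissible
  \<nu> defines, up to a constant, an affine function that agrees at the vertices with a multiple of
  this coordinate.\<close>

lemma side_normal_simplex:
  assumes C: "simplex_points C" and a: "a \<in> C" and kv: "bary C a = (\<lambda>x. k + v \<bullet> x)"
  shows "v \<noteq> 0" "side_normal (convex hull (C - {a})) (convex hull C) = v /\<^sub>R norm v"
    "x \<in> convex hull (C - {a}) \<Longrightarrow> bary C a x = 0"
proof -
  have "2 \<le> card C" using C by (simp add: simplex_points_def Suc_le_eq)
  have "C - {a} \<noteq> {}"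
  proof
    assume "C - {a} = {}"
    then have "C = {a}" using a by blast
    then show False using \<open>2 \<le> card C\<close> by simp
  qed
  then obtain s where s: "s \<in> C" "s \<noteq> a" by blast
  have ba: "bary C a a = 1" "bary C a s = 0" using bary_vertex[OF C] a s by auto
  show v0: "v \<noteq> 0" using ba by (auto simp: kv)
  have S0: "bary C a x = 0" if "x \<in> convex hull (C - {a})" for x
    using that convex_hull_bary[OF C, of "C - {a}"] a by auto
  then show "x \<in> convex hull (C - {a}) \<Longrightarrow> bary C a x = 0" .
  have sS: "s \<in> convex hull (C - {a})" using s by (simp add: hull_inc)
  show "side_normal (convex hull (C - {a})) (convex hull C) = v /\<^sub>R norm v"
    unfolding side_normal_def
  proof (rule the_equality, intro conjI ballI)
    show "norm (v /\<^sub>R norm v) = 1" using v0 by simp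
    show "(v /\<^sub>R norm v) \<bullet> (y - x) = 0" if "x \<in> convex hull (C - {a})" "y \<in> convex hull (C - {a})" for x y
      using S0[OF that(1)] S0[OF that(2)] by (simp add: kv inner_diff_right)
    show "0 \<le> (v /\<^sub>R norm v) \<bullet> (y - x)" if "x \<in> convex hull (C - {a})" "y \<in> convex hull C" for x y
    proof -
      have "bary C a x = 0" "0 \<le> bary C a y" using S0[OF that(1)] simplex_bary[OF C, of y] that(2) a by auto
      then have "v \<bullet> x \<le> v \<bullet> y" by (simp add: kv)
      then show ?thesis by (simp add: inner_diff_right mult_left_mono)
    qed
  next
    fix \<nu> assume \<nu>: "norm \<nu> = 1 \<and> (\<forall>x\<in>convex hull (C - {a}). \<forall>y\<in>convex hull (C - {a}). \<nu> \<bullet> (y - x) = 0) \<and>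
      (\<forall>x\<in>convex hull (C - {a}). \<forall>y\<in>convex hull C. 0 \<le> \<nu> \<bullet> (y - x))"
    \<comment> \<open>The value of \<nu> on a vector from the side to a, along which the coordinate
      of a grows by 1; hence the factor between the two.\<close>
    define \<beta> where "\<beta> = \<nu> \<bullet> (a - s)"
    have \<beta>0: "0 \<le> \<beta>" using \<nu> sS a unfolding \<beta>_def by (meson hull_inc)
    have "- (\<nu> \<bullet> s) + \<nu> \<bullet> c = \<beta> * k + (\<beta> *\<^sub>R v) \<bullet> c" if "c \<in> C" for c
    proof (cases "c = a")
      case True
      then show ?thesis using ba(1) by (simp add: \<beta>_def kv inner_diff_right distrib_left[symmetric])
    next
      case False
      then have "c \<in> convex hull (C - {a})" using that by (simp add: hull_inc)
      then have "\<nu> \<bullet> (c - s) = 0" "bary C a c = 0" using \<nu> sS S0 by blast+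
      then show ?thesis by (simp add: kv inner_diff_right distrib_left[symmetric])
    qed
    from affine_fun_eqI(2)[OF C this] have \<nu>v: "\<nu> = \<beta> *\<^sub>R v" .
    then have "\<beta> * norm v = 1" using \<nu> \<beta>0 by simp
    then show "\<nu> = v /\<^sub>R norm v" using \<nu>v v0 by (simp add: field_simps)
  qed
qed

definition facet_center :: "(real^'n) set \<Rightarrow> real^'n \<Rightarrow> real^'n" where
  "facet_center C a = (\<Sum>c\<in>C - {a}. (1 / real CARD('n)) *\<^sub>R c)"

text \<open>At the centre the coordinates of the facet vertices all equal 1 / n; by
  \<open>bary_lipschitz\<close> they remain nonnegative within distance 2 \<rho> / n. So near the
  centre the coordinate of a alone decides membership.\<close>

lemma facet_center_ball:
  fixes C :: "(real^'n) set"
  assumes C: "simplex_points C" and a: "a \<in> C" and z: "cball z \<rho> \<subseteq> convex hull C"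
    and r: "real CARD('n) * r \<le> 2 * \<rho>" "0 < r" and x: "dist x (facet_center C a) \<le> r"
  shows "0 \<le> bary C a x \<Longrightarrow> x \<in> convex hull C" "bary C a x = 0 \<Longrightarrow> x \<in> convex hull (C - {a})"
    "bary C a (facet_center C a) = 0"
proof -
  let ?n = "real CARD('n)" and ?y = "facet_center C a"
  have n: "0 < ?n" by simp
  have \<rho>: "0 < \<rho>" using r n by (smt (verit) mult_pos_pos)
  have card: "card (C - {a}) = CARD('n)" using C a by (simp add: simplex_points_def simplex_points_finite[OF C])
  have sum1: "(\<Sum>c\<in>C - {a}. 1 / ?n) = 1" using card by simp
  have b: "bary C c ?y = (if c \<in> C - {a} then 1 / ?n else 0)" for c
    unfolding facet_center_def
    by (rule bary_sum_vertices[OF C _ _ sum1]) (use simplex_points_finite[OF C] in auto)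
  show "bary C a ?y = 0" using b[of a] by simp
  have pos: "0 \<le> bary C c x" if c: "c \<in> C" "c \<noteq> a" for c
  proof -
    have "2 * \<rho> * \<bar>bary C c x - bary C c ?y\<bar> \<le> r"
      using bary_lipschitz[OF C c(1) z, of x ?y] \<rho> x by simp
    then have "?n * (2 * \<rho> * \<bar>bary C c x - bary C c ?y\<bar>) \<le> 2 * \<rho>"
      using r n by (smt (verit) mult_left_mono)
    then have "?n * \<bar>bary C c x - bary C c ?y\<bar> \<le> 1"
      using \<rho> by (simp add: mult.left_commute[of ?n])
    then have "\<bar>bary C c x - 1 / ?n\<bar> \<le> 1 / ?n"
      using b[of c] c n by (simp add: field_simps)
    then show ?thesis by linarith
  qed
  show "x \<in> convex hull C" if "0 \<le> bary C a x"
    using pos that simplex_bary[OF C] by metis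
  show "x \<in> convex hull (C - {a})" if "bary C a x = 0"
    using pos that convex_hull_bary[OF C, of "C - {a}"] by (auto, metis order_refl)
qed

section \<open>Shape-regular meshes\<close>

text \<open>Taking k at least 2 makes the ratio 2 / k at most 1, so that its powers
  decrease.\<close>

locale fat_mesh =
  fixes \<Omega> :: "(real^'n) set" and \<T> :: "(real^'n) set set" and k :: real
  assumes dim: "2 \<le> CARD('n)"
    and open_\<Omega>: "open \<Omega>" and bounded_\<Omega>: "bounded \<Omega>" and lip_\<Omega>: "lipschitz_boundary \<Omega>"
    and mesh: "mesh \<Omega> \<T>" and fat: "\<And>T. T \<in> \<T> \<Longrightarrow> fat k T" and k: "2 \<le> k"
begin

lemma finite_mesh: "finite \<T>"
  using mesh by (simp add: mesh_def triangulation_def)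

lemma Union_mesh: "\<Union>\<T> = closure \<Omega>"
  using mesh by (simp add: mesh_def)

lemma element:
  assumes "T \<in> \<T>"
  shows "simplex_points (vertices T)" "T = convex hull (vertices T)"
proof -
  have "int CARD('n) simplex T" using mesh assms by (simp add: mesh_def)
  then obtain C where C: "simplex_points C" "T = convex hull C" by (rule simplex_pointsE)
  then show "simplex_points (vertices T)" "T = convex hull (vertices T)"
    using vertices_simplex[OF C(1)] by simp_all
qed

lemma element_topology:
  assumes "T \<in> \<T>"
  shows "compact T" "closed T" "convex T" "bounded T" "finite (vertices T)" "vertices T \<subseteq> T"
    "0 < diameter T"
proof -
  note E = element[OF assms]
  show fin: "finite (vertices T)" by (rule simplex_points_finite[OF E(1)])
  have "compact (convex hull (vertices T))" using fin by (rule finite_imp_compact_convex_hull)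
  then show "compact T" "closed T" "bounded T"
    using E(2) by (auto simp: compact_imp_closed compact_imp_bounded)
  show "convex T" by (subst E(2)) (rule convex_convex_hull)
  show "vertices T \<subseteq> T" by (subst (2) E(2)) (rule hull_subset)
  show "0 < diameter T" by (subst E(2)) (rule simplex_diameter_pos[OF E(1)])
qed

lemma element_ball:
  assumes "T \<in> \<T>"
  obtains z where "cball z (diameter T / k) \<subseteq> T"
  using fat[OF assms] by (auto simp: fat_def)

lemma inradius_pos: "T \<in> \<T> \<Longrightarrow> 0 < diameter T / k"
  using element_topology(7) k by simp

lemma interior_element_nonempty: "T \<in> \<T> \<Longrightarrow> interior T \<noteq> {}"
proof -
  assume T: "T \<in> \<T>"
  obtain z where "cball z (diameter T / k) \<subseteq> T" using element_ball[OF T] .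
  then have "ball z (diameter T / k) \<subseteq> interior T"
    using ball_subset_cball by (intro interior_maximal) auto
  then show ?thesis using inradius_pos[OF T] by (metis centre_in_ball empty_iff subset_empty)
qed

lemma interior_element_subset: "T \<in> \<T> \<Longrightarrow> interior T \<subseteq> \<Omega>"
  using interior_closure_lipschitz(1)[OF open_\<Omega> lip_\<Omega>] Union_mesh interior_mono[of T "closure \<Omega>"] by blast

lemma dist_le_diameter_element: "T \<in> \<T> \<Longrightarrow> x \<in> T \<Longrightarrow> y \<in> T \<Longrightarrow> dist x y \<le> diameter T"
  using diameter_bounded_bound[OF element_topology(4)] by blast

lemma diameter_element_le: "T \<in> \<T> \<Longrightarrow> diameter T \<le> diameter \<Omega>"
proof -
  assume "T \<in> \<T>"
  then have "diameter T \<le> diameter (closure \<Omega>)"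
    using Union_mesh by (intro diameter_subset bounded_closure bounded_\<Omega>) auto
  then show ?thesis by (simp add: diameter_closure[OF bounded_\<Omega>])
qed

lemma inter_face: "T \<in> \<T> \<Longrightarrow> T' \<in> \<T> \<Longrightarrow> (T \<inter> T') face_of T"
  using mesh by (simp add: mesh_def triangulation_def)

text \<open>The intersection is a face of T. A proper face misses the interior of T. If it is all of
  T, then T is a proper face of T' and misses the interior of T', which contains that of T.\<close>

lemma interior_disjoint:
  assumes T: "T \<in> \<T>" "T' \<in> \<T>" "T \<noteq> T'"
  shows "interior T \<inter> T' = {}"
proof (cases "T \<inter> T' = T")
  case True
  then have "T face_of T'" using inter_face[OF T(2,1)] by (simp add: Int_commute)
  then have "T \<inter> interior T' = {}" using T(3) by (rule face_of_disjoint_interior)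
  moreover have "interior T \<subseteq> interior T'" using True by (intro interior_mono) auto
  ultimately show ?thesis using interior_element_nonempty[OF T(1)] interior_subset by blast
next
  case False
  have "T \<inter> T' \<inter> interior T = {}" by (rule face_of_disjoint_interior[OF inter_face[OF T(1,2)] False])
  then show ?thesis using interior_subset by blast
qed

lemma vertex_transfer:
  assumes T: "T \<in> \<T>" "T' \<in> \<T>" and c: "c \<in> vertices T" "c \<in> T'"
  shows "c \<in> vertices T'"
proof -
  have "c extreme_point_of T" "c \<in> T" using c(1) by (auto simp: vertices_def extreme_point_of_def)
  then have "c extreme_point_of (T \<inter> T')" using c(2) by (auto simp: extreme_point_of_def)
  then have "{c} face_of (T' \<inter> T)" by (simp add: face_of_singleton Int_commute)
  then have "{c} face_of T'" using inter_face[OF T(2,1)] face_of_trans by blast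
  then show ?thesis by (simp add: vertices_def face_of_singleton)
qed

text \<open>The common face is the hull of some vertices of T, and its points have zero coordinates
  at all other vertices.\<close>

lemma pos_bary_transfer:
  assumes T: "T \<in> \<T>" "T' \<in> \<T>" and x: "x \<in> T" "x \<in> T'" and c: "c \<in> vertices T" "0 < bary (vertices T) c x"
  shows "c \<in> vertices T'"
proof -
  note E = element[OF T(1)]
  have "(T \<inter> T') face_of (convex hull (vertices T))" using inter_face[OF T] E(2) by simp
  then obtain C0 where C0: "C0 \<subseteq> vertices T" "T \<inter> T' = convex hull C0"
    using face_of_convex_hull_affine_independent E(1) unfolding simplex_points_def by blast
  have "x \<in> convex hull C0" using x C0 by blast
  then have "c \<in> C0" using convex_hull_bary[OF E(1) C0(1)] c by (auto, metis DiffI less_irrefl)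
  then have "c \<in> T'" using C0(2) hull_inc[of c C0] by blast
  then show ?thesis using vertex_transfer[OF T c(1)] by blast
qed

lemma shared_edge_diameter:
  assumes T: "T \<in> \<T>" "T' \<in> \<T>" and c: "c \<in> vertices T" "c' \<in> vertices T" "c \<noteq> c'" "c \<in> T'" "c' \<in> T'"
  shows "2 / k * diameter T \<le> diameter T'"
proof -
  obtain z where z: "cball z (diameter T / k) \<subseteq> T" using element_ball[OF T(1)] .
  have "cball z (diameter T / k) \<subseteq> convex hull (vertices T)" using z element(2)[OF T(1)] by metis
  from simplex_edge_ge[OF element(1)[OF T(1)] c(1-3) this]
  have "2 * (diameter T / k) \<le> dist c c'" using inradius_pos[OF T(1)] by simp
  also have "\<dots> \<le> diameter T'" by (rule dist_le_diameter_element[OF T(2) c(4,5)])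
  finally show ?thesis by simp
qed

text \<open>Shrink the elements at a towards a until all have the size \<delta> of the smallest one.
  Their inscribed balls then have radius \<delta> / k, are disjoint and lie in the ball of radius
  \<delta> about a; compare volumes.\<close>

lemma card_elements_at_point: "real (card {T\<in>\<T>. a \<in> T}) \<le> k ^ CARD('n)"
proof (cases "{T\<in>\<T>. a \<in> T} = {}")
  case False
  let ?G = "{T\<in>\<T>. a \<in> T}"
  have fin: "finite ?G" using finite_mesh by simp
  define \<delta> where "\<delta> = Min (diameter ` ?G)"
  have \<delta>_le: "\<delta> \<le> diameter T" if "T \<in> ?G" for T using that fin by (simp add: \<delta>_def)
  have "\<delta> \<in> diameter ` ?G" unfolding \<delta>_def using fin False by (intro Min_in) auto
  then have \<delta>: "0 < \<delta>" using element_topology(7) by auto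
  have "\<forall>T\<in>?G. \<exists>z. cball z (diameter T / k) \<subseteq> T" using fat by (auto simp: fat_def)
  then obtain z where z: "\<And>T. T \<in> ?G \<Longrightarrow> cball (z T) (diameter T / k) \<subseteq> T" by metis
  \<comment> \<open>The inscribed ball of T after shrinking towards a by the factor \<delta> /
    diameter T.\<close>
  define B where "B T = ball (a + (\<delta> / diameter T) *\<^sub>R (z T - a)) (\<delta> / k)" for T
  have B: "x \<in> T \<and> dist a x \<le> \<delta>" if T: "T \<in> ?G" and x: "x \<in> B T" for T x
  proof -
    let ?h = "diameter T"
    have h: "0 < ?h" using T element_topology(7) by auto
    define y where "y = a + (?h / \<delta>) *\<^sub>R (x - a)"
    have "(?h / \<delta>) *\<^sub>R (x - (a + (\<delta> / ?h) *\<^sub>R (z T - a))) =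
        (?h / \<delta>) *\<^sub>R (x - a) - (?h / \<delta> * (\<delta> / ?h)) *\<^sub>R (z T - a)"
      unfolding scaleR_scaleR[symmetric] scaleR_diff_right[symmetric] by (simp add: diff_diff_eq)
    then have "y - z T = (?h / \<delta>) *\<^sub>R (x - (a + (\<delta> / ?h) *\<^sub>R (z T - a)))"
      using \<delta> h by (simp add: y_def)
    then have "dist (z T) y = ?h / \<delta> * dist (a + (\<delta> / ?h) *\<^sub>R (z T - a)) x"
      using \<delta> h by (simp add: dist_norm norm_minus_commute)
    also have "\<dots> \<le> ?h / \<delta> * (\<delta> / k)"
      using x \<delta> h by (intro mult_left_mono) (auto simp: B_def)
    finally have y: "y \<in> T" using z[OF T] \<delta> by auto
    have xe: "x = (1 - \<delta> / ?h) *\<^sub>R a + (\<delta> / ?h) *\<^sub>R y"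
      using \<delta> h by (simp add: y_def algebra_simps)
    have "convex T" using T element_topology(3) by blast
    then have "x \<in> T"
      unfolding xe using T y \<delta> h \<delta>_le[OF T] by (intro convexD) auto
    moreover have "dist a x = \<delta> / ?h * dist a y"
    proof -
      have "x - a = (\<delta> / ?h) *\<^sub>R (y - a)" using \<delta> h by (simp add: y_def)
      then have "norm (x - a) = \<delta> / ?h * norm (y - a)" using \<delta> h by simp
      then show ?thesis by (simp add: dist_norm norm_minus_commute)
    qed
    moreover have "dist a y \<le> ?h" using T y by (intro dist_le_diameter_element) auto
    then have "\<delta> / ?h * dist a y \<le> \<delta> / ?h * ?h" using \<delta> h by (intro mult_left_mono) auto
    ultimately show ?thesis using h by simp
  qed
  have Bint: "B T \<subseteq> interior T" if "T \<in> ?G" for T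
    using B[OF that] by (intro interior_maximal) (auto simp: B_def)
  have disj: "disjoint_family_on B ?G"
    unfolding disjoint_family_on_def
  proof (intro ballI impI)
    fix T T' assume T: "T \<in> ?G" "T' \<in> ?G" "T \<noteq> T'"
    then have "interior T \<inter> T' = {}" by (intro interior_disjoint) auto
    then show "B T \<inter> B T' = {}" using Bint[OF T(1)] Bint[OF T(2)] interior_subset[of T'] by blast
  qed
  have "(\<Sum>T\<in>?G. measure lborel (B T)) = measure lborel (\<Union>T\<in>?G. B T)"
    by (rule measure_finite_Union[symmetric, OF fin _ disj]) (auto simp: B_def, metis bounded_ball emeasure_bounded_finite infinity_ennreal_def less_irrefl)
  also have "\<dots> \<le> measure lborel (cball a \<delta>)"
  proof (rule measure_mono_fmeasurable)
    show "cball a \<delta> \<in> fmeasurable lborel"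
      using emeasure_bounded_finite[OF bounded_cball] by (intro fmeasurableI) auto
  qed (use B fin in \<open>auto simp: B_def\<close>)
  also have "\<dots> = unit_ball_vol (real CARD('n)) * \<delta> ^ CARD('n)" using \<delta> by (simp add: content_cball)
  also have "(\<Sum>T\<in>?G. measure lborel (B T)) = real (card ?G) * (unit_ball_vol (real CARD('n)) * (\<delta> / k) ^ CARD('n))"
    using \<delta> k by (simp add: B_def content_ball)
  finally have "unit_ball_vol (real CARD('n)) * (real (card ?G) * (\<delta> / k) ^ CARD('n)) \<le> unit_ball_vol (real CARD('n)) * \<delta> ^ CARD('n)"
    by (simp add: mult_ac)
  then have "real (card ?G) * (\<delta> / k) ^ CARD('n) \<le> \<delta> ^ CARD('n)"
    using unit_ball_vol_pos[of "real CARD('n)"] by simp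
  then show ?thesis using \<delta> k by (simp add: power_divide field_simps)
next
  case True
  then show ?thesis using k by (simp only: True) simp
qed

text \<open>The elements at an interior vertex \<open>a\<close> fill a punctured ball, which is connected. So they
  cannot be split into two classes meeting only in \<open>a\<close>, and any two of them are linked by a chain
  of elements sharing edges.\<close>

lemma elements_at_vertex_linked:
  assumes a: "a \<in> \<Omega>" and A: "A \<subseteq> {T\<in>\<T>. a \<in> T}" "A \<noteq> {}" "A \<noteq> {T\<in>\<T>. a \<in> T}"
  shows "\<exists>T\<in>A. \<exists>T'\<in>{T\<in>\<T>. a \<in> T} - A. T \<inter> T' \<noteq> {a}"
proof (rule ccontr)
  assume neg: "\<not> ?thesis"
  let ?G = "{T\<in>\<T>. a \<in> T}"
  define U where "U = \<Union>A"
  define V where "V = \<Union>(?G - A)"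
  \<comment> \<open>The elements away from a form a closed set, so some ball about a meets only
    elements that contain a.\<close>
  define W where "W = \<Union>(\<T> - ?G)"
  have fin: "finite A" "finite (?G - A)" "finite (\<T> - ?G)"
    using finite_mesh finite_subset[OF A(1)] by auto
  have cl: "closed U" "closed V" "closed W"
    unfolding U_def V_def W_def using fin A(1) element_topology(2) by (auto intro!: closed_Union)
  have UV: "U \<inter> V \<subseteq> {a}" unfolding U_def V_def using neg A(1) by blast
  have "a \<in> \<Omega> \<inter> - W" using a by (auto simp: W_def)
  moreover have "open (\<Omega> \<inter> - W)" using cl open_\<Omega> by auto
  ultimately obtain r where r: "0 < r" "ball a r \<subseteq> \<Omega> \<inter> - W" by (meson open_contains_ball)
  have cover: "ball a r \<subseteq> U \<union> V"
  proof
    fix x assume x: "x \<in> ball a r"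
    then have "x \<in> \<Omega>" "x \<notin> W" using r(2) by auto
    then have "x \<in> \<Union>\<T>" "x \<notin> W" using Union_mesh closure_subset by auto
    then show "x \<in> U \<union> V" unfolding U_def V_def W_def by blast
  qed
  have meets: "\<exists>x\<in>T. x \<in> ball a r - {a}" if T: "T \<in> ?G" for T
  proof -
    have "\<exists>y\<in>T. y \<noteq> a"
    proof (rule ccontr)
      assume "\<not> ?thesis"
      then have "T = {a}" using T by blast
      then show False using T element_topology(7)[of T] by simp
    qed
    then obtain y where y: "y \<in> T" "y \<noteq> a" by blast
    define s where "s = min 1 (r / (2 * dist a y))"
    have s: "0 < s" "s \<le> 1" "s * dist a y < r"
      using r y by (auto simp: s_def min_def field_simps)
    have cT: "convex T" using T element_topology(3) by blast
    have "(1 - s) *\<^sub>R a + s *\<^sub>R y \<in> T" using s T y by (intro convexD[OF cT]) auto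
    moreover have "(1 - s) *\<^sub>R a + s *\<^sub>R y - a = s *\<^sub>R (y - a)" by (simp add: algebra_simps)
    then have "norm ((1 - s) *\<^sub>R a + s *\<^sub>R y - a) = s * dist a y" using s by (simp add: dist_norm norm_minus_commute)
    then have "(1 - s) *\<^sub>R a + s *\<^sub>R y \<in> ball a r - {a}"
      using s y by (auto simp: dist_norm norm_minus_commute)
    ultimately show ?thesis by blast
  qed
  have conn: "connected (ball a r - {a})"
    using dim by (intro connected_punctured_ball) simp
  obtain T where "T \<in> A" using A(2) by blast
  then have Une: "U \<inter> (ball a r - {a}) \<noteq> {}" using meets[of T] A(1) unfolding U_def by blast
  obtain T' where "T' \<in> ?G - A" using A by blast
  then have Vne: "V \<inter> (ball a r - {a}) \<noteq> {}" using meets[of T'] unfolding V_def by blast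
  show False
    using conn cl(1,2) UV cover Une Vne unfolding connected_closed by blast
qed

text \<open>A common point other than a has a positive coordinate at some other vertex c, and
  \<open>pos_bary_transfer\<close> moves c to T'.\<close>

lemma face_second_vertex:
  assumes T: "T \<in> \<T>" "T' \<in> \<T>" and a: "a \<in> T" "a \<in> T'" "a \<in> vertices T" and ne: "T \<inter> T' \<noteq> {a}"
  shows "\<exists>c\<in>vertices T. c \<noteq> a \<and> c \<in> T'"
proof -
  note E = element[OF T(1)]
  obtain x where x: "x \<in> T" "x \<in> T'" "x \<noteq> a" using ne a by blast
  have "\<exists>c\<in>vertices T. c \<noteq> a \<and> 0 < bary (vertices T) c x"
  proof (rule ccontr)
    assume "\<not> ?thesis"
    then have "bary (vertices T) c x = 0" if "c \<in> vertices T" "c \<noteq> a" for c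
      using simplex_bary[OF E(1), of x] x(1) E(2) that by force
    then have "x \<in> convex hull {a}"
      using a(3) x(1) simplex_bary[OF E(1), of x] E(2) by (subst convex_hull_bary[OF E(1)]) auto
    then show False using x(3) by simp
  qed
  then obtain c where c: "c \<in> vertices T" "c \<noteq> a" "0 < bary (vertices T) c x" by blast
  then have "c \<in> vertices T'" using pos_bary_transfer[OF T x(1,2)] by blast
  then show ?thesis using c element_topology(6)[OF T(2)] by blast
qed

text \<open>Elements that share an edge have comparable diameters, with ratio q = 2 / k. The sets A
  j of elements at a of diameter at least q^j times that of T grow with j by
  \<open>elements_at_vertex_linked\<close> until they exhaust the at most N elements at a, so N
  steps suffice.\<close>

lemma vertex_diameter:
  assumes a: "a \<in> \<Omega>" "a \<in> vertices T" and T: "T \<in> \<T>" "T' \<in> \<T>" and aT': "a \<in> T'"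
    and N: "card {T\<in>\<T>. a \<in> T} \<le> N"
  shows "(2 / k) ^ N * diameter T \<le> diameter T'"
proof -
  let ?G = "{T\<in>\<T>. a \<in> T}"
  define q where "q = 2 / k"
  have q: "0 < q" "q \<le> 1" using k by (auto simp: q_def)
  define A where "A j = {T'\<in>?G. q ^ j * diameter T \<le> diameter T'}" for j
  have aT: "a \<in> T" using a(2) element_topology(6)[OF T(1)] by blast
  have hT: "0 < diameter T" by (rule element_topology(7)[OF T(1)])
  have mono: "q ^ Suc j * diameter T \<le> q ^ j * diameter T" for j
    using q hT by (intro mult_right_mono) (auto intro: power_decreasing mult_left_le_one_le)
  have fin: "finite ?G" using finite_mesh by simp
  have finA: "finite (A j)" for j by (rule finite_subset[OF _ fin]) (auto simp: A_def)
  have TA: "T \<in> A j" for j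
    using T aT hT q power_le_one[of q j] by (simp add: A_def mult_left_le_one_le)
  have "A j = ?G \<or> Suc j \<le> card (A j)" for j
  proof (induction j)
    case 0
    then show ?case using TA[of 0] finA by (metis Suc_leI card_gt_0_iff empty_iff)
  next
    case (Suc j)
    have sub: "A j \<subseteq> A (Suc j)" unfolding A_def using mono[of j] by fastforce
    show ?case
    proof (cases "A j = ?G")
      case True
      then have "A (Suc j) = ?G" using sub by (auto simp: A_def)
      then show ?thesis by blast
    next
      case False
      have "A j \<subseteq> ?G" "A j \<noteq> {}" using TA by (auto simp: A_def)
      from elements_at_vertex_linked[OF a(1) this False]
      obtain S S' where S: "S \<in> A j" "S' \<in> ?G - A j" "S \<inter> S' \<noteq> {a}" by blast
      have mem: "S \<in> \<T>" "S' \<in> \<T>" "a \<in> S" "a \<in> S'" using S by (auto simp: A_def)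
      have aS: "a \<in> vertices S" by (rule vertex_transfer[OF T(1) mem(1) a(2) mem(3)])
      obtain c where c: "c \<in> vertices S" "c \<noteq> a" "c \<in> S'"
        using face_second_vertex[OF mem aS S(3)] by blast
      have "q * diameter S \<le> diameter S'"
        unfolding q_def by (rule shared_edge_diameter[OF mem(1,2) c(1) aS c(2,3) mem(4)])
      moreover have "q * (q ^ j * diameter T) \<le> q * diameter S"
        using S(1) q by (intro mult_left_mono) (auto simp: A_def)
      ultimately have "S' \<in> A (Suc j)" using S(2) by (simp add: A_def mult.assoc)
      then have "A j \<subset> A (Suc j)" using sub S(2) by blast
      then have "card (A j) < card (A (Suc j))" using finA psubset_card_mono by blast
      then show ?thesis using Suc False by simp
    qed
  qed
  moreover have "card (A N) \<le> card ?G" by (rule card_mono[OF fin]) (auto simp: A_def)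
  then have "card (A N) \<le> N" using N by simp
  ultimately have "A N = ?G" by (metis not_less_eq_eq)
  then have "T' \<in> A N" using T aT' by blast
  then show ?thesis by (simp add: A_def q_def)
qed

text \<open>Inside the ball, the elements that contain b and those that do not form two closed sets
  covering it. By \<open>far\<close> they are disjoint there, and the ball is connected.\<close>

lemma elements_near_point:
  assumes r: "ball b r \<subseteq> \<Omega>" and b: "b \<in> \<Omega>"
    and far: "\<And>T T' y. T \<in> \<T> \<Longrightarrow> b \<in> T \<Longrightarrow> T' \<in> \<T> \<Longrightarrow> b \<notin> T' \<Longrightarrow> y \<in> T \<Longrightarrow> y \<in> T' \<Longrightarrow> r \<le> dist b y"
    and T: "T \<in> \<T>" "x \<in> T" "x \<in> ball b r"
  shows "b \<in> T"
proof -
  have r0: "0 < r" using T(3) by (metis dist_not_less_zero less_le_trans mem_ball not_le)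
  define U where "U = \<Union>{T\<in>\<T>. b \<in> T}"
  define V where "V = \<Union>{T\<in>\<T>. b \<notin> T}"
  have cl: "closed U" "closed V"
    unfolding U_def V_def using finite_mesh element_topology(2) by (auto intro!: closed_Union)
  have cov: "ball b r \<subseteq> U \<union> V" using r Union_mesh closure_subset unfolding U_def V_def by blast
  have disj: "U \<inter> V \<inter> ball b r = {}"
  proof (rule ccontr)
    assume "U \<inter> V \<inter> ball b r \<noteq> {}"
    then obtain y T1 T2 where "y \<in> ball b r" "T1 \<in> \<T>" "b \<in> T1" "T2 \<in> \<T>" "b \<notin> T2" "y \<in> T1" "y \<in> T2"
      unfolding U_def V_def by blast
    then show False using far[of T1 T2 y] by simp
  qed
  have "b \<in> \<Union>\<T>" using b Union_mesh closure_subset by blast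
  then have "b \<in> U \<inter> ball b r" using r0 unfolding U_def by auto
  moreover have "connected (ball b r)" by (rule connected_ball)
  ultimately have V0: "V \<inter> ball b r = {}"
    using cl cov disj unfolding connected_closed by blast
  show ?thesis
  proof (rule ccontr)
    assume "b \<notin> T"
    then have "x \<in> V \<inter> ball b r" using T unfolding V_def by blast
    then show False using V0 by blast
  qed
qed

end

text \<open>Dropping the small barycentric coordinates of \<open>x\<^sub>0\<close> gives a nearby point \<open>b\<close> of a face all of
  whose coordinates are bounded below. The thresholds form a geometric sequence; by the pigeonhole
  principle one gap of this sequence contains no coordinate.\<close>

lemma geometric_gap:
  fixes l :: "'a \<Rightarrow> real" and \<eta> \<tau> :: real
  assumes fin: "finite C" and \<eta>: "0 < \<eta>" "\<eta> \<le> 1" and \<tau>: "0 < \<tau>"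
  shows "\<exists>j\<le>card C. \<forall>c\<in>C. l c \<le> \<tau> * \<eta> ^ Suc j \<or> \<tau> * \<eta> ^ j < l c"
proof (rule ccontr)
  assume "\<not> ?thesis"
  then have "\<forall>j\<in>{..card C}. \<not> (\<forall>c\<in>C. l c \<le> \<tau> * \<eta> ^ Suc j \<or> \<tau> * \<eta> ^ j < l c)"
    by blast
  then have "\<forall>j\<in>{..card C}. \<exists>c\<in>C. \<tau> * \<eta> ^ Suc j < l c \<and> l c \<le> \<tau> * \<eta> ^ j"
    unfolding ball_simps de_Morgan_disj not_le not_less .
  then obtain f where f: "\<And>j. j \<le> card C \<Longrightarrow> f j \<in> C \<and> \<tau> * \<eta> ^ Suc j < l (f j) \<and> l (f j) \<le> \<tau> * \<eta> ^ j"
    by (metis atMost_iff)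
  \<comment> \<open>The gaps are disjoint intervals, so different gaps contain coordinates of
    different vertices. There are card C + 1 gaps, one more than vertices.\<close>
  have lt: "f i \<noteq> f j" if "i < j" "j \<le> card C" for i j
  proof -
    have "\<eta> ^ j \<le> \<eta> ^ Suc i" using that \<eta> by (intro power_decreasing) auto
    then have "\<tau> * \<eta> ^ j \<le> \<tau> * \<eta> ^ Suc i" using \<tau> by simp
    then show ?thesis using f[of i] f[of j] that by fastforce
  qed
  have "inj_on f {..card C}"
    by (rule inj_onI) (metis lt atMost_iff linorder_neqE_nat)
  then have "card {..card C} \<le> card C" using f fin by (intro card_inj_on_le) auto
  then show False by simp
qed

section \<open>The point b near x0, and facets shared by two elements\<close>

context fat_mesh
begin

text \<open>\<theta> prescribes how close b must be to x0 relative to r. N bounds the number of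
  elements at a vertex and enters c6 through \<open>vertex_diameter\<close>; \<eta> is the ratio of
  consecutive thresholds, and \<tau> keeps the ball inside \<Omega>. None of these constants depends
  on the mesh beyond k.\<close>

lemma point_location:
  assumes x0: "x0 \<in> T" "T \<in> \<T>" and \<delta>: "0 < \<delta>" "ball x0 \<delta> \<subseteq> \<Omega>" "\<delta> \<le> D" "diameter \<Omega> \<le> D"
    and \<theta>: "0 < \<theta>" "\<theta> \<le> 1"
    and N: "N = nat \<lceil>k ^ CARD('n)\<rceil>" and m: "m = CARD('n) + 1"
    and c6: "c6 = (2 / k) ^ Suc (Suc N)" and \<eta>: "\<eta> = \<theta> * c6 / real m" and \<tau>: "\<tau> = \<delta> / (2 * D)"
  obtains b r where "b \<in> T" "c6 * (\<tau> * \<eta> ^ m) * diameter T \<le> r" "r \<le> diameter T" "0 < r" "ball b r \<subseteq> \<Omega>"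
    "dist x0 b \<le> \<theta> * r" "\<And>T' x. T' \<in> \<T> \<Longrightarrow> x \<in> T' \<Longrightarrow> x \<in> ball b r \<Longrightarrow> b \<in> T'"
proof -
  let ?h = "diameter T" and ?C = "vertices T"
  note E = element[OF x0(2)] and ET = element_topology[OF x0(2)]
  have C: "simplex_points ?C" by (rule E(1))
  have card: "card ?C = m" using C by (simp add: simplex_points_def m)
  have q: "0 < 2 / k" "2 / k \<le> 1" using k by auto
  have c6p: "0 < c6" "c6 \<le> 1" unfolding c6
    by (rule zero_less_power[OF q(1)], rule power_le_one[OF less_imp_le[OF q(1)] q(2)])
  have m1: "1 \<le> m" "0 < real m" by (simp_all add: m)
  have \<eta>p: "0 < \<eta>" using \<theta> c6p m1 by (simp add: \<eta>)
  have "\<theta> * c6 \<le> 1" using mult_mono[of \<theta> 1 c6 1] \<theta> c6p by simp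
  then have m\<eta>: "real m * \<eta> \<le> 1" using m1 by (simp add: \<eta>)
  have "1 * \<eta> \<le> real m * \<eta>" using m1 \<eta>p by (intro mult_right_mono) auto
  then have \<eta>1: "\<eta> \<le> 1" using m\<eta> by simp
  have D: "0 < D" using \<delta> by simp
  have \<tau>p: "0 < \<tau>" "\<tau> \<le> 1/2" using \<delta> D by (auto simp: \<tau> field_simps)
  have hD: "?h \<le> D" using diameter_element_le[OF x0(2)] \<delta>(4) by simp
  obtain j where j: "j \<le> m" "\<And>c. c \<in> ?C \<Longrightarrow> bary ?C c x0 \<le> \<tau> * \<eta> ^ Suc j \<or> \<tau> * \<eta> ^ j < bary ?C c x0"
    using geometric_gap[OF ET(5) \<eta>p \<eta>1 \<tau>p(1), of "\<lambda>c. bary ?C c x0"] card by blast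
  \<comment> \<open>Every coordinate of x0 is either larger than t or at most t \<eta>. The vertices
    of the first kind, collected in A, span the face that will carry b.\<close>
  define t where "t = \<tau> * \<eta> ^ j"
  have t: "0 < t" "t \<le> \<tau>" "\<tau> * \<eta> ^ m \<le> t"
    using \<tau>p \<eta>p \<eta>1 j(1) by (auto simp: t_def mult_left_le power_le_one intro: power_decreasing)
  have jt: "bary ?C c x0 \<le> t * \<eta> \<or> t < bary ?C c x0" if "c \<in> ?C" for c
    using j(2)[OF that] by (simp add: t_def ac_simps)
  define A where "A = {c\<in>?C. t < bary ?C c x0}"
  let ?l = "\<lambda>c. bary ?C c x0"
  have A: "A \<subseteq> ?C" "finite A" using ET(5) by (auto simp: A_def)
  have l0: "0 \<le> ?l c" if "c \<in> ?C" for c using simplex_bary[OF C, of x0] x0(1) E(2) that by auto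
  have small: "?l c \<le> t * \<eta>" if "c \<in> ?C - A" for c using jt[of c] that by (auto simp: A_def)
  define s where "s = (\<Sum>c\<in>A. ?l c)"
  have split: "s + (\<Sum>c\<in>?C - A. ?l c) = 1"
    using sum.subset_diff[OF A(1) ET(5), of ?l] bary_partition(2)[OF C, of x0] by (simp add: s_def)
  have rest: "(\<Sum>c\<in>?C - A. ?l c) \<le> real m * (t * \<eta>)"
  proof -
    have "(\<Sum>c\<in>?C - A. ?l c) \<le> (\<Sum>c\<in>?C - A. t * \<eta>)" by (intro sum_mono small)
    also have "\<dots> = real (card (?C - A)) * (t * \<eta>)" by simp
    also have "\<dots> \<le> real m * (t * \<eta>)"
      using card card_mono[OF ET(5), of "?C - A"] t \<eta>p by (intro mult_right_mono) auto
    finally show ?thesis .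
  qed
  have rest0: "0 \<le> (\<Sum>c\<in>?C - A. ?l c)" using l0 by (intro sum_nonneg) auto
  have "real m * \<eta> * t \<le> 1 * t" using m\<eta> t by (intro mult_right_mono) auto
  moreover have "real m * (t * \<eta>) = real m * \<eta> * t" by simp
  ultimately have "real m * (t * \<eta>) \<le> 1/2" using t \<tau>p by linarith
  then have s: "1/2 \<le> s" "s \<le> 1" using split rest rest0 by auto
  \<comment> \<open>b arises from x0 by dropping the small coordinates and renormalising. The sum s
    of the kept ones lies between 1/2 and 1, so division by s does not lower them.\<close>
  define \<beta> where "\<beta> c = ?l c / s" for c
  define b where "b = (\<Sum>c\<in>A. \<beta> c *\<^sub>R c)"
  have \<beta>1: "(\<Sum>c\<in>A. \<beta> c) = 1" using s by (simp add: \<beta>_def sum_divide_distrib[symmetric] s_def[symmetric])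
  have \<beta>t: "t \<le> \<beta> c" if "c \<in> A" for c
  proof -
    have "t < ?l c" "c \<in> ?C" using that by (auto simp: A_def)
    moreover have "?l c \<le> \<beta> c" using s l0[OF \<open>c \<in> ?C\<close>] by (simp add: \<beta>_def le_divide_eq mult_left_le)
    ultimately show ?thesis by simp
  qed
  have bA: "b \<in> convex hull A"
    unfolding convex_hull_finite[OF A(2)] b_def using \<beta>1 \<beta>t t by (intro CollectI exI[of _ \<beta>]) (auto intro: order_trans[OF less_imp_le])
  have bT: "b \<in> T" using bA hull_mono[OF A(1), of convex] E(2) by blast
  \<comment> \<open>x0 - b is the combination of the vectors c - b over the dropped vertices c, with
    their small coordinates as factors.\<close>
  have dist_xb: "dist x0 b \<le> real m * (t * \<eta>) * ?h"
  proof -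
    have sb: "s *\<^sub>R b = (\<Sum>c\<in>A. ?l c *\<^sub>R c)"
      using s by (simp add: b_def scaleR_sum_right \<beta>_def)
    have e1: "x0 = s *\<^sub>R b + (\<Sum>c\<in>?C - A. ?l c *\<^sub>R c)"
      unfolding sb using sum.subset_diff[OF A(1) ET(5), of "\<lambda>c. ?l c *\<^sub>R c"] bary_partition(1)[OF C, of x0]
      by (simp add: add.commute)
    have e2: "b = s *\<^sub>R b + (\<Sum>c\<in>?C - A. ?l c) *\<^sub>R b"
      unfolding scaleR_left_distrib[symmetric] split by simp
    have "x0 - b = (s *\<^sub>R b + (\<Sum>c\<in>?C - A. ?l c *\<^sub>R c)) - (s *\<^sub>R b + (\<Sum>c\<in>?C - A. ?l c) *\<^sub>R b)"
      by (rule arg_cong2[OF e1 e2])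
    also have "\<dots> = (\<Sum>c\<in>?C - A. ?l c *\<^sub>R c) - (\<Sum>c\<in>?C - A. ?l c) *\<^sub>R b"
      by (rule add_diff_cancel_left)
    also have "\<dots> = (\<Sum>c\<in>?C - A. ?l c *\<^sub>R (c - b))"
      by (simp add: scaleR_sum_left sum_subtractf scaleR_diff_right)
    finally have "dist x0 b = norm (\<Sum>c\<in>?C - A. ?l c *\<^sub>R (c - b))" by (simp add: dist_norm)
    also have "\<dots> \<le> (\<Sum>c\<in>?C - A. ?l c * ?h)"
    proof (rule sum_norm_le)
      fix c assume c: "c \<in> ?C - A"
      then have "dist c b \<le> ?h" using ET(6) bT by (intro dist_le_diameter_element[OF x0(2)]) auto
      then show "norm (?l c *\<^sub>R (c - b)) \<le> ?l c * ?h" using l0[of c] c by (simp add: dist_norm mult_left_mono)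
    qed
    also have "\<dots> = (\<Sum>c\<in>?C - A. ?l c) * ?h" by (simp add: sum_distrib_right)
    also have "\<dots> \<le> real m * (t * \<eta>) * ?h" using rest ET(7) by (intro mult_right_mono) auto
    finally show ?thesis .
  qed
  \<comment> \<open>With this radius m t \<eta> h equals \<theta> r, by the choice of \<eta>, and 2
    r is at most \<delta>, by the choice of \<tau>.\<close>
  define r where "r = c6 * t * ?h"
  have r: "0 < r" using c6p t ET(7) by (simp add: r_def)
  have "real m * (t * \<eta>) * ?h = \<theta> * r" using m1 by (simp add: \<eta> r_def)
  then have d\<theta>: "dist x0 b \<le> \<theta> * r" using dist_xb by simp
  moreover have "\<theta> * r \<le> 1 * r" using \<theta> r by (intro mult_right_mono) auto
  ultimately have dr: "dist x0 b \<le> r" by linarith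
  have "c6 * t \<le> 1 * \<tau>" using c6p t by (intro mult_mono) auto
  then have "c6 * t * ?h \<le> \<tau> * D" using hD ET(7) \<tau>p by (intro mult_mono) auto
  then have r\<delta>: "2 * r \<le> \<delta>" using D by (simp add: \<tau> r_def)
  have ball: "ball b r \<subseteq> \<Omega>"
  proof
    fix x assume "x \<in> ball b r"
    then have "dist x0 x < \<delta>" using dist_triangle[of x0 x b] dr r\<delta> by simp
    then show "x \<in> \<Omega>" using \<delta>(2) by auto
  qed
  have b\<Omega>: "b \<in> \<Omega>" using ball r by auto
  have "A \<noteq> {}" using \<beta>1 by auto
  have cardN: "card {T\<in>\<T>. a \<in> T} \<le> N" for a
    using card_elements_at_point[of a] unfolding N by linarith
  have AT': "A \<subseteq> vertices T'" if T': "T' \<in> \<T>" "b \<in> T'" for T'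
  proof
    fix c assume c: "c \<in> A"
    have "bary ?C c b = \<beta> c" unfolding b_def using bary_sum_vertices[OF C A(2,1) \<beta>1, of c] c by simp
    then have "0 < bary ?C c b" using \<beta>t[OF c] t by simp
    then show "c \<in> vertices T'" using pos_bary_transfer[OF x0(2) T'(1) bT T'(2)] c A(1) by blast
  qed
  \<comment> \<open>If b is a vertex, an element through b may share no edge with T, and the chain
    of \<open>vertex_diameter\<close> is needed. Otherwise A has at least two vertices, and every
    element through b contains all of them, hence an edge of T.\<close>
  have size: "(2 / k) ^ Suc N * ?h \<le> diameter T'" if T': "T' \<in> \<T>" "b \<in> T'" for T'
  proof -
    obtain a where a: "a \<in> A" using \<open>A \<noteq> {}\<close> by blast
    show ?thesis
    proof (cases "A = {a}")
      case True
      then have "b = a" using bA by simp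
      then have "(2 / k) ^ N * ?h \<le> diameter T'"
        using vertex_diameter[OF _ _ x0(2) T'(1) _ cardN] b\<Omega> A(1) a T'(2) by blast
      moreover have "(2 / k) ^ Suc N * ?h \<le> (2 / k) ^ N * ?h"
        using q ET(7) by (intro mult_right_mono power_decreasing) auto
      ultimately show ?thesis by simp
    next
      case False
      then obtain a' where a': "a' \<in> A" "a' \<noteq> a" using a by blast
      have "a \<in> T'" "a' \<in> T'" using AT'[OF T'] a a'(1) element_topology(6)[OF T'(1)] by blast+
      then have "2 / k * ?h \<le> diameter T'"
        using shared_edge_diameter[OF x0(2) T'(1), of a a'] a a' A(1) by blast
      moreover have "(2 / k) ^ Suc N * ?h \<le> (2 / k) ^ 1 * ?h"
        using q ET(7) by (intro mult_right_mono power_decreasing) auto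
      ultimately show ?thesis by simp
    qed
  qed
  \<comment> \<open>T'' misses some vertex c in A. The coordinate of c in T' is at least t at b, but
    zero at the points that T' shares with T''. So the Lipschitz bound keeps y away from b, at the
    cost of the last factor 2 / k in c6.\<close>
  have far: "r \<le> dist b y"
    if T': "T' \<in> \<T>" "b \<in> T'" and T'': "T'' \<in> \<T>" "b \<notin> T''" and y: "y \<in> T'" "y \<in> T''" for T' T'' y
  proof -
    note E' = element[OF T'(1)]
    have "\<exists>c\<in>A. c \<notin> T''"
    proof (rule ccontr)
      assume "\<not> ?thesis"
      then have "convex hull A \<subseteq> T''" by (intro hull_minimal element_topology(3)[OF T''(1)]) auto
      then show False using bA T''(2) by blast
    qed
    then obtain c where c: "c \<in> A" "c \<notin> T''" by blast
    have c': "c \<in> vertices T'" using AT'[OF T'] c(1) by blast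
    have "\<not> 0 < bary (vertices T') c y"
      using pos_bary_transfer[OF T'(1) T''(1) y c'] element_topology(6)[OF T''(1)] c(2) by blast
    then have 0: "bary (vertices T') c y \<le> 0" by simp
    have "bary (vertices T') c b = \<beta> c"
      unfolding b_def using bary_sum_vertices[OF E'(1) A(2) AT'[OF T'] \<beta>1, of c] c(1) by simp
    then have ge: "t \<le> \<bar>bary (vertices T') c b - bary (vertices T') c y\<bar>" using \<beta>t[OF c(1)] 0 by simp
    obtain z where z: "cball z (diameter T' / k) \<subseteq> T'" using element_ball[OF T'(1)] .
    then have "cball z (diameter T' / k) \<subseteq> convex hull (vertices T')" using E'(2) by metis
    from bary_lipschitz[OF E'(1) c' this, of b y]
    have le: "2 * (diameter T' / k) * \<bar>bary (vertices T') c b - bary (vertices T') c y\<bar> \<le> dist b y"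
      using inradius_pos[OF T'(1)] by simp
    have "r = 2 / k * ((2 / k) ^ Suc N * ?h) * t" by (simp add: r_def c6)
    also have "\<dots> \<le> 2 / k * diameter T' * t"
      using size[OF T'] q t by (intro mult_right_mono mult_left_mono) auto
    also have "\<dots> \<le> 2 / k * diameter T' * \<bar>bary (vertices T') c b - bary (vertices T') c y\<bar>"
      using ge inradius_pos[OF T'(1)] by (intro mult_left_mono) auto
    also have "\<dots> \<le> dist b y" using le by simp
    finally show ?thesis .
  qed
  show thesis
  proof (rule that[OF bT _ _ r ball d\<theta>])
    show "c6 * (\<tau> * \<eta> ^ m) * ?h \<le> r"
      unfolding r_def using t c6p ET(7) by (intro mult_right_mono mult_left_mono) auto
    have "c6 * t \<le> 1 * 1" using c6p t \<tau>p by (intro mult_mono) auto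
    then show "r \<le> ?h" unfolding r_def using ET(7) mult_right_mono[of "c6 * t" 1 ?h] by simp
    show "b \<in> T'" if "T' \<in> \<T>" "x \<in> T'" "x \<in> ball b r" for T' x
      by (rule elements_near_point[OF ball b\<Omega> _ that]) (rule far; assumption)
  qed
qed

lemma facet_vertex:
  assumes T: "T \<in> \<T>" and S: "S facet_of T"
  obtains a where "a \<in> vertices T" "S = convex hull (vertices T - {a})"
proof -
  have "S facet_of (convex hull (vertices T))" using S element(2)[OF T] by simp
  then show thesis
    using facet_of_convex_hull_affine_independent[of "vertices T" S] element(1)[OF T] that
    unfolding simplex_points_def by blast
qed

text \<open>The distance from the plane of the facet is a multiple of the barycentric coordinate of
  a. So \<open>facet_center_ball\<close> puts the half-ball on the side of the normal into the
  element and the flat disc into the facet.\<close>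

lemma facet_halfball:
  assumes T: "T \<in> \<T>" and a: "a \<in> vertices T" and S: "S = convex hull (vertices T - {a})"
    and r: "real CARD('n) * r \<le> 2 * (diameter T / k)" "0 < r"
  defines "y \<equiv> facet_center (vertices T) a" and "\<nu> \<equiv> side_normal S T"
  shows "norm \<nu> = 1"
    "\<And>x. x \<in> ball y r \<Longrightarrow> 0 < (x - y) \<bullet> \<nu> \<Longrightarrow> x \<in> interior T"
    "\<And>x. x \<in> ball y r \<Longrightarrow> (x - y) \<bullet> \<nu> = 0 \<Longrightarrow> x \<in> S"
    "\<And>x. x \<in> S \<Longrightarrow> (x - y) \<bullet> \<nu> = 0"
    "y \<in> S" "\<exists>\<alpha>. \<forall>x. bary (vertices T) a x = \<alpha> * ((x - y) \<bullet> \<nu>)"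
proof -
  note E = element[OF T]
  obtain z where "cball z (diameter T / k) \<subseteq> T" using element_ball[OF T] .
  then have z: "cball z (diameter T / k) \<subseteq> convex hull (vertices T)" using E(2) by metis
  obtain l v where lv: "bary (vertices T) a = (\<lambda>x. l + v \<bullet> x)" using bary_affine[OF E(1)] by blast
  note N = side_normal_simplex[OF E(1) a lv]
  have \<nu>: "\<nu> = v /\<^sub>R norm v" unfolding \<nu>_def S using N(2) E(2) by simp
  show "norm \<nu> = 1" using N(1) by (simp add: \<nu>)
  note F = facet_center_ball[OF E(1) a z r, folded y_def]
  have y0: "bary (vertices T) a y = 0" using F(3)[of y] r(2) by simp
  have b: "bary (vertices T) a x = norm v * ((x - y) \<bullet> \<nu>)" for x
  proof -
    have "bary (vertices T) a x = bary (vertices T) a x - bary (vertices T) a y" using y0 by simp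
    also have "\<dots> = v \<bullet> (x - y)" by (simp add: lv inner_diff_right)
    also have "\<dots> = norm v * ((x - y) \<bullet> \<nu>)" using N(1) by (simp add: \<nu> inner_commute)
    finally show ?thesis .
  qed
  then show "\<exists>\<alpha>. \<forall>x. bary (vertices T) a x = \<alpha> * ((x - y) \<bullet> \<nu>)" by blast
  have nv: "0 < norm v" using N(1) by simp
  show "x \<in> interior T" if x: "x \<in> ball y r" "0 < (x - y) \<bullet> \<nu>" for x
  proof -
    have "open (ball y r \<inter> {x. 0 < (x - y) \<bullet> \<nu>})"
      by (intro open_Int open_ball open_Collect_less continuous_intros)
    moreover have "ball y r \<inter> {x. 0 < (x - y) \<bullet> \<nu>} \<subseteq> T"
    proof
      fix x assume x: "x \<in> ball y r \<inter> {x. 0 < (x - y) \<bullet> \<nu>}"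
      then have "0 \<le> bary (vertices T) a x" using b[of x] nv by simp
      moreover have "dist x y \<le> r" using x by (simp add: dist_commute)
      ultimately have "x \<in> convex hull (vertices T)" using F(1) by blast
      then show "x \<in> T" using E(2) by metis
    qed
    ultimately show ?thesis using x interior_maximal by blast
  qed
  show "x \<in> S" if x: "x \<in> ball y r" "(x - y) \<bullet> \<nu> = 0" for x
    using F(2)[of x] x b[of x] S by (simp add: dist_commute)
  then show "y \<in> S" using r(2) by simp
  show "(x - y) \<bullet> \<nu> = 0" if "x \<in> S" for x
    using N(3)[of x] that b[of x] nv S by simp
qed

lemma facet_two_vertices:
  assumes T: "T \<in> \<T>" and a: "a \<in> vertices T"
  obtains c c' where "c \<in> vertices T - {a}" "c' \<in> vertices T - {a}" "c \<noteq> c'"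
proof -
  have "card (vertices T - {a}) = CARD('n)"
    using element(1)[OF T] a element_topology(5)[OF T] by (simp add: simplex_points_def)
  then have "2 \<le> card (vertices T - {a})" using dim by simp
  then have "\<not> card (vertices T - {a}) \<le> Suc 0" by simp
  then show thesis using that card_le_Suc0_iff_eq[of "vertices T - {a}"] element_topology(5)[OF T] by blast
qed

text \<open>The two elements share the vertices of S, hence the facet centre, and also an edge. The
  extra factor 2 / k in the radius compares the diameter of T' with that of T.\<close>

lemma shared_facet:
  assumes T: "T \<in> \<T>" "T' \<in> \<T>" and S: "S facet_of T" "S facet_of T'"
    and r: "0 < r" "real CARD('n) * r \<le> 2 * (2 / k * (diameter T / k))"
  shows "\<exists>y. (\<forall>x\<in>ball y r. 0 < (x - y) \<bullet> side_normal S T \<longrightarrow> x \<in> interior T) \<and>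
     (\<forall>x\<in>ball y r. 0 < (x - y) \<bullet> side_normal S T' \<longrightarrow> x \<in> interior T') \<and>
     (\<forall>x\<in>ball y r. (x - y) \<bullet> side_normal S T = 0 \<longrightarrow> x \<in> S) \<and>
     (\<forall>x\<in>S. (x - y) \<bullet> side_normal S T = 0) \<and> y \<in> S \<and> norm (side_normal S T) = 1 \<and>
     (side_normal S T' = side_normal S T \<or> side_normal S T' = - side_normal S T)"
proof -
  obtain a where a: "a \<in> vertices T" "S = convex hull (vertices T - {a})" using facet_vertex[OF T(1) S(1)] .
  obtain a' where a': "a' \<in> vertices T'" "S = convex hull (vertices T' - {a'})" using facet_vertex[OF T(2) S(2)] .
  note E = element[OF T(1)] and E' = element[OF T(2)]
  have ind: "\<not> affine_dependent (vertices T - {a})" "\<not> affine_dependent (vertices T' - {a'})"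
    using E(1) E'(1) affine_independent_subset unfolding simplex_points_def by blast+
  have "vertices T - {a} = {x. x extreme_point_of S}"
    unfolding a(2) extreme_point_of_convex_hull_affine_independent[OF ind(1)] by (simp only: Collect_mem_eq)
  moreover have "vertices T' - {a'} = {x. x extreme_point_of S}"
    unfolding a'(2) extreme_point_of_convex_hull_affine_independent[OF ind(2)] by (simp only: Collect_mem_eq)
  ultimately have eq: "vertices T - {a} = vertices T' - {a'}" by simp
  define y where "y = facet_center (vertices T) a"
  have y': "y = facet_center (vertices T') a'" by (simp add: y_def facet_center_def eq)
  obtain c c' where c: "c \<in> vertices T - {a}" "c' \<in> vertices T - {a}" "c \<noteq> c'"
    using facet_two_vertices[OF T(1) a(1)] .
  then have "c \<in> T'" "c' \<in> T'" using eq element_topology(6)[OF T(2)] by blast+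
  then have h: "2 / k * diameter T \<le> diameter T'"
    using shared_edge_diameter[OF T, of c c'] c by blast
  show ?thesis
  proof (intro exI[of _ y])
    have "2 / k * (diameter T / k) \<le> 1 * (diameter T / k)"
      using k inradius_pos[OF T(1)] by (intro mult_right_mono) auto
    then have r1: "real CARD('n) * r \<le> 2 * (diameter T / k)" using r by simp
    have "2 / k * (diameter T / k) \<le> diameter T' / k"
      using divide_right_mono[OF h, of k] k by simp
    then have r2: "real CARD('n) * r \<le> 2 * (diameter T' / k)" using r by simp
    have r0: "0 < r" using r by simp
    note F = facet_halfball[OF T(1) a r1 r0, folded y_def]
    note F' = facet_halfball[OF T(2) a' r2 r0, folded y']
    have normals: "side_normal S T' = side_normal S T \<or> side_normal S T' = - side_normal S T"
    proof -
      let ?\<nu> = "side_normal S T" and ?\<nu>' = "side_normal S T'"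
      obtain \<alpha> where \<alpha>: "\<And>x. bary (vertices T) a x = \<alpha> * ((x - y) \<bullet> ?\<nu>)" using F(6) by blast
      \<comment> \<open>The affine function belonging to the second normal vanishes on S, so it is a
        multiple of the first. The factor \<beta> is its value at a, where \<alpha> times the first
        function equals 1.\<close>
      define \<beta> where "\<beta> = (a - y) \<bullet> ?\<nu>' * \<alpha>"
      have "- (y \<bullet> ?\<nu>') + ?\<nu>' \<bullet> x = - (\<beta> * (y \<bullet> ?\<nu>)) + (\<beta> *\<^sub>R ?\<nu>) \<bullet> x" if x: "x \<in> vertices T" for x
      proof -
        have "(x - y) \<bullet> ?\<nu>' = \<beta> * ((x - y) \<bullet> ?\<nu>)"
        proof (cases "x = a")
          case True
          then have "\<alpha> * ((x - y) \<bullet> ?\<nu>) = 1" using \<alpha>[of a] bary_vertex[OF E(1) a(1), of a] by simp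
          then show ?thesis unfolding \<beta>_def using True by (metis mult.assoc mult.right_neutral)
        next
          case False
          then have "x \<in> S" using x a(2) hull_inc[of x "vertices T - {a}"] by blast
          then show ?thesis using F(4) F'(4) by simp
        qed
        then show ?thesis by (simp add: inner_diff_left inner_commute algebra_simps)
      qed
      from affine_fun_eqI(2)[OF E(1) this] have "?\<nu>' = \<beta> *\<^sub>R ?\<nu>" .
      moreover from this have "\<bar>\<beta>\<bar> = 1" using F(1) F'(1) by simp
      ultimately show ?thesis by (cases "0 \<le> \<beta>") auto
    qed
    show "(\<forall>x\<in>ball y r. 0 < (x - y) \<bullet> side_normal S T \<longrightarrow> x \<in> interior T) \<and>
     (\<forall>x\<in>ball y r. 0 < (x - y) \<bullet> side_normal S T' \<longrightarrow> x \<in> interior T') \<and>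
     (\<forall>x\<in>ball y r. (x - y) \<bullet> side_normal S T = 0 \<longrightarrow> x \<in> S) \<and>
     (\<forall>x\<in>S. (x - y) \<bullet> side_normal S T = 0) \<and> y \<in> S \<and> norm (side_normal S T) = 1 \<and>
     (side_normal S T' = side_normal S T \<or> side_normal S T' = - side_normal S T)"
      using F(1-5) F'(2) normals by blast
  qed
qed

text \<open>With equal normals, a point slightly above the facet centre would be interior to both
  elements.\<close>

lemma shared_facet_same_side:
  assumes T: "T \<in> \<T>" "T' \<in> \<T>" and S: "S facet_of T" "S facet_of T'"
    and eq: "side_normal S T' = side_normal S T"
  shows "T = T'"
proof (rule ccontr)
  assume ne: "T \<noteq> T'"
  define r where "r = 2 * (2 / k * (diameter T / k)) / real CARD('n)"
  have r: "0 < r" "real CARD('n) * r \<le> 2 * (2 / k * (diameter T / k))"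
    using k element_topology(7)[OF T(1)] by (simp_all add: r_def)
  obtain y where y: "\<forall>x\<in>ball y r. 0 < (x - y) \<bullet> side_normal S T \<longrightarrow> x \<in> interior T"
    "\<forall>x\<in>ball y r. 0 < (x - y) \<bullet> side_normal S T' \<longrightarrow> x \<in> interior T'" "norm (side_normal S T) = 1"
    using shared_facet[OF T S r] by (elim exE conjE) (rule that)
  define x where "x = y + (r / 2) *\<^sub>R side_normal S T"
  have "x \<in> ball y r" using r(1) y(3) by (simp add: x_def dist_norm)
  moreover have "0 < (x - y) \<bullet> side_normal S T" using r(1) y(3) by (simp add: x_def norm_eq_1)
  ultimately have "x \<in> interior T" "x \<in> interior T'" using y(1,2) eq by auto
  then show False using interior_disjoint[OF T ne] interior_subset by blast
qed

text \<open>Among three elements sharing S, two would have the same normal.\<close>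

lemma internal_side:
  assumes T: "T \<in> \<T>" and S: "S \<in> internal_sides \<T>" "S facet_of T"
  obtains T' where "T' \<in> \<T>" "T' \<noteq> T" "S facet_of T'" "{T\<in>\<T>. S facet_of T} = {T, T'}"
    "side_normal S T' = - side_normal S T"
proof -
  obtain T1 T2 where T12: "T1 \<in> \<T>" "T2 \<in> \<T>" "T1 \<noteq> T2" "S facet_of T1" "S facet_of T2"
    using S(1) by (auto simp: internal_sides_def)
  then obtain T' where T': "T' \<in> \<T>" "T' \<noteq> T" "S facet_of T'" by metis
  have opp: "side_normal S T'' = - side_normal S T" if T'': "T'' \<in> \<T>" "T'' \<noteq> T" "S facet_of T''" for T''
  proof -
    define r where "r = 2 * (2 / k * (diameter T / k)) / real CARD('n)"
    have r: "0 < r" "real CARD('n) * r \<le> 2 * (2 / k * (diameter T / k))"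
      using k element_topology(7)[OF T] by (simp_all add: r_def)
    have "side_normal S T'' = side_normal S T \<or> side_normal S T'' = - side_normal S T"
      using shared_facet[OF T T''(1) S(2) T''(3) r] by blast
    then show ?thesis using shared_facet_same_side[OF T T''(1) S(2) T''(3)] T''(2) by blast
  qed
  have "T'' = T'" if T'': "T'' \<in> \<T>" "S facet_of T''" "T'' \<noteq> T" for T''
    using shared_facet_same_side[OF T'(1) T''(1) T'(3) T''(2)] opp[OF T'] opp[OF T''(1,3,2)] by simp
  then have "{T\<in>\<T>. S facet_of T} = {T, T'}" using T T' S(2) by blast
  then show thesis using that[OF T'] opp[OF T'] by blast
qed

end

section \<open>Testing with dilated bumps\<close>

lemma partial_shift:
  assumes "f differentiable (at (b + c))"
  shows "((\<lambda>b. f (b + c)) has_derivative frechet_derivative f (at (b + c))) (at b)"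
proof -
  have "((\<lambda>b. b + c) has_derivative (\<lambda>h. h)) (at b)" by (auto intro!: derivative_eq_intros)
  from has_derivative_compose[OF this assms[unfolded frechet_derivative_works]] show ?thesis .
qed

text \<open>The coefficients of the interpolation along lines do not depend on the base point, so
  the identity may be differentiated in that point. Keeping the same degree bound is enough.\<close>

lemma line_poly_partial:
  fixes f :: "real^'n \<Rightarrow> real"
  assumes f: "line_poly K f" and sm: "smooth f"
  shows "line_poly K (partial j f)"
proof (rule line_poly_Lagrange[OF inj_on_node[of K "{..K}"], where 'a="real^'n"])
  fix L :: "nat \<Rightarrow> real poly" assume deg: "\<And>i. i \<le> K \<Longrightarrow> degree (L i) \<le> K" and
    L: "\<And>(f::real^'n \<Rightarrow> real) b y t. line_poly K f \<Longrightarrow> f (b + t *\<^sub>R y) = (\<Sum>i\<le>K. poly (L i) t * f (b + node K i *\<^sub>R y))"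
  note d = smooth_differentiable[OF sm]
  have "partial j f (b + t *\<^sub>R y) = (\<Sum>i\<le>K. poly (L i) t * partial j f (b + node K i *\<^sub>R y))" for b y t
  proof -
    have 1: "((\<lambda>b. f (b + t *\<^sub>R y)) has_derivative frechet_derivative f (at (b + t *\<^sub>R y))) (at b)"
      by (rule partial_shift[OF d])
    have "((\<lambda>b. \<Sum>i\<le>K. poly (L i) t * f (b + node K i *\<^sub>R y)) has_derivative
      (\<lambda>h. \<Sum>i\<le>K. poly (L i) t * frechet_derivative f (at (b + node K i *\<^sub>R y)) h)) (at b)"
      by (intro has_derivative_sum has_derivative_mult_right partial_shift d)
    then have 2: "((\<lambda>b. f (b + t *\<^sub>R y)) has_derivative
      (\<lambda>h. \<Sum>i\<le>K. poly (L i) t * frechet_derivative f (at (b + node K i *\<^sub>R y)) h)) (at b)"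
      using L[OF f, of _ t y] by (simp only:)
    show ?thesis using has_derivative_unique[OF 1 2] by (simp add: partial_def)
  qed
  from line_poly_of_Lagrange[where L = L and x = "node K", OF deg this] show ?thesis .
qed

definition smooth_line_poly :: "nat \<Rightarrow> (real^'n \<Rightarrow> real) \<Rightarrow> bool" where
  "smooth_line_poly K f \<longleftrightarrow> smooth f \<and> line_poly K f"

lemma smooth_line_poly_partial: "smooth_line_poly K f \<Longrightarrow> smooth_line_poly K (partial j f)"
  by (simp add: smooth_line_poly_def smooth_partial line_poly_partial)

lemma smooth_line_poly_add: "smooth_line_poly K f \<Longrightarrow> smooth_line_poly K g \<Longrightarrow> smooth_line_poly K (\<lambda>x. f x + g x)"
  by (simp add: smooth_line_poly_def smooth_add line_poly_add)

lemma smooth_line_poly_diff: "smooth_line_poly K f \<Longrightarrow> smooth_line_poly K g \<Longrightarrow> smooth_line_poly K (\<lambda>x. f x - g x)"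
  by (simp add: smooth_line_poly_def smooth_diff line_poly_diff)

lemma smooth_line_poly_cmult: "smooth_line_poly K f \<Longrightarrow> smooth_line_poly K (\<lambda>x. c * f x)"
  by (simp add: smooth_line_poly_def smooth_mult smooth_const line_poly_cmult)

lemma smooth_line_poly_sum: "(\<And>i. i \<in> A \<Longrightarrow> smooth_line_poly K (f i)) \<Longrightarrow> smooth_line_poly K (\<lambda>x. \<Sum>i\<in>A. f i x)"
  by (simp add: smooth_line_poly_def smooth_sum line_poly_sum)

lemma smooth_line_poly_mono: "smooth_line_poly K f \<Longrightarrow> K \<le> L \<Longrightarrow> smooth_line_poly L f"
  using line_poly_mono by (auto simp: smooth_line_poly_def)

lemma smooth_line_poly_poly_space:
  assumes "g \<in> poly_space k" shows "smooth_line_poly k g"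
proof -
  obtain c where c: "g = (\<lambda>x. \<Sum>\<alpha> | (\<Sum>i\<in>UNIV. \<alpha> i) \<le> k. c \<alpha> * (\<Prod>i\<in>UNIV. x $ i ^ \<alpha> i))"
    using assms by (auto simp: poly_space_def)
  have "smooth_line_poly k (\<lambda>x::real^'a. \<Prod>i\<in>UNIV. x $ i ^ \<alpha> i)" if "(\<Sum>i\<in>UNIV. \<alpha> i) \<le> k" for \<alpha>
  proof -
    have "line_poly (\<Sum>i\<in>UNIV. \<alpha> i * Suc 0) (\<lambda>x::real^'a. \<Prod>i\<in>UNIV. x $ i ^ \<alpha> i)"
      by (intro line_poly_prod line_poly_power line_poly_component)
    moreover have "smooth (\<lambda>x::real^'a. \<Prod>i\<in>UNIV. x $ i ^ \<alpha> i)"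
      by (intro smooth_prod smooth_power smooth_component)
    ultimately show ?thesis using that line_poly_mono by (auto simp: smooth_line_poly_def)
  qed
  then show ?thesis unfolding c by (intro smooth_line_poly_sum smooth_line_poly_cmult) auto
qed

text \<open>The multi-indices of degree at most 1 are 0 and the unit vectors.\<close>

lemma affine_in_poly_space: "(\<lambda>x::real^'n. k + v \<bullet> x) \<in> poly_space 1"
proof -
  define e :: "'n \<Rightarrow> 'n \<Rightarrow> nat" where "e i = (\<lambda>j. if j = i then 1 else 0)" for i
  have sum_e: "(\<Sum>j\<in>UNIV. e i j) = 1" for i by (simp add: e_def)
  have inj: "inj e" by (intro injI) (metis e_def one_neq_zero)
  have e0: "(\<lambda>_. 0) \<notin> range e"
  proof
    assume "(\<lambda>_. 0) \<in> range e"
    then obtain i where "(\<lambda>_. 0) = e i" by blast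
    from fun_cong[OF this, of i] show False by (simp add: e_def)
  qed
  have set: "{\<alpha>::'n \<Rightarrow> nat. (\<Sum>i\<in>UNIV. \<alpha> i) \<le> 1} = insert (\<lambda>_. 0) (range e)"
  proof (intro equalityI subsetI)
    fix \<alpha> :: "'n \<Rightarrow> nat" assume "\<alpha> \<in> {\<alpha>. (\<Sum>i\<in>UNIV. \<alpha> i) \<le> 1}"
    then have le: "(\<Sum>i\<in>UNIV. \<alpha> i) \<le> 1" by simp
    show "\<alpha> \<in> insert (\<lambda>_. 0) (range e)"
    proof (cases "\<alpha> = (\<lambda>_. 0)")
      case False
      then obtain i where i: "0 < \<alpha> i" by (auto simp: fun_eq_iff)
      have split: "(\<Sum>i\<in>UNIV. \<alpha> i) = \<alpha> i + (\<Sum>j\<in>UNIV - {i}. \<alpha> j)" by (simp add: sum.remove)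
      then have "\<alpha> i = 1" "(\<Sum>j\<in>UNIV - {i}. \<alpha> j) = 0" using le i by linarith+
      moreover from this have "\<alpha> j = 0" if "j \<noteq> i" for j using that by simp
      ultimately have "\<alpha> = e i" by (auto simp: e_def fun_eq_iff)
      then show ?thesis by blast
    qed simp
  qed (auto simp: sum_e)
  define c where "c \<alpha> = (if \<alpha> = (\<lambda>_. 0) then k else v $ (inv e \<alpha>))" for \<alpha>
  have mono: "(\<Prod>j\<in>UNIV. x $ j ^ e i j) = x $ i" for x :: "real^'n" and i
  proof -
    have "(\<Prod>j\<in>UNIV. x $ j ^ e i j) = (\<Prod>j\<in>UNIV. if j = i then x $ j else 1)"
      by (intro prod.cong) (auto simp: e_def)
    then show ?thesis by simp
  qed
  have "k + v \<bullet> x = (\<Sum>\<alpha> | (\<Sum>i\<in>UNIV. \<alpha> i) \<le> 1. c \<alpha> * (\<Prod>i\<in>UNIV. x $ i ^ \<alpha> i))" for x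
  proof -
    have "(\<Sum>\<alpha>\<in>range e. c \<alpha> * (\<Prod>i\<in>UNIV. x $ i ^ \<alpha> i)) = (\<Sum>i\<in>UNIV. c (e i) * (\<Prod>j\<in>UNIV. x $ j ^ e i j))"
      by (simp add: sum.reindex[OF inj] o_def)
    also have "\<dots> = (\<Sum>i\<in>UNIV. v $ i * x $ i)"
    proof (intro sum.cong refl)
      fix i
      have "e i \<noteq> (\<lambda>_. 0)" using e0 by (metis rangeI)
      then show "c (e i) * (\<Prod>j\<in>UNIV. x $ j ^ e i j) = v $ i * x $ i"
        unfolding mono c_def using inj by simp
    qed
    finally show ?thesis unfolding set using e0 by (simp add: c_def inner_vec_def)
  qed
  then show ?thesis unfolding poly_space_def by blast
qed

text \<open>A function of degree at most 1 along lines that vanishes at two points vanishes on their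
  line, so its zero set is affine.\<close>

lemma line_poly_1_eq_0:
  fixes f :: "real^'n \<Rightarrow> real"
  assumes f: "line_poly 1 f" and C: "affine hull C = UNIV" "\<And>c. c \<in> C \<Longrightarrow> f c = 0"
  shows "f x = 0"
proof -
  have "affine {x. f x = 0}"
    unfolding affine_def
  proof safe
    fix x y and u v :: real assume xy: "f x = 0" "f y = 0" "u + v = 1"
    obtain p where p: "degree p \<le> 1" "\<And>t. f (x + t *\<^sub>R (y - x)) = poly p t" using line_polyD[OF f] by blast
    obtain p0 p1 where pp: "p = [:p0, p1:]" 
    proof (rule that[of "coeff p 0" "coeff p 1"], rule poly_eqI)
      fix n show "coeff p n = coeff [:coeff p 0, coeff p 1:] n"
        using p(1) by (auto simp: coeff_pCons coeff_eq_0 split: nat.splits)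
    qed
    have "p0 = 0" "p1 = 0" using p(2)[of 0] p(2)[of 1] xy by (auto simp: pp)
    then have "f (x + v *\<^sub>R (y - x)) = 0" using p(2) by (simp add: pp)
    moreover have "x + v *\<^sub>R (y - x) = u *\<^sub>R x + v *\<^sub>R y"
    proof -
      have "u = 1 - v" using xy by simp
      show ?thesis unfolding \<open>u = 1 - v\<close> by (simp add: algebra_simps)
    qed
    ultimately show "f (u *\<^sub>R x + v *\<^sub>R y) = 0" by simp
  qed
  then have "affine hull C \<subseteq> {x. f x = 0}" using C(2) by (intro hull_minimal) auto
  then show ?thesis using C(1) by auto
qed

text \<open>The difference of two candidates has degree at most 1 along lines and vanishes at the
  vertices, whose affine hull is the whole space.\<close>

lemma barycentric_eq_bary:
  assumes C: "simplex_points (vertices T)"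
  shows "barycentric T z = bary (vertices T) z"
  unfolding barycentric_def
proof (rule the_equality, intro conjI ballI)
  show "bary (vertices T) z \<in> poly_space 1" using bary_affine[OF C, of z] affine_in_poly_space by metis
  show "bary (vertices T) z w = (if w = z then 1 else 0)" if "w \<in> vertices T" for w
    by (rule bary_vertex[OF C that])
  fix l assume l: "l \<in> poly_space 1 \<and> (\<forall>w\<in>vertices T. l w = (if w = z then 1 else 0))"
  have "line_poly 1 (bary (vertices T) z)" "line_poly 1 l"
    using smooth_line_poly_poly_space l \<open>bary (vertices T) z \<in> poly_space 1\<close> by (auto simp: smooth_line_poly_def)
  then have "line_poly 1 (\<lambda>x. l x - bary (vertices T) z x)" by (intro line_poly_diff)
  then have "l x - bary (vertices T) z x = 0" for x
    by (rule line_poly_1_eq_0[OF _ simplex_points_hull[OF C]]) (use l bary_vertex[OF C] in auto)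
  then show "l = bary (vertices T) z" by auto
qed

lemma smooth_line_poly_bubble:
  fixes T :: "(real^'n) set"
  assumes C: "simplex_points (vertices T)"
  shows "smooth_line_poly (CARD('n) + 1) (bubble T)"
proof -
  have g: "smooth_line_poly 1 (bary (vertices T) z)" for z
    using smooth_line_poly_poly_space[of _ 1] bary_affine[OF C, of z] affine_in_poly_space by metis
  have "line_poly (\<Sum>z\<in>vertices T. 1) (\<lambda>x. \<Prod>z\<in>vertices T. bary (vertices T) z x)"
    using g by (intro line_poly_prod) (auto simp: smooth_line_poly_def)
  moreover have "smooth (\<lambda>x. \<Prod>z\<in>vertices T. bary (vertices T) z x)"
    using g by (intro smooth_prod) (auto simp: smooth_line_poly_def)
  moreover have "card (vertices T) = CARD('n) + 1" using C by (simp add: simplex_points_def)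
  ultimately show ?thesis unfolding bubble_def[abs_def] barycentric_eq_bary[OF C] smooth_line_poly_def by simp
qed

lemma smooth_line_poly_local_space:
  fixes T :: "(real^'n) set"
  assumes C: "simplex_points (vertices T)" and g: "g \<in> local_space el T"
  shows "smooth_line_poly (CARD('n) + 1) g"
proof (cases el)
  case Mini
  then obtain h c where h: "g = (\<lambda>x. h x + c * bubble T x)" "h \<in> poly_space 1"
    using g by (auto simp: local_space_def)
  have "smooth_line_poly (CARD('n) + 1) h" by (rule smooth_line_poly_mono[OF smooth_line_poly_poly_space[OF h(2)]]) simp
  then show ?thesis unfolding h(1) by (intro smooth_line_poly_add smooth_line_poly_cmult smooth_line_poly_bubble C)
next
  case Taylor_Hood
  then have "g \<in> poly_space 2" using g by (simp add: local_space_def)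
  moreover have "2 \<le> CARD('n) + 1" using zero_less_card_finite[where 'a='n] by linarith
  ultimately show ?thesis using smooth_line_poly_mono[OF smooth_line_poly_poly_space] by blast
qed

lemma smooth_affine:
  assumes "smooth f" shows "smooth (\<lambda>x. f (d + c *\<^sub>R x))"
    and "partial j (\<lambda>x. f (d + c *\<^sub>R x)) x = c *\<^sub>R partial j f (d + c *\<^sub>R x)"
proof -
  have der: "((\<lambda>x. f (d + c *\<^sub>R x)) has_derivative (\<lambda>h. c *\<^sub>R frechet_derivative f (at (d + c *\<^sub>R x)) h)) (at x)"
    if "f differentiable (at (d + c *\<^sub>R x))" for f :: "real^'a \<Rightarrow> 'b" and x
  proof -
    have "((\<lambda>x. d + c *\<^sub>R x) has_derivative (\<lambda>h. c *\<^sub>R h)) (at x)" by (auto intro!: derivative_eq_intros)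
    from has_derivative_compose[OF this that[unfolded frechet_derivative_works]]
    show ?thesis
      using linear_cmul[OF linear_frechet_derivative[OF that]] by simp
  qed
  have p: "partial j (\<lambda>x. f (d + c *\<^sub>R x)) x = c *\<^sub>R partial j f (d + c *\<^sub>R x)"
    if "f differentiable (at (d + c *\<^sub>R x))" for f :: "real^'a \<Rightarrow> 'b" and x j
    using partial_eq[OF der[OF that]] by (simp add: partial_def)
  show "partial j (\<lambda>x. f (d + c *\<^sub>R x)) x = c *\<^sub>R partial j f (d + c *\<^sub>R x)"
    by (rule p[OF smooth_differentiable[OF assms]])
  have "C_k k f \<Longrightarrow> C_k k (\<lambda>x. f (d + c *\<^sub>R x))" for k
  proof (induction k arbitrary: f)
    case 0
    then have f0: "continuous_on UNIV f" by simp
    have "continuous_on UNIV (\<lambda>x. f (d + c *\<^sub>R x))"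
      by (rule continuous_on_compose2[OF f0]) (auto intro!: continuous_intros)
    then show ?case by simp
  next
    case (Suc k)
    then have d: "f differentiable (at x)" for x by simp
    have "partial j (\<lambda>x. f (d + c *\<^sub>R x)) = (\<lambda>x. c *\<^sub>R partial j f (d + c *\<^sub>R x))" for j
      using p[OF d] by blast
    moreover have "C_k k (\<lambda>x. c *\<^sub>R partial j f (d + c *\<^sub>R x))" for j
      using Suc by (intro C_k_scaleR C_k_const) auto
    ultimately show ?case using der[OF d] by (auto simp: differentiable_def)
  qed
  then show "smooth (\<lambda>x. f (d + c *\<^sub>R x))" using assms by (simp add: smooth_def)
qed

definition dilated_bump :: "real^'n \<Rightarrow> real \<Rightarrow> real^'n \<Rightarrow> real" where
  "dilated_bump b s x = bump ((1 / s) *\<^sub>R (x - b))"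

lemma dilated_bump:
  fixes b :: "real^'n"
  assumes s: "0 < s"
  shows "smooth (dilated_bump b s)" "grad (dilated_bump b s) x = (1 / s) *\<^sub>R grad bump ((1 / s) *\<^sub>R (x - b))"
    "x \<notin> ball b s \<Longrightarrow> dilated_bump b s x = 0" "x \<notin> ball b s \<Longrightarrow> grad (dilated_bump b s) x = 0"
    "dist x b \<le> s / 2 \<Longrightarrow> dilated_bump b s x = 1"
    "ball b s \<subseteq> \<Omega> \<Longrightarrow> test_function \<Omega> (dilated_bump b s)"
proof -
  have eq: "dilated_bump b s = (\<lambda>x. bump (- ((1 / s) *\<^sub>R b) + (1 / s) *\<^sub>R x))"
    by (auto simp: dilated_bump_def algebra_simps)
  note A = smooth_affine[OF smooth_bump, where d = "- ((1 / s) *\<^sub>R b)" and c = "1 / s"]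
  show sm: "smooth (dilated_bump b s)" unfolding eq by (rule A(1))
  have arg: "- ((1 / s) *\<^sub>R b) + (1 / s) *\<^sub>R x = (1 / s) *\<^sub>R (x - b)" for x by (simp add: algebra_simps)
  show g: "grad (dilated_bump b s) x = (1 / s) *\<^sub>R grad bump ((1 / s) *\<^sub>R (x - b))" for x
  proof -
    have "partial i (dilated_bump b s) x = (1 / s) *\<^sub>R partial i bump ((1 / s) *\<^sub>R (x - b))" for i
      unfolding eq by (subst A(2)) (simp only: arg)
    then show ?thesis by (simp add: grad_def vec_eq_iff)
  qed
  have nrm: "norm ((1 / s) *\<^sub>R (x - b)) = dist x b / s" for x using s by (simp add: dist_norm)
  have out: "1 \<le> norm ((1 / s) *\<^sub>R (x - b))" if "x \<notin> ball b s" for x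
    unfolding nrm using that s by (simp add: dist_commute not_less)
  show "dilated_bump b s x = 0" if "x \<notin> ball b s"
    using bump_eq_0(1)[OF out[OF that]] by (simp add: dilated_bump_def)
  show "grad (dilated_bump b s) x = 0" if "x \<notin> ball b s"
  proof -
    have "grad bump ((1 / s) *\<^sub>R (x - b)) = 0"
      unfolding grad_def partial_bump using bump_eq_0(2)[OF out[OF that]] by (simp add: vec_eq_iff)
    then show ?thesis by (simp only: g) simp
  qed
  show "dilated_bump b s x = 1" if "dist x b \<le> s / 2"
    unfolding dilated_bump_def by (rule bump_eq_1, unfold nrm) (use that s in \<open>simp add: field_simps\<close>)
  show "test_function \<Omega> (dilated_bump b s)" if "ball b s \<subseteq> \<Omega>"
  proof -
    have "closure {x. dilated_bump b s x \<noteq> 0} \<subseteq> {x. ((1 / s) *\<^sub>R (x - b)) \<bullet> ((1 / s) *\<^sub>R (x - b)) \<le> 3/4}"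
      by (intro closure_minimal closed_Collect_le continuous_intros)
        (use bump_outer(1) in \<open>force simp: dilated_bump_def\<close>)
    also have "\<dots> \<subseteq> ball b s"
    proof
      fix x assume "x \<in> {x. ((1 / s) *\<^sub>R (x - b)) \<bullet> ((1 / s) *\<^sub>R (x - b)) \<le> 3/4}"
      then have "(norm ((1 / s) *\<^sub>R (x - b)))\<^sup>2 \<le> 3/4" unfolding power2_norm_eq_inner by blast
      then have "(norm ((1 / s) *\<^sub>R (x - b)))\<^sup>2 < 1\<^sup>2" unfolding one_power2 by linarith
      then have "norm ((1 / s) *\<^sub>R (x - b)) < 1" by (rule power_less_imp_less_base) simp
      then show "x \<in> ball b s" unfolding nrm using s by (simp add: dist_commute)
    qed
    finally have sub: "closure {x. dilated_bump b s x \<noteq> 0} \<subseteq> ball b s" .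
    then have "compact (closure {x. dilated_bump b s x \<noteq> 0})"
      by (meson bounded_ball bounded_subset closed_closure compact_eq_bounded_closed)
    then show ?thesis using sub that sm by (auto simp: test_function_def smooth_def)
  qed
qed

lemma grad_bump_bounded:
  obtains B where "0 < B" "\<And>y::real^'n. norm (grad bump y) \<le> B"
proof -
  have c: "continuous_on UNIV (grad (bump :: real^'n \<Rightarrow> real))"
    unfolding grad_def by (intro continuous_intros continuous_partial_bump)
  have 0: "grad bump y = 0" if "y \<notin> ball 0 1" for y :: "real^'n"
    unfolding grad_def partial_bump using bump_eq_0(2)[of y] that by (simp add: vec_eq_iff)
  show thesis using bounded_compact_support[OF c 0 bounded_ball] that by blast
qed

lemma sum_weighted_diff:
  fixes a :: real
  shows "a * (\<Sum>i\<in>A. w i * d i) - (\<Sum>i\<in>A. w i * q i) = (\<Sum>i\<in>A. w i * (a * d i - q i))"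
  unfolding sum_distrib_left sum_subtractf[symmetric] by (intro sum.cong) (auto simp: algebra_simps)

lemma sum_weighted_const:
  fixes G :: real
  shows "(\<Sum>i\<in>A. w i * (G * (B / (t i * r) * E))) = G * ((B * (\<Sum>i\<in>A. w i / t i)) / r * E)"
proof -
  have "w i * (G * (B / (t i * r) * E)) = (G * B / r * E) * (w i / t i)" for i
    by (simp add: ac_simps)
  then have "(\<Sum>i\<in>A. w i * (G * (B / (t i * r) * E))) = (G * B / r * E) * (\<Sum>i\<in>A. w i / t i)"
    by (simp only: sum_distrib_left)
  then show ?thesis by (simp add: ac_simps)
qed

text \<open>\<open>Fh\<close> stands for the discrete stress and \<open>e\<close> for the pointwise
  error. For the element residual, the jump and the source, the Stokes problem enters only through
  the last assumption. \<open>Fh\<close> is polynomial only in the interiors of elements, since uh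
  need not be differentiable on sides.\<close>

locale fat_residual = fat_mesh \<Omega> \<T> k
  for \<Omega> :: "(real^'n) set" and \<T> k +
  fixes Fh :: "real^'n \<Rightarrow> real^'n^'n" and e :: "real^'n \<Rightarrow> real" and f x0 :: "real^'n" and p :: real and K :: nat
  assumes p: "1 < p"
    and Fh_poly: "\<And>T. T \<in> \<T> \<Longrightarrow> \<exists>M. (\<forall>i j. smooth_line_poly K (\<lambda>x. M x $ i $ j)) \<and> (\<forall>x\<in>interior T. Fh x = M x)"
    and Fh_integrable: "integrable (lebesgue_on \<Omega>) Fh"
    and e_nonneg: "\<And>x. 0 \<le> e x" and e_Lp: "Lp p \<Omega> e"
    and residual: "\<And>\<phi> g. test_function \<Omega> \<phi> \<Longrightarrow>
      \<bar>(f \<bullet> g) * \<phi> x0 - (LINT x|lebesgue_on \<Omega>. g \<bullet> (Fh x *v grad \<phi> x))\<bar>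
        \<le> norm g * (LINT x|lebesgue_on \<Omega>. e x * norm (grad \<phi> x))"
begin

lemma lmeasurable_\<Omega>: "\<Omega> \<in> lmeasurable"
  by (rule bounded_open_lmeasurable[OF open_\<Omega> bounded_\<Omega>])

lemma integral_e_ball:
  assumes "ball b r \<subseteq> \<Omega>"
  shows "integrable (lebesgue_on (ball b r)) e"
  using Lp_integrable[OF Lp_subset[OF e_Lp assms]] p lmeasurable_\<Omega> by (simp add: fmeasurableD)

text \<open>Under x = b + s y the volume contributes s^n and the gradient of the dilated bump 1 / s,
  which leaves s^(n-1). The error is integrated over the largest ball for every s, so that the
  bounds can be added.\<close>

lemma dilated_test:
  assumes s: "0 < s" "s \<le> r" and b: "ball b r \<subseteq> \<Omega>" and B: "\<And>y::real^'n. norm (grad bump y) \<le> B"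
  shows "integrable lebesgue (\<lambda>y. g \<bullet> (Fh (b + s *\<^sub>R y) *v grad bump y))"
    "\<bar>(f \<bullet> g) * dilated_bump b s x0 - s ^ (CARD('n) - 1) * integral\<^sup>L lebesgue (\<lambda>y. g \<bullet> (Fh (b + s *\<^sub>R y) *v grad bump y))\<bar>
      \<le> norm g * (B / s * (LINT x|lebesgue_on (ball b r). e x))"
proof -
  let ?\<phi> = "dilated_bump b s"
  note D = dilated_bump[OF s(1), where b = b]
  have bs: "ball b s \<subseteq> \<Omega>" using b s subset_ball[of s r b] by blast
  have tf: "test_function \<Omega> ?\<phi>" by (rule D(6)[OF bs])
  note S = open_sets_lebesgue[OF open_\<Omega>]
  have B0: "0 \<le> B" using B[of 0] norm_ge_zero order_trans by blast
  have gz: "grad ?\<phi> x = 0" if "x \<notin> A" "ball b s \<subseteq> A" for x A using D(4)[of x] that by blast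
  obtain B' where B': "continuous_on UNIV (grad ?\<phi>)" "\<And>x. norm (grad ?\<phi> x) \<le> B'"
    using grad_test_function[OF tf] by blast
  let ?F = "\<lambda>x. g \<bullet> (Fh x *v grad ?\<phi> x)"
  have F0: "?F x = 0" if "x \<notin> \<Omega>" for x
  proof -
    have "x \<notin> ball b s" using bs that by blast
    then show ?thesis using D(4)[of x] by simp
  qed
  have "integrable (lebesgue_on \<Omega>) ?F" by (rule integrable_matrix_inner[OF Fh_integrable B'])
  then have Fi: "integrable lebesgue ?F" using integrable_lebesgue_on_support[OF S, of ?F] F0 by blast
  have Fs: "?F (b + s *\<^sub>R y) = (1 / s) * (g \<bullet> (Fh (b + s *\<^sub>R y) *v grad bump y))" for y
    unfolding D(2) using s(1) by (simp add: matrix_vector_mult_scaleR)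
  note aff = lebesgue_affine[OF _ Fi, of s b, unfolded Fs]
  have sn: "s \<noteq> 0" using s by simp
  show int: "integrable lebesgue (\<lambda>y. g \<bullet> (Fh (b + s *\<^sub>R y) *v grad bump y))"
    using integrable_mult_right[OF aff(1)[OF sn], of s] s by simp
  have "(LINT x|lebesgue_on \<Omega>. ?F x) = integral\<^sup>L lebesgue ?F"
    using F0 by (intro integral_lebesgue_on_support[OF S]) auto
  also have "\<dots> = s ^ CARD('n) * ((1 / s) * integral\<^sup>L lebesgue (\<lambda>y. g \<bullet> (Fh (b + s *\<^sub>R y) *v grad bump y)))"
    using aff(2)[OF sn] s by simp
  also have "\<dots> = s ^ (CARD('n) - 1) * integral\<^sup>L lebesgue (\<lambda>y. g \<bullet> (Fh (b + s *\<^sub>R y) *v grad bump y))"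
    using s by (cases "CARD('n)") auto
  finally have F_eq: "(LINT x|lebesgue_on \<Omega>. ?F x) =
    s ^ (CARD('n) - 1) * integral\<^sup>L lebesgue (\<lambda>y. g \<bullet> (Fh (b + s *\<^sub>R y) *v grad bump y))" .
  have "(LINT x|lebesgue_on \<Omega>. e x * norm (grad ?\<phi> x)) = integral\<^sup>L lebesgue (\<lambda>x. e x * norm (grad ?\<phi> x))"
    by (intro integral_lebesgue_on_support[OF S]) (simp add: gz[OF _ bs])
  also have "\<dots> = (LINT x|lebesgue_on (ball b r). e x * norm (grad ?\<phi> x))"
    by (intro integral_lebesgue_on_support[symmetric]) (simp_all add: gz[OF _ subset_ball[OF s(2)]])
  also have "\<dots> \<le> (LINT x|lebesgue_on (ball b r). B / s * e x)"
  proof (rule integral_mono')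
    show "integrable (lebesgue_on (ball b r)) (\<lambda>x. B / s * e x)" using integral_e_ball[OF b] by simp
    show "e x * norm (grad ?\<phi> x) \<le> B / s * e x" for x
    proof -
      have "norm (grad ?\<phi> x) \<le> B / s"
        unfolding D(2) norm_scaleR using s B by (simp add: divide_right_mono)
      from mult_left_mono[OF this e_nonneg[of x]] show ?thesis by (simp add: ac_simps)
    qed
    show "0 \<le> B / s * e x" for x using B0 s e_nonneg by simp
  qed
  also have "\<dots> = B / s * (LINT x|lebesgue_on (ball b r). e x)" by simp
  finally have e_le: "(LINT x|lebesgue_on \<Omega>. e x * norm (grad ?\<phi> x)) \<le> B / s * (LINT x|lebesgue_on (ball b r). e x)" .
  have "norm g * (LINT x|lebesgue_on \<Omega>. e x * norm (grad ?\<phi> x)) \<le> norm g * (B / s * (LINT x|lebesgue_on (ball b r). e x))"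
    using e_le by (intro mult_left_mono) auto
  then show "\<bar>(f \<bullet> g) * ?\<phi> x0 - s ^ (CARD('n) - 1) * integral\<^sup>L lebesgue (\<lambda>y. g \<bullet> (Fh (b + s *\<^sub>R y) *v grad bump y))\<bar>
      \<le> norm g * (B / s * (LINT x|lebesgue_on (ball b r). e x))"
    using residual[OF tf, of g] unfolding F_eq by linarith
qed

text \<open>The powers of the nodes are the factors s^(n-1) of \<open>dilated_test\<close> for s =
  node times r, the power of r being kept outside. By \<open>weight_poly\<close> this is the
  coefficient of t^l in t^(n-1) F(b + t r y), wherever F is one polynomial along the ray and M is
  large enough.\<close>

definition combined :: "nat \<Rightarrow> nat \<Rightarrow> real^'n \<Rightarrow> real \<Rightarrow> real^'n \<Rightarrow> real^'n^'n" where
  "combined M l b r y = (\<Sum>i\<le>M. (weight M l i * node M i ^ (CARD('n) - 1)) *\<^sub>R Fh (b + node M i *\<^sub>R (r *\<^sub>R y)))"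

lemma combined_test:
  assumes r: "0 < r" "ball b r \<subseteq> \<Omega>" and B: "\<And>y::real^'n. norm (grad bump y) \<le> B"
  shows "\<bar>(f \<bullet> g) * (\<Sum>i\<le>M. weight M l i * dilated_bump b (node M i * r) x0)
      - r ^ (CARD('n) - 1) * integral\<^sup>L lebesgue (\<lambda>y. g \<bullet> (combined M l b r y *v grad bump y))\<bar>
    \<le> norm g * ((B * (\<Sum>i\<le>M. \<bar>weight M l i\<bar> / node M i)) / r * (LINT x|lebesgue_on (ball b r). e x))"
proof -
  let ?n = "CARD('n) - 1" and ?w = "weight M l" and ?t = "node M"
  let ?e = "LINT x|lebesgue_on (ball b r). e x"
  let ?I = "\<lambda>i. integral\<^sup>L lebesgue (\<lambda>y. g \<bullet> (Fh (b + (?t i * r) *\<^sub>R y) *v grad bump y))"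
  have s: "0 < ?t i * r" "?t i * r \<le> r" if "i \<le> M" for i
    using node_pos[of M i] node_le_1[OF that] r by (auto simp: mult_left_le_one_le)
  note T = dilated_test[OF s r(2) B]
  have comb: "g \<bullet> (combined M l b r y *v v) = (\<Sum>i\<le>M. (?w i * ?t i ^ ?n) * (g \<bullet> (Fh (b + (?t i * r) *\<^sub>R y) *v v)))" for y v
  proof -
    have lin: "bounded_linear (\<lambda>A. g \<bullet> (A *v v))" for v :: "real^'n"
    proof -
      have "(\<lambda>A. g \<bullet> (A *v v)) = (\<lambda>A::real^'n^'n. A \<bullet> (\<chi> i j. g $ i * v $ j))" by (simp add: outer_inner)
      then show ?thesis by (simp add: bounded_linear_inner_left)
    qed
    show ?thesis unfolding combined_def
      by (simp add: linear_sum[OF bounded_linear.linear[OF lin]] linear_cmul[OF bounded_linear.linear[OF lin]])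
  qed
  have "r ^ ?n * integral\<^sup>L lebesgue (\<lambda>y. g \<bullet> (combined M l b r y *v grad bump y)) =
      r ^ ?n * (\<Sum>i\<le>M. (?w i * ?t i ^ ?n) * ?I i)"
    unfolding comb using T(1) by (subst Bochner_Integration.integral_sum) auto
  also have "\<dots> = (\<Sum>i\<le>M. ?w i * ((?t i * r) ^ ?n * ?I i))"
    by (simp add: sum_distrib_left power_mult_distrib ac_simps)
  finally have I_eq: "r ^ ?n * integral\<^sup>L lebesgue (\<lambda>y. g \<bullet> (combined M l b r y *v grad bump y)) =
      (\<Sum>i\<le>M. ?w i * ((?t i * r) ^ ?n * ?I i))" .
  have "\<bar>(f \<bullet> g) * (\<Sum>i\<le>M. ?w i * dilated_bump b (?t i * r) x0)
      - r ^ ?n * integral\<^sup>L lebesgue (\<lambda>y. g \<bullet> (combined M l b r y *v grad bump y))\<bar> =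
      \<bar>\<Sum>i\<le>M. ?w i * ((f \<bullet> g) * dilated_bump b (?t i * r) x0 - (?t i * r) ^ ?n * ?I i)\<bar>"
    unfolding I_eq by (rule arg_cong[OF sum_weighted_diff])
  also have "\<dots> \<le> (\<Sum>i\<le>M. \<bar>?w i\<bar> * (norm g * (B / (?t i * r) * ?e)))"
  proof (rule order_trans[OF sum_abs], rule sum_mono)
    fix i assume "i \<in> {..M}"
    then show "\<bar>?w i * ((f \<bullet> g) * dilated_bump b (?t i * r) x0 - (?t i * r) ^ ?n * ?I i)\<bar>
      \<le> \<bar>?w i\<bar> * (norm g * (B / (?t i * r) * ?e))"
      unfolding abs_mult[of "?w i"] using T(2)[of i] by (intro mult_left_mono) auto
  qed
  also have "\<dots> = norm g * ((B * (\<Sum>i\<le>M. \<bar>?w i\<bar> / ?t i)) / r * ?e)"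
    by (rule sum_weighted_const)
  finally show ?thesis .
qed

lemma mean_bound:
  assumes b: "0 < r" "ball b r \<subseteq> A" and A: "A \<subseteq> \<Omega>" "A \<in> sets lebesgue"
    and M: "0 < M" and X: "0 \<le> X" "X * r ^ CARD('n) \<le> M * (LINT x|lebesgue_on (ball b r). e x)"
  shows "X powr p * r ^ CARD('n) \<le>
    2 * M * (2 * M * unit_ball_vol (real CARD('n))) powr (p - 1) * (LINT x|lebesgue_on A. e x powr p)"
proof -
  have sub: "ball b r \<subseteq> \<Omega>" using b A by blast
  have L: "Lp p (ball b r) e" using Lp_subset[OF e_Lp sub] lmeasurable_\<Omega> by (simp add: fmeasurableD)
  have m: "measure lebesgue (ball b r) \<le> unit_ball_vol (real CARD('n)) * r ^ CARD('n)"
    using content_ball[of r b] b by simp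
  have "X powr p * r ^ CARD('n) \<le>
    2 * M * (2 * M * unit_ball_vol (real CARD('n))) powr (p - 1) * (LINT x|lebesgue_on (ball b r). e x powr p)"
    by (rule mean_bound_imp_powr_bound[OF p _ m b(1) _ M X(1) e_nonneg _ _ X(2)])
      (use L in \<open>auto simp: Lp_def e_nonneg\<close>)
  also have "\<dots> \<le> 2 * M * (2 * M * unit_ball_vol (real CARD('n))) powr (p - 1) * (LINT x|lebesgue_on A. e x powr p)"
  proof (intro mult_left_mono)
    have LA: "Lp p A e" using Lp_subset[OF e_Lp A] lmeasurable_\<Omega> by (simp add: fmeasurableD)
    have "(LINT x|lebesgue_on (ball b r). e x powr p) = integral\<^sup>L lebesgue (\<lambda>x. if x \<in> ball b r then e x powr p else 0)"
      by (rule Lebesgue_Measure.integral_restrict_UNIV[symmetric]) simp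
    also have "\<dots> \<le> integral\<^sup>L lebesgue (\<lambda>x. if x \<in> A then e x powr p else 0)"
    proof (rule integral_mono')
      show "integrable lebesgue (\<lambda>x. if x \<in> A then e x powr p else 0)"
        using LA Lebesgue_Measure.integrable_restrict_UNIV[OF A(2), of "\<lambda>x. e x powr p"] by (simp add: Lp_def e_nonneg)
    qed (use b(2) in auto)
    also have "\<dots> = (LINT x|lebesgue_on A. e x powr p)"
      by (rule Lebesgue_Measure.integral_restrict_UNIV[OF A(2)])
    finally show "(LINT x|lebesgue_on (ball b r). e x powr p) \<le> (LINT x|lebesgue_on A. e x powr p)" .
  qed (use M in auto)
  finally show ?thesis .
qed

end

lemma integral_cong_AE_lebesgue:
  fixes f g :: "'a::euclidean_space \<Rightarrow> 'b::euclidean_space"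
  assumes "AE x in lebesgue. f x = g x"
  shows "integral\<^sup>L lebesgue f = integral\<^sup>L lebesgue g"
  using integral_cong_AE_on[of UNIV f g] AE_lebesgue_on_iff[of UNIV "\<lambda>x. f x = g x"] assms
  by (simp add: lebesgue_on_UNIV_eq)

lemma integral_triple_sum:
  fixes c :: "'i \<Rightarrow> 'j \<Rightarrow> 'l \<Rightarrow> real" and h :: "'j \<Rightarrow> 'l \<Rightarrow> 'a \<Rightarrow> real"
  assumes "\<And>j l. integrable M (h j l)"
  shows "integral\<^sup>L M (\<lambda>y. \<Sum>i\<in>A. \<Sum>j\<in>B. \<Sum>l\<in>C. c i j l * h j l y) =
    (\<Sum>i\<in>A. \<Sum>j\<in>B. \<Sum>l\<in>C. c i j l * integral\<^sup>L M (h j l))"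
proof -
  have 1: "integrable M (\<lambda>y. c i j l * h j l y)" for i j l using assms by simp
  have 2: "integrable M (\<lambda>y. \<Sum>l\<in>C. c i j l * h j l y)" for i j
    by (rule Bochner_Integration.integrable_sum[OF 1])
  have 3: "integrable M (\<lambda>y. \<Sum>j\<in>B. \<Sum>l\<in>C. c i j l * h j l y)" for i
    by (rule Bochner_Integration.integrable_sum[OF 2])
  show ?thesis
    unfolding Bochner_Integration.integral_sum[OF 3] Bochner_Integration.integral_sum[OF 2]
      Bochner_Integration.integral_sum[OF 1] by simp
qed

lemma line_coeffs:
  fixes f :: "real^'n \<Rightarrow> real"
  assumes f: "smooth f" and p: "\<And>t. f (b + t *\<^sub>R y) = poly p t"
  shows "coeff p 0 = f b" "coeff p 1 = (\<Sum>l\<in>UNIV. y $ l * partial l f b)"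
proof -
  show "coeff p 0 = f b" using p[of 0] by (simp add: poly_0_coeff_0)
  have "((\<lambda>t. b + t *\<^sub>R y) has_derivative (\<lambda>h. h *\<^sub>R y)) (at 0)" by (auto intro!: derivative_eq_intros)
  moreover have "(f has_derivative (\<lambda>h. \<Sum>l\<in>UNIV. h $ l *\<^sub>R partial l f b)) (at (b + 0 *\<^sub>R y))"
    using has_derivative_partial[OF smooth_differentiable[OF f, of b]] by simp
  ultimately have "((\<lambda>t. f (b + t *\<^sub>R y)) has_derivative (\<lambda>h. \<Sum>l\<in>UNIV. (h *\<^sub>R y) $ l *\<^sub>R partial l f b)) (at 0)"
    by (rule has_derivative_compose)
  then have "((\<lambda>t. poly p t) has_derivative (\<lambda>h. (\<Sum>l\<in>UNIV. y $ l * partial l f b) * h)) (at 0)"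
    unfolding p by (simp add: sum_distrib_left sum_distrib_right ac_simps)
  then have "(poly p has_real_derivative (\<Sum>l\<in>UNIV. y $ l * partial l f b)) (at 0)"
    by (simp add: has_field_derivative_def)
  then have "(\<Sum>l\<in>UNIV. y $ l * partial l f b) = poly (pderiv p) 0"
    using DERIV_unique poly_DERIV by blast
  then show "coeff p 1 = (\<Sum>l\<in>UNIV. y $ l * partial l f b)"
    by (simp add: poly_0_coeff_0 coeff_pderiv)
qed

lemma grad_bump_eq_0: "y \<notin> ball 0 1 \<Longrightarrow> grad bump y = 0"
  unfolding grad_def partial_bump using bump_eq_0(2)[of y] by (simp add: vec_eq_iff)

text \<open>Integration by parts against a coordinate function. Contracted with the derivatives of
  F, the Kronecker delta leaves the divergence.\<close>

lemma integral_component_partial_bump: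
  fixes j l :: "'n::finite"
  shows "integrable lebesgue (\<lambda>y::real^'n. y $ l * partial j bump y)"
    "integral\<^sup>L lebesgue (\<lambda>y::real^'n. y $ l * partial j bump y) = (if j = l then - integral\<^sup>L lebesgue (bump::real^'n \<Rightarrow> real) else 0)"
proof -
  have b: "bump x = 0" if "x \<notin> ball 0 1" for x :: "real^'n" using bump_eq_0(1)[of x] that by simp
  note P = integral_by_parts[where j = j and K = "ball 0 1", OF smooth_component[of l] smooth_bump b bounded_ball]
  show "integrable lebesgue (\<lambda>y::real^'n. y $ l * partial j bump y)" by (rule P(2))
  have "partial j (\<lambda>y::real^'n. y $ l) x = (if j = l then 1 else 0)" for x
    using partial_eq[OF bounded_linear_imp_has_derivative[OF bounded_linear_vec_nth[of l]], of j x]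
    by (simp add: axis_def)
  then show "integral\<^sup>L lebesgue (\<lambda>y::real^'n. y $ l * partial j bump y) = (if j = l then - integral\<^sup>L lebesgue (bump::real^'n \<Rightarrow> real) else 0)"
    using P(1) by simp
qed

text \<open>For tests whose vector g is the quantity V to be bounded: one factor norm V
  cancels.\<close>

lemma inner_mult_self_le:
  fixes V :: "'a::real_inner"
  assumes "a * (V \<bullet> V) \<le> norm V * c" "0 \<le> c" "0 \<le> a"
  shows "a * norm V \<le> c"
proof (cases "V = 0")
  case False
  have "norm V * (a * norm V) \<le> norm V * c"
    using assms(1) by (simp add: power2_norm_eq_inner[symmetric] power2_eq_square ac_simps)
  then show ?thesis using False by simp
qed (use assms in simp)

section \<open>Pointwise bounds for the divergence, the jump and the source\<close>

context fat_residual
begin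

text \<open>All the bumps vanish at x0, so the source drops out.\<close>

lemma combined_test_far:
  assumes r: "0 < r" "ball b r \<subseteq> \<Omega>" and B: "\<And>y::real^'n. norm (grad bump y) \<le> B"
    and x0: "x0 \<notin> ball b r" and W: "B * (\<Sum>i\<le>M. \<bar>weight M l i\<bar> / node M i) \<le> W"
  shows "r ^ (CARD('n) - 1) * \<bar>integral\<^sup>L lebesgue (\<lambda>y. g \<bullet> (combined M l b r y *v grad bump y))\<bar>
    \<le> norm g * (W / r * (LINT x|lebesgue_on (ball b r). e x))"
proof -
  have "dilated_bump b (node M i * r) x0 = 0" if "i \<le> M" for i
  proof -
    have "node M i * r \<le> 1 * r" using node_le_1[OF that] r by (intro mult_right_mono) auto
    then have "x0 \<notin> ball b (node M i * r)" using x0 by auto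
    then show ?thesis using dilated_bump(3)[of "node M i * r" x0 b] node_pos[of M i] r by simp
  qed
  then have "(\<Sum>i\<le>M. weight M l i * dilated_bump b (node M i * r) x0) = 0" by simp
  then have "\<bar>r ^ (CARD('n) - 1) * integral\<^sup>L lebesgue (\<lambda>y. g \<bullet> (combined M l b r y *v grad bump y))\<bar>
    \<le> norm g * ((B * (\<Sum>i\<le>M. \<bar>weight M l i\<bar> / node M i)) / r * (LINT x|lebesgue_on (ball b r). e x))"
    using combined_test[OF r B, of g M l] by simp
  also have "\<dots> \<le> norm g * (W / r * (LINT x|lebesgue_on (ball b r). e x))"
    using W r e_nonneg by (intro mult_left_mono mult_right_mono divide_right_mono) auto
  finally show ?thesis using r by (simp add: abs_mult)
qed

lemma combined_entry:
  assumes m: "line_poly K (\<lambda>x. m x $ i $ j)" and M: "CARD('n) - 1 + K \<le> M"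
    and eq: "\<And>i. i \<le> M \<Longrightarrow> Fh (b + node M i *\<^sub>R (r *\<^sub>R y)) = m (b + node M i *\<^sub>R (r *\<^sub>R y))"
  obtains q where "degree q \<le> K" "\<And>t. m (b + t *\<^sub>R (r *\<^sub>R y)) $ i $ j = poly q t"
    "combined M l b r y $ i $ j = (if l < CARD('n) - 1 then 0 else coeff q (l - (CARD('n) - 1)))"
proof -
  obtain q where q: "degree q \<le> K" "\<And>t. m (b + t *\<^sub>R (r *\<^sub>R y)) $ i $ j = poly q t"
    using line_polyD[OF m] by blast
  have "combined M l b r y $ i $ j =
    (\<Sum>i'\<le>M. weight M l i' * node M i' ^ (CARD('n) - 1) * poly q (node M i'))"
    unfolding combined_def using eq q(2) by simp
  then show thesis using that[OF q] weight_poly[OF q(1) M, of l] by simp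
qed

text \<open>For l = n the combination is the derivative of F at b in direction r y. Integrated
  against the gradient of the bump it gives, by \<open>integral_component_partial_bump\<close>, -r
  times the integral of the bump times the divergence D of F at b. The test vector is D
  itself.\<close>

lemma interior_point_bound:
  assumes T: "T \<in> \<T>" and m: "\<And>i j. smooth_line_poly K (\<lambda>x. m x $ i $ j)" "\<And>x. x \<in> interior T \<Longrightarrow> Fh x = m x"
    and r: "0 < r" "ball b r \<subseteq> interior T" and x0: "x0 \<notin> ball b r"
    and B: "\<And>y::real^'n. norm (grad bump y) \<le> B"
    and W: "B * (\<Sum>i\<le>M. \<bar>weight M (CARD('n)) i\<bar> / node M i) \<le> W" and M: "CARD('n) - 1 + K \<le> M"
  shows "norm (r *\<^sub>R (\<chi> i. \<Sum>j\<in>UNIV. partial j (\<lambda>x. m x $ i $ j) b)) * r ^ CARD('n) \<le>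
    W / integral\<^sup>L lebesgue (bump :: real^'n \<Rightarrow> real) * (LINT x|lebesgue_on (ball b r). e x)"
proof -
  let ?\<beta> = "integral\<^sup>L lebesgue (bump :: real^'n \<Rightarrow> real)" and ?e = "LINT x|lebesgue_on (ball b r). e x"
  define D where "D = (\<chi> i. \<Sum>j\<in>UNIV. partial j (\<lambda>x. m x $ i $ j) b)"
  define a where "a i j l = partial l (\<lambda>x. m x $ i $ j) b" for i j l
  have \<beta>: "0 < ?\<beta>" by (rule integral_bump_pos)
  have n1: "CARD('n) - 1 < CARD('n)" "CARD('n) - (CARD('n) - 1) = 1" using dim by auto
  have entry: "combined M (CARD('n)) b r y $ i $ j = (\<Sum>l\<in>UNIV. r * y $ l * a i j l)"
    if y: "y \<in> ball 0 1" for y i j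
  proof -
    have "Fh (b + node M i *\<^sub>R (r *\<^sub>R y)) = m (b + node M i *\<^sub>R (r *\<^sub>R y))" if "i \<le> M" for i
    proof (rule m(2))
      have "norm (node M i *\<^sub>R (r *\<^sub>R y)) = node M i * (r * norm y)"
        using node_pos[of M i] r by (simp add: abs_mult)
      also have "\<dots> \<le> 1 * (r * norm y)" using node_le_1[OF that] r by (intro mult_right_mono) auto
      also have "\<dots> < r" using y r by simp
      finally have "b + node M i *\<^sub>R (r *\<^sub>R y) \<in> ball b r" by (simp add: dist_norm)
      then show "b + node M i *\<^sub>R (r *\<^sub>R y) \<in> interior T" using r(2) by blast
    qed
    from combined_entry[OF _ M this, of i j "CARD('n)"] m(1)[of i j]
    obtain q where q: "\<And>t. m (b + t *\<^sub>R (r *\<^sub>R y)) $ i $ j = poly q t"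
      "combined M (CARD('n)) b r y $ i $ j = (if CARD('n) < CARD('n) - 1 then 0 else coeff q (CARD('n) - (CARD('n) - 1)))"
      unfolding smooth_line_poly_def by metis
    have "combined M (CARD('n)) b r y $ i $ j = coeff q 1" using q(2) n1 by simp
    also have "\<dots> = (\<Sum>l\<in>UNIV. (r *\<^sub>R y) $ l * a i j l)"
      unfolding a_def by (rule line_coeffs(2)[OF _ q(1)]) (use m(1) in \<open>simp add: smooth_line_poly_def\<close>)
    finally show ?thesis by simp
  qed
  have int: "integral\<^sup>L lebesgue (\<lambda>y. D \<bullet> (combined M (CARD('n)) b r y *v grad bump y)) = - (r * ?\<beta> * (D \<bullet> D))"
  proof -
    have "D \<bullet> (combined M (CARD('n)) b r y *v grad bump y) =
      (\<Sum>i\<in>UNIV. \<Sum>j\<in>UNIV. \<Sum>l\<in>UNIV. (D $ i * r * a i j l) * (y $ l * partial j bump y))" for y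
    proof (cases "y \<in> ball 0 1")
      case True
      have "D \<bullet> (combined M (CARD('n)) b r y *v grad bump y) =
        (\<Sum>i\<in>UNIV. D $ i * (\<Sum>j\<in>UNIV. (\<Sum>l\<in>UNIV. r * y $ l * a i j l) * partial j bump y))"
        by (simp add: inner_vec_def matrix_vector_mult_def grad_def entry[OF True])
      then show ?thesis by (simp add: sum_distrib_left sum_distrib_right ac_simps)
    next
      case False
      then have "grad bump y = 0" by (rule grad_bump_eq_0)
      moreover from this have "partial j bump y = 0" for j by (metis grad_def vec_lambda_beta zero_index)
      ultimately show ?thesis by simp
    qed
    then have "integral\<^sup>L lebesgue (\<lambda>y. D \<bullet> (combined M (CARD('n)) b r y *v grad bump y)) =
      integral\<^sup>L lebesgue (\<lambda>y. \<Sum>i\<in>UNIV. \<Sum>j\<in>UNIV. \<Sum>l\<in>UNIV. (D $ i * r * a i j l) * (y $ l * partial j bump y))"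
      by (simp only:)
    also have "\<dots> = (\<Sum>i\<in>UNIV. \<Sum>j\<in>UNIV. \<Sum>l\<in>UNIV. (D $ i * r * a i j l) * integral\<^sup>L lebesgue (\<lambda>y. y $ l * partial j bump y))"
      by (rule integral_triple_sum[OF integral_component_partial_bump(1)])
    also have "\<dots> = (\<Sum>i\<in>UNIV. \<Sum>j\<in>UNIV. \<Sum>l\<in>UNIV. if j = l then - (D $ i * r * a i j l * ?\<beta>) else 0)"
      unfolding integral_component_partial_bump(2) by (intro sum.cong refl) auto
    also have "\<dots> = (\<Sum>i\<in>UNIV. \<Sum>j\<in>UNIV. - (D $ i * r * a i j j * ?\<beta>))" by simp
    also have "\<dots> = - (r * ?\<beta> * (\<Sum>i\<in>UNIV. D $ i * (\<Sum>j\<in>UNIV. a i j j)))"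
      by (simp add: sum_distrib_left sum_negf ac_simps)
    also have "(\<Sum>i\<in>UNIV. D $ i * (\<Sum>j\<in>UNIV. a i j j)) = D \<bullet> D" by (simp add: inner_vec_def D_def a_def)
    finally show ?thesis .
  qed
  have sub: "ball b r \<subseteq> \<Omega>" using r(2) interior_element_subset[OF T] by blast
  have e0: "0 \<le> ?e" using e_nonneg by simp
  have B0: "0 \<le> B" using B[of 0] norm_ge_zero order_trans by blast
  have "0 \<le> B * (\<Sum>i\<le>M. \<bar>weight M (CARD('n)) i\<bar> / node M i)"
    using B0 node_pos[of M] by (intro mult_nonneg_nonneg sum_nonneg divide_nonneg_pos) auto
  then have W0: "0 \<le> W" using W by linarith
  have "r ^ (CARD('n) - 1) * (r * ?\<beta> * (D \<bullet> D)) \<le> norm D * (W / r * ?e)"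
    using combined_test_far[OF r(1) sub B x0 W, of D] r(1) \<beta> unfolding int by (simp add: abs_mult)
  then have "(r ^ (CARD('n) - 1) * (r * ?\<beta>)) * norm D \<le> W / r * ?e"
    using r(1) \<beta> W0 e0 by (intro inner_mult_self_le) (auto simp: ac_simps)
  moreover have rn: "r ^ (CARD('n) - 1) * r = r ^ CARD('n)" using dim by (simp add: power_eq_if)
  ultimately have "r ^ CARD('n) * ?\<beta> * norm D \<le> W / r * ?e" by (simp add: mult.assoc[symmetric])
  then have "r * (r ^ CARD('n) * ?\<beta> * norm D) \<le> W * ?e"
    using mult_left_mono[of _ "W / r * ?e" r] r(1) by fastforce
  then have "(r * norm D * r ^ CARD('n)) * ?\<beta> \<le> W * ?e" by (simp add: ac_simps)
  then have "r * norm D * r ^ CARD('n) \<le> W * ?e / ?\<beta>" using \<beta> by (simp add: pos_le_divide_eq)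
  then show ?thesis using r(1) by (simp add: D_def)
qed

text \<open>For l = n - 1 the combination is the constant part: m b on one half of the ball, m' b on
  the other. By \<open>halfspace_integral_grad_bump\<close> the halves contribute opposite multiples
  of m b and m' b applied to \<nu>. The test vector is the jump J itself.\<close>

lemma side_point_bound:
  assumes \<nu>: "norm \<nu> = 1" and m: "\<And>i j. smooth_line_poly K (\<lambda>x. m x $ i $ j)" "\<And>i j. smooth_line_poly K (\<lambda>x. m' x $ i $ j)"
    and eq: "\<And>x. x \<in> ball b r \<Longrightarrow> 0 < (x - b) \<bullet> \<nu> \<Longrightarrow> Fh x = m x"
      "\<And>x. x \<in> ball b r \<Longrightarrow> (x - b) \<bullet> \<nu> < 0 \<Longrightarrow> Fh x = m' x"
    and r: "0 < r" "ball b r \<subseteq> \<Omega>" and x0: "x0 \<notin> ball b r"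
    and B: "\<And>y::real^'n. norm (grad bump y) \<le> B"
    and W: "B * (\<Sum>i\<le>M. \<bar>weight M (CARD('n) - 1) i\<bar> / node M i) \<le> W" and M: "CARD('n) - 1 + K \<le> M"
    and c: "0 < c" "\<And>\<nu>::real^'n. norm \<nu> = 1 \<Longrightarrow>
      c \<le> integral\<^sup>L lebesgue (\<lambda>y. indicator {y. 0 < y \<bullet> \<nu>} y * (bump_slope y * (y \<bullet> \<nu>)))"
  shows "norm ((m b - m' b) *v \<nu>) * r ^ CARD('n) \<le> W / c * (LINT x|lebesgue_on (ball b r). e x)"
proof -
  let ?e = "LINT x|lebesgue_on (ball b r). e x"
  define J where "J = (m b - m' b) *v \<nu>"
  define C where "C \<mu> = integral\<^sup>L lebesgue (\<lambda>y::real^'n. indicator {y. 0 < y \<bullet> \<mu>} y * (bump_slope y * (y \<bullet> \<mu>)))" for \<mu>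
  \<comment> \<open>Equal constants for both halves make the contributions combine to a
    difference.\<close>
  have Cm: "C (- \<nu>) = C \<nu>"
    using halfspace_integral_normal[of \<nu>] halfspace_integral_normal[of "- \<nu>"] by (simp add: C_def)
  have cC: "c \<le> C \<nu>" using c(2)[OF \<nu>] by (simp add: C_def)
  have inb: "b + node M i *\<^sub>R (r *\<^sub>R y) \<in> ball b r" if "i \<le> M" "y \<in> ball 0 1" for i y
  proof -
    have "norm (node M i *\<^sub>R (r *\<^sub>R y)) = node M i * (r * norm y)"
      using node_pos[of M i] r by (simp add: abs_mult)
    also have "\<dots> \<le> 1 * (r * norm y)" using node_le_1[OF that(1)] r by (intro mult_right_mono) auto
    also have "\<dots> < r" using that(2) r by simp
    finally show ?thesis by (simp add: dist_norm)
  qed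
  have comb: "combined M (CARD('n) - 1) b r y = m'' b"
    if y: "y \<in> ball 0 1" and m'': "\<And>i j. smooth_line_poly K (\<lambda>x. m'' x $ i $ j)"
      and F: "\<And>i. i \<le> M \<Longrightarrow> Fh (b + node M i *\<^sub>R (r *\<^sub>R y)) = m'' (b + node M i *\<^sub>R (r *\<^sub>R y))" for y m''
  proof -
    have "combined M (CARD('n) - 1) b r y $ i $ j = m'' b $ i $ j" for i j
    proof -
      from combined_entry[OF _ M F, of i j "CARD('n) - 1"] m''[of i j]
      obtain q where q: "\<And>t. m'' (b + t *\<^sub>R (r *\<^sub>R y)) $ i $ j = poly q t"
        "combined M (CARD('n) - 1) b r y $ i $ j = coeff q 0"
        unfolding smooth_line_poly_def by (metis diff_self_eq_0 less_irrefl)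
      then show ?thesis using line_coeffs(1)[OF _ q(1)] m''[of i j] by (simp add: smooth_line_poly_def)
    qed
    then show ?thesis by (simp add: vec_eq_iff)
  qed
  have pos: "combined M (CARD('n) - 1) b r y = m b" if y: "y \<in> ball 0 1" "0 < y \<bullet> \<nu>" for y
    by (rule comb[OF y(1) m(1)], rule eq(1)[OF inb[OF _ y(1)]])
      (use y(2) r node_pos[of M] in simp_all)
  have neg: "combined M (CARD('n) - 1) b r y = m' b" if y: "y \<in> ball 0 1" "y \<bullet> \<nu> < 0" for y
    by (rule comb[OF y(1) m(2)], rule eq(2)[OF inb[OF _ y(1)]])
      (use y(2) r node_pos[of M] in \<open>simp_all add: mult_less_0_iff zero_less_mult_iff\<close>)
  have vm: "J \<bullet> (A *v v) = v \<bullet> (J v* A)" for A v by (metis dot_lmul_matrix inner_commute)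
  let ?p = "\<lambda>y. indicator {y. 0 < y \<bullet> \<nu>} y * (grad bump y \<bullet> (J v* m b))"
  let ?q = "\<lambda>y. indicator {y. 0 < y \<bullet> - \<nu>} y * (grad bump y \<bullet> (J v* m' b))"
  have gi: "integrable lebesgue (\<lambda>y. indicator {y. 0 < y \<bullet> \<mu>} y * (grad bump y \<bullet> \<tau>))" for \<mu> \<tau> :: "real^'n"
  proof -
    have "integrable lebesgue (\<lambda>y::real^'n. grad bump y \<bullet> \<tau>)"
    proof (rule integrable_lebesgue_compact_support[OF _ _ bounded_ball])
      show "continuous_on UNIV (\<lambda>y::real^'n. grad bump y \<bullet> \<tau>)"
        unfolding grad_def by (intro continuous_intros continuous_partial_bump)
      show "grad bump y \<bullet> \<tau> = 0" if "y \<notin> ball 0 1" for y using grad_bump_eq_0[OF that] by simp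
    qed
    from integrable_mult_indicator[OF halfspace_sets this] show ?thesis by simp
  qed
  \<comment> \<open>On the plane between the halves neither polynomial is prescribed, but this plane
    is a null set.\<close>
  have "\<nu> \<noteq> 0" using \<nu> by auto
  then have "negligible {y. \<nu> \<bullet> y = 0}" by (intro negligible_hyperplane) simp
  then have "AE y in lebesgue. y \<notin> {y. \<nu> \<bullet> y = 0}"
    by (intro AE_not_in) (simp add: negligible_iff_null_sets)
  then have "AE y in lebesgue. J \<bullet> (combined M (CARD('n) - 1) b r y *v grad bump y) = ?p y + ?q y"
  proof eventually_elim
    case (elim y)
    show ?case
    proof (cases "y \<in> ball 0 1")
      case True
      show ?thesis
      proof (cases "0 < y \<bullet> \<nu>")
        case pos': True
        then show ?thesis using pos[OF True pos'] by (simp add: vm)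
      next
        case False
        then have "y \<bullet> \<nu> < 0" using elim by (simp add: inner_commute)
        then show ?thesis using neg[OF True] by (simp add: vm)
      qed
    next
      case False
      then show ?thesis using grad_bump_eq_0[OF False] by simp
    qed
  qed
  then have "integral\<^sup>L lebesgue (\<lambda>y. J \<bullet> (combined M (CARD('n) - 1) b r y *v grad bump y)) =
      integral\<^sup>L lebesgue (\<lambda>y. ?p y + ?q y)" by (rule integral_cong_AE_lebesgue)
  also have "\<dots> = integral\<^sup>L lebesgue ?p + integral\<^sup>L lebesgue ?q"
    by (rule Bochner_Integration.integral_add[OF gi gi])
  also have "integral\<^sup>L lebesgue ?p = - C \<nu> * (\<nu> \<bullet> (J v* m b))"
    unfolding C_def by (rule halfspace_integral_grad_bump[OF \<nu>])
  also have "integral\<^sup>L lebesgue ?q = - C (- \<nu>) * ((- \<nu>) \<bullet> (J v* m' b))"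
    unfolding C_def by (rule halfspace_integral_grad_bump) (use \<nu> in simp)
  also have "- C \<nu> * (\<nu> \<bullet> (J v* m b)) + - C (- \<nu>) * ((- \<nu>) \<bullet> (J v* m' b)) = - (C \<nu> * (J \<bullet> J))"
  proof -
    have "\<nu> \<bullet> (J v* A) = J \<bullet> (A *v \<nu>)" for A by (metis dot_lmul_matrix inner_commute)
    then show ?thesis
      unfolding Cm by (simp add: J_def matrix_vector_mult_diff_rdistrib inner_diff_right right_diff_distrib)
  qed
  finally have int: "integral\<^sup>L lebesgue (\<lambda>y. J \<bullet> (combined M (CARD('n) - 1) b r y *v grad bump y)) = - (C \<nu> * (J \<bullet> J))" .
  have e0: "0 \<le> ?e" using e_nonneg by simp
  have B0: "0 \<le> B" using B[of 0] norm_ge_zero order_trans by blast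
  have "0 \<le> B * (\<Sum>i\<le>M. \<bar>weight M (CARD('n) - 1) i\<bar> / node M i)"
    using B0 node_pos[of M] by (intro mult_nonneg_nonneg sum_nonneg divide_nonneg_pos) auto
  then have W0: "0 \<le> W" using W by linarith
  have "r ^ (CARD('n) - 1) * (c * (J \<bullet> J)) \<le> r ^ (CARD('n) - 1) * (C \<nu> * (J \<bullet> J))"
    using cC r(1) by (intro mult_left_mono mult_right_mono) auto
  also have "\<dots> \<le> norm J * (W / r * ?e)"
    using combined_test_far[OF r B x0 W, of J] c(1) cC unfolding int by (simp add: abs_mult)
  finally have "(r ^ (CARD('n) - 1) * c) * norm J \<le> W / r * ?e"
    using r(1) c(1) W0 e0 by (intro inner_mult_self_le) (auto simp: ac_simps)
  then have "r * ((r ^ (CARD('n) - 1) * c) * norm J) \<le> W * ?e"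
    using mult_left_mono[of _ "W / r * ?e" r] r(1) by fastforce
  moreover have rn: "r ^ CARD('n) = r * r ^ (CARD('n) - 1)" using dim by (simp add: power_eq_if)
  ultimately have "(norm J * r ^ CARD('n)) * c \<le> W * ?e" unfolding rn by (simp add: ac_simps)
  then have "norm J * r ^ CARD('n) \<le> W * ?e / c" using c(1) by (simp add: pos_le_divide_eq)
  then show ?thesis by (simp add: J_def)
qed

text \<open>The boundaries of the elements form a null set, which the inverse dilation maps to a
  null set.\<close>

lemma AE_interior_element:
  assumes r: "0 < r" "ball b r \<subseteq> \<Omega>"
  shows "AE y in lebesgue. y \<in> ball 0 1 \<longrightarrow> (\<exists>T\<in>\<T>. b + r *\<^sub>R y \<in> interior T)"
proof -
  define N where "N = (\<Union>T\<in>\<T>. frontier T)"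
  have "negligible N" unfolding N_def
    using finite_mesh element_topology(3) by (intro negligible_Union) (auto intro: negligible_convex_frontier)
  then have "negligible ((\<lambda>x. (1 / r) *\<^sub>R (x - b)) ` N)"
  proof (rule negligible_locally_Lipschitz_image[OF order_refl])
    fix x
    show "\<exists>T B. open T \<and> x \<in> T \<and> (\<forall>y\<in>N \<inter> T. norm ((1 / r) *\<^sub>R (y - b) - (1 / r) *\<^sub>R (x - b)) \<le> B * norm (y - x))"
    proof (intro exI[of _ UNIV] exI[of _ "1 / r"] conjI ballI)
      fix y
      have "(1 / r) *\<^sub>R (y - b) - (1 / r) *\<^sub>R (x - b) = (1 / r) *\<^sub>R (y - x)" by (simp add: scaleR_diff_right)
      then show "norm ((1 / r) *\<^sub>R (y - b) - (1 / r) *\<^sub>R (x - b)) \<le> 1 / r * norm (y - x)" using r(1) by simp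
    qed auto
  qed
  then have "AE y in lebesgue. y \<notin> (\<lambda>x. (1 / r) *\<^sub>R (x - b)) ` N"
    by (intro AE_not_in) (simp add: negligible_iff_null_sets)
  then show ?thesis
  proof eventually_elim
    case (elim y)
    show ?case
    proof
      assume "y \<in> ball 0 1"
      then have "b + r *\<^sub>R y \<in> ball b r" using r(1) by (simp add: dist_norm)
      then have "b + r *\<^sub>R y \<in> \<Union>\<T>" using r(2) Union_mesh closure_subset by blast
      then obtain T where T: "T \<in> \<T>" "b + r *\<^sub>R y \<in> T" by blast
      have "b + r *\<^sub>R y \<notin> N"
      proof
        assume "b + r *\<^sub>R y \<in> N"
        then have "(1 / r) *\<^sub>R ((b + r *\<^sub>R y) - b) \<in> (\<lambda>x. (1 / r) *\<^sub>R (x - b)) ` N" by blast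
        then show False using elim r(1) by simp
      qed
      then show "\<exists>T\<in>\<T>. b + r *\<^sub>R y \<in> interior T"
        using T element_topology(2)[OF T(1)] by (auto simp: N_def frontier_def)
    qed
  qed
qed

text \<open>With l = 0 and n at least 2, t^(n-1) F has no constant term, so the stress disappears
  whatever its values. Along almost every ray F is one polynomial, since an element near b contains
  b and is convex. The bumps are 1 at x0, so their weighted sum there is the zeroth moment, which is
  1. The left-hand side has the shape that \<open>mean_bound\<close> expects.\<close>

lemma source_point_bound:
  assumes r: "0 < r" "ball b r \<subseteq> \<Omega>" and d: "dist x0 b \<le> 1 / (2 * real (Suc M)) * r"
    and near: "\<And>T x. T \<in> \<T> \<Longrightarrow> x \<in> T \<Longrightarrow> x \<in> ball b r \<Longrightarrow> b \<in> T"
    and B: "\<And>y::real^'n. norm (grad bump y) \<le> B"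
    and W: "B * (\<Sum>i\<le>M. \<bar>weight M 0 i\<bar> / node M i) \<le> W" and M: "CARD('n) - 1 + K \<le> M"
  shows "norm f / r ^ (CARD('n) - 1) * r ^ CARD('n) \<le> W * (LINT x|lebesgue_on (ball b r). e x)"
proof -
  let ?e = "LINT x|lebesgue_on (ball b r). e x"
  have e0: "0 \<le> ?e" using e_nonneg by simp
  have "dilated_bump b (node M i * r) x0 = 1" if "i \<le> M" for i
  proof (rule dilated_bump(5))
    show "0 < node M i * r" using node_pos[of M i] r by simp
    \<comment> \<open>A bump of radius s equals 1 within s / 2 of its centre, and the smallest node
      is 1 / (M + 1); hence the factor 1 / (2 (M + 1)).\<close>
    have "dist x0 b \<le> 1 / real (Suc M) * (r / 2)" using d by (simp del: of_nat_Suc add: mult.commute)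
    also have "\<dots> \<le> node M i * (r / 2)" using node_ge[of M i] r by (intro mult_right_mono) auto
    also have "\<dots> = node M i * r / 2" by simp
    finally show "dist x0 b \<le> node M i * r / 2" .
  qed
  then have "(\<Sum>i\<le>M. weight M 0 i * dilated_bump b (node M i * r) x0) = (\<Sum>i\<le>M. weight M 0 i * node M i ^ 0)"
    by (intro sum.cong) auto
  also have "\<dots> = 1" using weight[of 0 M 0] by simp
  finally have sum1: "(\<Sum>i\<le>M. weight M 0 i * dilated_bump b (node M i * r) x0) = 1" .
  have "AE y in lebesgue. f \<bullet> (combined M 0 b r y *v grad bump y) = 0"
    using AE_interior_element[OF r]
  proof eventually_elim
    case (elim y)
    show ?case
    proof (cases "y \<in> ball 0 1")
      case True
      with elim obtain T where T: "T \<in> \<T>" "b + r *\<^sub>R y \<in> interior T" by blast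
      have "b + r *\<^sub>R y \<in> ball b r" using True r(1) by (simp add: dist_norm)
      then have bT: "b \<in> T" using near[OF T(1)] T(2) interior_subset by blast
      obtain m where m: "\<And>i j. smooth_line_poly K (\<lambda>x. m x $ i $ j)" "\<And>x. x \<in> interior T \<Longrightarrow> Fh x = m x"
        using Fh_poly[OF T(1)] by blast
      have F: "Fh (b + node M i *\<^sub>R (r *\<^sub>R y)) = m (b + node M i *\<^sub>R (r *\<^sub>R y))" if "i \<le> M" for i
      proof (rule m(2))
        have "b - node M i *\<^sub>R (b - (b + r *\<^sub>R y)) \<in> interior T"
          by (rule mem_interior_convex_shrink[OF element_topology(3)[OF T(1)] T(2) bT node_pos node_le_1[OF that]])
        then show "b + node M i *\<^sub>R (r *\<^sub>R y) \<in> interior T" by simp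
      qed
      have "combined M 0 b r y $ i $ j = 0" for i j
      proof -
        from combined_entry[OF _ M F, of i j 0] m(1)[of i j]
        show ?thesis unfolding smooth_line_poly_def using dim by (metis Suc_1 Suc_le_lessD zero_less_diff)
      qed
      then have "combined M 0 b r y = 0" by (simp add: vec_eq_iff)
      then show ?thesis by simp
    next
      case False
      then show ?thesis using grad_bump_eq_0[OF False] by simp
    qed
  qed
  then have "integral\<^sup>L lebesgue (\<lambda>y. f \<bullet> (combined M 0 b r y *v grad bump y)) = integral\<^sup>L lebesgue (\<lambda>y::real^'n. 0::real)"
    by (rule integral_cong_AE_lebesgue)
  then have "\<bar>f \<bullet> f\<bar> \<le> norm f * ((B * (\<Sum>i\<le>M. \<bar>weight M 0 i\<bar> / node M i)) / r * ?e)"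
    using combined_test[OF r B, of f M 0] sum1 by simp
  also have "\<dots> \<le> norm f * (W / r * ?e)"
    using W r e0 by (intro mult_left_mono mult_right_mono divide_right_mono) auto
  finally have "1 * (f \<bullet> f) \<le> norm f * (W / r * ?e)" by simp
  moreover have B0: "0 \<le> B" using B[of 0] norm_ge_zero order_trans by blast
  have "0 \<le> B * (\<Sum>i\<le>M. \<bar>weight M 0 i\<bar> / node M i)"
    using B0 node_pos[of M] by (intro mult_nonneg_nonneg sum_nonneg divide_nonneg_pos) auto
  then have W0: "0 \<le> W" using W by linarith
  ultimately have "1 * norm f \<le> W / r * ?e"
    using r(1) e0 by (intro inner_mult_self_le) auto
  then have "r * norm f \<le> W * ?e" using mult_left_mono[of "norm f" "W / r * ?e" r] r(1) by simp
  moreover have "r ^ CARD('n) = r * r ^ (CARD('n) - 1)" using dim by (simp add: power_eq_if)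
  ultimately show ?thesis using r(1) by (simp add: ac_simps)
qed

end

text \<open>X is the p-th root of Q / r^n. The components of V are bounded by X on the small ball
  and extrapolated along rays; summing them puts the dimension into the constant.\<close>

lemma extrapolated_bound:
  fixes V :: "real^'n \<Rightarrow> real^'n"
  assumes ext: "\<forall>(f::real^'n \<Rightarrow> real) b r X x. line_poly K f \<longrightarrow>
        (\<forall>z. norm (z - b) \<le> r \<longrightarrow> \<bar>f z\<bar> \<le> X) \<longrightarrow> norm (x - b) \<le> R * r \<longrightarrow> \<bar>f x\<bar> \<le> Cx * X"
    and Cx: "0 < Cx" and p: "0 < p"
    and V: "\<And>i. line_poly K (\<lambda>x. V x $ i)" and r: "0 < r"
    and bd: "\<And>b. dist b b0 \<le> r \<Longrightarrow> norm (V b) powr p * r ^ CARD('n) \<le> Q"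
    and x: "dist x b0 \<le> R * r"
  shows "norm (V x) powr p * r ^ CARD('n) \<le> (real CARD('n) * Cx) powr p * Q"
proof -
  define X where "X = (Q / r ^ CARD('n)) powr (1 / p)"
  have Q0: "0 \<le> Q" using bd[of b0] r by (smt (verit) dist_self mult_nonneg_nonneg powr_ge_zero zero_le_power)
  have rn: "0 < r ^ CARD('n)" using r by simp
  have le: "norm (V b) \<le> X" if "dist b b0 \<le> r" for b
  proof -
    have "norm (V b) powr p \<le> Q / r ^ CARD('n)" using bd[OF that] rn by (simp add: pos_le_divide_eq)
    then have "(norm (V b) powr p) powr (1 / p) \<le> X" unfolding X_def using p by (intro powr_mono2) auto
    then show ?thesis using p by (simp add: powr_powr)
  qed
  have "\<bar>V x $ i\<bar> \<le> Cx * X" for i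
  proof (rule ext[rule_format, OF V])
    show "\<bar>V z $ i\<bar> \<le> X" if "norm (z - b0) \<le> r" for z
      using le[of z] that component_le_norm_cart[of "V z" i] by (simp add: dist_norm)
    show "norm (x - b0) \<le> R * r" using x by (simp add: dist_norm)
  qed
  then have "norm (V x) \<le> (\<Sum>i\<in>(UNIV::'n set). Cx * X)"
    using norm_le_l1_cart[of "V x"] by (meson order_trans sum_mono)
  then have "norm (V x) \<le> real CARD('n) * Cx * X" by simp
  then have "norm (V x) powr p \<le> (real CARD('n) * Cx * X) powr p" using p by (intro powr_mono2) auto
  also have "\<dots> = (real CARD('n) * Cx) powr p * X powr p"
    using Cx by (subst powr_mult) (auto simp: X_def)
  also have "X powr p = Q / r ^ CARD('n)" using p Q0 rn by (simp add: X_def powr_powr)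
  finally show ?thesis using rn by (simp add: pos_le_divide_eq)
qed

text \<open>The two candidates are 2 s apart, so x0 is closer than s to at most one of them.\<close>

lemma far_center:
  fixes x0 z u :: "'a::real_normed_vector"
  assumes u: "norm u = 1" and s: "0 \<le> s"
  obtains b0 where "s \<le> dist x0 b0" "dist z b0 = s" "b0 = z + s *\<^sub>R u \<or> b0 = z - s *\<^sub>R u"
proof (cases "s \<le> dist x0 (z + s *\<^sub>R u)")
  case True
  then show thesis using that[of "z + s *\<^sub>R u"] u s by (simp add: dist_norm)
next
  case False
  have "(z + s *\<^sub>R u) - (z - s *\<^sub>R u) = (2 * s) *\<^sub>R u" by (simp add: scaleR_2[symmetric])
  then have "dist (z + s *\<^sub>R u) (z - s *\<^sub>R u) = 2 * s" using u s by (simp add: dist_norm)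
  then have "2 * s \<le> dist x0 (z + s *\<^sub>R u) + dist x0 (z - s *\<^sub>R u)" by (metis dist_triangle3)
  then show thesis using that[of "z - s *\<^sub>R u"] u s False by (simp add: dist_norm)
qed

lemma line_poly_compose_affine:
  assumes f: "line_poly K f" and L: "linear L"
  shows "line_poly K (\<lambda>z. f (c + L z))"
  unfolding line_poly_def
proof (intro allI)
  fix b y
  obtain q where "degree q \<le> K" "\<And>t. f ((c + L b) + t *\<^sub>R L y) = poly q t" using line_polyD[OF f] by blast
  then show "\<exists>p. degree p \<le> K \<and> (\<forall>t. f (c + L (b + t *\<^sub>R y)) = poly p t)"
    by (intro exI[of _ q]) (simp add: linear_add[OF L] linear_cmul[OF L] add.assoc)
qed

section \<open>Traces on sides and surface integrals\<close>

context fat_mesh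
begin

lemma trace_from_eq:
  assumes T: "T \<in> \<T>" and m: "continuous_on UNIV m" "\<And>x. x \<in> interior T \<Longrightarrow> F x = m x" and x: "x \<in> T"
  shows "trace_from T F x = m x"
  unfolding trace_from_def
proof (rule tendsto_Lim)
  have "x \<in> closure (interior T)"
    using convex_closure_interior[OF element_topology(3)[OF T] interior_element_nonempty[OF T]] x closure_subset by blast
  have "x islimpt interior T"
  proof (cases "x \<in> interior T")
    case True
    then show ?thesis by (intro interior_limit_point) simp
  next
    case False
    then show ?thesis using \<open>x \<in> closure (interior T)\<close> by (simp add: closure_def)
  qed
  then show "\<not> trivial_limit (at x within interior T)" by (simp add: trivial_limit_within)
  have "(m \<longlongrightarrow> m x) (at x within interior T)"
    using m(1) by (meson UNIV_I continuous_on_def subset_UNIV tendsto_within_subset)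
  then show "(F \<longlongrightarrow> m x) (at x within interior T)"
    by (rule Lim_transform_eventually) (simp add: eventually_at_filter m(2))
qed

lemma facet_affine_hull:
  assumes T: "T \<in> \<T>" and a: "a \<in> vertices T" "S = convex hull (vertices T - {a})" and x: "bary (vertices T) a x = 0"
  shows "x \<in> affine hull S"
proof -
  note E = element(1)[OF T] and fin = element_topology(5)[OF T]
  have "(\<Sum>c\<in>vertices T - {a}. bary (vertices T) c x *\<^sub>R c) = (\<Sum>c\<in>vertices T. bary (vertices T) c x *\<^sub>R c)"
    "(\<Sum>c\<in>vertices T - {a}. bary (vertices T) c x) = (\<Sum>c\<in>vertices T. bary (vertices T) c x)"
    using x fin by (intro sum.mono_neutral_left; auto)+
  then have "x \<in> affine hull (vertices T - {a})"
    using bary_partition[OF E, of x] fin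
    by (subst affine_hull_finite) (auto intro!: exI[of _ "\<lambda>c. bary (vertices T) c x"])
  then show ?thesis by (simp add: a(2) affine_hull_convex_hull)
qed

text \<open>The prism of height one over \<open>S\<close> is sliced into at most \<open>1 / h + 2\<close> layers of thickness at most
  \<open>h\<close>, and each layer lies in a ball of radius \<open>2 * h\<close>.\<close>

lemma surface_integral_le:
  assumes T: "T \<in> \<T>" and S: "S facet_of T" and g: "\<And>x. x \<in> S \<Longrightarrow> 0 \<le> g x \<and> g x \<le> Q" and D: "diameter \<Omega> \<le> D"
  shows "diameter T * surface_integral S g \<le> (1 + 2 * D) * (unit_ball_vol (real CARD('n)) * 2 ^ CARD('n)) * diameter T ^ CARD('n) * Q"
proof -
  let ?h = "diameter T" and ?H = "affine hull S"
  have h: "0 < ?h" by (rule element_topology(7)[OF T])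
  obtain a where a: "a \<in> vertices T" "S = convex hull (vertices T - {a})" using facet_vertex[OF T S] .
  define r where "r = 2 * (?h / k) / real CARD('n)"
  have r: "real CARD('n) * r \<le> 2 * (?h / k)" "0 < r" using h k by (simp_all add: r_def)
  define y where "y = facet_center (vertices T) a"
  define \<nu> where "\<nu> = side_normal S T"
  note F = facet_halfball[OF T a r, folded y_def \<nu>_def]
  have \<nu>\<nu>: "\<nu> \<bullet> \<nu> = 1" using F(1) by (simp add: norm_eq_1)
  have "affine {x. \<nu> \<bullet> x = \<nu> \<bullet> y}" by (rule affine_hyperplane)
  then have "?H \<subseteq> {x. \<nu> \<bullet> x = \<nu> \<bullet> y}"
  proof (intro hull_minimal subsetI)
    fix x assume "x \<in> S"
    then have "x \<bullet> \<nu> = y \<bullet> \<nu>" using F(4)[of x] by (simp add: inner_diff_left)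
    then show "x \<in> {x. \<nu> \<bullet> x = \<nu> \<bullet> y}" by (simp add: inner_commute)
  qed
  then have Hsub: "(x - y) \<bullet> \<nu> = 0" if "x \<in> ?H" for x
    using that by (metis (mono_tags) diff_self inner_commute inner_diff_left mem_Collect_eq subsetD)
  have Hsup: "x \<in> ?H" if "(x - y) \<bullet> \<nu> = 0" for x
  proof -
    obtain \<alpha> where "\<And>x. bary (vertices T) a x = \<alpha> * ((x - y) \<bullet> \<nu>)" using F(6) by blast
    then have "bary (vertices T) a x = 0" using that by simp
    then show ?thesis by (rule facet_affine_hull[OF T a])
  qed
  \<comment> \<open>The orthogonal projection onto the plane of S; \<open>cp\<close> identifies it
    with the closest point in \<open>surface_integral\<close>.\<close>
  define pr where "pr z = z - ((z - y) \<bullet> \<nu>) *\<^sub>R \<nu>" for z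
  have prH: "pr z \<in> ?H" for z by (rule Hsup) (simp add: pr_def inner_diff_left \<nu>\<nu>)
  have far: "\<bar>(z - y) \<bullet> \<nu>\<bar> \<le> dist z w" if "w \<in> ?H" for z w
  proof -
    have "(z - y) \<bullet> \<nu> = (z - w) \<bullet> \<nu>" using Hsub[OF that] by (simp add: inner_diff_left)
    then show ?thesis using Cauchy_Schwarz_ineq2[of "z - w" \<nu>] F(1) by (simp add: dist_norm)
  qed
  have cp: "closest_point ?H z = pr z" for z
  proof (rule closest_point_unique[symmetric])
    show "\<forall>w\<in>?H. dist z (pr z) \<le> dist z w"
    proof
      fix w assume "w \<in> ?H"
      have "dist z (pr z) = \<bar>(z - y) \<bullet> \<nu>\<bar>" using F(1) by (simp add: pr_def dist_norm)
      then show "dist z (pr z) \<le> dist z w" using far[OF \<open>w \<in> ?H\<close>] by simp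
    qed
  qed (auto simp: affine_imp_convex affine_closed prH)
  define P where "P = {z. closest_point ?H z \<in> S \<and> infdist z ?H \<le> 1 / 2}"
  have Sclosed: "closed S"
  proof -
    have "finite (vertices T - {a})" using element_topology(5)[OF T] by simp
    then show ?thesis unfolding a(2) by (intro compact_imp_closed finite_imp_compact_convex_hull)
  qed
  have SH: "y \<in> ?H" using F(5) by (rule hull_inc)
  have P_slab: "\<bar>(z - y) \<bullet> \<nu>\<bar> \<le> 1/2" "pr z \<in> S" if "z \<in> P" for z
  proof -
    have "?H \<noteq> {}" using SH by blast
    then have "\<bar>(z - y) \<bullet> \<nu>\<bar> \<le> infdist z ?H"
      unfolding infdist_notempty[OF \<open>?H \<noteq> {}\<close>] using far by (intro cINF_greatest) auto
    then show "\<bar>(z - y) \<bullet> \<nu>\<bar> \<le> 1/2" using that by (simp add: P_def)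
    show "pr z \<in> S" using that by (simp add: P_def cp)
  qed
  have "continuous_on UNIV pr" unfolding pr_def by (intro continuous_intros)
  then have "closed (pr -` S)" using Sclosed by (simp add: continuous_closed_vimage continuous_on_eq_continuous_at)
  moreover have "closed {z. infdist z ?H \<le> 1 / 2}"
    by (intro closed_Collect_le continuous_intros)
  ultimately have "closed (pr -` S \<inter> {z. infdist z ?H \<le> 1 / 2})" by (rule closed_Int)
  moreover have "P = pr -` S \<inter> {z. infdist z ?H \<le> 1 / 2}" by (auto simp: P_def cp)
  ultimately have Pm: "P \<in> sets lebesgue" by (simp add: borel_closed)
  define N where "N = nat \<lceil>1 / ?h\<rceil>"
  have q: "0 < 1 / ?h" using h by simp
  then have "-1 < 1 / ?h" by linarith
  then have "real N = of_int \<lceil>1 / ?h\<rceil>" unfolding N_def by (simp add: zero_le_ceiling)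
  then have N1: "1 / ?h \<le> real N" "real N \<le> 1 / ?h + 1" using ceiling_correct[of "1 / ?h"] by linarith+
  have N0: "0 < real N" using N1(1) h by (smt (verit) divide_pos_pos)
  have Nh: "1 / real N \<le> ?h" using N1(1) N0 h by (simp add: field_simps)
  \<comment> \<open>The heights run from -1/2 to 1/2 in steps 1 / N of at most the diameter. A point
    of a layer is within one diameter of the centre in height and within another one along the
    facet; hence the radius.\<close>
  define L where "L i = cball (y + (real i / real N - 1/2) *\<^sub>R \<nu>) (2 * ?h)" for i :: nat
  have ST: "S \<subseteq> T" using S by (simp add: facet_of_imp_subset)
  have cover: "P \<subseteq> (\<Union>i\<in>{..N}. L i)"
  proof
    fix z assume z: "z \<in> P"
    define t where "t = (z - y) \<bullet> \<nu>"
    have t: "- (1/2) \<le> t" "t \<le> 1/2" using P_slab(1)[OF z] by (auto simp: t_def)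
    define i where "i = nat \<lfloor>(t + 1/2) * real N\<rfloor>"
    have nn: "0 \<le> (t + 1/2) * real N" using t by simp
    have i: "real i \<le> (t + 1/2) * real N" "(t + 1/2) * real N \<le> real i + 1"
      using nn unfolding i_def by linarith+
    have "(t + 1/2) * real N \<le> 1 * real N" using t by (intro mult_right_mono) auto
    then have "i \<le> N" using i(1) by linarith
    have "real i / real N \<le> t + 1/2" using i(1) N0 by (simp add: pos_divide_le_eq)
    moreover have "t + 1/2 \<le> real i / real N + 1 / real N"
      using i(2) N0 by (simp add: add_divide_distrib[symmetric] pos_le_divide_eq)
    ultimately have u: "\<bar>t - (real i / real N - 1/2)\<bar> \<le> ?h" using Nh by linarith
    have "z - (y + (real i / real N - 1/2) *\<^sub>R \<nu>) = (pr z - y) + (t - (real i / real N - 1/2)) *\<^sub>R \<nu>"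
      by (simp add: pr_def t_def[symmetric] scaleR_diff_left)
    then have "norm (z - (y + (real i / real N - 1/2) *\<^sub>R \<nu>)) \<le> norm (pr z - y) + norm ((t - (real i / real N - 1/2)) *\<^sub>R \<nu>)"
      using norm_triangle_ineq by metis
    moreover have "norm (pr z - y) \<le> ?h"
      using dist_le_diameter_element[OF T, of "pr z" y] P_slab(2)[OF z] F(5) ST by (auto simp: dist_norm)
    moreover have "norm ((t - (real i / real N - 1/2)) *\<^sub>R \<nu>) \<le> ?h" using u F(1) by simp
    ultimately have "z \<in> L i" by (simp add: L_def dist_norm norm_minus_commute)
    then show "z \<in> (\<Union>i\<in>{..N}. L i)" using \<open>i \<le> N\<close> by blast
  qed
  have Lm: "L i \<in> lmeasurable" for i by (simp add: L_def)
  have Um: "(\<Union>i\<in>{..N}. L i) \<in> lmeasurable" by (rule fmeasurable.finite_UN[OF finite_atMost Lm])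
  have Pl: "P \<in> lmeasurable" by (rule fmeasurableI2[OF Um cover Pm])
  have "measure lebesgue P \<le> measure lebesgue (\<Union>i\<in>{..N}. L i)"
    by (rule measure_mono_fmeasurable[OF cover Pm Um])
  also have "\<dots> \<le> (\<Sum>i\<in>{..N}. measure lebesgue (L i))"
    using Lm by (intro measure_UNION_le) (auto simp: fmeasurableD)
  also have "\<dots> = real (Suc N) * (unit_ball_vol (real CARD('n)) * (2 * ?h) ^ CARD('n))"
    using h by (simp add: L_def content_cball)
  finally have P_le: "measure lebesgue P \<le> real (Suc N) * (unit_ball_vol (real CARD('n)) * (2 * ?h) ^ CARD('n))" .
  \<comment> \<open>There are at most 1 / h + 2 balls, so one factor h turns their number into a
    constant.\<close>
  have "?h * real (Suc N) \<le> ?h * (1 / ?h + 2)" using N1(2) h by (intro mult_left_mono) auto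
  also have "\<dots> = 1 + 2 * ?h" using h by (simp add: distrib_left)
  also have "\<dots> \<le> 1 + 2 * D" using diameter_element_le[OF T] D by simp
  finally have hN: "?h * real (Suc N) \<le> 1 + 2 * D" .
  have Q0: "0 \<le> Q" using g[OF F(5)] by linarith
  interpret finite_measure "lebesgue_on P" using Pl by (rule finite_measure_lebesgue_on)
  have "surface_integral S g = (LINT z|lebesgue_on P. g (closest_point ?H z))"
    by (simp add: surface_integral_def P_def)
  also have "\<dots> \<le> (LINT z|lebesgue_on P. Q)"
  proof (rule integral_mono')
    show "g (closest_point ?H z) \<le> Q" if "z \<in> space (lebesgue_on P)" for z
      using g[of "closest_point ?H z"] that by (simp add: P_def)
  qed (use Q0 in simp_all)
  also have "\<dots> = measure lebesgue P * Q"
    using Pm by (simp add: measure_restrict_space)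
  finally have "?h * surface_integral S g \<le> ?h * (measure lebesgue P * Q)"
    using h by (intro mult_left_mono) auto
  also have "\<dots> \<le> ?h * (real (Suc N) * (unit_ball_vol (real CARD('n)) * (2 * ?h) ^ CARD('n)) * Q)"
    using h Q0 P_le by (intro mult_left_mono mult_right_mono) auto
  also have "\<dots> = (?h * real (Suc N)) * (unit_ball_vol (real CARD('n)) * (2 * ?h) ^ CARD('n) * Q)"
    by (simp only: ac_simps)
  also have "\<dots> \<le> (1 + 2 * D) * (unit_ball_vol (real CARD('n)) * (2 * ?h) ^ CARD('n) * Q)"
    using hN h Q0 by (intro mult_right_mono) auto
  finally show ?thesis by (simp add: power_mult_distrib ac_simps)
qed

end

section \<open>Bounds over whole elements and sides\<close>

context fat_residual
begin

text \<open>The inscribed ball about z has radius 4 r. The centre b0 has distance 2 r from z and at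
  least 2 r from x0, so the balls of radius r about all b within r of b0 stay inside and avoid x0.
  The bound at these b extends to T, whose diameter is 4 k r.\<close>

lemma element_residual_bound:
  assumes T: "T \<in> \<T>" and m: "\<And>i j. smooth_line_poly K (\<lambda>x. m x $ i $ j)" "\<And>x. x \<in> interior T \<Longrightarrow> Fh x = m x"
    and A: "interior T \<subseteq> A" "A \<subseteq> \<Omega>" "A \<in> sets lebesgue"
    and B: "\<And>y::real^'n. norm (grad bump y) \<le> B"
    and W: "B * (\<Sum>i\<le>M. \<bar>weight M (CARD('n)) i\<bar> / node M i) \<le> W" "0 < W" and M: "CARD('n) - 1 + K \<le> M"
    and ext: "\<forall>(f::real^'n \<Rightarrow> real) b r X x. line_poly K f \<longrightarrow>
        (\<forall>z. norm (z - b) \<le> r \<longrightarrow> \<bar>f z\<bar> \<le> X) \<longrightarrow> norm (x - b) \<le> (4 * k) * r \<longrightarrow> \<bar>f x\<bar> \<le> Cx * X"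
    and Cx: "0 < Cx" and W': "W' = W / integral\<^sup>L lebesgue (bump :: real^'n \<Rightarrow> real)"
    and C: "C = (4 * k) powr p * (4 * k) ^ CARD('n) * ((real CARD('n) * Cx) powr p *
      (2 * W' * (2 * W' * unit_ball_vol (real CARD('n))) powr (p - 1)))"
    and x: "x \<in> T"
  shows "(diameter T * norm (\<chi> i. \<Sum>j\<in>UNIV. partial j (\<lambda>x. m x $ i $ j) x)) powr p * diameter T ^ CARD('n) \<le>
    C * (LINT x|lebesgue_on A. e x powr p)"
proof -
  let ?I = "LINT x|lebesgue_on A. e x powr p" and ?h = "diameter T"
  let ?C1 = "2 * W' * (2 * W' * unit_ball_vol (real CARD('n))) powr (p - 1)"
  define D where "D x = (\<chi> i. \<Sum>j\<in>UNIV. partial j (\<lambda>x. m x $ i $ j) x)" for x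
  define r where "r = ?h / (4 * k)"
  have h: "0 < ?h" by (rule element_topology(7)[OF T])
  have r: "0 < r" using h k by (simp add: r_def)
  have hr: "?h = 4 * k * r" using k by (simp add: r_def)
  have W'0: "0 < W'" using W(2) integral_bump_pos[where 'n='n] by (simp add: W')
  obtain z where z: "cball z (?h / k) \<subseteq> T" using element_ball[OF T] .
  have z4: "cball z (4 * r) \<subseteq> T" using z k by (simp add: hr)
  \<comment> \<open>Any unit vector serves as direction from z to b0; a coordinate axis supplies
    one.\<close>
  obtain i0 :: 'n where True by blast
  have "norm (axis i0 1 :: real^'n) = 1" by simp
  from far_center[OF this, of "2 * r" x0 z] r
  obtain b0 where b0: "2 * r \<le> dist x0 b0" "dist z b0 = 2 * r" by auto
  have bd: "norm (r *\<^sub>R D b) powr p * r ^ CARD('n) \<le> ?C1 * ?I" if b: "dist b b0 \<le> r" for b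
  proof -
    have "ball b r \<subseteq> ball z (4 * r)"
    proof
      fix w assume "w \<in> ball b r"
      then have "dist b w < r" by simp
      moreover have "dist z w \<le> dist z b0 + dist b0 b + dist b w"
        by (meson add_le_cancel_right dist_triangle dist_triangle_le order_trans)
      ultimately show "w \<in> ball z (4 * r)" using b b0(2) by (simp add: dist_commute)
    qed
    moreover have "ball z (4 * r) \<subseteq> interior T"
      using z4 ball_subset_cball by (intro interior_maximal) auto
    ultimately have sub: "ball b r \<subseteq> interior T" by blast
    have "x0 \<notin> ball b r"
    proof
      assume "x0 \<in> ball b r"
      then have "dist x0 b < r" by (simp add: dist_commute)
      then show False using b0(1) b dist_triangle[of x0 b0 b] by simp
    qed
    from interior_point_bound[OF T m r sub this B W(1) M]
    have "norm (r *\<^sub>R D b) * r ^ CARD('n) \<le> W' * (LINT x|lebesgue_on (ball b r). e x)"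
      unfolding W' D_def .
    from mean_bound[OF r _ A(2,3) W'0 norm_ge_zero this] show ?thesis using sub A(1) by blast
  qed
  have lp: "line_poly K (\<lambda>x. (r *\<^sub>R D x) $ i)" for i
  proof -
    have "smooth_line_poly K (\<lambda>x. r * (\<Sum>j\<in>UNIV. partial j (\<lambda>x. m x $ i $ j) x))"
      by (intro smooth_line_poly_cmult smooth_line_poly_sum smooth_line_poly_partial m)
    then show ?thesis by (simp add: D_def smooth_line_poly_def)
  qed
  have b0T: "b0 \<in> T" using z4 b0(2) r by (auto simp: subset_eq)
  then have "dist x b0 \<le> 4 * k * r" using dist_le_diameter_element[OF T x] hr by simp
  from extrapolated_bound[where V = "\<lambda>x. r *\<^sub>R D x" and R = "4 * k", OF ext Cx _ lp r bd this]
  have "norm (r *\<^sub>R D x) powr p * r ^ CARD('n) \<le> (real CARD('n) * Cx) powr p * (?C1 * ?I)"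
    using k p by simp
  then have le: "(4 * k) powr p * (4 * k) ^ CARD('n) * (norm (r *\<^sub>R D x) powr p * r ^ CARD('n)) \<le>
      (4 * k) powr p * (4 * k) ^ CARD('n) * ((real CARD('n) * Cx) powr p * (?C1 * ?I))"
    using k by (intro mult_left_mono) auto
  have "?h * norm (D x) = (4 * k) * norm (r *\<^sub>R D x)" using r by (simp add: hr)
  then have "(?h * norm (D x)) powr p = (4 * k) powr p * norm (r *\<^sub>R D x) powr p"
    by (simp only: powr_mult)
  moreover have "?h ^ CARD('n) = (4 * k) ^ CARD('n) * r ^ CARD('n)" by (simp add: hr power_mult_distrib)
  ultimately have "(?h * norm (D x)) powr p * ?h ^ CARD('n) =
    (4 * k) powr p * (4 * k) ^ CARD('n) * (norm (r *\<^sub>R D x) powr p * r ^ CARD('n))" by (simp only: ac_simps)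
  then show ?thesis using le unfolding C D_def by (simp only: ac_simps)
qed

text \<open>The counterpart of \<open>element_residual_bound\<close>, with the ball of radius 8 r
  about the facet centre y and with b0 moved by 4 r along the side. The balls of radius r about
  points within r of b0 stay inside and avoid x0. The extrapolation factor 4 n k^2 reaches all of S,
  as that many r make two diameters of T.\<close>

lemma jump_bound:
  assumes T: "T \<in> \<T>" and S: "S \<in> internal_sides \<T>" "S facet_of T"
    and A: "patch \<T> T \<inter> \<Omega> \<subseteq> A" "A \<subseteq> \<Omega>" "A \<in> sets lebesgue"
    and B: "\<And>y::real^'n. norm (grad bump y) \<le> B"
    and W: "B * (\<Sum>i\<le>M. \<bar>weight M (CARD('n) - 1) i\<bar> / node M i) \<le> W" "0 < W" and M: "CARD('n) - 1 + K \<le> M"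
    and c: "0 < c" "\<And>\<nu>::real^'n. norm \<nu> = 1 \<Longrightarrow>
      c \<le> integral\<^sup>L lebesgue (\<lambda>y. indicator {y. 0 < y \<bullet> \<nu>} y * (bump_slope y * (y \<bullet> \<nu>)))"
    and ext: "\<forall>(f::real^'n \<Rightarrow> real) b r X x. line_poly K f \<longrightarrow>
        (\<forall>z. norm (z - b) \<le> r \<longrightarrow> \<bar>f z\<bar> \<le> X) \<longrightarrow>
        norm (x - b) \<le> (4 * real CARD('n) * k ^ 2) * r \<longrightarrow> \<bar>f x\<bar> \<le> Cx * X"
    and Cx: "0 < Cx" and W': "W' = W / c"
    and C: "C = (2 * real CARD('n) * k ^ 2) ^ CARD('n) * ((real CARD('n) * Cx) powr p *
      (2 * W' * (2 * W' * unit_ball_vol (real CARD('n))) powr (p - 1)))"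
    and x: "x \<in> S"
  shows "norm (jump \<T> S Fh x) powr p * diameter T ^ CARD('n) \<le> C * (LINT x|lebesgue_on A. e x powr p)"
proof -
  let ?I = "LINT x|lebesgue_on A. e x powr p" and ?h = "diameter T" and ?n = "real CARD('n)"
  let ?C1 = "2 * W' * (2 * W' * unit_ball_vol (real CARD('n))) powr (p - 1)"
  have h: "0 < ?h" by (rule element_topology(7)[OF T])
  have W'0: "0 < W'" using W(2) c(1) by (simp add: W')
  obtain T' where T': "T' \<in> \<T>" "T' \<noteq> T" "S facet_of T'" "{T\<in>\<T>. S facet_of T} = {T, T'}"
    and opp: "side_normal S T' = - side_normal S T" using internal_side[OF T S] .
  define \<nu> where "\<nu> = side_normal S T"
  have nk: "0 < ?n * k ^ 2" using k by simp
  \<comment> \<open>With this choice 8 r is exactly the radius that \<open>shared_facet\<close>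
    allows.\<close>
  define r where "r = ?h / (2 * ?n * k ^ 2)"
  have r: "0 < r" using h nk unfolding r_def by (intro divide_pos_pos) auto
  have hr: "?h = 2 * ?n * k ^ 2 * r" using nk k by (simp add: r_def)
  have r8p: "0 < 8 * r" using r by simp
  have r8: "?n * (8 * r) \<le> 2 * (2 / k * (?h / k))"
    using k by (simp add: hr power2_eq_square)
  obtain y where y: "\<forall>x\<in>ball y (8 * r). 0 < (x - y) \<bullet> side_normal S T \<longrightarrow> x \<in> interior T"
    "\<forall>x\<in>ball y (8 * r). 0 < (x - y) \<bullet> side_normal S T' \<longrightarrow> x \<in> interior T'"
    "\<forall>x\<in>ball y (8 * r). (x - y) \<bullet> side_normal S T = 0 \<longrightarrow> x \<in> S"
    "\<forall>x\<in>S. (x - y) \<bullet> side_normal S T = 0" "y \<in> S" "norm (side_normal S T) = 1"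
    using shared_facet[OF T T'(1) S(2) T'(3) r8p r8] by (elim exE conjE) (rule that; assumption)
  note y = y[folded \<nu>_def]
  have opp': "side_normal S T' = - \<nu>" using opp by (simp add: \<nu>_def)
  have \<nu>\<nu>: "\<nu> \<bullet> \<nu> = 1" using y(6) by (simp add: norm_eq_1)
  have STs: "S \<subseteq> T" "S \<subseteq> T'" using S(2) T'(3) by (simp_all add: facet_of_imp_subset)
  have ball_sub: "ball y (8 * r) \<subseteq> T \<union> T'"
  proof
    fix w assume w: "w \<in> ball y (8 * r)"
    consider "0 < (w - y) \<bullet> \<nu>" | "0 < (w - y) \<bullet> - \<nu>" | "(w - y) \<bullet> \<nu> = 0"
      by (auto simp: inner_minus_right intro: linorder_cases)
    then show "w \<in> T \<union> T'"
    proof cases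
      case 1
      then show ?thesis using y(1) w interior_subset by blast
    next
      case 2
      then show ?thesis using y(2) w interior_subset unfolding opp' by blast
    next
      case 3
      then show ?thesis using y(3) w STs by blast
    qed
  qed
  have ball_\<Omega>: "ball y (8 * r) \<subseteq> \<Omega>"
  proof -
    have "T \<union> T' \<subseteq> closure \<Omega>" using T T'(1) Union_mesh by blast
    then have "ball y (8 * r) \<subseteq> interior (closure \<Omega>)" using ball_sub by (intro interior_maximal) auto
    then show ?thesis using interior_closure_lipschitz(1)[OF open_\<Omega> lip_\<Omega>] by blast
  qed
  have "T \<inter> T' \<noteq> {}" "T \<inter> T \<noteq> {}" using y(5) STs by blast+
  then have "T \<union> T' \<subseteq> patch \<T> T" using T T'(1) unfolding patch_def by blast
  then have ball_A: "ball y (8 * r) \<subseteq> A" using ball_sub ball_\<Omega> A(1) by blast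
  obtain m where m: "\<And>i j. smooth_line_poly K (\<lambda>x. m x $ i $ j)" "\<And>x. x \<in> interior T \<Longrightarrow> Fh x = m x"
    using Fh_poly[OF T] by blast
  obtain m' where m': "\<And>i j. smooth_line_poly K (\<lambda>x. m' x $ i $ j)" "\<And>x. x \<in> interior T' \<Longrightarrow> Fh x = m' x"
    using Fh_poly[OF T'(1)] by blast
  have cont: "continuous_on UNIV m''" if "\<And>i j. smooth_line_poly K (\<lambda>x. m'' x $ i $ j)" for m'' :: "real^'n \<Rightarrow> real^'n^'n"
  proof -
    have "continuous_on UNIV (\<lambda>x. \<chi> i j. m'' x $ i $ j)"
      by (intro continuous_intros smooth_continuous) (use that in \<open>simp add: smooth_line_poly_def\<close>)
    then show ?thesis by simp
  qed
  have jump: "jump \<T> S Fh w = (m w - m' w) *v \<nu>" if w: "w \<in> S" for w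
  proof -
    have "trace_from T Fh w = m w" by (rule trace_from_eq[OF T cont[OF m(1)]], erule m(2), rule subsetD[OF STs(1) w])
    moreover have "trace_from T' Fh w = m' w" by (rule trace_from_eq[OF T'(1) cont[OF m'(1)]], erule m'(2), rule subsetD[OF STs(2) w])
    moreover have "m' w *v (- \<nu>) = - (m' w *v \<nu>)"
      using matrix_vector_mult_scaleR[of "m' w" "-1" \<nu>] by simp
    ultimately show ?thesis
      unfolding jump_def T'(4) using T'(2) opp'
      by (simp add: \<nu>_def[symmetric] matrix_vector_mult_diff_rdistrib)
  qed
  \<comment> \<open>A tangential direction exists because the dimension is at least 2; it keeps b0
    in the plane of S.\<close>
  obtain \<tau>0 where \<tau>0: "\<tau>0 \<noteq> 0" "\<nu> \<bullet> \<tau>0 = 0"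
    using orthogonal_to_vector_exists[of \<nu>] dim by (auto simp: orthogonal_def)
  define \<tau> where "\<tau> = \<tau>0 /\<^sub>R norm \<tau>0"
  have \<tau>: "norm \<tau> = 1" "\<tau> \<bullet> \<nu> = 0" using \<tau>0 by (auto simp: \<tau>_def inner_commute)
  from far_center[OF \<tau>(1), of "4 * r" x0 y] r
  obtain b0 where b0: "4 * r \<le> dist x0 b0" "dist y b0 = 4 * r" "b0 = y + (4 * r) *\<^sub>R \<tau> \<or> b0 = y - (4 * r) *\<^sub>R \<tau>" by auto
  have b0\<nu>: "(b0 - y) \<bullet> \<nu> = 0" using b0(3) \<tau>(2) by (auto simp: inner_diff_left inner_add_left)
  define L where "L z = z - (z \<bullet> \<nu>) *\<^sub>R \<nu>" for z :: "real^'n"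
  have linL: "linear L" unfolding L_def by (rule linearI) (simp_all add: inner_add_left algebra_simps)
  \<comment> \<open>Jumps can be bounded only at points of the side, whereas extrapolation starts
    from a full ball. Composing with the projection onto the plane makes V constant in the normal
    direction and keeps it polynomial along lines, as the projection is affine.\<close>
  define pr where "pr z = (y \<bullet> \<nu>) *\<^sub>R \<nu> + L z" for z
  have pr_eq: "pr z = z - ((z - y) \<bullet> \<nu>) *\<^sub>R \<nu>" for z by (simp add: pr_def L_def inner_diff_left scaleR_diff_left)
  have pr_plane: "(pr z - y) \<bullet> \<nu> = 0" for z by (simp add: pr_eq inner_diff_left \<nu>\<nu>)
  have pr_id: "pr z = z" if "(z - y) \<bullet> \<nu> = 0" for z using that by (simp add: pr_eq)
  have pr_dist: "dist (pr z) b0 \<le> dist z b0" for z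
  proof -
    have "pr z - b0 = L (z - b0)"
      using pr_id[OF b0\<nu>] linear_diff[OF linL, of z b0] by (metis add_diff_cancel_left pr_def)
    moreover have "norm (L w) \<le> norm w" for w
    proof -
      have "norm (L w) ^ 2 = norm w ^ 2 - (w \<bullet> \<nu>) ^ 2"
        unfolding power2_norm_eq_inner
        by (simp add: L_def inner_diff_left inner_diff_right \<nu>\<nu> inner_commute power2_eq_square)
      then have "norm (L w) ^ 2 \<le> norm w ^ 2" by simp
      then show ?thesis by (rule power2_le_imp_le) simp
    qed
    ultimately show ?thesis by (simp add: dist_norm)
  qed
  define V where "V z = (m (pr z) - m' (pr z)) *v \<nu>" for z
  have bd: "norm (V z) powr p * r ^ CARD('n) \<le> ?C1 * ?I" if z: "dist z b0 \<le> r" for z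
  proof -
    let ?b = "pr z"
    have b: "dist ?b b0 \<le> r" using pr_dist[of z] z by simp
    have sub: "ball ?b r \<subseteq> ball y (8 * r)"
    proof
      fix w assume "w \<in> ball ?b r"
      then have "dist ?b w < r" by simp
      moreover have "dist y w \<le> dist y b0 + dist b0 ?b + dist ?b w"
        by (meson add_le_cancel_right dist_triangle dist_triangle_le order_trans)
      ultimately show "w \<in> ball y (8 * r)" using b b0(2) r by (simp add: dist_commute)
    qed
    have "x0 \<notin> ball ?b r"
    proof
      assume "x0 \<in> ball ?b r"
      then have "dist x0 ?b < r" by (simp add: dist_commute)
      then show False using b0(1) b dist_triangle[of x0 b0 ?b] r by simp
    qed
    moreover have "(w - ?b) \<bullet> \<nu> = (w - y) \<bullet> \<nu>" for w using pr_plane[of z] by (simp add: inner_diff_left)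
    then have "Fh w = m w" if "w \<in> ball ?b r" "0 < (w - ?b) \<bullet> \<nu>" for w
      using that y(1) sub m(2) by (metis subsetD)
    moreover have "Fh w = m' w" if "w \<in> ball ?b r" "(w - ?b) \<bullet> \<nu> < 0" for w
    proof -
      have "0 < (w - y) \<bullet> (- \<nu>)" using that(2) \<open>\<And>w. (w - ?b) \<bullet> \<nu> = (w - y) \<bullet> \<nu>\<close> by simp
      then show ?thesis using that(1) y(2) sub m'(2) unfolding opp' by blast
    qed
    moreover have "ball ?b r \<subseteq> \<Omega>" using sub ball_\<Omega> by blast
    ultimately have "norm (V z) * r ^ CARD('n) \<le> W' * (LINT x|lebesgue_on (ball ?b r). e x)"
      unfolding W' V_def using side_point_bound[OF y(6) m(1) m'(1) _ _ r _ _ B W(1) M c] by blast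
    from mean_bound[OF r _ A(2,3) W'0 norm_ge_zero this] show ?thesis using sub ball_A by blast
  qed
  have lp: "line_poly K (\<lambda>z. V z $ i)" for i
  proof -
    have "line_poly K (\<lambda>z. \<Sum>j\<in>UNIV. \<nu> $ j * (m (pr z) $ i $ j - m' (pr z) $ i $ j))"
      unfolding pr_def using m(1) m'(1)
      by (intro line_poly_sum line_poly_cmult line_poly_diff line_poly_compose_affine[OF _ linL]) (auto simp: smooth_line_poly_def)
    then show ?thesis by (simp add: V_def matrix_vector_mult_def mult.commute)
  qed
  have k4: "4 \<le> k ^ 2" using power_mono[of 2 k 2] k by simp
  have r4: "4 * r \<le> ?h"
  proof -
    have "2 * 4 \<le> ?n * k ^ 2" using dim k4 by (intro mult_mono) auto
    then have "4 * r \<le> 2 * (?n * k ^ 2) * r" using r by (intro mult_right_mono) auto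
    then show ?thesis by (simp add: hr)
  qed
  have "dist x b0 \<le> dist x y + dist y b0" by (rule dist_triangle)
  also have "\<dots> \<le> ?h + ?h"
    using dist_le_diameter_element[OF T subsetD[OF STs(1) x] subsetD[OF STs(1) y(5)]] r4 unfolding b0(2) by linarith
  also have "\<dots> = (4 * ?n * k ^ 2) * r" by (simp add: hr)
  finally have "dist x b0 \<le> (4 * ?n * k ^ 2) * r" .
  from extrapolated_bound[where V = V and R = "4 * ?n * k ^ 2", OF ext Cx _ lp r bd this]
  have "norm (V x) powr p * r ^ CARD('n) \<le> (?n * Cx) powr p * (?C1 * ?I)"
    using nk p by (simp add: mult.assoc)
  moreover have "V x = jump \<T> S Fh x"
    using jump[OF x] pr_id[of x] y(4) x by (simp add: V_def)
  ultimately have "(2 * ?n * k ^ 2) ^ CARD('n) * (norm (jump \<T> S Fh x) powr p * r ^ CARD('n)) \<le>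
      (2 * ?n * k ^ 2) ^ CARD('n) * ((?n * Cx) powr p * (?C1 * ?I))"
    using nk by (intro mult_left_mono) auto
  moreover have "?h ^ CARD('n) = (2 * ?n * k ^ 2) ^ CARD('n) * r ^ CARD('n)" unfolding hr by (rule power_mult_distrib)
  ultimately show ?thesis unfolding C by (simp only: ac_simps)
qed

text \<open>\<open>mean_bound\<close> is applied with X = norm f / r^(n-1), and the left-hand side
  becomes the p-th power of norm f times r^s. Since s is nonnegative and r is at least c times the
  diameter, r may be replaced by the diameter.\<close>

lemma source_bound:
  assumes x0: "x0 \<in> T" "T \<in> \<T>" and \<delta>: "0 < \<delta>" "ball x0 \<delta> \<subseteq> \<Omega>" "\<delta> \<le> D" "diameter \<Omega> \<le> D"
    and A: "patch \<T> T \<inter> \<Omega> \<subseteq> A" "A \<subseteq> \<Omega>" "A \<in> sets lebesgue"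
    and N: "N = nat \<lceil>k ^ CARD('n)\<rceil>" and c6: "c6 = (2 / k) ^ Suc (Suc N)"
    and \<eta>: "\<eta> = 1 / (2 * real (Suc M)) * c6 / real (CARD('n) + 1)"
    and c: "c = c6 * (\<delta> / (2 * D) * \<eta> ^ (CARD('n) + 1))"
    and B: "\<And>y::real^'n. norm (grad bump y) \<le> B"
    and W: "B * (\<Sum>i\<le>M. \<bar>weight M 0 i\<bar> / node M i) \<le> W" "0 < W" and M: "CARD('n) - 1 + K \<le> M"
    and s: "s = real CARD('n) - p * (real CARD('n) - 1)" "0 \<le> s"
    and C: "C = (1 / c) powr s * (2 * W * (2 * W * unit_ball_vol (real CARD('n))) powr (p - 1))"
  shows "diameter T powr s * norm f powr p \<le> C * (LINT x|lebesgue_on A. e x powr p)"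
proof -
  let ?I = "LINT x|lebesgue_on A. e x powr p" and ?h = "diameter T"
  let ?C1 = "2 * W * (2 * W * unit_ball_vol (real CARD('n))) powr (p - 1)"
  have h: "0 < ?h" by (rule element_topology(7)[OF x0(2)])
  \<comment> \<open>The ratio of dist x0 b to r that \<open>source_point_bound\<close>
    demands.\<close>
  have \<theta>: "0 < 1 / (2 * real (Suc M))" "1 / (2 * real (Suc M)) \<le> 1" by (auto simp: divide_simps)
  obtain b r where br: "b \<in> T" "c * ?h \<le> r" "r \<le> ?h" "0 < r" "ball b r \<subseteq> \<Omega>"
    "dist x0 b \<le> 1 / (2 * real (Suc M)) * r" "\<And>T' x. T' \<in> \<T> \<Longrightarrow> x \<in> T' \<Longrightarrow> x \<in> ball b r \<Longrightarrow> b \<in> T'"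
    using point_location[OF x0 \<delta> \<theta> N refl c6 \<eta> refl] unfolding c by blast
  have c6p: "0 < c6" unfolding c6 using k by simp
  then have "0 < \<eta>" unfolding \<eta> by (intro divide_pos_pos mult_pos_pos) auto
  then have c0: "0 < c" unfolding c using c6p \<delta> by simp
  have sub: "ball b r \<subseteq> A"
  proof
    fix x assume x: "x \<in> ball b r"
    then have "x \<in> \<Omega>" using br(5) by blast
    then obtain T' where T': "T' \<in> \<T>" "x \<in> T'" using Union_mesh closure_subset by blast
    then have "b \<in> T'" using br(7) x by blast
    then have "x \<in> patch \<T> T" unfolding patch_def using T' br(1) by blast
    then show "x \<in> A" using A(1) \<open>x \<in> \<Omega>\<close> by blast
  qed
  have "norm f / r ^ (CARD('n) - 1) * r ^ CARD('n) \<le> W * (LINT x|lebesgue_on (ball b r). e x)"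
    by (rule source_point_bound[OF br(4,5,6) br(7) B W(1) M])
  from mean_bound[OF br(4) sub A(2,3) W(2) _ this]
  have le: "(norm f / r ^ (CARD('n) - 1)) powr p * r ^ CARD('n) \<le> ?C1 * ?I" using br(4) by simp
  have n1: "real (CARD('n) - 1) = real CARD('n) - 1" using dim by (simp add: of_nat_diff)
  have "(norm f / r ^ (CARD('n) - 1)) powr p * r ^ CARD('n) = norm f powr p * r powr s"
  proof -
    have "(norm f / r ^ (CARD('n) - 1)) powr p = norm f powr p / (r powr (real CARD('n) - 1)) powr p"
      using br(4) n1 by (simp add: powr_divide powr_realpow[symmetric])
    also have "\<dots> = norm f powr p * r powr (- (p * (real CARD('n) - 1)))"
      by (simp add: powr_powr powr_minus_divide mult.commute)
    finally show ?thesis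
      using br(4) by (simp add: s(1) powr_realpow[symmetric] powr_add[symmetric] mult.assoc)
  qed
  with le have le': "norm f powr p * r powr s \<le> ?C1 * ?I" by simp
  have "?h \<le> 1 / c * r" using br(2) c0 by (simp add: field_simps)
  then have "?h powr s \<le> (1 / c * r) powr s" using h s(2) by (intro powr_mono2) auto
  also have "\<dots> = (1 / c) powr s * r powr s" by (rule powr_mult)
  finally have "?h powr s * norm f powr p \<le> (1 / c) powr s * r powr s * norm f powr p"
    by (intro mult_right_mono) auto
  also have "\<dots> = (1 / c) powr s * (norm f powr p * r powr s)" by simp
  also have "\<dots> \<le> (1 / c) powr s * (?C1 * ?I)" using le' by (intro mult_left_mono) auto
  finally show ?thesis by (simp add: C mult.assoc)
qed

end

section \<open>The discrete stress\<close>

lemma partial_cong_open: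
  assumes g: "g differentiable (at x)" and U: "open U" "x \<in> U" and eq: "\<And>y. y \<in> U \<Longrightarrow> f y = g y"
  shows "partial j f x = partial j g x"
proof -
  have "frechet_derivative g (at x) = frechet_derivative f (at x)"
    by (rule frechet_derivative_transform_within_open[OF g U]) (simp add: eq)
  then show ?thesis by (simp add: partial_def)
qed

lemma differentiable_smooth_components:
  fixes v :: "real^'n \<Rightarrow> real^'n"
  assumes "\<And>i. smooth (\<lambda>x. v x $ i)"
  shows "v differentiable (at x)"
  by (subst differentiable_componentwise_within)
    (auto simp: Basis_vec_def inner_axis smooth_differentiable[OF assms])

lemma partial_smooth_components:
  fixes v :: "real^'n \<Rightarrow> real^'n"
  assumes "\<And>i. smooth (\<lambda>x. v x $ i)"
  shows "partial j v x = (\<chi> i. partial j (\<lambda>x. v x $ i) x)"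
  using partial_bounded_linear(1)[OF bounded_linear_vec_nth differentiable_smooth_components[OF assms]]
  by (simp add: vec_eq_iff)

lemma jacobian_eq_partial: "jacobian v (at x) = (\<chi> i j. partial j v x $ i)"
  by (simp add: jacobian_def matrix_def partial_def)

lemma partial_diff_mult:
  assumes "f differentiable (at x)" "g differentiable (at x)"
  shows "partial j (\<lambda>x. f x - c * g x) x = partial j f x - (c::real) * partial j g x"
proof -
  have "((\<lambda>x. f x - c * g x) has_derivative (\<lambda>h. frechet_derivative f (at x) h - c * frechet_derivative g (at x) h)) (at x)"
    using assms unfolding frechet_derivative_works by (auto intro!: derivative_eq_intros)
  from partial_eq[OF this] show ?thesis by (simp add: partial_def)
qed

lemma integral_restrict_cong_AE:
  fixes f g :: "real^'n \<Rightarrow> real"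
  assumes S: "S \<in> sets lebesgue" "R \<in> sets lebesgue"
    and ae: "AE x in lebesgue. (if x \<in> S then f x else 0) = (if x \<in> R then g x else 0)"
  shows "(LINT x|lebesgue_on S. f x) = (LINT x|lebesgue_on R. g x)"
  using integral_cong_AE_lebesgue[OF ae]
  by (simp only: Lebesgue_Measure.integral_restrict_UNIV[OF S(1)] Lebesgue_Measure.integral_restrict_UNIV[OF S(2)])

lemma integral_restrict_mono_AE:
  fixes f g :: "real^'n \<Rightarrow> real"
  assumes S: "S \<in> sets lebesgue" "R \<in> sets lebesgue" and g: "integrable (lebesgue_on R) g" "\<And>x. 0 \<le> g x"
    and ae: "AE x in lebesgue. x \<in> S \<longrightarrow> x \<in> R \<and> f x \<le> g x"
  shows "(LINT x|lebesgue_on S. f x) \<le> (LINT x|lebesgue_on R. g x)"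
proof -
  define f' where "f' x = (if x \<in> S \<and> x \<in> R \<and> f x \<le> g x then f x else 0)" for x
  have "(LINT x|lebesgue_on S. f x) = (LINT x|lebesgue_on UNIV. f' x)"
    by (rule integral_restrict_cong_AE[OF S(1)]) (use ae in \<open>auto elim!: eventually_mono simp: f'_def\<close>)
  also have "\<dots> = integral\<^sup>L lebesgue f'" by (simp add: lebesgue_on_UNIV_eq)
  also have "\<dots> \<le> integral\<^sup>L lebesgue (\<lambda>x. if x \<in> R then g x else 0)"
  proof (rule integral_mono')
    show "integrable lebesgue (\<lambda>x. if x \<in> R then g x else 0)"
      using g(1) Lebesgue_Measure.integrable_restrict_UNIV[OF S(2)] by blast
  qed (use g(2) in \<open>auto simp: f'_def\<close>)
  also have "\<dots> = (LINT x|lebesgue_on R. g x)" by (rule Lebesgue_Measure.integral_restrict_UNIV[OF S(2)])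
  finally show ?thesis .
qed

section \<open>The discrete solution on elements and the passage to the abstract residual\<close>

context fat_mesh
begin

text \<open>The boundaries of the elements are null sets, and the interiors of elements lie in
  \<Omega>.\<close>

lemma AE_interior_mesh: "AE x in lebesgue. x \<in> closure \<Omega> \<longrightarrow> x \<in> \<Omega> \<and> (\<forall>T\<in>\<T>. x \<in> T \<longrightarrow> x \<in> interior T)"
proof -
  define N where "N = (\<Union>T\<in>\<T>. frontier T)"
  have "negligible N" unfolding N_def
    using finite_mesh element_topology(3) by (intro negligible_Union) (auto intro: negligible_convex_frontier)
  then have "N \<in> null_sets lebesgue" by (simp add: negligible_iff_null_sets)
  then have "AE x in lebesgue. x \<notin> N" by (rule AE_not_in)
  then show ?thesis
  proof eventually_elim
    case (elim x)
    have int: "x \<in> interior T" if "T \<in> \<T>" "x \<in> T" for T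
      using elim that closure_subset[of T] by (auto simp: N_def frontier_def)
    show ?case
    proof (intro impI conjI ballI)
      assume "x \<in> closure \<Omega>"
      then obtain T where "T \<in> \<T>" "x \<in> T" using Union_mesh by blast
      then show "x \<in> \<Omega>" using int interior_element_subset by blast
    qed (rule int)
  qed
qed

lemma element_subset_closure: "T \<in> \<T> \<Longrightarrow> T \<subseteq> closure \<Omega>"
  using Union_mesh by blast

lemma element_lebesgue: "T \<in> \<T> \<Longrightarrow> T \<in> sets lebesgue"
  using element_topology(2) by (simp add: borel_closed)

lemma measure_element_le:
  assumes T: "T \<in> \<T>"
  shows "measure lebesgue T \<le> unit_ball_vol (real CARD('n)) * diameter T ^ CARD('n)"
proof -
  obtain x where x: "x \<in> T" using interior_element_nonempty[OF T] interior_subset by blast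
  have "T \<subseteq> cball x (diameter T)" using dist_le_diameter_element[OF T x] by auto
  then have "measure lebesgue T \<le> measure lebesgue (cball x (diameter T))"
    using element_lebesgue[OF T] by (intro measure_mono_fmeasurable) auto
  also have "\<dots> = unit_ball_vol (real CARD('n)) * diameter T ^ CARD('n)"
    using element_topology(7)[OF T] by (simp add: content_cball)
  finally show ?thesis .
qed

lemma discrete_element:
  assumes T: "T \<in> \<T>" and uh: "velocity_space el \<Omega> p \<T> uh" and \<pi>h: "pressure_space \<Omega> p \<T> \<pi>h"
  obtains G P where "\<forall>i. smooth_line_poly (CARD('n) + 1) (\<lambda>x. G x $ i)" "smooth_line_poly (CARD('n) + 1) P"
    "\<forall>x\<in>T. uh x = G x" "\<forall>x\<in>T. \<pi>h x = P x"
proof -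
  have "\<forall>i. \<exists>g. g \<in> local_space el T \<and> (\<forall>x\<in>T. uh x $ i = g x)" using uh T unfolding velocity_space_def by blast
  then obtain g where g: "\<And>i. g i \<in> local_space el T" "\<And>i x. x \<in> T \<Longrightarrow> uh x $ i = g i x" by metis
  obtain P where P: "P \<in> poly_space 1" "\<And>x. x \<in> T \<Longrightarrow> \<pi>h x = P x" using \<pi>h T unfolding pressure_space_def by blast
  show thesis
  proof (rule that[of "\<lambda>x. \<chi> i. g i x" P])
    show "\<forall>i. smooth_line_poly (CARD('n) + 1) (\<lambda>x. (\<chi> i. g i x) $ i)"
      using smooth_line_poly_local_space[OF element(1)[OF T] g(1)] by simp
    show "smooth_line_poly (CARD('n) + 1) P" by (rule smooth_line_poly_mono[OF smooth_line_poly_poly_space[OF P(1)]]) simp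
  qed (auto simp: vec_eq_iff g(2) P(2))
qed

text \<open>Taking the divergence of the rows turns the gradient of uh into its Laplacian and \<pi>h
  times the identity into the gradient of \<pi>h. So the element residual is the divergence bounded
  by \<open>element_residual_bound\<close>.\<close>

lemma discrete_stress:
  assumes T: "T \<in> \<T>" and uh: "velocity_space el \<Omega> p \<T> uh" and \<pi>h: "pressure_space \<Omega> p \<T> \<pi>h"
  obtains m where "\<forall>i j. smooth_line_poly (CARD('n) + 1) (\<lambda>x. m x $ i $ j)"
    "\<forall>x\<in>interior T. jacobian uh (at x) - \<pi>h x *\<^sub>R mat 1 = m x"
    "\<forall>x\<in>interior T. laplacian uh x - grad \<pi>h x = (\<chi> i. \<Sum>j\<in>UNIV. partial j (\<lambda>x. m x $ i $ j) x)"
proof -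
  obtain G P where "\<forall>i. smooth_line_poly (CARD('n) + 1) (\<lambda>x. G x $ i)" and P: "smooth_line_poly (CARD('n) + 1) P"
    and eq: "\<forall>x\<in>T. uh x = G x" "\<forall>x\<in>T. \<pi>h x = P x"
    using discrete_element[OF T uh \<pi>h] .
  then have G: "smooth_line_poly (CARD('n) + 1) (\<lambda>x. G x $ i)" for i by blast
  have sG: "smooth (\<lambda>x. G x $ i)" and sP: "smooth P" for i using G P by (simp_all add: smooth_line_poly_def)
  have eqi: "uh y = G y" "\<pi>h y = P y" if "y \<in> interior T" for y using eq that interior_subset by blast+
  have d1: "partial j uh x = (\<chi> i. partial j (\<lambda>x. G x $ i) x)" if "x \<in> interior T" for x j
    using partial_cong_open[OF differentiable_smooth_components[OF sG] open_interior that eqi(1)]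
    by (simp add: partial_smooth_components[OF sG])
  have sG': "smooth (\<lambda>x. (\<chi> i. partial j (\<lambda>x. G x $ i) x) $ i)" for i j using smooth_partial[OF sG] by simp
  have d2: "partial j (partial j uh) x = (\<chi> i. partial j (partial j (\<lambda>x. G x $ i)) x)" if "x \<in> interior T" for x j
    using partial_cong_open[OF differentiable_smooth_components[OF sG'] open_interior that d1]
    by (simp add: partial_smooth_components[OF sG'])
  have dP: "partial j \<pi>h x = partial j P x" if "x \<in> interior T" for x j
    using partial_cong_open[OF smooth_differentiable[OF sP] open_interior that eqi(2)] .
  define m where "m x = (\<chi> i j. partial j (\<lambda>x. G x $ i) x - (mat 1 :: real^'n^'n) $ i $ j * P x)" for x
  show thesis
  proof (rule that[of m]; intro allI ballI)
    show "smooth_line_poly (CARD('n) + 1) (\<lambda>x. m x $ i $ j)" for i j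
      unfolding m_def vec_lambda_beta by (intro smooth_line_poly_diff smooth_line_poly_partial smooth_line_poly_cmult G P)
    fix x assume x: "x \<in> interior T"
    show "jacobian uh (at x) - \<pi>h x *\<^sub>R mat 1 = m x"
      by (simp add: vec_eq_iff m_def jacobian_eq_partial d1[OF x] eqi(2)[OF x])
    have "partial j (\<lambda>x. m x $ i $ j) x = partial j (partial j (\<lambda>x. G x $ i)) x - (mat 1 :: real^'n^'n) $ i $ j * partial j P x" for i j
      unfolding m_def vec_lambda_beta
      by (rule partial_diff_mult[OF smooth_differentiable[OF smooth_partial[OF sG]] smooth_differentiable[OF sP]])
    moreover have "(\<Sum>j\<in>UNIV. (mat 1 :: real^'n^'n) $ i $ j * partial j P x) = partial i P x" for i
      by (simp add: mat_def if_distrib[of "\<lambda>c. c * _"] cong: if_cong)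
    ultimately show "laplacian uh x - grad \<pi>h x = (\<chi> i. \<Sum>j\<in>UNIV. partial j (\<lambda>x. m x $ i $ j) x)"
      by (simp add: vec_eq_iff laplacian_def grad_def sum_subtractf d2[OF x] dP[OF x])
  qed
qed

text \<open>Membership in the velocity space provides a weak gradient on all of \<Omega>. Restricted
  to the interior of an element it must be the gradient of the polynomial there, and the element
  boundaries are null.\<close>

lemma weak_grad_discrete:
  assumes uh: "velocity_space el \<Omega> p \<T> uh" and \<pi>h: "pressure_space \<Omega> p \<T> \<pi>h"
  shows "AE x in lebesgue_on \<Omega>. weak_grad \<Omega> uh x = jacobian uh (at x)"
proof -
  have "W1p (conj_exp p) \<Omega> uh" using uh by (simp add: velocity_space_def W1p_0_def)
  note W = W1p_weak_grad(1)[OF open_\<Omega> this]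
  have "AE x in lebesgue. x \<in> interior T \<longrightarrow> weak_grad \<Omega> uh x = jacobian uh (at x)" if T: "T \<in> \<T>" for T
  proof -
    obtain G P where G: "\<forall>i. smooth_line_poly (CARD('n) + 1) (\<lambda>x. G x $ i)" "smooth_line_poly (CARD('n) + 1) P"
      and eq: "\<forall>x\<in>T. uh x = G x" "\<forall>x\<in>T. \<pi>h x = P x"
      using discrete_element[OF T uh \<pi>h] .
    have sG: "smooth (\<lambda>x. G x $ i)" for i using G(1) by (simp add: smooth_line_poly_def)
    have eqi: "uh y = G y" if "y \<in> interior T" for y using eq(1) that interior_subset by blast
    note H = has_weak_grad_smooth[OF open_interior[of T] sG]
    have "locally_integrable (interior T) G" using H by (simp add: has_weak_grad_def)
    then have "has_weak_grad (interior T) G (weak_grad \<Omega> uh)"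
      using has_weak_grad_restrict[OF open_\<Omega> open_interior interior_element_subset[OF T] W] eqi by blast
    from weak_grad_unique[OF open_interior this H] show ?thesis
    proof eventually_elim
      case (elim x)
      show ?case
      proof
        assume x: "x \<in> interior T"
        have "partial j uh x = (\<chi> i. partial j (\<lambda>x. G x $ i) x)" for j
          using partial_cong_open[OF differentiable_smooth_components[OF sG] open_interior x eqi]
          by (simp add: partial_smooth_components[OF sG])
        then show "weak_grad \<Omega> uh x = jacobian uh (at x)" using elim x by (simp add: jacobian_eq_partial)
      qed
    qed
  qed
  then have "AE x in lebesgue. \<forall>T\<in>\<T>. x \<in> interior T \<longrightarrow> weak_grad \<Omega> uh x = jacobian uh (at x)"
    using finite_mesh by (intro AE_finite_allI) auto
  then show ?thesis
    unfolding AE_lebesgue_on_iff[OF open_sets_lebesgue[OF open_\<Omega>]] using AE_interior_mesh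
  proof eventually_elim
    case (elim x)
    show ?case
    proof
      assume x: "x \<in> \<Omega>"
      then have "x \<in> closure \<Omega>" using closure_subset by blast
      then obtain T where "T \<in> \<T>" "x \<in> T" using Union_mesh by blast
      then show "weak_grad \<Omega> uh x = jacobian uh (at x)" using elim \<open>x \<in> closure \<Omega>\<close> by blast
    qed
  qed
qed

text \<open>The weak gradient of uh in \<open>residual_bound\<close> is exchanged for the
  elementwise classical one, which is the one known to be polynomial.\<close>

lemma stokes_fat_residual:
  assumes p: "1 < p" "p \<le> 2" and sol: "stokes_solution \<Omega> x0 p f u \<pi>"
    and disc: "discrete_stokes_solution el \<Omega> x0 p f \<T> uh \<pi>h"
  shows "fat_residual \<Omega> \<T> k (\<lambda>x. jacobian uh (at x) - \<pi>h x *\<^sub>R mat 1) (err \<Omega> u uh \<pi> \<pi>h) f x0 p (CARD('n) + 1)"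
proof -
  let ?F = "\<lambda>x. jacobian uh (at x) - \<pi>h x *\<^sub>R mat 1 :: real^'n^'n"
  let ?G = "\<lambda>x. weak_grad \<Omega> uh x - \<pi>h x *\<^sub>R mat 1 :: real^'n^'n"
  have V: "velocity_space el \<Omega> p \<T> uh" and Q: "pressure_space \<Omega> p \<T> \<pi>h"
    using disc by (simp_all add: discrete_stokes_solution_def)
  then have uh: "W1p (conj_exp p) \<Omega> uh" and \<pi>h: "Lp (conj_exp p) \<Omega> \<pi>h"
    by (simp_all add: velocity_space_def W1p_0_def pressure_space_def Lp_zero_mean_def)
  note E = err_Lp[OF open_\<Omega> bounded_\<Omega> p sol uh \<pi>h]
  note lm = bounded_open_lmeasurable[OF open_\<Omega> bounded_\<Omega>] and S = open_sets_lebesgue[OF open_\<Omega>]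
  have p1: "1 \<le> p" using p by simp
  have ae: "AE x in lebesgue_on \<Omega>. ?G x = ?F x" using weak_grad_discrete[OF V Q] by eventually_elim simp
  have Gi: "integrable (lebesgue_on \<Omega>) ?G"
    using Lp_integrable[OF E(1) p1 lm] Lp_integrable[OF E(2) p1 lm] by simp
  show ?thesis
  proof (intro fat_residual.intro[OF fat_mesh_axioms] fat_residual_axioms.intro p(1) E(6))
    show "\<exists>m. (\<forall>i j. smooth_line_poly (CARD('n) + 1) (\<lambda>x. m x $ i $ j)) \<and> (\<forall>x\<in>interior T. ?F x = m x)" if T: "T \<in> \<T>" for T
    proof -
      obtain m where "\<forall>i j. smooth_line_poly (CARD('n) + 1) (\<lambda>x. m x $ i $ j)" "\<forall>x\<in>interior T. ?F x = m x"
        "\<forall>x\<in>interior T. laplacian uh x - grad \<pi>h x = (\<chi> i. \<Sum>j\<in>UNIV. partial j (\<lambda>x. m x $ i $ j) x)"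
        using discrete_stress[OF T V Q] .
      then show ?thesis by (intro exI[of _ m] conjI)
    qed
    show "integrable (lebesgue_on \<Omega>) ?F" using integrable_cong_AE_on[OF S ae] Gi by blast
    show "0 \<le> err \<Omega> u uh \<pi> \<pi>h x" for x by (simp add: err_def)
    fix \<phi> :: "real^'n \<Rightarrow> real" and g :: "real^'n" assume \<phi>: "test_function \<Omega> \<phi>"
    have "(LINT x|lebesgue_on \<Omega>. g \<bullet> (?G x *v grad \<phi> x)) = (LINT x|lebesgue_on \<Omega>. g \<bullet> (?F x *v grad \<phi> x))"
      by (rule integral_cong_AE_on[OF S]) (use ae in eventually_elim, simp)
    then show "\<bar>(f \<bullet> g) * \<phi> x0 - (LINT x|lebesgue_on \<Omega>. g \<bullet> (?F x *v grad \<phi> x))\<bar>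
        \<le> norm g * (LINT x|lebesgue_on \<Omega>. err \<Omega> u uh \<pi> \<pi>h x * norm (grad \<phi> x))"
      using residual_bound[OF open_\<Omega> bounded_\<Omega> p sol uh \<pi>h \<phi>, of g] by simp
  qed
qed

lemma patch_lebesgue: "patch \<T> T \<in> sets lebesgue" "patch \<T> T \<subseteq> closure \<Omega>" "T \<in> \<T> \<Longrightarrow> T \<subseteq> patch \<T> T"
proof -
  show "patch \<T> T \<in> sets lebesgue" unfolding patch_def
    using finite_mesh element_lebesgue by (intro sets.finite_Union) auto
  show "patch \<T> T \<subseteq> closure \<Omega>" unfolding patch_def using Union_mesh by blast
  show "T \<subseteq> patch \<T> T" if "T \<in> \<T>" unfolding patch_def using that by blast
qed

text \<open>The two domains differ only by boundary points of elements, a null set.\<close>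

lemma integral_patch:
  fixes g :: "real^'n \<Rightarrow> real"
  shows "(LINT x|lebesgue_on (patch \<T> T). g x) = (LINT x|lebesgue_on (patch \<T> T \<inter> \<Omega>). g x)"
proof (rule integral_restrict_cong_AE)
  show "patch \<T> T \<in> sets lebesgue" "patch \<T> T \<inter> \<Omega> \<in> sets lebesgue"
    using patch_lebesgue(1) open_sets_lebesgue[OF open_\<Omega>] by auto
  show "AE x in lebesgue. (if x \<in> patch \<T> T then g x else 0) = (if x \<in> patch \<T> T \<inter> \<Omega> then g x else 0)"
    using AE_interior_mesh
  proof eventually_elim
    case (elim x)
    then show ?case using patch_lebesgue(2)[of T] by auto
  qed
qed

text \<open>Because div u = 0, the divergence of uh is minus the trace of the error
  gradient.\<close>

lemma divergence_bound:
  assumes p: "1 < p" "p \<le> 2" and sol: "stokes_solution \<Omega> x0 p f u \<pi>"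
    and disc: "discrete_stokes_solution el \<Omega> x0 p f \<T> uh \<pi>h" and T: "T \<in> \<T>"
  shows "(LINT x|lebesgue_on T. norm (weak_div \<Omega> uh x) powr p) \<le>
    norm (mat 1 :: real^'n^'n) powr p * (LINT x|lebesgue_on (patch \<T> T \<inter> \<Omega>). err \<Omega> u uh \<pi> \<pi>h x powr p)"
proof -
  let ?N = "norm (mat 1 :: real^'n^'n)" and ?e = "err \<Omega> u uh \<pi> \<pi>h" and ?A = "patch \<T> T \<inter> \<Omega>"
  have uh: "W1p (conj_exp p) \<Omega> uh" and \<pi>h: "Lp (conj_exp p) \<Omega> \<pi>h" using disc
    by (simp_all add: discrete_stokes_solution_def velocity_space_def W1p_0_def pressure_space_def Lp_zero_mean_def)
  note E = err_Lp[OF open_\<Omega> bounded_\<Omega> p sol uh \<pi>h]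
  note S = open_sets_lebesgue[OF open_\<Omega>]
  have A: "?A \<subseteq> \<Omega>" "?A \<in> sets lebesgue" using patch_lebesgue(1) S by auto
  have e0: "0 \<le> ?e x" for x by (simp add: err_def)
  have "Lp p ?A ?e" by (rule Lp_subset[OF E(6) A S])
  then have int: "integrable (lebesgue_on ?A) (\<lambda>x. ?N powr p * ?e x powr p)" using e0 by (simp add: Lp_def)
  have "AE x in lebesgue_on \<Omega>. norm (weak_div \<Omega> uh x) \<le> ?N * ?e x"
    using E(3) weak_div_stokes_solution[OF open_\<Omega> bounded_\<Omega> p(1) sol]
  proof eventually_elim
    case (elim x)
    let ?D = "weak_grad \<Omega> (\<lambda>x. u x - uh x) x"
    have "trace ?D = - weak_div \<Omega> uh x"
      using elim by (simp add: weak_div_def trace_eq_inner_mat inner_diff_left)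
    then have "norm (weak_div \<Omega> uh x) = \<bar>?D \<bullet> (mat 1 :: real^'n^'n)\<bar>" by (simp add: trace_eq_inner_mat[symmetric])
    also have "\<dots> \<le> norm ?D * ?N" by (rule Cauchy_Schwarz_ineq2)
    also have "\<dots> \<le> ?e x * ?N" by (intro mult_right_mono) (simp_all add: err_def)
    finally show ?case by (simp add: mult.commute)
  qed
  then have ae: "AE x in lebesgue. x \<in> \<Omega> \<longrightarrow> norm (weak_div \<Omega> uh x) \<le> ?N * ?e x"
    unfolding AE_lebesgue_on_iff[OF S] .
  have "(LINT x|lebesgue_on T. norm (weak_div \<Omega> uh x) powr p) \<le> (LINT x|lebesgue_on ?A. ?N powr p * ?e x powr p)"
  proof (rule integral_restrict_mono_AE[OF element_lebesgue[OF T] A(2) int])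
    show "AE x in lebesgue. x \<in> T \<longrightarrow> x \<in> ?A \<and> norm (weak_div \<Omega> uh x) powr p \<le> ?N powr p * ?e x powr p"
      using ae AE_interior_mesh
    proof eventually_elim
      case (elim x)
      show ?case
      proof
        assume x: "x \<in> T"
        then have "x \<in> \<Omega>" using elim(2) element_subset_closure[OF T] by blast
        then have "norm (weak_div \<Omega> uh x) powr p \<le> (?N * ?e x) powr p" using elim(1) p by (intro powr_mono2) auto
        then show "x \<in> ?A \<and> norm (weak_div \<Omega> uh x) powr p \<le> ?N powr p * ?e x powr p"
          using x \<open>x \<in> \<Omega>\<close> patch_lebesgue(3)[OF T] by (auto simp: powr_mult)
      qed
    qed
  qed simp
  then show ?thesis by simp
qed

lemma err_integral_le:
  assumes p: "1 < p" "p \<le> 2" and sol: "stokes_solution \<Omega> x0 p f u \<pi>"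
    and disc: "discrete_stokes_solution el \<Omega> x0 p f \<T> uh \<pi>h"
  shows "(LINT x|lebesgue_on (patch \<T> T \<inter> \<Omega>). err \<Omega> u uh \<pi> \<pi>h x powr p) \<le>
    2 powr p * (1 + norm (mat 1 :: real^'n^'n) powr p) *
    (Lp_norm p (patch \<T> T) (weak_grad \<Omega> (\<lambda>x. u x - uh x)) powr p + Lp_norm p (patch \<T> T) (\<lambda>x. \<pi> x - \<pi>h x) powr p)"
proof -
  let ?N = "norm (mat 1 :: real^'n^'n)" and ?e = "err \<Omega> u uh \<pi> \<pi>h" and ?A = "patch \<T> T \<inter> \<Omega>"
  let ?a = "\<lambda>x. norm (weak_grad \<Omega> (\<lambda>x. u x - uh x) x) powr p" and ?b = "\<lambda>x. norm (\<pi> x - \<pi>h x) powr p"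
  have uh: "W1p (conj_exp p) \<Omega> uh" and \<pi>h: "Lp (conj_exp p) \<Omega> \<pi>h" using disc
    by (simp_all add: discrete_stokes_solution_def velocity_space_def W1p_0_def pressure_space_def Lp_zero_mean_def)
  note E = err_Lp[OF open_\<Omega> bounded_\<Omega> p sol uh \<pi>h]
  note S = open_sets_lebesgue[OF open_\<Omega>]
  have A: "?A \<subseteq> \<Omega>" "?A \<in> sets lebesgue" using patch_lebesgue(1) S by auto
  have a: "integrable (lebesgue_on ?A) ?a" using Lp_subset[OF E(4) A S] by (simp add: Lp_def)
  have b: "integrable (lebesgue_on ?A) ?b" using Lp_subset[OF E(5) A S] by (simp add: Lp_def)
  have ia: "0 \<le> (LINT x|lebesgue_on ?A. ?a x)" and ib: "0 \<le> (LINT x|lebesgue_on ?A. ?b x)" by simp_all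
  have "(LINT x|lebesgue_on ?A. ?e x powr p) \<le> (LINT x|lebesgue_on ?A. 2 powr p * (?a x + ?N powr p * ?b x))"
  proof (rule integral_mono')
    show "integrable (lebesgue_on ?A) (\<lambda>x. 2 powr p * (?a x + ?N powr p * ?b x))" using a b by simp
    show "?e x powr p \<le> 2 powr p * (?a x + ?N powr p * ?b x)" for x
      using powr_add_le[of "norm (weak_grad \<Omega> (\<lambda>x. u x - uh x) x)" "?N * \<bar>\<pi> x - \<pi>h x\<bar>" p] p
      by (simp add: err_def powr_mult)
  qed simp
  also have "\<dots> = 2 powr p * ((LINT x|lebesgue_on ?A. ?a x) + ?N powr p * (LINT x|lebesgue_on ?A. ?b x))"
    using a b by simp
  also have "\<dots> \<le> 2 powr p * ((1 + ?N powr p) * ((LINT x|lebesgue_on ?A. ?a x) + (LINT x|lebesgue_on ?A. ?b x)))"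
  proof (rule mult_left_mono)
    have "0 \<le> ?N powr p * (LINT x|lebesgue_on ?A. ?a x)" using ia by (intro mult_nonneg_nonneg) auto
    then show "(LINT x|lebesgue_on ?A. ?a x) + ?N powr p * (LINT x|lebesgue_on ?A. ?b x) \<le>
      (1 + ?N powr p) * ((LINT x|lebesgue_on ?A. ?a x) + (LINT x|lebesgue_on ?A. ?b x))"
      using ib by (simp add: distrib_left distrib_right)
  qed simp
  finally show ?thesis
    using p by (simp add: Lp_norm_powr integral_patch mult.assoc)
qed

end

section \<open>Integration of the pointwise bounds\<close>

context fat_residual
begin

text \<open>The volume of T is at most a constant times the n-th power of its diameter, which
  cancels the power in the hypothesis.\<close>

lemma element_residual_integral:
  assumes T: "T \<in> \<T>" and R: "\<And>x. x \<in> interior T \<Longrightarrow>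
    (diameter T * norm (R x)) powr p * diameter T ^ CARD('n) \<le> Q"
  shows "diameter T powr p * (LINT x|lebesgue_on T. norm (R x :: real^'n) powr p) \<le> unit_ball_vol (real CARD('n)) * Q"
proof -
  let ?h = "diameter T"
  have h: "0 < ?h" by (rule element_topology(7)[OF T])
  have hn: "0 < ?h ^ CARD('n)" using h by simp
  have le: "?h powr p * norm (R x) powr p \<le> Q / ?h ^ CARD('n)" if "x \<in> interior T" for x
    using R[OF that] hn by (simp add: pos_le_divide_eq powr_mult)
  have Q: "0 \<le> Q"
  proof -
    obtain x where "x \<in> interior T" using interior_element_nonempty[OF T] by blast
    moreover have "0 \<le> (?h * norm (R x)) powr p * ?h ^ CARD('n)" using h by simp
    ultimately show ?thesis using R by (meson order_trans)
  qed
  have lm: "T \<in> lmeasurable" using element_topology(1)[OF T] by (rule lmeasurable_compact)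
  interpret finite_measure "lebesgue_on T" using lm by (rule finite_measure_lebesgue_on)
  have "?h powr p * (LINT x|lebesgue_on T. norm (R x) powr p) = (LINT x|lebesgue_on T. ?h powr p * norm (R x) powr p)"
    by simp
  also have "\<dots> \<le> (LINT x|lebesgue_on T. Q / ?h ^ CARD('n))"
  proof (rule integral_restrict_mono_AE[OF element_lebesgue[OF T] element_lebesgue[OF T]])
    show "0 \<le> Q / ?h ^ CARD('n)" using Q hn by simp
    show "AE x in lebesgue. x \<in> T \<longrightarrow> x \<in> T \<and> ?h powr p * norm (R x) powr p \<le> Q / ?h ^ CARD('n)"
      using AE_interior_mesh
    proof eventually_elim
      case (elim x)
      then show ?case using le T element_subset_closure[OF T] by blast
    qed
  qed simp
  also have "\<dots> = measure lebesgue T * (Q / ?h ^ CARD('n))"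
    using element_lebesgue[OF T] by (simp add: measure_restrict_space)
  also have "\<dots> \<le> unit_ball_vol (real CARD('n)) * ?h ^ CARD('n) * (Q / ?h ^ CARD('n))"
    using measure_element_le[OF T] Q hn by (intro mult_right_mono) auto
  also have "\<dots> = unit_ball_vol (real CARD('n)) * Q" using h by simp
  finally show ?thesis .
qed

text \<open>Facets are indexed by their opposite vertices, so there are at most n + 1 sides;
  \<open>surface_integral_le\<close> handles each.\<close>

lemma jump_integral:
  assumes T: "T \<in> \<T>" and D: "diameter \<Omega> \<le> D"
    and J: "\<And>S x. S \<in> internal_sides \<T> \<Longrightarrow> S facet_of T \<Longrightarrow> x \<in> S \<Longrightarrow>
      norm (jump \<T> S Fh x) powr p * diameter T ^ CARD('n) \<le> Q"
    and Q: "0 \<le> Q"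
  shows "diameter T * (\<Sum>S\<in>{S\<in>internal_sides \<T>. S facet_of T}. surface_integral S (\<lambda>x. norm (jump \<T> S Fh x) powr p)) \<le>
    real (CARD('n) + 1) * ((1 + 2 * D) * (unit_ball_vol (real CARD('n)) * 2 ^ CARD('n)) * Q)"
proof -
  let ?h = "diameter T" and ?\<S> = "{S\<in>internal_sides \<T>. S facet_of T}"
  let ?Z = "(1 + 2 * D) * (unit_ball_vol (real CARD('n)) * 2 ^ CARD('n)) * Q"
  have h: "0 < ?h" by (rule element_topology(7)[OF T])
  have hn: "0 < ?h ^ CARD('n)" using h by simp
  have D0: "0 \<le> D" using D diameter_ge_0[OF bounded_\<Omega>] by linarith
  have Z0: "0 \<le> ?Z" using D0 Q by simp
  have sub: "?\<S> \<subseteq> (\<lambda>a. convex hull (vertices T - {a})) ` vertices T"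
  proof
    fix S assume "S \<in> ?\<S>"
    then obtain a where "a \<in> vertices T" "S = convex hull (vertices T - {a})" using facet_vertex[OF T] by blast
    then show "S \<in> (\<lambda>a. convex hull (vertices T - {a})) ` vertices T" by blast
  qed
  have "card ?\<S> \<le> card ((\<lambda>a. convex hull (vertices T - {a})) ` vertices T)"
    using element_topology(5)[OF T] by (intro card_mono[OF _ sub]) simp
  also have "\<dots> \<le> card (vertices T)" by (rule card_image_le[OF element_topology(5)[OF T]])
  also have "\<dots> = CARD('n) + 1" using element(1)[OF T] by (simp add: simplex_points_def)
  finally have card: "real (card ?\<S>) \<le> real (CARD('n) + 1)" by (simp only: of_nat_le_iff)
  have "?h * surface_integral S (\<lambda>x. norm (jump \<T> S Fh x) powr p) \<le> ?Z" if S: "S \<in> ?\<S>" for S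
  proof -
    have b: "0 \<le> norm (jump \<T> S Fh x) powr p \<and> norm (jump \<T> S Fh x) powr p \<le> Q / ?h ^ CARD('n)" if "x \<in> S" for x
      using J[OF _ _ that] S hn by (simp add: pos_le_divide_eq)
    have ST: "S facet_of T" using S by simp
    have "?h * surface_integral S (\<lambda>x. norm (jump \<T> S Fh x) powr p) \<le>
        (1 + 2 * D) * (unit_ball_vol (real CARD('n)) * 2 ^ CARD('n)) * ?h ^ CARD('n) * (Q / ?h ^ CARD('n))"
      by (rule surface_integral_le[OF T ST b D])
    then show ?thesis using h by simp
  qed
  then have "(\<Sum>S\<in>?\<S>. ?h * surface_integral S (\<lambda>x. norm (jump \<T> S Fh x) powr p)) \<le> (\<Sum>S\<in>?\<S>. ?Z)"
    by (rule sum_mono)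
  also have "\<dots> \<le> real (CARD('n) + 1) * ?Z" using mult_right_mono[OF card Z0] by simp
  finally show ?thesis by (simp only: sum_distrib_left)
qed

end

section \<open>The local estimate\<close>

text \<open>All constants are fixed before the mesh is given; they depend on the dimension, p, k,
  \<Omega> and a radius \<delta> of a ball about x0 in \<Omega>. The four contributions to the
  indicator are bounded separately by the integral of e^p over the patch.\<close>

lemma eta_powr_le:
  fixes \<Omega> :: "(real^'n) set" and x0 :: "real^'n" and p k :: real
  assumes \<Omega>: "open \<Omega>" "bounded \<Omega>" "lipschitz_boundary \<Omega>" and n: "2 \<le> CARD('n)" and x0: "x0 \<in> \<Omega>"
    and p: "1 < p" "p \<le> 2" "0 \<le> real CARD('n) - p * (real CARD('n) - 1)" and k: "2 \<le> k"
  obtains C where "0 < C" "\<forall>\<T>. fat_mesh \<Omega> \<T> k \<longrightarrow> (\<forall>f el u \<pi> uh \<pi>h.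
    stokes_solution \<Omega> x0 p f u \<pi> \<and> discrete_stokes_solution el \<Omega> x0 p f \<T> uh \<pi>h \<longrightarrow>
    (\<forall>T\<in>\<T>. eta_powr el \<Omega> x0 p f \<T> uh \<pi>h T \<le>
      C * (Lp_norm p (patch \<T> T) (weak_grad \<Omega> (\<lambda>x. u x - uh x)) powr p
         + Lp_norm p (patch \<T> T) (\<lambda>x. \<pi> x - \<pi>h x) powr p)))"
proof -
  let ?n = "real CARD('n)" and ?K = "CARD('n) + 1" and ?N = "norm (mat 1 :: real^'n^'n)"
  let ?\<omega> = "unit_ball_vol (real CARD('n))"
  \<comment> \<open>The degree of t^(n-1) F(b + t r y) in t, so that M + 1 nodes determine its
    coefficients.\<close>
  define M where "M = CARD('n) - 1 + ?K"
  have M: "CARD('n) - 1 + ?K \<le> M" by (simp add: M_def)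
  obtain B where B: "0 < B" "\<And>y::real^'n. norm (grad bump y) \<le> B"
    by (rule grad_bump_bounded[where 'n='n]) (rule that; blast)
  obtain c where c: "0 < c" "\<And>\<nu>::real^'n. norm \<nu> = 1 \<Longrightarrow>
      c \<le> integral\<^sup>L lebesgue (\<lambda>y. indicator {y. 0 < y \<bullet> \<nu>} y * (bump_slope y * (y \<bullet> \<nu>)))"
    by (rule halfspace_constant[where 'n='n]) (rule that; blast)
  have ext: "\<exists>C. 0 < C \<and> (\<forall>(f::real^'n \<Rightarrow> real) b r X x. line_poly ?K f \<longrightarrow>
        (\<forall>z. norm (z - b) \<le> r \<longrightarrow> \<bar>f z\<bar> \<le> X) \<longrightarrow> norm (x - b) \<le> R * r \<longrightarrow> \<bar>f x\<bar> \<le> C * X)" if "0 < R" for R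
  proof (rule line_poly_extrapolation[where 'a="real^'n" and K="?K" and R=R])
    fix C assume C: "0 < C" and E: "\<And>(f::real^'n \<Rightarrow> real) b r X x. line_poly ?K f \<Longrightarrow>
        (\<And>z. norm (z - b) \<le> r \<Longrightarrow> \<bar>f z\<bar> \<le> X) \<Longrightarrow> norm (x - b) \<le> R * r \<Longrightarrow> R > 0 \<Longrightarrow> \<bar>f x\<bar> \<le> C * X"
    show ?thesis
    proof (intro exI[of _ C] conjI C allI impI)
      fix f :: "real^'n \<Rightarrow> real" and b r X x
      assume a: "line_poly ?K f" "\<forall>z. norm (z - b) \<le> r \<longrightarrow> \<bar>f z\<bar> \<le> X" "norm (x - b) \<le> R * r"
      show "\<bar>f x\<bar> \<le> C * X" by (rule E[OF a(1) _ a(3) that]) (use a(2) in blast)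
    qed
  qed
  have "0 < 4 * k" "0 < 4 * ?n * k ^ 2" using k by simp_all
  note ext = ext[OF this(1)] ext[OF this(2)]
  obtain Cx1 where Cx1: "0 < Cx1" and ext1: "\<forall>(f::real^'n \<Rightarrow> real) b r X x. line_poly ?K f \<longrightarrow>
        (\<forall>z. norm (z - b) \<le> r \<longrightarrow> \<bar>f z\<bar> \<le> X) \<longrightarrow> norm (x - b) \<le> (4 * k) * r \<longrightarrow> \<bar>f x\<bar> \<le> Cx1 * X"
    using ext(1) by (elim exE conjE) (rule that; assumption)
  obtain Cx2 where Cx2: "0 < Cx2" and ext2: "\<forall>(f::real^'n \<Rightarrow> real) b r X x. line_poly ?K f \<longrightarrow>
        (\<forall>z. norm (z - b) \<le> r \<longrightarrow> \<bar>f z\<bar> \<le> X) \<longrightarrow> norm (x - b) \<le> (4 * ?n * k ^ 2) * r \<longrightarrow> \<bar>f x\<bar> \<le> Cx2 * X"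
    using ext(2) by (elim exE conjE) (rule that; assumption)
  obtain \<delta> where \<delta>: "0 < \<delta>" "ball x0 \<delta> \<subseteq> \<Omega>" using openE[OF \<Omega>(1) x0] .
  \<comment> \<open>The added 1 ensures that the constant is positive, as \<open>mean_bound\<close>
    demands.\<close>
  define W where "W l = B * (\<Sum>i\<le>M. \<bar>weight M l i\<bar> / node M i) + 1" for l
  have W: "B * (\<Sum>i\<le>M. \<bar>weight M l i\<bar> / node M i) \<le> W l" "0 < W l" for l
  proof -
    have "0 \<le> B * (\<Sum>i\<le>M. \<bar>weight M l i\<bar> / node M i)"
      using B(1) node_pos[of M] by (intro mult_nonneg_nonneg sum_nonneg divide_nonneg_pos) auto
    then show "B * (\<Sum>i\<le>M. \<bar>weight M l i\<bar> / node M i) \<le> W l" "0 < W l" by (simp_all add: W_def)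
  qed
  define W1 where "W1 = W CARD('n) / integral\<^sup>L lebesgue (bump :: real^'n \<Rightarrow> real)"
  define C1 where "C1 = (4 * k) powr p * (4 * k) ^ CARD('n) * ((?n * Cx1) powr p *
      (2 * W1 * (2 * W1 * ?\<omega>) powr (p - 1)))"
  define W2 where "W2 = W (CARD('n) - 1) / c"
  define C2 where "C2 = (2 * ?n * k ^ 2) ^ CARD('n) * ((?n * Cx2) powr p *
      (2 * W2 * (2 * W2 * ?\<omega>) powr (p - 1)))"
  \<comment> \<open>\<open>source_bound\<close> asks for a length that dominates both \<delta> and
    the diameter of the domain.\<close>
  define D where "D = max (diameter \<Omega>) \<delta>"
  have D: "\<delta> \<le> D" "diameter \<Omega> \<le> D" by (simp_all add: D_def)
  define N where "N = nat \<lceil>k ^ CARD('n)\<rceil>"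
  define c6 where "c6 = (2 / k) ^ Suc (Suc N)"
  define \<eta> where "\<eta> = 1 / (2 * real (Suc M)) * c6 / real (CARD('n) + 1)"
  define c' where "c' = c6 * (\<delta> / (2 * D) * \<eta> ^ (CARD('n) + 1))"
  define s where "s = ?n - p * (?n - 1)"
  have s: "0 \<le> s" using p(3) by (simp add: s_def)
  define C3 where "C3 = (1 / c') powr s * (2 * W 0 * (2 * W 0 * ?\<omega>) powr (p - 1))"
  have C3: "0 \<le> C3" unfolding C3_def using W(2)[of 0] by simp
  have C2: "0 \<le> C2" unfolding C2_def W2_def using W(2)[of "CARD('n) - 1"] c(1) by simp
  define C where "C = ?\<omega> * C1 + (real (CARD('n) + 1) * ((1 + 2 * D) * (?\<omega> * 2 ^ CARD('n)) * C2)) + ?N powr p + C3"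
  define R where "R = 2 powr p * (1 + ?N powr p)"
  have R: "0 < R" unfolding R_def by (intro mult_pos_pos add_pos_nonneg) auto
  show thesis
  \<comment> \<open>The absolute value and the added 1 replace a proof that C is positive.\<close>
  proof (rule that[of "(\<bar>C\<bar> + 1) * R"]; (intro allI impI ballI)?)
    show "0 < (\<bar>C\<bar> + 1) * R" using R by (intro mult_pos_pos) auto
    fix \<T> f el u \<pi> uh \<pi>h T
    assume "fat_mesh \<Omega> \<T> k" and *: "stokes_solution \<Omega> x0 p f u \<pi> \<and> discrete_stokes_solution el \<Omega> x0 p f \<T> uh \<pi>h"
      and T: "T \<in> \<T>"
    interpret fat_mesh \<Omega> \<T> k by fact
    have sol: "stokes_solution \<Omega> x0 p f u \<pi>" and disc: "discrete_stokes_solution el \<Omega> x0 p f \<T> uh \<pi>h"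
      using * by simp_all
    have V: "velocity_space el \<Omega> p \<T> uh" and Q: "pressure_space \<Omega> p \<T> \<pi>h"
      using disc by (simp_all add: discrete_stokes_solution_def)
    define Fh where "Fh = (\<lambda>x. jacobian uh (at x) - \<pi>h x *\<^sub>R mat 1)"
    define e where "e = err \<Omega> u uh \<pi> \<pi>h"
    interpret F: fat_residual \<Omega> \<T> k Fh e f x0 p ?K
      unfolding Fh_def e_def by (rule stokes_fat_residual[OF p(1,2) sol disc])
    let ?A = "patch \<T> T \<inter> \<Omega>" and ?h = "diameter T"
    let ?I = "LINT x|lebesgue_on ?A. e x powr p"
    have I0: "0 \<le> ?I" by simp
    have A: "?A \<subseteq> ?A" "?A \<subseteq> \<Omega>" "?A \<in> sets lebesgue"
      using patch_lebesgue(1) open_sets_lebesgue[OF \<Omega>(1)] by auto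
    have intA: "interior T \<subseteq> ?A"
      using interior_element_subset[OF T] patch_lebesgue(3)[OF T] interior_subset by blast
    have p0: "0 < p" using p(1) by simp
    obtain m where m: "\<forall>i j. smooth_line_poly ?K (\<lambda>x. m x $ i $ j)"
      "\<forall>x\<in>interior T. jacobian uh (at x) - \<pi>h x *\<^sub>R mat 1 = m x"
      "\<forall>x\<in>interior T. laplacian uh x - grad \<pi>h x = (\<chi> i. \<Sum>j\<in>UNIV. partial j (\<lambda>x. m x $ i $ j) x)"
      using discrete_stress[OF T V Q] .
    have m1: "smooth_line_poly ?K (\<lambda>x. m x $ i $ j)" for i j using m(1) by blast
    have m2: "Fh x = m x" if "x \<in> interior T" for x using m(2) that by (simp add: Fh_def)
    have t1: "?h powr p * Lp_norm p T (\<lambda>x. laplacian uh x - grad \<pi>h x) powr p \<le> ?\<omega> * (C1 * ?I)"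
      unfolding Lp_norm_powr[OF p0]
    proof (rule F.element_residual_integral[OF T])
      fix x assume x: "x \<in> interior T"
      then have "x \<in> T" using interior_subset by blast
      from F.element_residual_bound[OF T m1 m2 intA A(2,3) B(2) W M ext1 Cx1 W1_def C1_def this]
      show "(?h * norm (laplacian uh x - grad \<pi>h x)) powr p * ?h ^ CARD('n) \<le> C1 * ?I"
        using m(3) x by simp
    qed
    have t2: "?h * (\<Sum>S\<in>{S\<in>internal_sides \<T>. S facet_of T}. surface_integral S (\<lambda>x. norm (jump \<T> S Fh x) powr p)) \<le>
      real (CARD('n) + 1) * ((1 + 2 * D) * (?\<omega> * 2 ^ CARD('n)) * (C2 * ?I))"
    proof (rule F.jump_integral[OF T D(2)])
      show "norm (jump \<T> S Fh x) powr p * ?h ^ CARD('n) \<le> C2 * ?I"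
        if "S \<in> internal_sides \<T>" "S facet_of T" "x \<in> S" for S x
        using F.jump_bound[OF T that(1,2) A B(2) W M c ext2 Cx2 W2_def C2_def that(3)] .
      show "0 \<le> C2 * ?I" using C2 I0 by (rule mult_nonneg_nonneg)
    qed
    have t3: "Lp_norm p T (weak_div \<Omega> uh) powr p \<le> ?N powr p * ?I"
      unfolding Lp_norm_powr[OF p0] e_def by (rule divergence_bound[OF p(1,2) sol disc T])
    have t4: "sigma el x0 T * ?h powr s * norm f powr p \<le> C3 * ?I"
    proof (cases "x0 \<in> T \<and> \<not> nodal el T x0")
      case True
      then have "x0 \<in> T" by simp
      from F.source_bound[OF this T \<delta> D A N_def c6_def \<eta>_def c'_def B(2) W M s_def s C3_def]
      show ?thesis using True by (simp add: sigma_def)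
    next
      case False
      then have "sigma el x0 T = 0" unfolding sigma_def by (rule if_not_P)
      then show ?thesis using C3 I0 by simp
    qed
    have "eta_powr el \<Omega> x0 p f \<T> uh \<pi>h T \<le> ?\<omega> * (C1 * ?I)
      + real (CARD('n) + 1) * ((1 + 2 * D) * (?\<omega> * 2 ^ CARD('n)) * (C2 * ?I)) + ?N powr p * ?I + C3 * ?I"
      unfolding eta_powr_def Fh_def[symmetric] s_def[symmetric] by (intro add_mono t1 t2 t3 t4)
    also have "\<dots> = C * ?I" unfolding C_def by (simp only: distrib_right mult.assoc)
    also have "\<dots> \<le> (\<bar>C\<bar> + 1) * ?I" using I0 by (intro mult_right_mono) auto
    also have "\<dots> \<le> (\<bar>C\<bar> + 1) * (R * (Lp_norm p (patch \<T> T) (weak_grad \<Omega> (\<lambda>x. u x - uh x)) powr p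
         + Lp_norm p (patch \<T> T) (\<lambda>x. \<pi> x - \<pi>h x) powr p))"
      unfolding e_def R_def by (intro mult_left_mono err_integral_le[OF p(1,2) sol disc]) simp
    finally show "eta_powr el \<Omega> x0 p f \<T> uh \<pi>h T \<le> (\<bar>C\<bar> + 1) * R * (Lp_norm p (patch \<T> T) (weak_grad \<Omega> (\<lambda>x. u x - uh x)) powr p
         + Lp_norm p (patch \<T> T) (\<lambda>x. \<pi> x - \<pi>h x) powr p)" by (simp only: mult.assoc)
  qed
qed

theorem theorem3:
  fixes \<Omega> :: "(real^'n) set"
  assumes "CARD('n) \<in> {2, 3}"
    and "open \<Omega>" and "connected \<Omega>" and "\<Omega> \<noteq> {}" and "bounded \<Omega>"
    and "polytopal \<Omega>" and "lipschitz_boundary \<Omega>"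
  shows "\<exists>\<epsilon>>0. \<forall>x0\<in>\<Omega>. \<forall>p.
    2 * real CARD('n) / (real CARD('n) + 1) - \<epsilon> < p \<and> p < real CARD('n) / (real CARD('n) - 1) \<longrightarrow>
    (\<forall>\<kappa>. \<exists>C>0. \<forall>\<T>0 \<TT>. mesh_family \<Omega> \<kappa> \<T>0 \<TT> \<longrightarrow>
      (\<forall>f. \<forall>\<T>\<in>\<TT>. \<forall>el u \<pi> uh \<pi>h.
        stokes_solution \<Omega> x0 p f u \<pi> \<and> discrete_stokes_solution el \<Omega> x0 p f \<T> uh \<pi>h \<longrightarrow>
        (\<forall>T\<in>\<T>. eta_powr el \<Omega> x0 p f \<T> uh \<pi>h T \<le>
           C * (Lp_norm p (patch \<T> T) (weak_grad \<Omega> (\<lambda>x. u x - uh x)) powr p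
              + Lp_norm p (patch \<T> T) (\<lambda>x. \<pi> x - \<pi>h x) powr p))))"
\<comment> \<open>With \<epsilon> = 1/3 the lower end of the range is 1 for d = 2 and 7/6 for d = 3,
  so p > 1. The upper end d / (d - 1) is at most 2, and p below it makes the exponent d - p (d - 1)
  positive.\<close>
proof (rule exI[of _ "1/3"], rule conjI; (intro ballI allI impI)?)
  fix x0 p and \<kappa> :: real
  assume x0: "x0 \<in> \<Omega>" and range: "2 * real CARD('n) / (real CARD('n) + 1) - 1 / 3 < p \<and> p < real CARD('n) / (real CARD('n) - 1)"
  have n: "CARD('n) = 2 \<or> CARD('n) = 3" using assms(1) by blast
  then have p: "2 \<le> CARD('n)" "1 < p" "p \<le> 2" "0 \<le> real CARD('n) - p * (real CARD('n) - 1)"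
    using range by auto
  \<comment> \<open>The constant of \<open>shape_regular_fat\<close>. It is at least 4, which covers
    the bound 2 of \<open>fat_mesh\<close>.\<close>
  let ?k = "4 * max \<kappa> 1"
  have k: "2 \<le> ?k" by simp
  obtain C where C: "0 < C" "\<forall>\<T>. fat_mesh \<Omega> \<T> ?k \<longrightarrow> (\<forall>f el u \<pi> uh \<pi>h.
    stokes_solution \<Omega> x0 p f u \<pi> \<and> discrete_stokes_solution el \<Omega> x0 p f \<T> uh \<pi>h \<longrightarrow>
    (\<forall>T\<in>\<T>. eta_powr el \<Omega> x0 p f \<T> uh \<pi>h T \<le>
      C * (Lp_norm p (patch \<T> T) (weak_grad \<Omega> (\<lambda>x. u x - uh x)) powr p
         + Lp_norm p (patch \<T> T) (\<lambda>x. \<pi> x - \<pi>h x) powr p)))"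
    using eta_powr_le[OF assms(2,5,7) p(1) x0 p(2-4) k] .
  have fat: "fat_mesh \<Omega> \<T> ?k" if "mesh_family \<Omega> \<kappa> \<T>0 \<TT>" "\<T> \<in> \<TT>" for \<T>0 \<TT> \<T>
  proof -
    have "mesh \<Omega> \<T>" "shape_regular \<kappa> \<T>" using that by (simp_all add: mesh_family_def)
    then show ?thesis
      by unfold_locales
        (auto simp: assms p(1) mesh_def shape_regular_def intro: shape_regular_fat)
  qed
  show "\<exists>C>0. \<forall>\<T>0 \<TT>. mesh_family \<Omega> \<kappa> \<T>0 \<TT> \<longrightarrow>
      (\<forall>f. \<forall>\<T>\<in>\<TT>. \<forall>el u \<pi> uh \<pi>h.
        stokes_solution \<Omega> x0 p f u \<pi> \<and> discrete_stokes_solution el \<Omega> x0 p f \<T> uh \<pi>h \<longrightarrow>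
        (\<forall>T\<in>\<T>. eta_powr el \<Omega> x0 p f \<T> uh \<pi>h T \<le>
           C * (Lp_norm p (patch \<T> T) (weak_grad \<Omega> (\<lambda>x. u x - uh x)) powr p
              + Lp_norm p (patch \<T> T) (\<lambda>x. \<pi> x - \<pi>h x) powr p)))"
    by (intro exI[of _ C] conjI C(1) allI impI ballI) (rule C(2)[rule_format, OF fat])
qed simp

end
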